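(* Let $K$ be a field of prime characteristic $p$ with $[K:K^p]<\infty$, and let $f=x_1^{d_1}\cdots x_n^{d_n}$ be a monomial in $S=K[\![x_1,\dots,x_n]\!]$ where $d_j$ is a positive integer for each $1\le j\le n$. Let $d=\max\{d_1,\dots,d_n\}$ and $R^{\bigstar}=S[\![u,v]\!]/(f+uv)$. For $1\le s\le n-1$ put $$W^{(n)}_s=\sum_{\{j_1,\dots,j_s\}\subseteq\{1,\dots,n\}}\Big[(d-d_{j_1})\cdots(d-d_{j_s})\prod_{j\in\{1,\dots,n\}\setminus\{j_1,\dots,j_s\}}d_j\Big],$$ the sum running over all $s$-element subsets of $\{1,\dots,n\}$. Then the F-signature of $R^{\bigstar}$ is $$\mathbb S(R^{\bigstar})=\frac{2}{d^{n+1}}\left[\frac{d_1d_2\cdots d_n}{n+1}+\frac{W^{(n)}_1}{n}+\dots+\frac{W^{(n)}_s}{n-s+1}+\dots+\frac{W^{(n)}_{n-1}}{2}\right].$$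
   Context: $u,v$ are new variables over $S$. For a ring $A$ of characteristic $p$ and $e\ge1$, $F_*^e(A)$ is the $A$-module equal to $A$ as an abelian group (the element corresponding to $m$ is written $F_*^e(m)$) with $aF_*^e(m)=F_*^e(a^{p^e}m)$. F-signature: let $(A,\mathfrak m,k)$ be a Noetherian local ring of prime characteristic $p$ and dimension $D$ that is F-finite (i.e. $F_*^1(A)$ is a finitely generated $A$-module). Let $a_e(A)$ be the maximal rank of a free direct summand of $F_*^e(A)$, i.e. the unique nonnegative integer with $F_*^e(A)\cong A^{a_e(A)}\oplus M_e$ where $M_e$ has no nonzero free direct summand. With $\alpha(A)=\log_p[k:k^p]$, the F-signature is $\mathbb S(A)=\lim_{e\to\infty}a_e(A)/p^{e(D+\alpha(A))}$. *)

theory Defs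
  imports "HOL-Algebra.Algebra" "HOL-Library.Extended_Nat" Complex_Main
begin

(* both shadow field names of the HOL-Algebra records *)
hide_const (open) Multiset.mult Wellorder_Constructions.zero

section \<open>Formal power series rings\<close>

text \<open>
  As in \<^theory>\<open>HOL-Algebra.Indexed_Polynomials\<close>, a monomial in the variables \<open>I\<close> is a multiset
  with support in \<open>I\<close>, and a series is its coefficient function, extended by zero to all other
  multisets. Hence \<open>ring.indexed_var R i\<close> and \<open>ring.indexed_const R c\<close> are the variables and the
  constants of \<open>power_series R I\<close>. The sum in the product
  runs over the finitely many factorisations \<open>m = a + (m - a)\<close>.
\<close>

definition power_series :: "('a, 'r) ring_scheme \<Rightarrow> 'i set \<Rightarrow> ('i multiset \<Rightarrow> 'a) ring" where
  "power_series R I =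
    \<lparr>carrier = {f. (\<forall>m. f m \<in> carrier R) \<and> (\<forall>m. \<not> set_mset m \<subseteq> I \<longrightarrow> f m = \<zero>\<^bsub>R\<^esub>)},
     mult = (\<lambda>f g m. \<Oplus>\<^bsub>R\<^esub>a\<in>{a. a \<subseteq># m}. f a \<otimes>\<^bsub>R\<^esub> g (m - a)),
     one = ring.indexed_const R \<one>\<^bsub>R\<^esub>,
     zero = ring.indexed_const R \<zero>\<^bsub>R\<^esub>,
     add = (\<lambda>f g m. f m \<oplus>\<^bsub>R\<^esub> g m)\<rparr>"


section \<open>Local rings, dimension, characteristic\<close>

definition has_char :: "('a, 'r) ring_scheme \<Rightarrow> nat \<Rightarrow> bool" where
  "has_char R c \<longleftrightarrow> (\<forall>n::nat. [n] \<cdot>\<^bsub>R\<^esub> \<one>\<^bsub>R\<^esub> = \<zero>\<^bsub>R\<^esub> \<longleftrightarrow> c dvd n)"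

definition noetherian_local_ring :: "('a, 'r) ring_scheme \<Rightarrow> bool" where
  "noetherian_local_ring A \<longleftrightarrow> cring A \<and> noetherian_ring A \<and> (\<exists>!m. maximalideal m A)"

definition residue_field :: "('a, 'r) ring_scheme \<Rightarrow> 'a set ring" where
  "residue_field A = A Quot (THE m. maximalideal m A)"

definition krull_dim :: "('a, 'r) ring_scheme \<Rightarrow> enat" where
  "krull_dim A = Sup {enat l | l. \<exists>P :: nat \<Rightarrow> 'a set.
     (\<forall>i\<le>l. primeideal (P i) A) \<and> (\<forall>i<l. P i \<subset> P (Suc i))}"

definition pth_powers :: "nat \<Rightarrow> ('a, 'r) ring_scheme \<Rightarrow> 'a set" where
  "pth_powers p k = (\<lambda>x. x [^]\<^bsub>k\<^esub> p) ` carrier k"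


section \<open>Modules\<close>

text \<open>
  Module records extend ring records; their multiplicative part is irrelevant for modules.
\<close>

definition free_module :: "('a, 'r) ring_scheme \<Rightarrow> nat \<Rightarrow> ('a, nat \<Rightarrow> 'a) module" where
  "free_module A n =
    \<lparr>carrier = {..<n} \<rightarrow>\<^sub>E carrier A, mult = undefined, one = undefined,
     zero = (\<lambda>i\<in>{..<n}. \<zero>\<^bsub>A\<^esub>),
     add = (\<lambda>x y. \<lambda>i\<in>{..<n}. x i \<oplus>\<^bsub>A\<^esub> y i),
     smult = (\<lambda>a x. \<lambda>i\<in>{..<n}. a \<otimes>\<^bsub>A\<^esub> x i)\<rparr>"

definition module_sum :: "('a, 'm) module \<Rightarrow> ('a, 'n) module \<Rightarrow> ('a, 'm \<times> 'n) module" where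
  "module_sum M N =
    \<lparr>carrier = carrier M \<times> carrier N, mult = undefined, one = undefined,
     zero = (\<zero>\<^bsub>M\<^esub>, \<zero>\<^bsub>N\<^esub>),
     add = (\<lambda>x y. (fst x \<oplus>\<^bsub>M\<^esub> fst y, snd x \<oplus>\<^bsub>N\<^esub> snd y)),
     smult = (\<lambda>a x. (a \<odot>\<^bsub>M\<^esub> fst x, a \<odot>\<^bsub>N\<^esub> snd x))\<rparr>"

definition module_isomorphic ::
    "('a, 'r) ring_scheme \<Rightarrow> ('a, 'm) module \<Rightarrow> ('a, 'n) module \<Rightarrow> bool" where
  "module_isomorphic A M N \<longleftrightarrow>
    (\<exists>h. bij_betw h (carrier M) (carrier N) \<and>
      (\<forall>x\<in>carrier M. \<forall>y\<in>carrier M. h (x \<oplus>\<^bsub>M\<^esub> y) = h x \<oplus>\<^bsub>N\<^esub> h y) \<and>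
      (\<forall>a\<in>carrier A. \<forall>x\<in>carrier M. h (a \<odot>\<^bsub>M\<^esub> x) = a \<odot>\<^bsub>N\<^esub> h x))"

text \<open>
  Taking the complement \<open>N\<close> over the same carrier type as \<open>M\<close> is no restriction, since every
  complement is isomorphic to a submodule of \<open>M\<close>.
\<close>

definition has_free_summand :: "('a, 'r) ring_scheme \<Rightarrow> ('a, 'm) module \<Rightarrow> nat \<Rightarrow> bool" where
  "has_free_summand A M n \<longleftrightarrow>
    (\<exists>N :: ('a, 'm) module. module A N \<and> module_isomorphic A M (module_sum (free_module A n) N))"

definition max_free_rank :: "('a, 'r) ring_scheme \<Rightarrow> ('a, 'm) module \<Rightarrow> nat" where
  "max_free_rank A M = (GREATEST n. has_free_summand A M n)"

definition finitely_generated_module :: "('a, 'r) ring_scheme \<Rightarrow> ('a, 'm) module \<Rightarrow> bool" where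
  "finitely_generated_module A M \<longleftrightarrow>
    (\<exists>B \<subseteq> carrier M. finite B \<and>
      (\<forall>x\<in>carrier M. \<exists>c \<in> B \<rightarrow> carrier A. x = (\<Oplus>\<^bsub>M\<^esub>b\<in>B. c b \<odot>\<^bsub>M\<^esub> b)))"


section \<open>F-signature\<close>

text \<open>The module \<open>F\<^sub>*\<^sup>e(A)\<close>, where \<open>F\<^sub>*\<^sup>e(m)\<close> is represented by \<open>m\<close> itself.\<close>

definition frobenius_module :: "nat \<Rightarrow> nat \<Rightarrow> ('a, 'r) ring_scheme \<Rightarrow> ('a, 'a) module" where
  "frobenius_module p e A =
    \<lparr>carrier = carrier A, mult = mult A, one = \<one>\<^bsub>A\<^esub>, zero = \<zero>\<^bsub>A\<^esub>, add = add A,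
     smult = (\<lambda>a m. a [^]\<^bsub>A\<^esub> (p ^ e) \<otimes>\<^bsub>A\<^esub> m)\<rparr>"

definition F_finite :: "nat \<Rightarrow> ('a, 'r) ring_scheme \<Rightarrow> bool" where
  "F_finite p A \<longleftrightarrow> finitely_generated_module A (frobenius_module p 1 A)"

definition frobenius_alpha :: "nat \<Rightarrow> ('a, 'r) ring_scheme \<Rightarrow> real" where
  "frobenius_alpha p A =
    (let k = residue_field A
     in log (real p) (real (ring.dim k (pth_powers p k) (carrier k))))"

text \<open>
  The F-signature as a relation: \<open>A\<close> satisfies the standing hypotheses under which the F-signature
  is defined, and the limit exists and equals \<open>s\<close>.
\<close>

definition has_F_signature :: "nat \<Rightarrow> ('a, 'r) ring_scheme \<Rightarrow> real \<Rightarrow> bool" where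
  "has_F_signature p A s \<longleftrightarrow>
    Factorial_Ring.prime p \<and> has_char A p \<and> noetherian_local_ring A \<and> F_finite p A \<and>
    (\<exists>D. krull_dim A = enat D \<and>
      (\<lambda>e. real (max_free_rank A (frobenius_module p e A))
            / real p powr (real e * (real D + frobenius_alpha p A))) \<longlonglongrightarrow> s)"


section \<open>The hypersurface\<close>

datatype uv = U | V

definition monomial_series ::
    "('a, 'r) ring_scheme \<Rightarrow> nat \<Rightarrow> (nat \<Rightarrow> nat) \<Rightarrow> nat multiset \<Rightarrow> 'a" where
  "monomial_series K n d =
    (let S = power_series K {1..n}
     in \<Otimes>\<^bsub>S\<^esub>j\<in>{1..n}. ring.indexed_var K j [^]\<^bsub>S\<^esub> d j)"

text \<open>\<open>S[[u,v]]/(f + uv)\<close> for a ring \<open>S\<close> and \<open>f\<close> in \<open>S\<close>\<close>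

definition star_ring ::
    "('a, 'r) ring_scheme \<Rightarrow> 'a \<Rightarrow> (uv multiset \<Rightarrow> 'a) set ring" where
  "star_ring S f =
    (let T = power_series S {U, V}
     in T Quot (PIdl\<^bsub>T\<^esub> (ring.indexed_const S f \<oplus>\<^bsub>T\<^esub>
                           ring.indexed_var S U \<otimes>\<^bsub>T\<^esub> ring.indexed_var S V)))"

definition W_sum :: "nat \<Rightarrow> (nat \<Rightarrow> nat) \<Rightarrow> nat \<Rightarrow> nat \<Rightarrow> real" where
  "W_sum n d dmax s =
    (\<Sum>J | J \<subseteq> {1..n} \<and> card J = s.
      (\<Prod>j\<in>J. real dmax - real (d j)) * (\<Prod>j\<in>{1..n} - J. real (d j)))"

end

theory Submission
  imports Defs "HOL-Library.Multiset_Order"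
begin

hide_const (open) Multiset.mult Wellorder_Constructions.zero

text \<open>
  The ring \<open>S[[u,v]]/(f + uv)\<close> is isomorphic to the ring of power series with exponents in a monoid \<open>P\<close> of
  multisets: substitute \<open>x\<^sub>j = y\<^sub>jz\<^sub>j\<close>, \<open>u = - \<Prod>y\<^sub>j^d\<^sub>j\<close>, \<open>v = \<Prod>z\<^sub>j^d\<^sub>j\<close>. Since \<open>P\<close> is closed under
  differences (where divisible), division by standard bases works as in \<open>K[[y,z]]\<close>; it shows that the ring is
  Noetherian and bounds the lengths of chains of primes by the growth \<open>O(k^(n+1))\<close> of \<open>P\<close>.

  A free summand of rank \<open>r\<close> of \<open>F\<^sub>*\<^sup>e\<close> is a family of \<open>r\<close> elements together with dual linear forms. For
  \<open>q = p^e\<close> the elements \<open>b y^m\<close>, with \<open>b\<close> in a basis of \<open>K\<close> over \<open>K^q\<close> and \<open>m \<in> P\<close> having all entries below \<open>q\<close>,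
  have dual forms, while every form maps all other \<open>b y^m\<close> into the maximal ideal. Hence the rank is
  \<open>[K : K^q]\<close> times the number \<open>\<Sum>\<^sub>i \<Prod>\<^sub>j max 0 (q - \<bar>i\<bar> d\<^sub>j)\<close> of such \<open>m\<close>, and the signature is twice the
  integral of \<open>\<Prod>(1 - t d\<^sub>j)\<close> over \<open>0 \<le> t \<le> 1/d\<close>.
\<close>

section \<open>Finite sums\<close>

text \<open>Closure of the monoid under differences means that a monomial dividing another in
  \<open>K[[y,z]]\<close> also divides it in the subring. Besides division, this is what makes
  extraction of the coefficients at \<open>m + q h\<close> a form: a q-th power has only exponents
  divisible by q, and the quotients stay in \<open>P\<close>. The upper bound for the rank is linear
  algebra modulo the maximal ideal: the pairing of r elements with their dual forms is an identity
  matrix, and it factors through the generators that some form can map to a unit. For the dimension,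
  the faces of \<open>P\<close> give a chain of n + 2 primes. Conversely, passing from a prime to a
  strictly smaller one raises the growth degree of the Hilbert function by at least one, the shift
  being controlled by Artin-Rees. In the limit \<open>[K : K^q]\<close> cancels the factor
  \<open>p^(e \<alpha>)\<close> of the denominator. The 2 comes from the pair i, -i, and
  \<open>d^(n+1)\<close> from the n denominators d of the expanded product and one integration of a
  power of 1 - t d. The sum stops at s = n - 1 because some d_j equals d.\<close>

context abelian_monoid
begin

lemma finsum_Sigma:
  assumes "finite A" "\<And>a. a \<in> A \<Longrightarrow> finite (B a)"
    and "\<And>a b. a \<in> A \<Longrightarrow> b \<in> B a \<Longrightarrow> f a b \<in> carrier G"
  shows "(\<Oplus>a\<in>A. \<Oplus>b\<in>B a. f a b) = (finsum G (\<lambda>(a, b). f a b) (Sigma A B))"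
  using assms
proof (induction A)
  case empty
  then show ?case by (simp add: finsum_empty)
next
  case (insert a A)
  have S: "Sigma (insert a A) B = Pair a ` B a \<union> Sigma A B" by auto
  have "(finsum G (\<lambda>(a, b). f a b) (Sigma (insert a A) B))
      = (finsum G (\<lambda>(a, b). f a b) (Pair a ` B a)) \<oplus> (finsum G (\<lambda>(a, b). f a b) (Sigma A B))"
    unfolding S using insert by (intro finsum_Un_disjoint) auto
  also have "(finsum G (\<lambda>(a, b). f a b) (Pair a ` B a)) = (\<Oplus>b\<in>B a. f a b)"
    using insert by (subst finsum_reindex) (auto simp: inj_on_def)
  also have "(finsum G (\<lambda>(a, b). f a b) (Sigma A B)) = (\<Oplus>a\<in>A. \<Oplus>b\<in>B a. f a b)"
    using insert by simp
  also have "(\<Oplus>b\<in>B a. f a b) \<oplus> (\<Oplus>a\<in>A. \<Oplus>b\<in>B a. f a b) = (\<Oplus>a\<in>insert a A. \<Oplus>b\<in>B a. f a b)"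
    using insert by (subst finsum_insert) (auto intro!: finsum_closed)
  finally show ?case by simp
qed

lemma finsum_bij:
  assumes "bij_betw h A B" "\<And>b. b \<in> B \<Longrightarrow> g b \<in> carrier G" "\<And>a. a \<in> A \<Longrightarrow> f a = g (h a)"
  shows "finsum G f A = finsum G g B"
proof -
  have B: "B = h ` A" "inj_on h A" using assms(1) by (auto simp: bij_betw_def)
  have "finsum G g B = finsum G (\<lambda>x. g (h x)) A"
    unfolding B(1) using assms(2) B by (intro finsum_reindex) auto
  also have "\<dots> = finsum G f A"
    using assms B by (intro finsum_cong') auto
  finally show ?thesis by simp
qed

lemma finsum_swap:
  assumes "finite A" "finite B" "\<And>a b. a \<in> A \<Longrightarrow> b \<in> B \<Longrightarrow> f a b \<in> carrier G"
  shows "(\<Oplus>a\<in>A. \<Oplus>b\<in>B. f a b) = (\<Oplus>b\<in>B. \<Oplus>a\<in>A. f a b)"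
proof -
  have "(\<Oplus>a\<in>A. \<Oplus>b\<in>B. f a b) = (finsum G (\<lambda>(a, b). f a b) (A \<times> B))"
    using assms by (intro finsum_Sigma) auto
  also have "\<dots> = (finsum G (\<lambda>(b, a). f a b) (B \<times> A))"
    by (rule finsum_bij[where h = prod.swap]) (use assms in \<open>auto simp: bij_betw_def inj_on_def image_iff\<close>)
  also have "\<dots> = (\<Oplus>b\<in>B. \<Oplus>a\<in>A. f a b)"
    using assms by (intro finsum_Sigma[symmetric]) auto
  finally show ?thesis .
qed

lemma finsum_neutral_left:
  assumes "finite B" "A \<subseteq> B" "\<And>b. b \<in> B - A \<Longrightarrow> f b = \<zero>" "\<And>b. b \<in> A \<Longrightarrow> f b \<in> carrier G"
  shows "finsum G f A = finsum G f B"
proof (rule add.finprod_mono_neutral_cong_left)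
  show "f \<in> B \<rightarrow> carrier G" using assms by (metis Diff_iff Pi_I zero_closed)
qed (use assms in auto)

lemma finsum_single:
  assumes "finite A" "a \<in> A" "\<And>b. b \<in> A \<Longrightarrow> b \<noteq> a \<Longrightarrow> f b = \<zero>" "f a \<in> carrier G"
  shows "finsum G f A = f a"
proof -
  have "finsum G f {a} = finsum G f A"
    using assms by (intro finsum_neutral_left) auto
  then show ?thesis using assms by (simp add: finsum_insert finsum_empty)
qed

lemma finsum_all_zero: "(\<And>x. x \<in> A \<Longrightarrow> f x = \<zero>) \<Longrightarrow> finsum G f A = \<zero>"
  by (rule add.finprod_one_eqI) auto

end


section \<open>Power series with exponents in a monoid\<close>

text \<open>The convolution still runs over all sub-multisets, in \<open>P\<close> or not: terms
  outside \<open>P\<close> vanish with their coefficients. Hence \<open>power_series\<close> is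
  literally the case of all multisets over \<open>I\<close>.\<close>

definition mseries :: "('a, 'r) ring_scheme \<Rightarrow> 'i multiset set \<Rightarrow> ('i multiset \<Rightarrow> 'a) ring" where
  "mseries R P =
    \<lparr>carrier = {f. (\<forall>m. f m \<in> carrier R) \<and> (\<forall>m. m \<notin> P \<longrightarrow> f m = \<zero>\<^bsub>R\<^esub>)},
     mult = (\<lambda>f g m. \<Oplus>\<^bsub>R\<^esub>a\<in>{a. a \<subseteq># m}. f a \<otimes>\<^bsub>R\<^esub> g (m - a)),
     one = ring.indexed_const R \<one>\<^bsub>R\<^esub>,
     zero = ring.indexed_const R \<zero>\<^bsub>R\<^esub>,
     add = (\<lambda>f g m. f m \<oplus>\<^bsub>R\<^esub> g m)\<rparr>"

lemma power_series_eq: "power_series R I = mseries R {m. set_mset m \<subseteq> I}"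
  by (simp add: power_series_def mseries_def)

text \<open>Symmetric index set of the convolution; commutativity and associativity become
  bijections between sets of tuples.\<close>

definition splits :: "'i multiset \<Rightarrow> ('i multiset \<times> 'i multiset) set" where
  "splits m = {(a, b). a + b = m}"

lemma splits_alt: "splits m = (\<lambda>a. (a, m - a)) ` {a. a \<subseteq># m}"
  by (auto simp: splits_def image_iff)

lemma finite_sub_multisets [simp]: "finite {a. a \<subseteq># m}"
proof (induction m)
  case empty
  then show ?case by simp
next
  case (add x m)
  have "{a. a \<subseteq># add_mset x m} \<subseteq> {a. a \<subseteq># m} \<union> add_mset x ` {a. a \<subseteq># m}"
  proof
    fix a assume a: "a \<in> {a. a \<subseteq># add_mset x m}"
    show "a \<in> {a. a \<subseteq># m} \<union> add_mset x ` {a. a \<subseteq># m}"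
    proof (cases "x \<in># a")
      case True
      then obtain b where "a = add_mset x b" by (metis multi_member_split)
      then show ?thesis using a by auto
    next
      case False
      have "a \<subseteq># m"
        using a False by (auto simp: subseteq_mset_def not_in_iff) (metis le0)
      then show ?thesis by simp
    qed
  qed
  then show ?case using add by (meson finite_UnI finite_imageI finite_subset)
qed

lemma finite_splits [simp]: "finite (splits m)"
  by (simp add: splits_alt)

text \<open>The coefficients form only a commutative ring because the construction is iterated:
  \<open>S[[u,v]]\<close> has coefficients in the series ring \<open>S\<close>.\<close>

locale monoid_series = cring R for R (structure) +
  fixes P :: "'i multiset set"
  assumes empty_in: "{#} \<in> P" and add_in: "a \<in> P \<Longrightarrow> b \<in> P \<Longrightarrow> a + b \<in> P"
begin

abbreviation "B \<equiv> mseries R P"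

lemma carrier_B: "f \<in> carrier B \<longleftrightarrow> (\<forall>m. f m \<in> carrier R) \<and> (\<forall>m. m \<notin> P \<longrightarrow> f m = \<zero>)"
  by (simp add: mseries_def)

lemma zero_apply [simp]: "\<zero>\<^bsub>B\<^esub> m = \<zero>"
  by (simp add: mseries_def indexed_const_def)

lemma one_apply: "\<one>\<^bsub>B\<^esub> m = (if m = {#} then \<one> else \<zero>)"
  by (simp add: mseries_def indexed_const_def)

lemma add_apply [simp]: "(f \<oplus>\<^bsub>B\<^esub> g) m = f m \<oplus> g m"
  by (simp add: mseries_def)

lemma mult_apply':
  "(f \<otimes>\<^bsub>B\<^esub> g) m = (\<Oplus>a\<in>{a. a \<subseteq># m}. f a \<otimes> g (m - a))"
  by (simp add: mseries_def)

lemma coeff_closed [simp]: "f \<in> carrier B \<Longrightarrow> f m \<in> carrier R"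
  by (simp add: carrier_B)

lemma coeff_outside: "f \<in> carrier B \<Longrightarrow> m \<notin> P \<Longrightarrow> f m = \<zero>"
  by (simp add: carrier_B)

lemma mult_apply:
  assumes "f \<in> carrier B" "g \<in> carrier B"
  shows "(f \<otimes>\<^bsub>B\<^esub> g) m = (finsum R (\<lambda>(a, b). f a \<otimes> g b) (splits m))"
  unfolding mult_apply'
  by (rule finsum_bij[where h = "\<lambda>a. (a, m - a)"])
    (use assms in \<open>auto simp: bij_betw_def inj_on_def splits_alt\<close>)

lemma mult_closed_B [simp]:
  assumes "f \<in> carrier B" "g \<in> carrier B"
  shows "f \<otimes>\<^bsub>B\<^esub> g \<in> carrier B"
  unfolding carrier_B
proof (intro conjI allI impI)
  fix m
  show "(f \<otimes>\<^bsub>B\<^esub> g) m \<in> carrier R"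
    unfolding mult_apply' using assms by (intro finsum_closed) auto
  assume m: "m \<notin> P"
  show "(f \<otimes>\<^bsub>B\<^esub> g) m = \<zero>"
    unfolding mult_apply[OF assms]
  proof (rule finsum_all_zero)
    fix x assume "x \<in> splits m"
    then have "fst x \<notin> P \<or> snd x \<notin> P" using m add_in by (auto simp: splits_def)
    then show "(case x of (a, b) \<Rightarrow> f a \<otimes> g b) = \<zero>"
      using assms by (auto simp: coeff_outside split: prod.splits)
  qed
qed

lemma mult_comm_B:
  assumes "f \<in> carrier B" "g \<in> carrier B"
  shows "f \<otimes>\<^bsub>B\<^esub> g = g \<otimes>\<^bsub>B\<^esub> f"
proof
  fix m
  show "(f \<otimes>\<^bsub>B\<^esub> g) m = (g \<otimes>\<^bsub>B\<^esub> f) m"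
    unfolding mult_apply[OF assms] mult_apply[OF assms(2,1)]
    by (rule finsum_bij[where h = prod.swap])
      (use assms in \<open>auto simp: bij_betw_def inj_on_def splits_def image_iff add.commute m_comm\<close>)
qed

lemma mult_assoc_B:
  assumes "f \<in> carrier B" "g \<in> carrier B" "h \<in> carrier B"
  shows "(f \<otimes>\<^bsub>B\<^esub> g) \<otimes>\<^bsub>B\<^esub> h = f \<otimes>\<^bsub>B\<^esub> (g \<otimes>\<^bsub>B\<^esub> h)"
proof
  fix m :: "'i multiset"
  note cl = assms
  let ?L = "SIGMA x:splits m. splits (fst x)" and ?R = "SIGMA x:splits m. splits (snd x)"
  have "((f \<otimes>\<^bsub>B\<^esub> g) \<otimes>\<^bsub>B\<^esub> h) m = (\<Oplus>x\<in>splits m. (\<Oplus>y\<in>splits (fst x). (f (fst y) \<otimes> g (snd y)) \<otimes> h (snd x)))"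
    using cl by (subst mult_apply)
      (auto simp: mult_apply finsum_ldistr case_prod_beta Pi_def intro!: finsum_cong')
  also have "\<dots> = (finsum R (\<lambda>(x, y). (f (fst y) \<otimes> g (snd y)) \<otimes> h (snd x)) (?L))"
    using cl by (intro finsum_Sigma) auto
  also have "\<dots> = (finsum R (\<lambda>(x, y). f (fst x) \<otimes> (g (fst y) \<otimes> h (snd y))) (?R))"
  \<comment> \<open>Both sides run over the triples (a, b, z) with sum m; the map only regroups
    them.\<close>
  proof (rule finsum_bij[where h = "\<lambda>((c, z), (a, b)). ((a, b + z), (b, z))"], goal_cases)
    case 1
    show ?case
      by (rule bij_betwI[where g = "\<lambda>((a, w), (b, z)). ((a + b, z), (a, b))"])
        (auto simp: splits_def add.assoc)
  qed (use cl in \<open>auto simp: m_assoc\<close>)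
  also have "\<dots> = (\<Oplus>x\<in>splits m. (\<Oplus>y\<in>splits (snd x). f (fst x) \<otimes> (g (fst y) \<otimes> h (snd y))))"
    using cl by (intro finsum_Sigma[symmetric]) auto
  also have "\<dots> = (f \<otimes>\<^bsub>B\<^esub> (g \<otimes>\<^bsub>B\<^esub> h)) m"
    using cl by (subst mult_apply)
      (auto simp: mult_apply finsum_rdistr case_prod_beta Pi_def intro!: finsum_cong')
  finally show "((f \<otimes>\<^bsub>B\<^esub> g) \<otimes>\<^bsub>B\<^esub> h) m = (f \<otimes>\<^bsub>B\<^esub> (g \<otimes>\<^bsub>B\<^esub> h)) m" .
qed

lemma one_in_B: "\<one>\<^bsub>B\<^esub> \<in> carrier B"
  using empty_in by (auto simp: carrier_B one_apply)

lemma one_mult_B: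
  assumes "f \<in> carrier B"
  shows "\<one>\<^bsub>B\<^esub> \<otimes>\<^bsub>B\<^esub> f = f"
proof
  fix m
  have "(\<one>\<^bsub>B\<^esub> \<otimes>\<^bsub>B\<^esub> f) m = \<one>\<^bsub>B\<^esub> {#} \<otimes> f (m - {#})"
    unfolding mult_apply' by (rule finsum_single) (use assms in \<open>auto simp: one_apply\<close>)
  then show "(\<one>\<^bsub>B\<^esub> \<otimes>\<^bsub>B\<^esub> f) m = f m" using assms by (simp add: one_apply)
qed

lemma distrib_B:
  assumes "f \<in> carrier B" "g \<in> carrier B" "h \<in> carrier B"
  shows "(f \<oplus>\<^bsub>B\<^esub> g) \<otimes>\<^bsub>B\<^esub> h = (f \<otimes>\<^bsub>B\<^esub> h) \<oplus>\<^bsub>B\<^esub> (g \<otimes>\<^bsub>B\<^esub> h)"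
proof
  fix m
  show "((f \<oplus>\<^bsub>B\<^esub> g) \<otimes>\<^bsub>B\<^esub> h) m = ((f \<otimes>\<^bsub>B\<^esub> h) \<oplus>\<^bsub>B\<^esub> (g \<otimes>\<^bsub>B\<^esub> h)) m"
    using assms by (simp add: mult_apply' l_distr finsum_addf Pi_def)
qed

lemma B_cring: "cring B"
proof (rule cringI)
  show "abelian_group B"
  proof (rule abelian_groupI)
    fix f assume f: "f \<in> carrier B"
    have "(\<lambda>m. \<ominus> f m) \<in> carrier B" using f by (auto simp: carrier_B)
    moreover have "(\<lambda>m. \<ominus> f m) \<oplus>\<^bsub>B\<^esub> f = \<zero>\<^bsub>B\<^esub>"
      using f by (auto simp: fun_eq_iff carrier_B l_neg)
    ultimately show "\<exists>y\<in>carrier B. y \<oplus>\<^bsub>B\<^esub> f = \<zero>\<^bsub>B\<^esub>" by blast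
  qed (auto simp: carrier_B fun_eq_iff a_ac)
  show "Group.comm_monoid B"
    by (rule comm_monoidI) (auto intro: mult_closed_B one_in_B mult_assoc_B one_mult_B mult_comm_B)
qed (auto intro: distrib_B)

sublocale B: cring B by (rule B_cring)

lemma minus_apply [simp]: "f \<in> carrier B \<Longrightarrow> (\<ominus>\<^bsub>B\<^esub> f) m = \<ominus> f m"
proof -
  assume f: "f \<in> carrier B"
  have "(\<lambda>m. \<ominus> f m) \<in> carrier B" using f by (auto simp: carrier_B)
  moreover have "(\<lambda>m. \<ominus> f m) \<oplus>\<^bsub>B\<^esub> f = \<zero>\<^bsub>B\<^esub>"
    using f by (auto simp: fun_eq_iff carrier_B l_neg)
  ultimately have "\<ominus>\<^bsub>B\<^esub> f = (\<lambda>m. \<ominus> f m)" using f B.minus_equality by blast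
  then show ?thesis by simp
qed

lemma diff_apply [simp]: "f \<in> carrier B \<Longrightarrow> g \<in> carrier B \<Longrightarrow> (f \<ominus>\<^bsub>B\<^esub> g) m = f m \<ominus> g m"
  by (simp add: a_minus_def)

lemma finsum_apply:
  assumes "finite A" "\<And>i. i \<in> A \<Longrightarrow> F i \<in> carrier B"
  shows "(\<Oplus>\<^bsub>B\<^esub>i\<in>A. F i) m = (\<Oplus>i\<in>A. F i m)"
  using assms
proof (induction A)
  case (insert a A)
  then show ?case by (simp add: Pi_def)
qed auto

definition mono :: "'i multiset \<Rightarrow> 'a \<Rightarrow> 'i multiset \<Rightarrow> 'a" where
  "mono a k m = (if m = a then k else \<zero>)"

lemma mono_closed [simp]: "a \<in> P \<Longrightarrow> k \<in> carrier R \<Longrightarrow> mono a k \<in> carrier B"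
  by (auto simp: mono_def carrier_B)

lemma mono_apply_same [simp]: "mono a k a = k" by (simp add: mono_def)

lemma mono_mult_apply:
  assumes "k \<in> carrier R" "f \<in> carrier B" "a \<in> P"
  shows "(mono a k \<otimes>\<^bsub>B\<^esub> f) m = (if a \<subseteq># m then k \<otimes> f (m - a) else \<zero>)"
proof (cases "a \<subseteq># m")
  case True
  have "(mono a k \<otimes>\<^bsub>B\<^esub> f) m = mono a k a \<otimes> f (m - a)"
    unfolding mult_apply' using True assms by (intro finsum_single) (auto simp: mono_def)
  then show ?thesis using True by simp
next
  case False
  then show ?thesis unfolding mult_apply' using assms
    by (auto intro!: finsum_all_zero simp: mono_def)
qed

lemma mono_mult_mono:
  assumes "k \<in> carrier R" "l \<in> carrier R" "a \<in> P" "b \<in> P"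
  shows "mono a k \<otimes>\<^bsub>B\<^esub> mono b l = mono (a + b) (k \<otimes> l)"
proof
  fix m
  have *: "a \<subseteq># m \<Longrightarrow> m - a = b \<longleftrightarrow> m = a + b"
    by (metis add_diff_cancel_left' subset_mset.add_diff_inverse)
  show "(mono a k \<otimes>\<^bsub>B\<^esub> mono b l) m = mono (a + b) (k \<otimes> l) m"
    using assms * by (subst mono_mult_apply) (auto simp: mono_def)
qed

lemma one_mono: "\<one>\<^bsub>B\<^esub> = mono {#} \<one>"
  by (auto simp: fun_eq_iff one_apply mono_def)

lemma mono_pow:
  assumes "k \<in> carrier R" "a \<in> P"
  shows "mono a k [^]\<^bsub>B\<^esub> (n::nat) = mono (repeat_mset n a) (k [^] n)"
proof (induction n)
  case 0
  then show ?case by (simp add: one_mono)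
next
  case (Suc n)
  have "repeat_mset n a \<in> P" using assms empty_in add_in by (induction n) auto
  then show ?case using Suc assms by (simp add: mono_mult_mono add.commute)
qed

lemma repeat_in: "a \<in> P \<Longrightarrow> repeat_mset n a \<in> P"
  using empty_in add_in by (induction n) auto

end

lemma mem_splits [simp]: "(a, b) \<in> splits m \<longleftrightarrow> a + b = m"
  by (simp add: splits_def)

section \<open>Leading exponents\<close>

text \<open>Comparing sizes first makes every exponent have only finitely many predecessors.\<close>

definition mless :: "'i::linorder multiset \<Rightarrow> 'i multiset \<Rightarrow> bool" where
  "mless a b \<longleftrightarrow> size a < size b \<or> size a = size b \<and> a < b"

lemma mless_irrefl [simp]: "\<not> mless a a"
  by (simp add: mless_def)

lemma mless_trans: "mless a b \<Longrightarrow> mless b c \<Longrightarrow> mless a c"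
  by (auto simp: mless_def)

lemma mless_asym: "mless a b \<Longrightarrow> \<not> mless b a"
  by (auto simp: mless_def)

lemma mless_total: "mless a b \<or> a = b \<or> mless b a"
  by (auto simp: mless_def)

lemma mless_add_right [simp]: "mless (a + c) (b + c) \<longleftrightarrow> mless a b"
  by (auto simp: mless_def)

lemma mless_add_left [simp]: "mless (c + a) (c + b) \<longleftrightarrow> mless a b"
  by (auto simp: mless_def)

lemma mless_add_mono: "\<not> mless a c \<Longrightarrow> \<not> mless b e \<Longrightarrow> mless (a + b) (c + e) \<Longrightarrow> False"
  by (metis mless_add_left mless_add_right mless_total mless_trans)

lemma not_mless_add_eq: "\<not> mless a c \<Longrightarrow> \<not> mless b e \<Longrightarrow> a + b = c + e \<Longrightarrow> a = c \<and> b = e"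
  by (metis add_left_cancel mless_add_left mless_add_right mless_irrefl mless_total mless_trans)

lemma mless_size: "mless a b \<Longrightarrow> size a \<le> size b"
  by (auto simp: mless_def)

lemma finite_bounded_multisets: "finite J \<Longrightarrow> finite {m. set_mset m \<subseteq> J \<and> size m \<le> k}"
proof (rule finite_subset)
  assume J: "finite J"
  show "{m. set_mset m \<subseteq> J \<and> size m \<le> k} \<subseteq> {a. a \<subseteq># repeat_mset k (mset_set J)}"
  proof safe
    fix m :: "'a multiset" assume m: "set_mset m \<subseteq> J" "size m \<le> k"
    show "m \<subseteq># repeat_mset k (mset_set J)"
      unfolding subseteq_mset_def
    proof
      fix a
      show "count m a \<le> count (repeat_mset k (mset_set J)) a"
        using m J count_le_size[of m a]
        by (cases "a \<in> J") (auto simp: count_mset_set' not_in_iff)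
    qed
  qed
qed simp

locale field_series = monoid_series R P + field R
  for R (structure) and P :: "'i::linorder multiset set" +
  fixes J :: "'i set"
  assumes finite_J: "finite J" and P_sub: "m \<in> P \<Longrightarrow> set_mset m \<subseteq> J"
begin

lemma finite_P_size: "finite {m \<in> P. size m \<le> k}"
  by (rule finite_subset[OF _ finite_bounded_multisets[OF finite_J, of k]]) (use P_sub in auto)

definition is_lead :: "('i multiset \<Rightarrow> 'a) \<Rightarrow> 'i multiset \<Rightarrow> bool" where
  "is_lead F m \<longleftrightarrow> F m \<noteq> \<zero> \<and> (\<forall>m'. mless m' m \<longrightarrow> F m' = \<zero>)"

lemma finite_mless: "finite {m' \<in> P. mless m' m}"
  by (rule finite_subset[OF _ finite_P_size[of "size m"]]) (auto dest: mless_size)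

text \<open>Rank of an exponent in the order \<open>mless\<close>. Finiteness of the set of
  predecessors turns minimal choices and the infinite division process into recursion over
  nat.\<close>

definition pos :: "'i multiset \<Rightarrow> nat" where
  "pos m = card {m' \<in> P. mless m' m}"

lemma pos_less: "a \<in> P \<Longrightarrow> mless a b \<Longrightarrow> pos a < pos b"
  unfolding pos_def
proof (intro psubset_card_mono finite_mless psubsetI)
  assume a: "a \<in> P" "mless a b"
  then show "{m' \<in> P. mless m' a} \<subseteq> {m' \<in> P. mless m' b}" by (auto intro: mless_trans)
  have "a \<in> {m' \<in> P. mless m' b}" "a \<notin> {m' \<in> P. mless m' a}" using a by auto
  then show "{m' \<in> P. mless m' a} \<noteq> {m' \<in> P. mless m' b}" by blast
qed

lemma pos_less_iff: "a \<in> P \<Longrightarrow> b \<in> P \<Longrightarrow> pos a < pos b \<longleftrightarrow> mless a b"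
  using pos_less mless_total[of a b] by (metis less_irrefl not_less_iff_gr_or_eq)

lemma pos_inj: "a \<in> P \<Longrightarrow> b \<in> P \<Longrightarrow> pos a = pos b \<Longrightarrow> a = b"
  using pos_less mless_total[of a b] by fastforce

lemma ex_lead:
  assumes "F \<in> carrier B" "F \<noteq> \<zero>\<^bsub>B\<^esub>"
  shows "\<exists>m\<in>P. is_lead F m"
proof -
  obtain m0 where "F m0 \<noteq> \<zero>" using assms(2) by fastforce
  then have "m0 \<in> P \<and> F m0 \<noteq> \<zero>" using assms coeff_outside by blast
  then obtain m where m: "m \<in> P \<and> F m \<noteq> \<zero>" "\<And>m'. m' \<in> P \<and> F m' \<noteq> \<zero> \<Longrightarrow> pos m \<le> pos m'"
    using ex_has_least_nat[of "\<lambda>m. m \<in> P \<and> F m \<noteq> \<zero>" m0 pos] by blast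
  then have "is_lead F m"
    unfolding is_lead_def using pos_less coeff_outside assms by (metis not_less)
  then show ?thesis using m by blast
qed

lemma lead_in: "F \<in> carrier B \<Longrightarrow> is_lead F m \<Longrightarrow> m \<in> P"
  using coeff_outside by (auto simp: is_lead_def)

text \<open>The order is compatible with addition, so a pair other than (a, b) whose sum does not
  exceed a + b has a component below a or below b. Hence only one term of the convolution survives
  at a + b, and none below.\<close>

lemma lead_mult:
  assumes F: "F \<in> carrier B" "is_lead F a" and G: "G \<in> carrier B" "is_lead G b"
  shows "is_lead (F \<otimes>\<^bsub>B\<^esub> G) (a + b)" "(F \<otimes>\<^bsub>B\<^esub> G) (a + b) = F a \<otimes> G b"
proof -
  have z: "F c \<otimes> G e = \<zero>" if "\<not> mless (a + b) (c + e)" "(c, e) \<noteq> (a, b)" for c e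
  proof -
    have "mless c a \<or> mless e b"
      using that not_mless_add_eq[of c a e b] mless_add_mono[of c a e b] mless_total[of "a + b" "c + e"]
      by (metis mless_total)
    then show ?thesis using F G by (auto simp: is_lead_def)
  qed
  show 1: "(F \<otimes>\<^bsub>B\<^esub> G) (a + b) = F a \<otimes> G b"
  proof -
    have "(F \<otimes>\<^bsub>B\<^esub> G) (a + b) = (case (a, b) of (a, b) \<Rightarrow> F a \<otimes> G b)"
      unfolding mult_apply[OF F(1) G(1)]
    proof (rule finsum_single)
      fix x assume x: "x \<in> splits (a + b)" "x \<noteq> (a, b)"
      obtain c e where ce: "x = (c, e)" by force
      then show "(case x of (a, b) \<Rightarrow> F a \<otimes> G b) = \<zero>"
        using x z[of c e] by (auto simp: splits_def)
    qed (use F G in auto)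
    then show ?thesis by simp
  qed
  have "(F \<otimes>\<^bsub>B\<^esub> G) m = \<zero>" if m: "mless m (a + b)" for m
    unfolding mult_apply[OF F(1) G(1)]
  proof (rule finsum_all_zero)
    fix x assume x: "x \<in> splits m"
    obtain c e where ce: "x = (c, e)" by force
    then show "(case x of (a, b) \<Rightarrow> F a \<otimes> G b) = \<zero>"
      using x z[of c e] m by (auto simp: splits_def dest: mless_asym)
  qed
  moreover have "F a \<otimes> G b \<noteq> \<zero>"
    using F G by (auto simp: is_lead_def integral_iff)
  ultimately show "is_lead (F \<otimes>\<^bsub>B\<^esub> G) (a + b)"
    by (simp add: is_lead_def 1)
qed

lemma B_domain: "domain B"
proof (rule domainI)
  show "\<one>\<^bsub>B\<^esub> \<noteq> \<zero>\<^bsub>B\<^esub>"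
    by (metis one_apply one_not_zero zero_apply)
next
  fix F G assume *: "F \<otimes>\<^bsub>B\<^esub> G = \<zero>\<^bsub>B\<^esub>" "F \<in> carrier B" "G \<in> carrier B"
  show "F = \<zero>\<^bsub>B\<^esub> \<or> G = \<zero>\<^bsub>B\<^esub>"
  proof (rule ccontr)
    assume "\<not> ?thesis"
    then obtain a b where "is_lead F a" "is_lead G b" using ex_lead * by blast
    then have "is_lead (F \<otimes>\<^bsub>B\<^esub> G) (a + b)" using lead_mult * by blast
    then show False using * by (simp add: is_lead_def)
  qed
qed (rule B_cring)

end


section \<open>Division by a standard basis\<close>

text \<open>By \<open>full\<close>, divisibility of monomials inside \<open>B\<close> is inclusion
  of multisets, so Dickson's lemma and monomial division can take place in the ambient free
  monoid.\<close>

locale full_series = field_series R P J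
  for R (structure) and P :: "'i::linorder multiset set" and J +
  assumes full: "a \<in> P \<Longrightarrow> b \<in> P \<Longrightarrow> a \<subseteq># b \<Longrightarrow> b - a \<in> P"
begin

text \<open>The exponents that are multiples of some element of \<open>E\<close> are cleared one by
  one in the order of \<open>pos\<close>. Each clearing affects only the current and later
  exponents, so every coefficient is settled after finitely many steps. No remainder is left, since
  its leading exponent would again be a multiple of an element of \<open>E\<close>. The last clause,
  that the quotients lose at most \<open>size \<alpha>\<close> in order, is what Artin-Rees
  needs.\<close>

lemma division:
  fixes E :: "'i multiset set" and g :: "'i multiset \<Rightarrow> 'i multiset \<Rightarrow> 'a"
  assumes Q: "ideal Q B" and y: "y \<in> Q" and E: "finite E" "E \<subseteq> P"
    and g: "\<And>\<alpha>. \<alpha> \<in> E \<Longrightarrow> g \<alpha> \<in> Q" "\<And>\<alpha>. \<alpha> \<in> E \<Longrightarrow> is_lead (g \<alpha>) \<alpha>" "\<And>\<alpha>. \<alpha> \<in> E \<Longrightarrow> g \<alpha> \<alpha> = \<one>"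
    and lead: "\<And>F m. F \<in> Q \<Longrightarrow> is_lead F m \<Longrightarrow> \<exists>\<alpha>\<in>E. \<alpha> \<subseteq># m"
  shows "\<exists>c \<in> E \<rightarrow> carrier B. y = (\<Oplus>\<^bsub>B\<^esub>\<alpha>\<in>E. c \<alpha> \<otimes>\<^bsub>B\<^esub> g \<alpha>) \<and>
    (\<forall>k. (\<forall>m. size m < k \<longrightarrow> y m = \<zero>) \<longrightarrow> (\<forall>\<alpha>\<in>E. \<forall>m. size m + size \<alpha> < k \<longrightarrow> c \<alpha> m = \<zero>))"
proof -
  interpret Q: ideal Q B by fact
  have QB: "F \<in> carrier B" if "F \<in> Q" for F using that Q.a_subset by blast
  define LE where "LE = {m \<in> P. \<exists>\<alpha>\<in>E. \<alpha> \<subseteq># m}"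
  \<comment> \<open>Fixing one divisor for every exponent makes each clearing contribute to exactly
    one quotient.\<close>
  define sel where "sel m = (SOME \<alpha>. \<alpha> \<in> E \<and> \<alpha> \<subseteq># m)" for m
  have sel: "sel m \<in> E" "sel m \<subseteq># m" if "m \<in> LE" for m
    using that someI_ex[of "\<lambda>\<alpha>. \<alpha> \<in> E \<and> \<alpha> \<subseteq># m"] by (auto simp: LE_def sel_def)
  have LEP: "m \<in> P" if "m \<in> LE" for m using that by (simp add: LE_def)
  define G where "G m = mono (m - sel m) \<one> \<otimes>\<^bsub>B\<^esub> g (sel m)" for m
  have dP: "m - sel m \<in> P" if "m \<in> LE" for m
    using sel[OF that] LEP[OF that] E full by blast
  have GQ: "G m \<in> Q" if "m \<in> LE" for m
    unfolding G_def using that dP sel g by (intro Q.I_l_closed) auto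
  have Gap: "G m m' = (if m - sel m \<subseteq># m' then g (sel m) (m' - (m - sel m)) else \<zero>)" if "m \<in> LE" for m m'
    unfolding G_def using that dP[OF that] sel[OF that] g QB by (subst mono_mult_apply) auto
  have Gm: "G m m = \<one>" if "m \<in> LE" for m
  proof -
    have "m - (m - sel m) = sel m" using sel(2)[OF that]
      by (metis add_diff_cancel_left' subset_mset.diff_add)
    then show ?thesis using sel[OF that] g by (simp add: Gap[OF that])
  qed
  have Gz: "G m m' = \<zero>" if "m \<in> LE" "mless m' m" for m m'
  proof (cases "m - sel m \<subseteq># m'")
    case True
    have "mless (m' - (m - sel m) + (m - sel m)) (sel m + (m - sel m))"
      using that sel(2)[of m] True by simp
    then have "mless (m' - (m - sel m)) (sel m)" by simp
    then show ?thesis using g(2)[OF sel(1)[OF that(1)]] that by (simp add: Gap is_lead_def)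
  qed (simp add: Gap that)
  \<comment> \<open>Step t clears the exponent of rank t, and does nothing when that exponent is not
    a multiple of an element of \<open>E\<close>.\<close>
  define stp where "stp t Y = (if \<exists>m\<in>LE. pos m = t then
      (let m = (THE m. m \<in> LE \<and> pos m = t) in Y \<ominus>\<^bsub>B\<^esub> mono {#} (Y m) \<otimes>\<^bsub>B\<^esub> G m) else Y)" for t Y
  have stp1: "stp (pos m) Y = Y \<ominus>\<^bsub>B\<^esub> mono {#} (Y m) \<otimes>\<^bsub>B\<^esub> G m" if "m \<in> LE" for m Y
  proof -
    have "(THE m'. m' \<in> LE \<and> pos m' = pos m) = m"
      using that pos_inj LEP by blast
    then show ?thesis using that by (auto simp: stp_def)
  qed
  have stp2: "stp t Y = Y" if "\<And>m. m \<in> LE \<Longrightarrow> pos m \<noteq> t" for t Y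
    using that by (auto simp: stp_def)
  define yt where "yt = rec_nat y stp"
  have yt0: "yt 0 = y" and ytS: "\<And>t. yt (Suc t) = stp t (yt t)" by (simp_all add: yt_def)
  have ytQ: "yt t \<in> Q" for t
  proof (induction t)
    case (Suc t)
    show ?case
    proof (cases "\<exists>m\<in>LE. pos m = t")
      case True
      then obtain m where m: "m \<in> LE" "pos m = t" by blast
      have "mono {#} (yt t m) \<otimes>\<^bsub>B\<^esub> G m \<in> Q"
        using GQ[OF m(1)] empty_in QB[OF Suc] by (intro Q.I_l_closed) auto
      then show ?thesis using stp1[OF m(1)] m Suc ytS
        by (metis Q.a_closed Q.a_inv_closed a_minus_def)
    next
      case False
      then show ?thesis using Suc stp2 ytS by metis
    qed
  qed (simp add: yt0 y)
  define \<kappa> where "\<kappa> m = yt (pos m) m" for m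
  have kc: "\<kappa> m \<in> carrier R" for m using QB[OF ytQ] by (simp add: \<kappa>_def)
  have stepv: "yt (Suc t) m' = yt t m' \<ominus> \<kappa> m \<otimes> G m m'" if "m \<in> LE" "pos m = t" for t m m'
  proof -
    have "(mono {#} (yt t m) \<otimes>\<^bsub>B\<^esub> G m) m' = \<kappa> m \<otimes> G m m'"
      using QB[OF ytQ] QB[OF GQ[OF that(1)]] empty_in that by (subst mono_mult_apply) (auto simp: \<kappa>_def)
    moreover have "mono {#} (yt t m) \<otimes>\<^bsub>B\<^esub> G m \<in> carrier B"
      using QB[OF ytQ] QB[OF GQ[OF that(1)]] empty_in by (intro mult_closed_B mono_closed) auto
    ultimately show ?thesis using stp1[OF that(1)] that QB[OF ytQ] by (simp add: ytS)
  qed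
  have van: "yt t m = \<zero>" if "m \<in> P" "pos m < t" for t m
    using that
  proof (induction t arbitrary: m)
    case (Suc t)
    show ?case
    proof (cases "\<exists>m\<in>LE. pos m = t")
      case True
      then obtain m' where m': "m' \<in> LE" "pos m' = t" by blast
      show ?thesis
      proof (cases "pos m < t")
        case True
        then have "mless m m'" using m' Suc.prems pos_less_iff LEP by blast
        then show ?thesis using stepv[OF m'] Suc.IH[OF Suc.prems(1) True] Gz m' kc by (simp add: a_minus_def)
      next
        case False
        then have mm: "m = m'" using Suc.prems m' pos_inj LEP by auto
        then have "yt t m = \<kappa> m" using m' by (simp add: \<kappa>_def)
        then show ?thesis using stepv[OF m', of m] Gm[OF m'(1)] mm kc by (simp add: a_minus_def r_neg)
      qed
    next
      case False
      then have yS: "yt (Suc t) = yt t" using stp2 ytS by metis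
      show ?thesis
      proof (cases "pos m < t")
        case True
        then show ?thesis using Suc yS by simp
      next
        case nt: False
        then have mt: "pos m = t" using Suc by simp
        show ?thesis
        proof (rule ccontr)
          \<comment> \<open>Exponents outside \<open>LE\<close> are never cleared, yet they vanish
            as well: with all smaller coefficients zero, m would be the leading exponent of an
            element of \<open>Q\<close>, which \<open>lead\<close> forces into
            \<open>LE\<close>.\<close>
          assume "yt (Suc t) m \<noteq> \<zero>"
          then have "yt t m \<noteq> \<zero>" by (simp add: yS)
          moreover have "yt t m' = \<zero>" if "mless m' m" for m'
          proof (cases "m' \<in> P")
            case True
            then have "pos m' < t" using pos_less that mt by blast
            then show ?thesis using Suc.IH True by blast
          next
            case False
            then show ?thesis using QB[OF ytQ] coeff_outside by blast
          qed
          ultimately have "is_lead (yt t) m" by (simp add: is_lead_def)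
          then have "m \<in> LE" using lead[OF ytQ] Suc.prems by (auto simp: LE_def)
          then show False using False mt by blast
        qed
      qed
    qed
  qed simp
  have fin: "finite {m \<in> LE. pos m < t}" for t
  proof -
    have "inj_on pos {m \<in> LE. pos m < t}" using pos_inj LEP by (auto simp: inj_on_def)
    moreover have "pos ` {m \<in> LE. pos m < t} \<subseteq> {..<t}" by auto
    ultimately show ?thesis by (meson finite_lessThan inj_on_finite)
  qed
  have tele: "y m' = yt t m' \<oplus> (\<Oplus>m\<in>{m \<in> LE. pos m < t}. \<kappa> m \<otimes> G m m')" for t m'
  proof (induction t)
    case 0
    then show ?case using QB[OF y] by (simp add: yt0)
  next
    case (Suc t)
    have cl: "(\<Oplus>m\<in>{m \<in> LE. pos m < t}. \<kappa> m \<otimes> G m m') \<in> carrier R"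
      using kc QB[OF GQ] by (intro finsum_closed) auto
    show ?case
    proof (cases "\<exists>m\<in>LE. pos m = t")
      case True
      then obtain m where m: "m \<in> LE" "pos m = t" by blast
      have "{m \<in> LE. pos m < Suc t} = insert m {m \<in> LE. pos m < t}"
        using m pos_inj LEP by (auto simp: less_Suc_eq)
      then have "(\<Oplus>m\<in>{m \<in> LE. pos m < Suc t}. \<kappa> m \<otimes> G m m')
          = \<kappa> m \<otimes> G m m' \<oplus> (\<Oplus>m\<in>{m \<in> LE. pos m < t}. \<kappa> m \<otimes> G m m')"
        using m fin[of t] kc QB[OF GQ] by (simp add: Pi_def)
      moreover have "yt t m' \<in> carrier R" "\<kappa> m \<otimes> G m m' \<in> carrier R"
        using kc QB[OF GQ[OF m(1)]] QB[OF ytQ] by auto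
      moreover have "yt (Suc t) m' = yt t m' \<ominus> \<kappa> m \<otimes> G m m'"
        by (rule stepv[OF m])
      ultimately show ?thesis
        unfolding Suc.IH using cl
        by (simp add: a_minus_def a_assoc) (simp add: r_neg1)
    next
      case False
      then have "yt (Suc t) = yt t" "{m \<in> LE. pos m < Suc t} = {m \<in> LE. pos m < t}"
        using stp2 ytS by (metis, auto simp: less_Suc_eq)
      then show ?thesis using Suc.IH by simp
    qed
  qed
  \<comment> \<open>Clearing the exponent \<gamma> + \<alpha> with the basis element \<alpha>
    subtracts a multiple of \<open>y^\<gamma> g \<alpha>\<close>; the multiplier is the coefficient
    of the quotient at \<gamma>.\<close>
  define c where "c \<alpha> \<gamma> = (if \<gamma> \<in> P \<and> sel (\<gamma> + \<alpha>) = \<alpha> then \<kappa> (\<gamma> + \<alpha>) else \<zero>)" for \<alpha> \<gamma>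
  have cB: "c \<alpha> \<in> carrier B" for \<alpha> using kc by (auto simp: carrier_B c_def)
  have inLE: "\<gamma> + \<alpha> \<in> LE" if "\<gamma> \<in> P" "\<alpha> \<in> E" for \<gamma> \<alpha>
    using that E add_in by (auto simp: LE_def intro!: bexI[of _ \<alpha>])
  \<comment> \<open>\<open>G m\<close> starts at m, so only clearings of rank at most
    \<open>pos m'\<close> reach the coefficient at m'. The infinite sum is therefore compared with
    the telescoped sum after \<open>Suc (pos m')\<close> steps.\<close>
  have main: "y m' = (\<Oplus>\<^bsub>B\<^esub>\<alpha>\<in>E. c \<alpha> \<otimes>\<^bsub>B\<^esub> g \<alpha>) m'" if m': "m' \<in> P" for m'
  proof -
    let ?S1 = "Sigma E (\<lambda>_. {\<gamma>. \<gamma> \<subseteq># m'})"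
    let ?S1' = "{(\<alpha>, \<gamma>). \<alpha> \<in> E \<and> \<gamma> \<subseteq># m' \<and> \<gamma> \<in> P \<and> sel (\<gamma> + \<alpha>) = \<alpha> \<and> \<not> mless m' (\<gamma> + \<alpha>)}"
    let ?S2 = "{m \<in> LE. pos m < Suc (pos m')}"
    let ?S2' = "{m \<in> ?S2. m - sel m \<subseteq># m'}"
    have "(\<Oplus>\<^bsub>B\<^esub>\<alpha>\<in>E. c \<alpha> \<otimes>\<^bsub>B\<^esub> g \<alpha>) m' = (\<Oplus>\<alpha>\<in>E. (\<Oplus>\<gamma>\<in>{\<gamma>. \<gamma> \<subseteq># m'}. c \<alpha> \<gamma> \<otimes> g \<alpha> (m' - \<gamma>)))"
      using E cB QB[OF g(1)] by (subst finsum_apply) (auto simp: mult_apply' intro!: mult_closed_B)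
    also have "\<dots> = (\<Oplus>x\<in>?S1. case x of (\<alpha>, \<gamma>) \<Rightarrow> c \<alpha> \<gamma> \<otimes> g \<alpha> (m' - \<gamma>))"
      using E cB QB[OF g(1)] by (intro finsum_Sigma) auto
    also have "\<dots> = (\<Oplus>x\<in>?S1'. case x of (\<alpha>, \<gamma>) \<Rightarrow> c \<alpha> \<gamma> \<otimes> g \<alpha> (m' - \<gamma>))"
    proof (rule finsum_neutral_left[symmetric], goal_cases)
      case (3 x)
      obtain \<alpha> \<gamma> where x: "x = (\<alpha>, \<gamma>)" by force
      have a: "\<alpha> \<in> E" "\<gamma> \<subseteq># m'" using 3 x by auto
      show ?case
      proof (cases "mless m' (\<gamma> + \<alpha>)")
        case True
        then have "mless (\<gamma> + (m' - \<gamma>)) (\<gamma> + \<alpha>)" using a by simp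
        then have "mless (m' - \<gamma>) \<alpha>" by simp
        then have "g \<alpha> (m' - \<gamma>) = \<zero>" using g(2)[OF a(1)] by (simp add: is_lead_def)
        then show ?thesis using x cB by simp
      next
        case False
        then have "c \<alpha> \<gamma> = \<zero>" using 3 x a by (auto simp: c_def)
        then show ?thesis using x QB[OF g(1)[OF a(1)]] by simp
      qed
    qed (use E cB QB[OF g(1)] in auto)
    also have "\<dots> = (\<Oplus>m\<in>?S2'. \<kappa> m \<otimes> G m m')"
    proof (rule finsum_bij[where h = "\<lambda>(\<alpha>, \<gamma>). \<gamma> + \<alpha>"], goal_cases)
      case 1
      show ?case
      proof (rule bij_betwI[where g = "\<lambda>m. (sel m, m - sel m)"])
        show "(\<lambda>(\<alpha>, \<gamma>). \<gamma> + \<alpha>) \<in> ?S1' \<rightarrow> ?S2'"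
          using inLE m' LEP pos_less_iff by (auto simp: less_Suc_eq_le not_less[symmetric])
        show "(\<lambda>m. (sel m, m - sel m)) \<in> ?S2' \<rightarrow> ?S1'"
          using sel dP m' LEP pos_less_iff by (auto simp: less_Suc_eq_le not_less[symmetric])
      qed (use sel in auto)
    next
      case (2 m)
      then show ?case using kc QB[OF GQ] by simp
    next
      case (3 x)
      obtain \<alpha> \<gamma> where x: "x = (\<alpha>, \<gamma>)" by force
      then show ?case using 3 inLE by (auto simp: c_def Gap)
    qed
    also have "\<dots> = (\<Oplus>m\<in>?S2. \<kappa> m \<otimes> G m m')"
    proof (rule finsum_neutral_left, goal_cases)
      case (3 b)
      then show ?case using kc by (auto simp: Gap)
    next
      case (4 b)
      then show ?case using kc QB[OF GQ] by auto
    qed (use fin in auto)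
    also have "\<dots> = y m'"
      using tele[of m' "Suc (pos m')"] van[OF m', of "Suc (pos m')"] kc QB[OF GQ]
      by (simp add: Pi_def)
    finally show ?thesis by simp
  qed
  have sB: "(\<Oplus>\<^bsub>B\<^esub>\<alpha>\<in>E. c \<alpha> \<otimes>\<^bsub>B\<^esub> g \<alpha>) \<in> carrier B"
    using cB QB[OF g(1)] by (intro B.finsum_closed) auto
  have eq: "y = (\<Oplus>\<^bsub>B\<^esub>\<alpha>\<in>E. c \<alpha> \<otimes>\<^bsub>B\<^esub> g \<alpha>)"
  proof
    fix m
    show "y m = (\<Oplus>\<^bsub>B\<^esub>\<alpha>\<in>E. c \<alpha> \<otimes>\<^bsub>B\<^esub> g \<alpha>) m"
      using main coeff_outside[OF sB] coeff_outside[OF QB[OF y]] by (cases "m \<in> P") auto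
  qed
  have "c \<alpha> m = \<zero>" if k: "\<forall>m. size m < k \<longrightarrow> y m = \<zero>" and m: "size m + size \<alpha> < k" for k \<alpha> m
  proof -
    have "\<forall>m. size m < k \<longrightarrow> yt t m = \<zero>" for t
    proof (induction t)
      case (Suc t)
      show ?case
      proof (cases "\<exists>m\<in>LE. pos m = t")
        case True
        then obtain m where m: "m \<in> LE" "pos m = t" by blast
        show ?thesis
        proof (intro allI impI)
          fix m' :: "'i multiset" assume m': "size m' < k"
          \<comment> \<open>Sizes are compared first in the order: an exponent of size below k has
            multiplier zero by induction, and one of size at least k affects no coefficient of size
            below k.\<close>
          have "\<kappa> m \<otimes> G m m' = \<zero>"
          proof (cases "size m < k")
            case True
            then have "\<kappa> m = \<zero>" using Suc m by (simp add: \<kappa>_def)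
            then show ?thesis using QB[OF GQ[OF m(1)]] by simp
          next
            case False
            then have "mless m' m" using m' by (simp add: mless_def)
            then show ?thesis using Gz m kc by simp
          qed
          then show "yt (Suc t) m' = \<zero>" using stepv[OF m, of m'] Suc m' by (simp add: a_minus_def)
        qed
      next
        case False
        then show ?thesis using stp2 ytS Suc by metis
      qed
    qed (simp add: yt0 k)
    then have "\<kappa> m' = \<zero>" if "size m' < k" for m' using that by (simp add: \<kappa>_def)
    then show ?thesis using m by (simp add: c_def)
  qed
  then show ?thesis using eq cB by (intro bexI[of _ c]) auto
qed

end

section \<open>Dickson's lemma and finite generation\<close>

text \<open>A monotone subsequence exists; if it is decreasing, it becomes constant once it attains
  its minimum.\<close>

lemma nat_seq_incseq:
  fixes f :: "nat \<Rightarrow> nat"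
  shows "\<exists>r. strict_mono r \<and> incseq (f \<circ> r)"
proof -
  obtain r where r: "strict_mono r" "monoseq (\<lambda>n. f (r n))"
    using seq_monosub[of f] by blast
  show ?thesis
  proof (cases "incseq (\<lambda>n. f (r n))")
    case True
    then show ?thesis using r by (auto simp: o_def)
  next
    case False
    then have dec: "decseq (\<lambda>n. f (r n))" using r by (simp add: monoseq_iff)
    define N where "N = (LEAST v. \<exists>n. f (r n) = v)"
    obtain n0 where n0: "f (r n0) = N" unfolding N_def using LeastI_ex[of "\<lambda>v. \<exists>n. f (r n) = v"] by blast
    have "N \<le> f (r n)" for n unfolding N_def by (rule Least_le) auto
    then have "f (r (n0 + n)) = N" for n
      using decseqD[OF dec, of n0 "n0 + n"] n0 by (simp add: antisym)
    then have "incseq (f \<circ> (\<lambda>n. r (n0 + n)))" by (simp add: incseq_def)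
    moreover have "strict_mono (\<lambda>n. r (n0 + n))" using r by (simp add: strict_mono_def)
    ultimately show ?thesis by blast
  qed
qed

lemma multiset_seq_incseq:
  fixes f :: "nat \<Rightarrow> 'i multiset"
  assumes "finite J"
  shows "\<exists>r. strict_mono r \<and> (\<forall>x\<in>J. incseq (\<lambda>n. count (f (r n)) x))"
  using assms
proof (induction J)
  case empty
  then show ?case by (auto intro!: exI[of _ id] simp: strict_mono_def)
next
  case (insert x J)
  then obtain r where r: "strict_mono r" "\<forall>x\<in>J. incseq (\<lambda>n. count (f (r n)) x)" by blast
  obtain s where s: "strict_mono s" "incseq ((\<lambda>n. count (f (r n)) x) \<circ> s)"
    using nat_seq_incseq by blast
  have "incseq (\<lambda>n. count (f (r (s n))) y)" if "y \<in> J" for y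
    using r(2) that s(1) unfolding incseq_def by (metis strict_mono_less_eq)
  then have "\<forall>y\<in>insert x J. incseq (\<lambda>n. count (f (r (s n))) y)"
    using s(2) by (auto simp: o_def)
  moreover have "strict_mono (r \<circ> s)" using r s by (simp add: strict_mono_o)
  ultimately show ?case by (intro exI[of _ "r \<circ> s"]) (simp add: o_def)
qed

text \<open>\<open>E\<close> consists of the minimal elements. An infinite sequence of distinct ones
  would have a subsequence along which every multiplicity is nondecreasing, hence two comparable
  minimal elements.\<close>

lemma dickson:
  assumes "finite J" "\<And>a. a \<in> A \<Longrightarrow> set_mset a \<subseteq> J"
  shows "\<exists>E\<subseteq>A. finite E \<and> (\<forall>a\<in>A. \<exists>e\<in>E. e \<subseteq># a)"
proof -
  define E where "E = {a \<in> A. \<forall>b\<in>A. b \<subseteq># a \<longrightarrow> b = a}"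
  have "\<exists>e\<in>E. e \<subseteq># a" if "a \<in> A" for a
    using that
  proof (induction "size a" arbitrary: a rule: less_induct)
    case less
    show ?case
    proof (cases "a \<in> E")
      case False
      then obtain b where b: "b \<in> A" "b \<subseteq># a" "b \<noteq> a" using less.prems by (auto simp: E_def)
      then have "size b < size a" by (simp add: mset_subset_size subset_mset.le_neq_trans)
      then obtain e where "e \<in> E" "e \<subseteq># b" using less b by blast
      then show ?thesis using b subset_mset.order_trans by blast
    qed auto
  qed
  moreover have "finite E"
  proof (rule ccontr)
    assume "infinite E"
    then obtain f :: "nat \<Rightarrow> _" where f: "inj f" "range f \<subseteq> E"
      using infinite_countable_subset by blast
    obtain r where r: "strict_mono r" "\<forall>x\<in>J. incseq (\<lambda>n. count (f (r n)) x)"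
      using multiset_seq_incseq[OF assms(1)] by blast
    have fA: "f n \<in> A" for n using f by (auto simp: E_def)
    have "f (r 0) \<subseteq># f (r 1)"
      unfolding subseteq_mset_def
    proof
      fix x
      show "count (f (r 0)) x \<le> count (f (r 1)) x"
      proof (cases "x \<in> J")
        case True
        then show ?thesis using r by (auto simp: incseq_def)
      next
        case False
        then have "x \<notin># f (r 0)" using fA assms by blast
        then show ?thesis by (simp add: not_in_iff)
      qed
    qed
    moreover have "f (r 0) \<in> A" "f (r 1) \<in> E" using f fA by auto
    ultimately have "f (r 0) = f (r 1)" by (simp add: E_def)
    then have "r 0 = r 1" using f by (simp add: inj_eq)
    then show False using r strict_mono_eq by force
  qed
  moreover have "E \<subseteq> A" by (auto simp: E_def)
  ultimately show ?thesis by blast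
qed

lemma (in cring) idealI_cring:
  assumes "I \<subseteq> carrier R" "\<zero> \<in> I" "\<And>a b. a \<in> I \<Longrightarrow> b \<in> I \<Longrightarrow> a \<oplus> b \<in> I"
    and "\<And>a x. a \<in> I \<Longrightarrow> x \<in> carrier R \<Longrightarrow> x \<otimes> a \<in> I"
  shows "ideal I R"
proof (rule idealI)
  have neg: "\<ominus> a \<in> I" if "a \<in> I" for a
  proof -
    have "a \<in> carrier R" using that assms by blast
    then have "\<ominus> a = (\<ominus> \<one>) \<otimes> a" by (simp add: l_minus)
    then show ?thesis using assms(4)[OF that, of "\<ominus> \<one>"] by simp
  qed
  show "subgroup I (add_monoid R)"
  proof (rule group.subgroupI[OF add.group_axioms])
    fix a assume "a \<in> I"
    then show "inv\<^bsub>add_monoid R\<^esub> a \<in> I" using neg unfolding a_inv_def by blast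
  qed (use assms in auto)
  fix a x assume ax: "a \<in> I" "x \<in> carrier R"
  then show "x \<otimes> a \<in> I" by (rule assms)
  then show "a \<otimes> x \<in> I" using m_comm[of a x] assms(1) ax by auto
qed (rule ring_axioms)

lemma (in ideal) finsum_in_ideal:
  assumes "\<And>x. x \<in> A \<Longrightarrow> f x \<in> I"
  shows "finsum R f A \<in> I"
  using assms
proof (induction A rule: infinite_finite_induct)
  case (insert x A)
  then have "f x \<in> carrier R" "f \<in> A \<rightarrow> carrier R" using a_subset by auto
  then show ?case using insert by (simp add: finsum_insert)
qed (auto simp: finsum_infinite)

section \<open>Standard bases; the ring is Noetherian and local\<close>

context full_series
begin

definition leads :: "('i multiset \<Rightarrow> 'a) set \<Rightarrow> 'i multiset set" where
  "leads I = {m. \<exists>F\<in>I. is_lead F m}"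

lemma leads_sub: "ideal I B \<Longrightarrow> leads I \<subseteq> P"
proof
  fix m assume I: "ideal I B" and "m \<in> leads I"
  then obtain F where F: "F \<in> I" "is_lead F m" unfolding leads_def by blast
  show "m \<in> P" by (rule lead_in[OF ideal.Icarr[OF I F(1)] F(2)])
qed

lemma scale_lead:
  assumes "F \<in> carrier B" "is_lead F m" "k \<in> carrier R" "k \<noteq> \<zero>"
  shows "is_lead (mono {#} k \<otimes>\<^bsub>B\<^esub> F) m" "(mono {#} k \<otimes>\<^bsub>B\<^esub> F) m = k \<otimes> F m"
  using assms empty_in integral_iff by (auto simp: is_lead_def mono_mult_apply)

lemma normalised_lead:
  assumes "ideal I B" "m \<in> leads I"
  shows "\<exists>F\<in>I. is_lead F m \<and> F m = \<one>"
proof -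
  interpret ideal I B by fact
  obtain F where F: "F \<in> I" "is_lead F m" using assms by (auto simp: leads_def)
  then have FB: "F \<in> carrier B" using a_subset by blast
  have u: "F m \<in> Units R" using F FB by (simp add: field_Units is_lead_def)
  then have "inv (F m) \<noteq> \<zero>" using Units_inv_Units field_Units by blast
  then have "is_lead (mono {#} (inv (F m)) \<otimes>\<^bsub>B\<^esub> F) m" "(mono {#} (inv (F m)) \<otimes>\<^bsub>B\<^esub> F) m = \<one>"
    using scale_lead[OF FB F(2), of "inv (F m)"] u by auto
  moreover have "mono {#} (inv (F m)) \<otimes>\<^bsub>B\<^esub> F \<in> I"
    using F u empty_in by (intro I_l_closed) auto
  ultimately show ?thesis by blast
qed

text \<open>Dickson's lemma is applied to the leading exponents of the ideal, and elements realising
  the selected exponents are normalised. Division without remainder then makes these elements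
  generators.\<close>

lemma standard_basis:
  assumes "ideal I B"
  shows "\<exists>E g. finite E \<and> E \<subseteq> P \<and> (\<forall>\<alpha>\<in>E. g \<alpha> \<in> I \<and> is_lead (g \<alpha>) \<alpha> \<and> g \<alpha> \<alpha> = \<one>) \<and>
    (\<forall>F\<in>I. \<forall>m. is_lead F m \<longrightarrow> (\<exists>\<alpha>\<in>E. \<alpha> \<subseteq># m))"
proof -
  obtain E where E: "E \<subseteq> leads I" "finite E" "\<forall>a\<in>leads I. \<exists>e\<in>E. e \<subseteq># a"
    using dickson[OF finite_J, of "leads I"] leads_sub[OF assms] P_sub by blast
  obtain g where "\<forall>\<alpha>\<in>E. g \<alpha> \<in> I \<and> is_lead (g \<alpha>) \<alpha> \<and> g \<alpha> \<alpha> = \<one>"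
    using E normalised_lead[OF assms] by (metis subset_iff)
  then show ?thesis using E leads_sub[OF assms] by (intro exI[of _ E] exI[of _ g]) (auto simp: leads_def)
qed

lemma B_noetherian: "noetherian_ring B"
proof (rule B.noetherian_ringI)
  fix I assume I: "ideal I B"
  interpret ideal I B by fact
  obtain E g where E: "finite E" "E \<subseteq> P" "\<forall>\<alpha>\<in>E. g \<alpha> \<in> I \<and> is_lead (g \<alpha>) \<alpha> \<and> g \<alpha> \<alpha> = \<one>"
    "\<forall>F\<in>I. \<forall>m. is_lead F m \<longrightarrow> (\<exists>\<alpha>\<in>E. \<alpha> \<subseteq># m)"
    using standard_basis[OF I] by blast
  have sub: "g ` E \<subseteq> carrier B" using E a_subset by auto
  interpret Q: ideal "Idl\<^bsub>B\<^esub> (g ` E)" B using B.genideal_ideal[OF sub] .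
  have "I \<subseteq> Idl\<^bsub>B\<^esub> (g ` E)"
  proof
    fix y assume "y \<in> I"
    then obtain c where c: "c \<in> E \<rightarrow> carrier B" "y = (\<Oplus>\<^bsub>B\<^esub>\<alpha>\<in>E. c \<alpha> \<otimes>\<^bsub>B\<^esub> g \<alpha>)"
      using division[OF I, of y E g] E by blast
    then show "y \<in> Idl\<^bsub>B\<^esub> (g ` E)"
      using B.genideal_self[OF sub] unfolding c(2) by (intro Q.finsum_in_ideal Q.I_l_closed) auto
  qed
  moreover have "Idl\<^bsub>B\<^esub> (g ` E) \<subseteq> I" using E I by (intro B.genideal_minimal) auto
  ultimately show "\<exists>A\<subseteq>carrier B. finite A \<and> I = Idl\<^bsub>B\<^esub> A" using sub E(1) by blast
qed

definition max_id :: "('i multiset \<Rightarrow> 'a) set" where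
  "max_id = {F \<in> carrier B. F {#} = \<zero>}"

lemma mult_const: "F \<in> carrier B \<Longrightarrow> G \<in> carrier B \<Longrightarrow> (F \<otimes>\<^bsub>B\<^esub> G) {#} = F {#} \<otimes> G {#}"
  by (simp add: mult_apply')

lemma max_id_ideal: "ideal max_id B"
  by (rule B.idealI_cring) (auto simp: max_id_def mult_const)

text \<open>An element with nonzero constant coefficient has leading exponent \<open>{#}\<close>,
  the least exponent of all.\<close>

lemma unit_ideal:
  assumes I: "ideal I B" and F: "F \<in> I" "F {#} \<noteq> \<zero>"
  shows "I = carrier B"
proof -
  interpret ideal I B by fact
  have FB: "F \<in> carrier B" using F a_subset by blast
  interpret Q: ideal "PIdl\<^bsub>B\<^esub> F" B by (rule B.cgenideal_ideal[OF FB])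
  have nl: "\<not> mless m {#}" for m :: "'i multiset" by (simp add: mless_def)
  then have "is_lead F {#}" using F by (simp add: is_lead_def)
  then have "{#} \<in> leads I" using F by (auto simp: leads_def)
  then obtain g where g: "g \<in> I" "is_lead g {#}" "g {#} = \<one>" using normalised_lead[OF I] by blast
  have gB: "g \<in> carrier B" using g a_subset by blast
  have one: "\<one>\<^bsub>B\<^esub> \<in> carrier B" by (rule one_in_B)
  \<comment> \<open>Division in the unit ideal with a single basis element: every exponent is a
    multiple of \<open>{#}\<close>, so 1 is a multiple of g. This takes the place of a geometric
    series.\<close>
  obtain c where c: "c \<in> {{#}} \<rightarrow> carrier B" "\<one>\<^bsub>B\<^esub> = (\<Oplus>\<^bsub>B\<^esub>\<alpha>\<in>{{#}}. c \<alpha> \<otimes>\<^bsub>B\<^esub> (\<lambda>_. g) \<alpha>)"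
    using division[OF B.oneideal one, of "{{#}}" "\<lambda>_. g"] g gB empty_in by auto
  then have "\<one>\<^bsub>B\<^esub> = c {#} \<otimes>\<^bsub>B\<^esub> g" using gB by (simp add: Pi_def)
  then have "\<one>\<^bsub>B\<^esub> \<in> I" using c g I_l_closed by (metis Pi_iff singletonI)
  then show ?thesis by (rule one_imp_carrier)
qed

lemma proper_ideal_sub: "ideal I B \<Longrightarrow> I \<noteq> carrier B \<Longrightarrow> I \<subseteq> max_id"
proof
  fix F assume I: "ideal I B" "I \<noteq> carrier B" and F: "F \<in> I"
  then show "F \<in> max_id" using unit_ideal[OF I(1) F] ideal.Icarr[OF I(1) F] by (auto simp: max_id_def)
qed

lemma max_id_proper: "max_id \<noteq> carrier B"
proof
  assume "max_id = carrier B"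
  then have "\<one>\<^bsub>B\<^esub> \<in> max_id" using one_in_B by simp
  then show False by (simp add: max_id_def one_apply)
qed

lemma max_id_maximal: "maximalideal max_id B"
  by (rule maximalidealI[OF max_id_ideal]) (use proper_ideal_sub max_id_proper in blast)+

lemma maximal_unique: "maximalideal I B \<longleftrightarrow> I = max_id"
proof
  assume "maximalideal I B"
  then interpret maximalideal I B .
  have "I \<subseteq> max_id" using proper_ideal_sub is_ideal I_notcarr by blast
  then show "I = max_id"
    using I_maximal[OF max_id_ideal] max_id_proper ideal.Icarr[OF max_id_ideal] by blast
qed (simp add: max_id_maximal)

lemma B_noetherian_local: "noetherian_local_ring B"
  unfolding noetherian_local_ring_def using B_cring B_noetherian maximal_unique by auto

section \<open>The filtration by size and the Artin-Rees property\<close>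

definition tail :: "nat \<Rightarrow> ('i multiset \<Rightarrow> 'a) set" where
  "tail k = {F \<in> carrier B. \<forall>m. size m < k \<longrightarrow> F m = \<zero>}"

lemma mult_tail:
  assumes "F \<in> carrier B" "\<And>m. size m < k \<Longrightarrow> F m = \<zero>" "G \<in> carrier B" "size m < k"
  shows "(F \<otimes>\<^bsub>B\<^esub> G) m = \<zero>"
  unfolding mult_apply'
proof (rule finsum_all_zero)
  fix a assume "a \<in> {a. a \<subseteq># m}"
  then have "size a < k" using assms(4) size_mset_mono[of a m] by simp
  then show "F a \<otimes> G (m - a) = \<zero>" using assms by simp
qed

lemma tail_ideal: "ideal (tail k) B"
proof (rule B.idealI_cring)
  fix F G assume *: "F \<in> tail k" "G \<in> carrier B"
  then have "F \<otimes>\<^bsub>B\<^esub> G \<in> tail k" using mult_tail by (auto simp: tail_def)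
  then show "G \<otimes>\<^bsub>B\<^esub> F \<in> tail k" using * mult_comm_B by (auto simp: tail_def)
qed (auto simp: tail_def)

abbreviation nbhd :: "('i multiset \<Rightarrow> 'a) set \<Rightarrow> nat \<Rightarrow> ('i multiset \<Rightarrow> 'a) set" where
  "nbhd I k \<equiv> I <+>\<^bsub>B\<^esub> tail k"

lemma nbhd_ideal: "ideal I B \<Longrightarrow> ideal (nbhd I k) B"
  using B.add_ideals tail_ideal by blast

lemma nbhd_iff: "F \<in> nbhd I k \<longleftrightarrow> (\<exists>f\<in>I. \<exists>t\<in>tail k. F = f \<oplus>\<^bsub>B\<^esub> t)"
  by (auto simp: set_add_def set_mult_def)

lemma nbhd_left: "ideal I B \<Longrightarrow> F \<in> I \<Longrightarrow> F \<in> nbhd I k"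
  unfolding nbhd_iff using ideal.Icarr[of I B F] additive_subgroup.zero_closed[OF ideal.axioms(1)[OF tail_ideal[of k]]]
  by (intro bexI[of _ F] bexI[of _ "\<zero>\<^bsub>B\<^esub>"]) auto

lemma nbhd_right: "ideal I B \<Longrightarrow> F \<in> tail k \<Longrightarrow> F \<in> nbhd I k"
  unfolding nbhd_iff using ideal.Icarr[OF tail_ideal, of F] additive_subgroup.zero_closed[OF ideal.axioms(1)]
  by (intro bexI[of _ "\<zero>\<^bsub>B\<^esub>"] bexI[of _ F]) auto

text \<open>Let g \<alpha> = gp \<alpha> + gb \<alpha> x be a standard basis of p + (x). If x b = f
  + t with f in p and t of high order, then t lies in p + (x), and division gives t = f' + b' x
  where b' has high order as well. Then x (b - b') lies in p, and primality gives b - b' in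
  p.\<close>

lemma artin_rees:
  assumes p: "primeideal p B" and x: "x \<in> carrier B" "x \<notin> p"
  shows "\<exists>c. \<forall>k. \<forall>b\<in>carrier B. x \<otimes>\<^bsub>B\<^esub> b \<in> nbhd p (k + c) \<longrightarrow> b \<in> nbhd p k"
proof -
  interpret primeideal p B by fact
  define Q where "Q = p <+>\<^bsub>B\<^esub> PIdl\<^bsub>B\<^esub> x"
  have Q: "ideal Q B"
    unfolding Q_def by (rule B.add_ideals[OF is_ideal B.cgenideal_ideal[OF x(1)]])
  have Qiff: "y \<in> Q \<longleftrightarrow> (\<exists>f\<in>p. \<exists>b\<in>carrier B. y = f \<oplus>\<^bsub>B\<^esub> b \<otimes>\<^bsub>B\<^esub> x)" for y
    unfolding Q_def set_add_def set_mult_def cgenideal_def by simp blast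
  obtain E g where E: "finite E" "E \<subseteq> P" "\<forall>\<alpha>\<in>E. g \<alpha> \<in> Q \<and> is_lead (g \<alpha>) \<alpha> \<and> g \<alpha> \<alpha> = \<one>"
    "\<forall>F\<in>Q. \<forall>m. is_lead F m \<longrightarrow> (\<exists>\<alpha>\<in>E. \<alpha> \<subseteq># m)"
    using standard_basis[OF Q] by blast
  obtain gp gb where gg: "\<And>\<alpha>. \<alpha> \<in> E \<Longrightarrow> gp \<alpha> \<in> p \<and> gb \<alpha> \<in> carrier B \<and> g \<alpha> = gp \<alpha> \<oplus>\<^bsub>B\<^esub> gb \<alpha> \<otimes>\<^bsub>B\<^esub> x"
  proof -
    have "\<forall>\<alpha>\<in>E. \<exists>f b. f \<in> p \<and> b \<in> carrier B \<and> g \<alpha> = f \<oplus>\<^bsub>B\<^esub> b \<otimes>\<^bsub>B\<^esub> x"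
      using E(3) Qiff by meson
    then show thesis using that by metis
  qed
  \<comment> \<open>The loss of order in a division is at most the largest size of a basis exponent;
    this is the shift.\<close>
  define C where "C = Max (insert 0 (size ` E))"
  have C: "size \<alpha> \<le> C" if "\<alpha> \<in> E" for \<alpha> unfolding C_def using E(1) that by (intro Max_ge) auto
  have "b \<in> nbhd p k" if b: "b \<in> carrier B" "x \<otimes>\<^bsub>B\<^esub> b \<in> nbhd p (k + C)" for k b
  proof -
    obtain f t where ft: "f \<in> p" "t \<in> tail (k + C)" "x \<otimes>\<^bsub>B\<^esub> b = f \<oplus>\<^bsub>B\<^esub> t"
      using b(2) unfolding nbhd_iff by blast
    have fB: "f \<in> carrier B" and tB: "t \<in> carrier B" using ft Icarr by (auto simp: tail_def)
    have te: "t = \<ominus>\<^bsub>B\<^esub> f \<oplus>\<^bsub>B\<^esub> b \<otimes>\<^bsub>B\<^esub> x"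
      using B.r_neg1[OF fB tB] ft(3) B.m_comm[OF x(1) b(1)] by simp
    have "t \<in> Q" unfolding Qiff
      by (rule bexI[OF _ a_inv_closed[OF ft(1)]], rule bexI[OF _ b(1)], rule te)
    have "\<exists>c\<in>E \<rightarrow> carrier B. t = (\<Oplus>\<^bsub>B\<^esub>\<alpha>\<in>E. c \<alpha> \<otimes>\<^bsub>B\<^esub> g \<alpha>) \<and>
      (\<forall>k. (\<forall>m. size m < k \<longrightarrow> t m = \<zero>) \<longrightarrow> (\<forall>\<alpha>\<in>E. \<forall>m. size m + size \<alpha> < k \<longrightarrow> c \<alpha> m = \<zero>))"
      by (rule division[OF Q \<open>t \<in> Q\<close> E(1,2)]) (use E(3,4) in auto)
    moreover have "\<forall>m. size m < k + C \<longrightarrow> t m = \<zero>" using ft(2) by (simp add: tail_def)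
    ultimately obtain c where c: "c \<in> E \<rightarrow> carrier B" "t = (\<Oplus>\<^bsub>B\<^esub>\<alpha>\<in>E. c \<alpha> \<otimes>\<^bsub>B\<^esub> g \<alpha>)"
      "\<forall>\<alpha>\<in>E. \<forall>m. size m + size \<alpha> < k + C \<longrightarrow> c \<alpha> m = \<zero>"
      by meson
    have cl: "c \<alpha> \<in> carrier B" "gp \<alpha> \<in> carrier B" "gb \<alpha> \<in> carrier B" if "\<alpha> \<in> E" for \<alpha>
      using that c(1) gg[OF that] Icarr[of "gp \<alpha>"] by auto
    define b' where "b' = (\<Oplus>\<^bsub>B\<^esub>\<alpha>\<in>E. c \<alpha> \<otimes>\<^bsub>B\<^esub> gb \<alpha>)"
    define f' where "f' = (\<Oplus>\<^bsub>B\<^esub>\<alpha>\<in>E. c \<alpha> \<otimes>\<^bsub>B\<^esub> gp \<alpha>)"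
    have f'p: "f' \<in> p" unfolding f'_def using cl gg by (intro finsum_in_ideal I_l_closed) auto
    have b'B: "b' \<in> carrier B" unfolding b'_def using cl by (intro B.finsum_closed) auto
    have "t = (\<Oplus>\<^bsub>B\<^esub>\<alpha>\<in>E. c \<alpha> \<otimes>\<^bsub>B\<^esub> gp \<alpha> \<oplus>\<^bsub>B\<^esub> (c \<alpha> \<otimes>\<^bsub>B\<^esub> gb \<alpha>) \<otimes>\<^bsub>B\<^esub> x)"
      unfolding c(2)
    proof (rule B.finsum_cong'[OF refl])
      fix \<alpha> assume a: "\<alpha> \<in> E"
      show "c \<alpha> \<otimes>\<^bsub>B\<^esub> g \<alpha> = c \<alpha> \<otimes>\<^bsub>B\<^esub> gp \<alpha> \<oplus>\<^bsub>B\<^esub> (c \<alpha> \<otimes>\<^bsub>B\<^esub> gb \<alpha>) \<otimes>\<^bsub>B\<^esub> x"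
        using gg[OF a] cl[OF a] x(1) by (simp add: B.r_distr B.m_assoc)
    qed (use cl x in auto)
    also have "\<dots> = f' \<oplus>\<^bsub>B\<^esub> (\<Oplus>\<^bsub>B\<^esub>\<alpha>\<in>E. (c \<alpha> \<otimes>\<^bsub>B\<^esub> gb \<alpha>) \<otimes>\<^bsub>B\<^esub> x)"
      unfolding f'_def using cl x by (intro B.finsum_addf) auto
    also have "(\<Oplus>\<^bsub>B\<^esub>\<alpha>\<in>E. (c \<alpha> \<otimes>\<^bsub>B\<^esub> gb \<alpha>) \<otimes>\<^bsub>B\<^esub> x) = b' \<otimes>\<^bsub>B\<^esub> x"
      unfolding b'_def using cl x E(1) by (intro B.finsum_ldistr[symmetric]) auto
    finally have t2: "t = f' \<oplus>\<^bsub>B\<^esub> b' \<otimes>\<^bsub>B\<^esub> x" .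
    have f'B: "f' \<in> carrier B" by (rule Icarr[OF f'p])
    have "x \<otimes>\<^bsub>B\<^esub> (b \<ominus>\<^bsub>B\<^esub> b') = f \<oplus>\<^bsub>B\<^esub> f'"
    proof -
      have "x \<otimes>\<^bsub>B\<^esub> (b \<ominus>\<^bsub>B\<^esub> b') = x \<otimes>\<^bsub>B\<^esub> b \<ominus>\<^bsub>B\<^esub> x \<otimes>\<^bsub>B\<^esub> b'"
        using x(1) b(1) b'B by (simp add: a_minus_def B.r_distr B.r_minus)
      also have "\<dots> = (f \<oplus>\<^bsub>B\<^esub> (f' \<oplus>\<^bsub>B\<^esub> x \<otimes>\<^bsub>B\<^esub> b')) \<ominus>\<^bsub>B\<^esub> x \<otimes>\<^bsub>B\<^esub> b'"
        using ft(3) t2 B.m_comm[OF x(1) b'B] by simp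
      also have "\<dots> = f \<oplus>\<^bsub>B\<^esub> f'"
        using fB f'B x(1) b'B by (simp add: a_minus_def B.a_assoc B.r_neg)
      finally show ?thesis .
    qed
    then have "x \<otimes>\<^bsub>B\<^esub> (b \<ominus>\<^bsub>B\<^esub> b') \<in> p" using ft(1) f'p by simp
    then have d: "b \<ominus>\<^bsub>B\<^esub> b' \<in> p" using I_prime[OF x(1) B.minus_closed[OF b(1) b'B]] x(2) by simp
    have "b' m = \<zero>" if m: "size m < k" for m
    proof -
      have "(c \<alpha> \<otimes>\<^bsub>B\<^esub> gb \<alpha>) m = \<zero>" if a: "\<alpha> \<in> E" for \<alpha>
        using cl[OF a] c(3) a C[OF a] m by (intro mult_tail[where k = "k + C - size \<alpha>"]) auto
      then show ?thesis unfolding b'_def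
        using cl E(1) by (subst finsum_apply) (auto intro: finsum_all_zero)
    qed
    then have "b' \<in> tail k" using b'B by (simp add: tail_def)
    moreover have "b = (b \<ominus>\<^bsub>B\<^esub> b') \<oplus>\<^bsub>B\<^esub> b'"
      using b(1) b'B by (simp add: a_minus_def B.a_assoc B.l_neg)
    ultimately show ?thesis unfolding nbhd_iff using d by blast
  qed
  then show ?thesis by blast
qed

end

section \<open>Chains of primes and the growth of the Hilbert function\<close>

text \<open>More unknowns than equations. The equation m0 is removed with a pivot s0:
  \<open>\<nu>'\<close> consists of the other rows after subtraction of the multiple of the pivot
  row that clears m0.\<close>

lemma (in field) nontrivial_solution:
  assumes "finite S" "finite H" "card H < card S"
    and "\<And>s m. s \<in> S \<Longrightarrow> m \<in> H \<Longrightarrow> \<nu> s m \<in> carrier R"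
  shows "\<exists>\<kappa>. (\<forall>s\<in>S. \<kappa> s \<in> carrier R) \<and> (\<exists>s\<in>S. \<kappa> s \<noteq> \<zero>) \<and> (\<forall>m\<in>H. (\<Oplus>s\<in>S. \<kappa> s \<otimes> \<nu> s m) = \<zero>)"
  using assms(2,1,3,4)
proof (induction H arbitrary: S \<nu>)
  case empty
  then show ?case by (intro exI[of _ "\<lambda>_. \<one>"]) (auto simp: card_gt_0_iff)
next
  case (insert m0 H)
  show ?case
  proof (cases "\<forall>s\<in>S. \<nu> s m0 = \<zero>")
    case True
    obtain \<kappa> where k: "\<forall>s\<in>S. \<kappa> s \<in> carrier R" "\<exists>s\<in>S. \<kappa> s \<noteq> \<zero>" "\<forall>m\<in>H. (\<Oplus>s\<in>S. \<kappa> s \<otimes> \<nu> s m) = \<zero>"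
      using insert.IH[of S \<nu>] insert.prems insert.hyps by auto
    moreover have "(\<Oplus>s\<in>S. \<kappa> s \<otimes> \<nu> s m0) = \<zero>" using True k by (intro finsum_all_zero) auto
    ultimately show ?thesis by (intro exI[of _ \<kappa>]) auto
  next
    case False
    then obtain s0 where s0: "s0 \<in> S" "\<nu> s0 m0 \<noteq> \<zero>" by blast
    define S' where "S' = S - {s0}"
    have S': "finite S'" "s0 \<notin> S'" "S = insert s0 S'" "card H < card S'"
      using insert.prems insert.hyps s0 by (auto simp: S'_def)
    have u: "\<nu> s0 m0 \<in> Units R" using s0 insert.prems by (simp add: field_Units)
    define w where "w = inv (\<nu> s0 m0)"
    have w: "w \<in> carrier R" "w \<otimes> \<nu> s0 m0 = \<one>" using u by (auto simp: w_def)
    define \<nu>' where "\<nu>' s m = \<nu> s m \<ominus> \<nu> s m0 \<otimes> w \<otimes> \<nu> s0 m" for s m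
    have nc: "\<nu> s m \<in> carrier R" if "s \<in> S" "m \<in> insert m0 H" for s m using that insert.prems by auto
    have "\<nu>' s m \<in> carrier R" if "s \<in> S'" "m \<in> H" for s m
      using that nc s0 w S' by (simp add: \<nu>'_def)
    then obtain \<kappa> where k: "\<forall>s\<in>S'. \<kappa> s \<in> carrier R" "\<exists>s\<in>S'. \<kappa> s \<noteq> \<zero>" "\<forall>m\<in>H. (\<Oplus>s\<in>S'. \<kappa> s \<otimes> \<nu>' s m) = \<zero>"
      using insert.IH[of S' \<nu>'] S' by blast
    define A where "A = (\<Oplus>s\<in>S'. \<kappa> s \<otimes> \<nu> s m0)"
    have A: "A \<in> carrier R" unfolding A_def using k nc S' by (intro finsum_closed) auto
    \<comment> \<open>The value at the pivot is forced by the equation m0; the remaining equations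
      then follow from those for \<open>\<nu>'\<close>.\<close>
    define \<kappa>' where "\<kappa>' = \<kappa>(s0 := \<ominus> (A \<otimes> w))"
    have k's: "\<kappa>' s = \<kappa> s" if "s \<in> S'" for s using that S' by (auto simp: \<kappa>'_def)
    have k'0: "\<kappa>' s0 = \<ominus> (A \<otimes> w)" by (simp add: \<kappa>'_def)
    have split: "(\<Oplus>s\<in>S. \<kappa>' s \<otimes> \<nu> s m) = \<ominus> (A \<otimes> w) \<otimes> \<nu> s0 m \<oplus> (\<Oplus>s\<in>S'. \<kappa> s \<otimes> \<nu> s m)"
      if m: "m \<in> insert m0 H" for m
    proof -
      have "(\<Oplus>s\<in>S. \<kappa>' s \<otimes> \<nu> s m) = \<kappa>' s0 \<otimes> \<nu> s0 m \<oplus> (\<Oplus>s\<in>S'. \<kappa>' s \<otimes> \<nu> s m)"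
        unfolding S'(3) by (rule finsum_insert) (use S' k k's k'0 nc[OF _ m] A w in auto)
      also have "(\<Oplus>s\<in>S'. \<kappa>' s \<otimes> \<nu> s m) = (\<Oplus>s\<in>S'. \<kappa> s \<otimes> \<nu> s m)"
        by (rule finsum_cong') (use k's k nc[OF _ m] S' in auto)
      finally show ?thesis by (simp add: k'0)
    qed
    have "(\<Oplus>s\<in>S. \<kappa>' s \<otimes> \<nu> s m) = \<zero>" if m: "m \<in> insert m0 H" for m
    proof (cases "m = m0")
      case True
      have "\<ominus> (A \<otimes> w) \<otimes> \<nu> s0 m0 = \<ominus> A"
        using A w nc s0 by (simp add: l_minus m_assoc)
      then show ?thesis using split[of m0] A True by (simp add: A_def[symmetric] l_neg)
    next
      case False
      then have mH: "m \<in> H" using m by simp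
      have n0: "\<nu> s0 m \<in> carrier R" using nc s0 m by simp
      have "(\<Oplus>s\<in>S'. \<kappa> s \<otimes> \<nu> s m) = (\<Oplus>s\<in>S'. \<kappa> s \<otimes> \<nu>' s m \<oplus> (\<kappa> s \<otimes> \<nu> s m0) \<otimes> (w \<otimes> \<nu> s0 m))"
      proof (rule finsum_cong'[OF refl])
        fix s assume s: "s \<in> S'"
        have c: "\<kappa> s \<in> carrier R" "\<nu> s m \<in> carrier R" "\<nu> s m0 \<in> carrier R"
          using s k nc S' m by auto
        have "\<nu> s m = \<nu>' s m \<oplus> \<nu> s m0 \<otimes> (w \<otimes> \<nu> s0 m)"
          using c w n0 by (simp add: \<nu>'_def a_minus_def m_assoc a_assoc l_neg)
        moreover have "\<nu>' s m \<in> carrier R" using c w n0 by (simp add: \<nu>'_def)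
        ultimately show "\<kappa> s \<otimes> \<nu> s m = \<kappa> s \<otimes> \<nu>' s m \<oplus> (\<kappa> s \<otimes> \<nu> s m0) \<otimes> (w \<otimes> \<nu> s0 m)"
          using c w n0 by (metis m_assoc m_closed r_distr)
      qed (use k nc w S' n0 m in \<open>auto simp: \<nu>'_def\<close>)
      also have "\<dots> = (\<Oplus>s\<in>S'. \<kappa> s \<otimes> \<nu>' s m) \<oplus> (\<Oplus>s\<in>S'. (\<kappa> s \<otimes> \<nu> s m0) \<otimes> (w \<otimes> \<nu> s0 m))"
        by (rule finsum_addf) (use k nc w S' n0 m in \<open>auto simp: \<nu>'_def\<close>)
      also have "(\<Oplus>s\<in>S'. \<kappa> s \<otimes> \<nu>' s m) = \<zero>" using k mH by blast
      also have "(\<Oplus>s\<in>S'. (\<kappa> s \<otimes> \<nu> s m0) \<otimes> (w \<otimes> \<nu> s0 m)) = A \<otimes> (w \<otimes> \<nu> s0 m)"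
        unfolding A_def by (rule finsum_ldistr[symmetric]) (use S' k nc w n0 in auto)
      finally have "(\<Oplus>s\<in>S'. \<kappa> s \<otimes> \<nu> s m) = A \<otimes> w \<otimes> \<nu> s0 m"
        using A w n0 by (simp add: m_assoc)
      then show ?thesis using split[OF m] A w n0 by (simp add: l_minus l_neg)
    qed
    moreover have "\<forall>s\<in>S. \<kappa>' s \<in> carrier R"
      using S'(3) k k's k'0 A w by auto
    moreover have "\<exists>s\<in>S. \<kappa>' s \<noteq> \<zero>" using k(2) k's S'(3) by auto
    ultimately show ?thesis by blast
  qed
qed

context full_series
begin

text \<open>The monomials with these exponents form a basis of \<open>B\<close> modulo
  \<open>nbhd I k\<close>, so the cardinality is the Hilbert function of B/I for the filtration by
  size. The next lemmas prove independence and spanning.\<close>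

definition std_exps :: "('i multiset \<Rightarrow> 'a) set \<Rightarrow> nat \<Rightarrow> 'i multiset set" where
  "std_exps I k = {m \<in> P. size m < k \<and> m \<notin> leads I}"

lemma finite_std_exps [simp]: "finite (std_exps I k)"
  by (rule finite_subset[OF _ finite_P_size[of k]]) (auto simp: std_exps_def)

lemma in_ideal_diff:
  assumes "ideal I B" "F \<in> I" "G \<in> I" shows "F \<ominus>\<^bsub>B\<^esub> G \<in> I"
proof -
  interpret ideal I B by fact
  show ?thesis unfolding a_minus_def using assms by (intro a_closed a_inv_closed)
qed

text \<open>Below size k the series G agrees with an element of I, so its leading exponent would be
  a leading exponent of I.\<close>

lemma std_exps_independent:
  assumes I: "ideal I B" and G: "G \<in> nbhd I k" and sup: "\<And>m. G m \<noteq> \<zero> \<Longrightarrow> m \<in> std_exps I k"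
  shows "G = \<zero>\<^bsub>B\<^esub>"
proof (rule ccontr)
  assume nz: "G \<noteq> \<zero>\<^bsub>B\<^esub>"
  obtain f t where ft: "f \<in> I" "t \<in> tail k" "G = f \<oplus>\<^bsub>B\<^esub> t" using G unfolding nbhd_iff by blast
  have fB: "f \<in> carrier B" by (rule ideal.Icarr[OF I ft(1)])
  have tB: "t \<in> carrier B" using ft(2) by (simp add: tail_def)
  have GB: "G \<in> carrier B" unfolding ft(3) using fB tB by (rule B.add.m_closed)
  obtain m where m: "is_lead G m" using ex_lead[OF GB nz] by blast
  have mS: "m \<in> std_exps I k" using sup m by (simp add: is_lead_def)
  have eq: "f m' = G m'" if "size m' < k" for m'
    using ft(2,3) fB that by (simp add: tail_def)
  have "is_lead f m"
    unfolding is_lead_def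
  proof (intro conjI allI impI)
    show "f m \<noteq> \<zero>" using eq[of m] mS m by (simp add: std_exps_def is_lead_def)
    fix m' assume "mless m' m"
    moreover from this have "size m' < k" using mS mless_size[of m' m] by (simp add: std_exps_def)
    ultimately show "f m' = \<zero>" using eq m by (simp add: is_lead_def)
  qed
  then have "m \<in> leads I" using ft(1) unfolding leads_def by blast
  then show False using mS by (simp add: std_exps_def)
qed

text \<open>A coefficient at a leading exponent of I is removed with an element of I, and one at a
  standard exponent is moved into G. This is done in increasing rank, and j counts the ranks still
  to be treated.\<close>

lemma std_exps_span:
  assumes I: "ideal I B" and F: "F \<in> carrier B"
  shows "\<exists>G\<in>carrier B. (\<forall>m. G m \<noteq> \<zero> \<longrightarrow> m \<in> std_exps I k) \<and> F \<ominus>\<^bsub>B\<^esub> G \<in> nbhd I k"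
proof -
  \<comment> \<open>All exponents of size below k have rank less than N, so the process stops after
    N steps.\<close>
  define N where "N = Suc (Max (insert 0 (pos ` {m \<in> P. size m \<le> k})))"
  have N: "pos m < N" if "m \<in> P" "size m < k" for m
    unfolding N_def less_Suc_eq_le using finite_P_size[of k] that by (intro Max_ge) auto
  interpret N: ideal "nbhd I k" B by (rule nbhd_ideal[OF I])
  have "\<exists>G\<in>carrier B. (\<forall>m. G m \<noteq> \<zero> \<longrightarrow> m \<in> std_exps I k) \<and> F \<ominus>\<^bsub>B\<^esub> G \<in> nbhd I k"
    if "F \<in> carrier B" "\<And>m. m \<in> P \<Longrightarrow> size m < k \<Longrightarrow> pos m < N - j \<Longrightarrow> F m = \<zero>" for j F
    using that
  proof (induction j arbitrary: F)
    case 0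
    have "F m = \<zero>" if "size m < k" for m
      using 0 N that coeff_outside by (cases "m \<in> P") auto
    then have "F \<in> tail k" using 0 by (simp add: tail_def)
    then have "F \<ominus>\<^bsub>B\<^esub> \<zero>\<^bsub>B\<^esub> \<in> nbhd I k"
      using nbhd_right[OF I] 0 by (simp add: a_minus_def)
    moreover have "\<forall>m. \<zero>\<^bsub>B\<^esub> m \<noteq> \<zero> \<longrightarrow> m \<in> std_exps I k" by simp
    ultimately show ?case using B.zero_closed by blast
  next
    case (Suc j)
    show ?case
    proof (cases "\<exists>m. m \<in> P \<and> size m < k \<and> pos m = N - Suc j \<and> F m \<noteq> \<zero>")
      case False
      have "F m = \<zero>" if "m \<in> P" "size m < k" "pos m < N - j" for m
      proof (cases "pos m = N - Suc j")
        case True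
        then show ?thesis using False that by blast
      next
        case False
        then have "pos m < N - Suc j" using that by linarith
        then show ?thesis using Suc.prems that by blast
      qed
      then show ?thesis using Suc.IH Suc.prems by blast
    next
      case True
      then obtain m where m: "m \<in> P" "size m < k" "pos m = N - Suc j" "F m \<noteq> \<zero>" by blast
      have FB: "F \<in> carrier B" by fact
      have red: "F \<ominus>\<^bsub>B\<^esub> D \<in> carrier B \<and> (\<forall>m'. m' \<in> P \<longrightarrow> size m' < k \<longrightarrow> pos m' < N - j \<longrightarrow> (F \<ominus>\<^bsub>B\<^esub> D) m' = \<zero>)"
        if D: "D \<in> carrier B" "is_lead D m" "D m = F m" for D
      proof (intro conjI allI impI)
        show "F \<ominus>\<^bsub>B\<^esub> D \<in> carrier B" using FB D by simp
        fix m' assume m': "m' \<in> P" "size m' < k" "pos m' < N - j"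
        show "(F \<ominus>\<^bsub>B\<^esub> D) m' = \<zero>"
        proof (cases "m' = m")
          case True
          then show ?thesis using FB D by (simp add: a_minus_def r_neg)
        next
          case False
          then have "pos m' < N - Suc j" using m' m pos_inj[of m' m] by linarith
          moreover from this have "mless m' m" using m m' pos_less_iff[of m' m] by simp
          ultimately show ?thesis using Suc.prems(2)[OF m'(1,2)] D FB by (simp add: is_lead_def a_minus_def)
        qed
      qed
      show ?thesis
      proof (cases "m \<in> leads I")
        case True
        obtain f where f: "f \<in> I" "is_lead f m" "f m = \<one>" using normalised_lead[OF I True] by blast
        have fB: "f \<in> carrier B" by (rule ideal.Icarr[OF I f(1)])
        define D where "D = mono {#} (F m) \<otimes>\<^bsub>B\<^esub> f"
        have DB: "D \<in> carrier B" unfolding D_def using fB empty_in FB by simp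
        have DI: "D \<in> I" unfolding D_def
          by (rule ideal.I_l_closed[OF I f(1)]) (use empty_in FB in simp)
        have "is_lead D m" "D m = F m"
          unfolding D_def using scale_lead[OF fB f(2), of "F m"] f(3) m(4) FB by auto
        note red = red[OF DB this]
        obtain G where G: "G \<in> carrier B" "\<forall>m. G m \<noteq> \<zero> \<longrightarrow> m \<in> std_exps I k" "F \<ominus>\<^bsub>B\<^esub> D \<ominus>\<^bsub>B\<^esub> G \<in> nbhd I k"
          using Suc.IH[of "F \<ominus>\<^bsub>B\<^esub> D"] red by blast
        have "F \<ominus>\<^bsub>B\<^esub> D \<ominus>\<^bsub>B\<^esub> G = (F \<ominus>\<^bsub>B\<^esub> G) \<ominus>\<^bsub>B\<^esub> D"
          using FB DB G(1) by (simp add: a_minus_def B.a_ac)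
        then have "F \<ominus>\<^bsub>B\<^esub> G = (F \<ominus>\<^bsub>B\<^esub> D \<ominus>\<^bsub>B\<^esub> G) \<oplus>\<^bsub>B\<^esub> D"
          using FB DB G(1) by (simp add: a_minus_def B.a_assoc B.l_neg)
        then have "F \<ominus>\<^bsub>B\<^esub> G \<in> nbhd I k" using N.a_closed[OF G(3) nbhd_left[OF I DI]] by simp
        then show ?thesis using G by blast
      next
        case False
        define D where "D = mono m (F m)"
        have DB: "D \<in> carrier B" unfolding D_def using m FB by simp
        have "is_lead D m" "D m = F m" using m(4) by (auto simp: D_def is_lead_def mono_def)
        note red = red[OF DB this]
        obtain G where G: "G \<in> carrier B" "\<forall>m. G m \<noteq> \<zero> \<longrightarrow> m \<in> std_exps I k" "F \<ominus>\<^bsub>B\<^esub> D \<ominus>\<^bsub>B\<^esub> G \<in> nbhd I k"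
          using Suc.IH[of "F \<ominus>\<^bsub>B\<^esub> D"] red by blast
        have "F \<ominus>\<^bsub>B\<^esub> (D \<oplus>\<^bsub>B\<^esub> G) = F \<ominus>\<^bsub>B\<^esub> D \<ominus>\<^bsub>B\<^esub> G"
          using FB DB G(1) by (simp add: a_minus_def B.a_ac B.minus_add)
        then have "F \<ominus>\<^bsub>B\<^esub> (D \<oplus>\<^bsub>B\<^esub> G) \<in> nbhd I k" using G(3) by simp
        moreover have "\<forall>m'. (D \<oplus>\<^bsub>B\<^esub> G) m' \<noteq> \<zero> \<longrightarrow> m' \<in> std_exps I k"
        proof (intro allI impI)
          fix m' assume "(D \<oplus>\<^bsub>B\<^esub> G) m' \<noteq> \<zero>"
          then have "m' = m \<or> G m' \<noteq> \<zero>" using G(1) by (auto simp: D_def mono_def)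
          then show "m' \<in> std_exps I k" using G(2) m False by (auto simp: std_exps_def)
        qed
        moreover have "D \<oplus>\<^bsub>B\<^esub> G \<in> carrier B" using DB G(1) by simp
        ultimately show ?thesis by blast
      qed
    qed
  qed
  from this[of F N] F show ?thesis by simp
qed

text \<open>
  Multiplication by some \<open>x \<in> p' - p\<close> embeds \<open>B/p\<close> into \<open>p'/p\<close>, shifting the filtration by a bounded
  amount because of the Artin-Rees property.
\<close>

lemma hilbert_step:
  assumes p: "primeideal p B" and p': "ideal p' B" "p \<subset> p'"
  shows "\<exists>c. \<forall>k. card (std_exps p k) + card (std_exps p' (k + c)) \<le> card (std_exps p (k + c))"
proof -
  interpret primeideal p B by fact
  obtain x where x: "x \<in> p'" "x \<notin> p" using p' by blast
  have xB: "x \<in> carrier B" by (rule ideal.Icarr[OF p'(1) x(1)])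
  obtain c where c: "\<forall>k. \<forall>b\<in>carrier B. x \<otimes>\<^bsub>B\<^esub> b \<in> nbhd p (k + c) \<longrightarrow> b \<in> nbhd p k"
    using artin_rees[OF p xB x(2)] by blast
  have "card (std_exps p k) + card (std_exps p' (k + c)) \<le> card (std_exps p (k + c))" for k
  proof (rule ccontr)
    assume less: "\<not> ?thesis"
    let ?H1 = "std_exps p k" and ?H2 = "std_exps p' (k + c)" and ?H = "std_exps p (k + c)"
    \<comment> \<open>The left summand stands for x times a basis modulo \<open>nbhd p k\<close>,
      the right one for a basis modulo \<open>nbhd p' (k + c)\<close>. If the inequality failed,
      these elements would outnumber the dimension \<open>card ?H\<close> modulo
      \<open>nbhd p (k + c)\<close> and satisfy a relation there.\<close>
    define S where "S = Inl ` ?H1 \<union> Inr ` ?H2"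
    define v :: "'i multiset + 'i multiset \<Rightarrow> 'i multiset \<Rightarrow> 'a" where
      "v s = (case s of Inl m \<Rightarrow> x \<otimes>\<^bsub>B\<^esub> mono m \<one> | Inr m \<Rightarrow> mono m \<one>)" for s
    have HP: "m \<in> P" if "m \<in> std_exps I k" for m I k using that by (simp add: std_exps_def)
    have vB: "v s \<in> carrier B" if "s \<in> S" for s
      using that xB HP by (auto simp: S_def v_def)
    have "card S = card ?H1 + card ?H2"
      unfolding S_def by (subst card_Un_disjoint) (auto simp: card_image)
    then have cS: "card ?H < card S" using less by simp
    have fS: "finite S" by (simp add: S_def)
    have "\<forall>s\<in>S. \<exists>G. G \<in> carrier B \<and> (\<forall>m. G m \<noteq> \<zero> \<longrightarrow> m \<in> ?H) \<and> v s \<ominus>\<^bsub>B\<^esub> G \<in> nbhd p (k + c)"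
      using std_exps_span[OF is_ideal vB] by meson
    then obtain \<nu> where nu: "\<And>s. s \<in> S \<Longrightarrow> \<nu> s \<in> carrier B"
      "\<And>s m. s \<in> S \<Longrightarrow> \<nu> s m \<noteq> \<zero> \<Longrightarrow> m \<in> ?H" "\<And>s. s \<in> S \<Longrightarrow> v s \<ominus>\<^bsub>B\<^esub> \<nu> s \<in> nbhd p (k + c)"
      by metis
    obtain \<kappa> where k: "\<forall>s\<in>S. \<kappa> s \<in> carrier R" "\<exists>s\<in>S. \<kappa> s \<noteq> \<zero>" "\<forall>m\<in>?H. (\<Oplus>s\<in>S. \<kappa> s \<otimes> \<nu> s m) = \<zero>"
      using nontrivial_solution[OF fS finite_std_exps cS, of \<nu>] nu(1) by auto
    interpret N: ideal "nbhd p (k + c)" B by (rule nbhd_ideal[OF is_ideal])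
    have mk: "mono {#} (\<kappa> s) \<in> carrier B" if "s \<in> S" for s using that k empty_in by simp
    define Vs where "Vs = (\<Oplus>\<^bsub>B\<^esub>s\<in>S. mono {#} (\<kappa> s) \<otimes>\<^bsub>B\<^esub> v s)"
    have nuz: "(\<Oplus>\<^bsub>B\<^esub>s\<in>S. mono {#} (\<kappa> s) \<otimes>\<^bsub>B\<^esub> \<nu> s) = \<zero>\<^bsub>B\<^esub>"
    proof
      fix m
      have "(\<Oplus>\<^bsub>B\<^esub>s\<in>S. mono {#} (\<kappa> s) \<otimes>\<^bsub>B\<^esub> \<nu> s) m = (\<Oplus>s\<in>S. (mono {#} (\<kappa> s) \<otimes>\<^bsub>B\<^esub> \<nu> s) m)"
        by (rule finsum_apply) (use fS mk nu in auto)
      also have "\<dots> = (\<Oplus>s\<in>S. \<kappa> s \<otimes> \<nu> s m)"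
        by (rule finsum_cong'[OF refl]) (use k nu empty_in in \<open>auto simp: mono_mult_apply\<close>)
      also have "\<dots> = \<zero>"
      proof (cases "m \<in> ?H")
        case True
        then show ?thesis using k by blast
      next
        case False
        then have "\<nu> s m = \<zero>" if "s \<in> S" for s using nu(2)[OF that, of m] by blast
        then show ?thesis using k by (intro finsum_all_zero) auto
      qed
      finally show "(\<Oplus>\<^bsub>B\<^esub>s\<in>S. mono {#} (\<kappa> s) \<otimes>\<^bsub>B\<^esub> \<nu> s) m = \<zero>\<^bsub>B\<^esub> m" by simp
    qed
    have "Vs = (\<Oplus>\<^bsub>B\<^esub>s\<in>S. mono {#} (\<kappa> s) \<otimes>\<^bsub>B\<^esub> (v s \<ominus>\<^bsub>B\<^esub> \<nu> s) \<oplus>\<^bsub>B\<^esub> mono {#} (\<kappa> s) \<otimes>\<^bsub>B\<^esub> \<nu> s)"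
      unfolding Vs_def
    proof (rule B.finsum_cong'[OF refl])
      fix s assume s: "s \<in> S"
      show "mono {#} (\<kappa> s) \<otimes>\<^bsub>B\<^esub> v s = mono {#} (\<kappa> s) \<otimes>\<^bsub>B\<^esub> (v s \<ominus>\<^bsub>B\<^esub> \<nu> s) \<oplus>\<^bsub>B\<^esub> mono {#} (\<kappa> s) \<otimes>\<^bsub>B\<^esub> \<nu> s"
        using mk[OF s] vB[OF s] nu(1)[OF s]
        by (simp add: a_minus_def B.r_distr[symmetric] B.a_assoc B.l_neg)
    qed (use mk vB nu in auto)
    also have "\<dots> = (\<Oplus>\<^bsub>B\<^esub>s\<in>S. mono {#} (\<kappa> s) \<otimes>\<^bsub>B\<^esub> (v s \<ominus>\<^bsub>B\<^esub> \<nu> s)) \<oplus>\<^bsub>B\<^esub> \<zero>\<^bsub>B\<^esub>"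
      unfolding nuz[symmetric] by (rule B.finsum_addf) (use mk vB nu in auto)
    also have "\<dots> = (\<Oplus>\<^bsub>B\<^esub>s\<in>S. mono {#} (\<kappa> s) \<otimes>\<^bsub>B\<^esub> (v s \<ominus>\<^bsub>B\<^esub> \<nu> s))"
      by (rule B.r_zero) (use mk vB nu in \<open>auto intro!: B.finsum_closed\<close>)
    also have "\<dots> \<in> nbhd p (k + c)"
      using nu(3) mk by (intro N.finsum_in_ideal N.I_l_closed) auto
    finally have VN: "Vs \<in> nbhd p (k + c)" .
    define G where "G = (\<lambda>m. if m \<in> ?H1 then \<kappa> (Inl m) else \<zero>)"
    define L where "L = (\<lambda>m. if m \<in> ?H2 then \<kappa> (Inr m) else \<zero>)"
    have GB: "G \<in> carrier B" and LB: "L \<in> carrier B"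
      using k HP by (auto simp: G_def L_def carrier_B S_def)
    have sums: "(\<Oplus>\<^bsub>B\<^esub>m\<in>H. mono {#} (\<kappa> (h m)) \<otimes>\<^bsub>B\<^esub> mono m \<one>) = (\<lambda>m. if m \<in> H then \<kappa> (h m) else \<zero>)"
      if H: "finite H" "H \<subseteq> P" "\<And>m. m \<in> H \<Longrightarrow> \<kappa> (h m) \<in> carrier R" for H :: "'i multiset set" and h
    proof
      fix m
      have "(\<Oplus>\<^bsub>B\<^esub>m\<in>H. mono {#} (\<kappa> (h m)) \<otimes>\<^bsub>B\<^esub> mono m \<one>) m = (\<Oplus>m'\<in>H. (mono {#} (\<kappa> (h m')) \<otimes>\<^bsub>B\<^esub> mono m' \<one>) m)"
        using H empty_in by (intro finsum_apply mult_closed_B mono_closed) auto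
      also have "\<dots> = (\<Oplus>m'\<in>H. if m' = m then \<kappa> (h m') else \<zero>)"
      proof (rule finsum_cong'[OF refl])
        fix m' assume m': "m' \<in> H"
        show "(mono {#} (\<kappa> (h m')) \<otimes>\<^bsub>B\<^esub> mono m' \<one>) m = (if m' = m then \<kappa> (h m') else \<zero>)"
          using H(2,3) m' empty_in by (auto simp: mono_mult_mono mono_def)
      qed (use H in auto)
      also have "\<dots> = (if m \<in> H then \<kappa> (h m) else \<zero>)"
      proof (cases "m \<in> H")
        case True
        have "(\<Oplus>m'\<in>H. if m' = m then \<kappa> (h m') else \<zero>) = (if m = m then \<kappa> (h m) else \<zero>)"
          by (rule finsum_single) (use True H in auto)
        then show ?thesis using True by simp
      next
        case False
        then show ?thesis by (auto intro: finsum_all_zero)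
      qed
      finally show "(\<Oplus>\<^bsub>B\<^esub>m\<in>H. mono {#} (\<kappa> (h m)) \<otimes>\<^bsub>B\<^esub> mono m \<one>) m = (if m \<in> H then \<kappa> (h m) else \<zero>)" .
    qed
    have "Vs = (\<Oplus>\<^bsub>B\<^esub>s\<in>Inl ` ?H1. mono {#} (\<kappa> s) \<otimes>\<^bsub>B\<^esub> v s) \<oplus>\<^bsub>B\<^esub> (\<Oplus>\<^bsub>B\<^esub>s\<in>Inr ` ?H2. mono {#} (\<kappa> s) \<otimes>\<^bsub>B\<^esub> v s)"
      unfolding Vs_def S_def by (rule B.finsum_Un_disjoint) (use mk vB in \<open>auto simp: S_def\<close>)
    also have "(\<Oplus>\<^bsub>B\<^esub>s\<in>Inl ` ?H1. mono {#} (\<kappa> s) \<otimes>\<^bsub>B\<^esub> v s) = (\<Oplus>\<^bsub>B\<^esub>m\<in>?H1. mono {#} (\<kappa> (Inl m)) \<otimes>\<^bsub>B\<^esub> v (Inl m))"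
      by (rule B.finsum_reindex) (use mk vB in \<open>auto simp: S_def\<close>)
    also have "\<dots> = (\<Oplus>\<^bsub>B\<^esub>m\<in>?H1. x \<otimes>\<^bsub>B\<^esub> (mono {#} (\<kappa> (Inl m)) \<otimes>\<^bsub>B\<^esub> mono m \<one>))"
    proof (rule B.finsum_cong'[OF refl])
      fix m assume m: "m \<in> ?H1"
      then have "mono {#} (\<kappa> (Inl m)) \<in> carrier B" "mono m \<one> \<in> carrier B" using mk HP by (auto simp: S_def)
      then show "mono {#} (\<kappa> (Inl m)) \<otimes>\<^bsub>B\<^esub> v (Inl m) = x \<otimes>\<^bsub>B\<^esub> (mono {#} (\<kappa> (Inl m)) \<otimes>\<^bsub>B\<^esub> mono m \<one>)"
        using xB by (simp add: v_def B.m_lcomm)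
    qed (use mk HP xB in \<open>auto simp: S_def\<close>)
    also have "\<dots> = x \<otimes>\<^bsub>B\<^esub> (\<Oplus>\<^bsub>B\<^esub>m\<in>?H1. mono {#} (\<kappa> (Inl m)) \<otimes>\<^bsub>B\<^esub> mono m \<one>)"
      by (rule B.finsum_rdistr[symmetric]) (use mk HP xB in \<open>auto simp: S_def\<close>)
    also have "(\<Oplus>\<^bsub>B\<^esub>m\<in>?H1. mono {#} (\<kappa> (Inl m)) \<otimes>\<^bsub>B\<^esub> mono m \<one>) = G"
      unfolding G_def by (rule sums) (use HP k in \<open>auto simp: S_def\<close>)
    also have "(\<Oplus>\<^bsub>B\<^esub>s\<in>Inr ` ?H2. mono {#} (\<kappa> s) \<otimes>\<^bsub>B\<^esub> v s) = (\<Oplus>\<^bsub>B\<^esub>m\<in>?H2. mono {#} (\<kappa> (Inr m)) \<otimes>\<^bsub>B\<^esub> v (Inr m))"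
      by (rule B.finsum_reindex) (use mk vB in \<open>auto simp: S_def\<close>)
    also have "\<dots> = (\<Oplus>\<^bsub>B\<^esub>m\<in>?H2. mono {#} (\<kappa> (Inr m)) \<otimes>\<^bsub>B\<^esub> mono m \<one>)"
      by (simp add: v_def)
    also have "\<dots> = L"
      unfolding L_def by (rule sums) (use HP k in \<open>auto simp: S_def\<close>)
    finally have V: "Vs = x \<otimes>\<^bsub>B\<^esub> G \<oplus>\<^bsub>B\<^esub> L" .
    have xG: "x \<otimes>\<^bsub>B\<^esub> G \<in> p'" by (rule ideal.I_r_closed[OF p'(1) x(1) GB])
    have xGB: "x \<otimes>\<^bsub>B\<^esub> G \<in> carrier B" using xB GB by simp
    interpret N': ideal "nbhd p' (k + c)" B by (rule nbhd_ideal[OF p'(1)])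
    \<comment> \<open>Since x lies in p', the relation modulo p' involves only \<open>L\<close>,
      which must vanish. What is left is x G, and Artin-Rees cancels x.\<close>
    have "Vs \<in> nbhd p' (k + c)" using VN p'(2) unfolding nbhd_iff by blast
    then have "Vs \<ominus>\<^bsub>B\<^esub> x \<otimes>\<^bsub>B\<^esub> G \<in> nbhd p' (k + c)"
      by (rule in_ideal_diff[OF nbhd_ideal[OF p'(1)] _ nbhd_left[OF p'(1) xG]])
    moreover have "Vs \<ominus>\<^bsub>B\<^esub> x \<otimes>\<^bsub>B\<^esub> G = L"
      unfolding V using xGB LB by (simp add: a_minus_def B.a_ac B.r_neg B.r_neg2 B.r_neg1)
    ultimately have "L \<in> nbhd p' (k + c)" by simp
    then have L0: "L = \<zero>\<^bsub>B\<^esub>"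
      by (rule std_exps_independent[OF p'(1)]) (auto simp: L_def split: if_splits)
    then have "x \<otimes>\<^bsub>B\<^esub> G \<in> nbhd p (k + c)" using VN V xGB by simp
    then have "G \<in> nbhd p k" using c GB by blast
    then have G0: "G = \<zero>\<^bsub>B\<^esub>"
      by (rule std_exps_independent[OF is_ideal]) (auto simp: G_def split: if_splits)
    have "\<kappa> s = \<zero>" if "s \<in> S" for s
    proof (cases s)
      case (Inl m)
      then have "m \<in> ?H1" using that by (auto simp: S_def)
      then have "G m = \<kappa> s" using Inl by (simp add: G_def)
      then show ?thesis using G0 by simp
    next
      case (Inr m)
      then have "m \<in> ?H2" using that by (auto simp: S_def)
      then have "L m = \<kappa> s" using Inr by (simp add: L_def)
      then show ?thesis using L0 by simp
    qed
    then show False using k(2) by blast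
  qed
  then show ?thesis by blast
qed

lemma std_exps_mono: "k \<le> k' \<Longrightarrow> card (std_exps I k) \<le> card (std_exps I k')"
  by (rule card_mono[OF finite_std_exps]) (auto simp: std_exps_def)

text \<open>Iterating \<open>hilbert_step\<close> sums the Hilbert function of the larger prime. By
  Pascal's rule a lower bound of binomial degree j becomes one of degree j + 1, at the price of a
  larger scale c.\<close>

lemma hilbert_chain:
  assumes pr: "\<And>i. i \<le> l \<Longrightarrow> primeideal (Q i) B" and sub: "\<And>i. i < l \<Longrightarrow> Q i \<subset> Q (Suc i)"
    and "j \<le> l"
  shows "\<exists>c>0. \<forall>k. k choose j \<le> card (std_exps (Q (l - j)) (c * Suc k))"
  using \<open>j \<le> l\<close>
proof (induction j)
  case 0
  interpret primeideal "Q l" B using pr by simp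
  have "{#} \<notin> leads (Q l)"
  proof
    assume "{#} \<in> leads (Q l)"
    then obtain F where "F \<in> Q l" "is_lead F {#}" unfolding leads_def by blast
    then have "Q l = carrier B" using unit_ideal[OF is_ideal] by (simp add: is_lead_def)
    then show False using I_notcarr by simp
  qed
  then have "{#} \<in> std_exps (Q l) (1 * Suc k)" for k using empty_in by (simp add: std_exps_def)
  then have "1 \<le> card (std_exps (Q l) (1 * Suc k))" for k
    using card_gt_0_iff[of "std_exps (Q l) (1 * Suc k)"] by (auto simp: Suc_le_eq)
  then show ?case by (intro exI[of _ 1]) simp
next
  case (Suc j)
  define q where "q = Q (l - Suc j)"
  define q' where "q' = Q (l - j)"
  have l: "l - Suc j < l" "Suc (l - Suc j) = l - j" using Suc.prems by auto
  have q: "primeideal q B" "primeideal q' B" "q \<subset> q'"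
    using pr[of "l - Suc j"] pr[of "l - j"] sub[OF l(1)] l by (auto simp: q_def q'_def)
  obtain c' where c': "c' > 0" "\<And>k. k choose j \<le> card (std_exps q' (c' * Suc k))"
    using Suc by (auto simp: q'_def)
  obtain c where c: "\<And>k. card (std_exps q k) + card (std_exps q' (k + c)) \<le> card (std_exps q (k + c))"
    using hilbert_step[OF q(1) primeideal.axioms(1)[OF q(2)] q(3)] by blast
  have "k choose (Suc j) \<le> card (std_exps q ((c + c') * Suc k))" for k
  proof (induction k)
    case (Suc k)
    \<comment> \<open>The scale c + c' leaves room in each step both for the shift c and for the
      scale c' of the larger prime.\<close>
    have e: "(c + c') * Suc (Suc k) = (c + c') * Suc k + c' + c" by simp
    have "Suc k choose Suc j = (k choose Suc j) + (k choose j)" by simp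
    also have "\<dots> \<le> card (std_exps q ((c + c') * Suc k)) + card (std_exps q' (c' * Suc k))"
      using Suc c' by (intro add_mono) auto
    also have "\<dots> \<le> card (std_exps q ((c + c') * Suc k + c')) + card (std_exps q' ((c + c') * Suc k + c' + c))"
      by (intro add_mono std_exps_mono) (auto simp: algebra_simps)
    also have "\<dots> \<le> card (std_exps q ((c + c') * Suc (Suc k)))"
      unfolding e using c by blast
    finally show ?case .
  qed simp
  then show ?case using c' by (intro exI[of _ "c + c'"]) (simp add: q_def)
qed

lemma prime_chain_bound:
  assumes growth: "\<And>k. card {m \<in> P. size m < k} \<le> A * k ^ D"
    and pr: "\<And>i. i \<le> l \<Longrightarrow> primeideal (Q i) B" and sub: "\<And>i. i < l \<Longrightarrow> Q i \<subset> Q (Suc i)"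
  shows "l \<le> D"
proof (rule ccontr)
  assume "\<not> l \<le> D"
  then have lD: "D < l" by simp
  obtain c where c: "c > 0" "\<And>k. k choose l \<le> card (std_exps (Q 0) (c * Suc k))"
    using hilbert_chain[of l Q l, OF pr sub] by auto
  have up: "k choose l \<le> A * (c * Suc k) ^ D" for k
  proof -
    have "k choose l \<le> card (std_exps (Q 0) (c * Suc k))" by (rule c)
    also have "\<dots> \<le> card {m \<in> P. size m < c * Suc k}"
      by (rule card_mono) (auto simp: std_exps_def intro: finite_subset[OF _ finite_P_size[of "c * Suc k"]])
    also have "\<dots> \<le> A * (c * Suc k) ^ D" by (rule growth)
    finally show ?thesis .
  qed
  define M where "M = A * (c * (l + 1)) ^ D"
  \<comment> \<open>At k = l t the binomial coefficient is at least \<open>t^l\<close>, hence at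
    least \<open>t^(D+1)\<close>, while the growth bound gives at most \<open>M * t^D\<close>; any t
    above M yields the contradiction.\<close>
  define t where "t = Suc M"
  have "t ^ Suc D \<le> t ^ l" using lD by (intro power_increasing) (auto simp: t_def)
  also have "t ^ l \<le> (l * t) choose l"
  proof -
    have "(real (l * t) / real l) ^ l \<le> real ((l * t) choose l)"
      by (rule binomial_ge_n_over_k_pow_k) (auto simp: t_def)
    then show ?thesis using lD by (simp flip: of_nat_power)
  qed
  also have "\<dots> \<le> A * (c * Suc (l * t)) ^ D" by (rule up)
  also have "\<dots> \<le> A * (c * ((l + 1) * t)) ^ D"
    by (intro mult_left_mono power_mono) (auto simp: t_def)
  also have "c * ((l + 1) * t) = (c * (l + 1)) * t" by (simp only: mult.assoc)
  also have "A * ((c * (l + 1)) * t) ^ D = M * t ^ D" unfolding M_def power_mult_distrib[of _ t] by simp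
  finally have "t * t ^ D \<le> M * t ^ D" by simp
  then have "t \<le> M" by (simp add: t_def)
  then show False by (simp add: t_def)
qed

end

section \<open>Frobenius powers\<close>

context cring
begin

lemma binomial_cring:
  assumes a: "a \<in> carrier R" and b: "b \<in> carrier R"
  shows "(a \<oplus> b) [^] (n::nat) = (\<Oplus>k\<in>{..n}. [(n choose k)] \<cdot>\<^bsub>R\<^esub> (a [^] k \<otimes> b [^] (n - k)))"
proof (induction n)
  case 0
  then show ?case using a b by (simp add: finsum_0)
next
  case (Suc n)
  let ?S = "\<Oplus>k\<in>{..n}. [(n choose k)] \<cdot>\<^bsub>R\<^esub> (a [^] Suc k \<otimes> b [^] (n - k))"
  let ?S' = "\<Oplus>k\<in>{..n}. [(n choose Suc k)] \<cdot>\<^bsub>R\<^esub> (a [^] Suc k \<otimes> b [^] (n - k))"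
  have cl: "(\<Oplus>k\<in>{..n}. [(f k)] \<cdot>\<^bsub>R\<^esub> (a [^] g k \<otimes> b [^] h k)) \<in> carrier R" for f g h :: "nat \<Rightarrow> nat"
    using a b by (intro finsum_closed) auto
  have 1: "(\<Oplus>k\<in>{..n}. [(n choose k)] \<cdot>\<^bsub>R\<^esub> (a [^] k \<otimes> b [^] (n - k))) \<otimes> a = ?S"
  proof -
    have "(\<Oplus>k\<in>{..n}. [(n choose k)] \<cdot>\<^bsub>R\<^esub> (a [^] k \<otimes> b [^] (n - k))) \<otimes> a
        = (\<Oplus>k\<in>{..n}. [(n choose k)] \<cdot>\<^bsub>R\<^esub> (a [^] k \<otimes> b [^] (n - k)) \<otimes> a)"
      using a b by (intro finsum_ldistr) auto
    also have "\<dots> = ?S"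
      using a b by (intro finsum_cong'[OF refl]) (auto simp: add_pow_ldistr m_assoc m_comm[of "b [^] j" a for j :: nat])
    finally show ?thesis .
  qed
  have 2: "(\<Oplus>k\<in>{..n}. [(n choose k)] \<cdot>\<^bsub>R\<^esub> (a [^] k \<otimes> b [^] (n - k))) \<otimes> b = ?S' \<oplus> b [^] Suc n"
  proof -
    have "(\<Oplus>k\<in>{..n}. [(n choose k)] \<cdot>\<^bsub>R\<^esub> (a [^] k \<otimes> b [^] (n - k))) \<otimes> b
        = (\<Oplus>k\<in>{..n}. [(n choose k)] \<cdot>\<^bsub>R\<^esub> (a [^] k \<otimes> b [^] (n - k)) \<otimes> b)"
      using a b by (intro finsum_ldistr) auto
    also have "\<dots> = (\<Oplus>k\<in>{..n}. [(n choose k)] \<cdot>\<^bsub>R\<^esub> (a [^] k \<otimes> b [^] (Suc n - k)))"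
      using a b by (intro finsum_cong'[OF refl]) (auto simp: add_pow_ldistr m_assoc Suc_diff_le)
    also have "\<dots> = (\<Oplus>k\<in>{..Suc n}. [(n choose k)] \<cdot>\<^bsub>R\<^esub> (a [^] k \<otimes> b [^] (Suc n - k)))"
      using a b by (subst finsum_Suc) (auto intro!: finsum_closed simp: binomial_eq_0)
    also have "\<dots> = (\<Oplus>k\<in>{..n}. [(n choose Suc k)] \<cdot>\<^bsub>R\<^esub> (a [^] Suc k \<otimes> b [^] (Suc n - Suc k))) \<oplus> b [^] Suc n"
      using a b by (subst finsum_Suc2) auto
    finally show ?thesis by simp
  qed
  have "(\<Oplus>k\<in>{..Suc n}. [(Suc n choose k)] \<cdot>\<^bsub>R\<^esub> (a [^] k \<otimes> b [^] (Suc n - k)))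
      = (\<Oplus>k\<in>{..n}. [(Suc n choose Suc k)] \<cdot>\<^bsub>R\<^esub> (a [^] Suc k \<otimes> b [^] (n - k))) \<oplus> b [^] Suc n"
    using a b by (subst finsum_Suc2) auto
  also have "(\<Oplus>k\<in>{..n}. [(Suc n choose Suc k)] \<cdot>\<^bsub>R\<^esub> (a [^] Suc k \<otimes> b [^] (n - k)))
      = (\<Oplus>k\<in>{..n}. [(n choose k)] \<cdot>\<^bsub>R\<^esub> (a [^] Suc k \<otimes> b [^] (n - k)) \<oplus> [(n choose Suc k)] \<cdot>\<^bsub>R\<^esub> (a [^] Suc k \<otimes> b [^] (n - k)))"
    using a b by (intro finsum_cong'[OF refl]) (auto simp: add.nat_pow_mult)
  also have "\<dots> = ?S \<oplus> ?S'" using a b by (intro finsum_addf) auto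
  finally have R: "(\<Oplus>k\<in>{..Suc n}. [(Suc n choose k)] \<cdot>\<^bsub>R\<^esub> (a [^] k \<otimes> b [^] (Suc n - k))) = ?S \<oplus> ?S' \<oplus> b [^] Suc n" .
  have "(a \<oplus> b) [^] Suc n = (\<Oplus>k\<in>{..n}. [(n choose k)] \<cdot>\<^bsub>R\<^esub> (a [^] k \<otimes> b [^] (n - k))) \<otimes> (a \<oplus> b)"
    using Suc by simp
  also have "\<dots> = ?S \<oplus> (?S' \<oplus> b [^] Suc n)"
    using a b cl by (simp add: r_distr 1 2)
  also have "\<dots> = ?S \<oplus> ?S' \<oplus> b [^] Suc n"
    by (rule a_assoc[symmetric]) (use a b cl[of "\<lambda>k. n choose k" Suc "\<lambda>k. n - k"] cl[of "\<lambda>k. n choose Suc k" Suc "\<lambda>k. n - k"] in auto)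
  finally show ?case using R by simp
qed

lemma frobenius_add:
  assumes p: "Factorial_Ring.prime p" "[p] \<cdot>\<^bsub>R\<^esub> \<one> = \<zero>" and a: "a \<in> carrier R" and b: "b \<in> carrier R"
  shows "(a \<oplus> b) [^] (p::nat) = a [^] p \<oplus> b [^] p"
proof -
  have p0: "p > 0" using p(1) by (simp add: prime_gt_0_nat)
  have z: "[(p * k)] \<cdot>\<^bsub>R\<^esub> x = \<zero>" if "x \<in> carrier R" for k x
  proof -
    have "[p] \<cdot>\<^bsub>R\<^esub> x = ([p] \<cdot>\<^bsub>R\<^esub> \<one>) \<otimes> x" using that by (simp add: add_pow_ldistr)
    then have "[p] \<cdot>\<^bsub>R\<^esub> x = \<zero>" using that p by simp
    then show ?thesis using that by (simp add: add.nat_pow_pow[symmetric])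
  qed
  have "(a \<oplus> b) [^] p = (\<Oplus>k\<in>{..p}. [(p choose k)] \<cdot>\<^bsub>R\<^esub> (a [^] k \<otimes> b [^] (p - k)))"
    by (rule binomial_cring[OF a b])
  also have "\<dots> = (\<Oplus>k\<in>{0, p}. [(p choose k)] \<cdot>\<^bsub>R\<^esub> (a [^] k \<otimes> b [^] (p - k)))"
  proof (rule finsum_neutral_left[symmetric])
    fix k assume "k \<in> {..p} - {0, p}"
    then have "p dvd (p choose k)" using p(1) by (intro dvd_choose_prime) auto
    then obtain j where "p choose k = p * j" by (auto elim: dvdE)
    then show "[(p choose k)] \<cdot>\<^bsub>R\<^esub> (a [^] k \<otimes> b [^] (p - k)) = \<zero>" using z a b by simp
  qed (use a b in auto)
  also have "\<dots> = b [^] p \<oplus> a [^] p" using a b p0 by (simp add: finsum_insert)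
  finally show ?thesis using a b by (simp add: a_comm)
qed

lemma frobenius_add_iter:
  assumes p: "Factorial_Ring.prime p" "[p] \<cdot>\<^bsub>R\<^esub> \<one> = \<zero>" and a: "a \<in> carrier R" and b: "b \<in> carrier R"
  shows "(a \<oplus> b) [^] ((p::nat) ^ e) = a [^] (p ^ e) \<oplus> b [^] (p ^ e)"
proof (induction e)
  case (Suc e)
  have *: "x [^] (p ^ Suc e) = (x [^] (p ^ e)) [^] p" if "x \<in> carrier R" for x
    using that by (simp add: nat_pow_pow mult.commute)
  show ?case using Suc a b frobenius_add[OF p] by (simp add: * del: power_Suc)
qed (use a b in simp)

lemma frobenius_finsum:
  assumes p: "Factorial_Ring.prime p" "[p] \<cdot>\<^bsub>R\<^esub> \<one> = \<zero>" and "finite A" "\<And>x. x \<in> A \<Longrightarrow> f x \<in> carrier R"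
  shows "(\<Oplus>x\<in>A. f x) [^] ((p::nat) ^ e) = (\<Oplus>x\<in>A. f x [^] (p ^ e))"
  using assms(3,4)
proof (induction A)
  case empty
  have "p ^ e > 0" using p(1) by (simp add: prime_gt_0_nat)
  then show ?case by (simp add: nat_pow_zero)
next
  case (insert x A)
  then have "f x \<in> carrier R" "(\<Oplus>x\<in>A. f x) \<in> carrier R" "f \<in> A \<rightarrow> carrier R" by (auto intro!: finsum_closed)
  then show ?case using insert frobenius_add_iter[OF p] by (simp add: Pi_def)
qed

end

lemma (in ideal) nat_pow_in: "a \<in> I \<Longrightarrow> (n::nat) > 0 \<Longrightarrow> a [^] n \<in> I"
proof -
  assume a: "a \<in> I" "n > 0"
  then obtain k where "n = Suc k" by (cases n) auto
  then show "a [^] n \<in> I" using I_l_closed[OF a(1) nat_pow_closed[OF Icarr[OF a(1)], of k]] by simp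
qed

lemma (in monoid_series) add_pow_apply: "F \<in> carrier B \<Longrightarrow> ([(n::nat)] \<cdot>\<^bsub>B\<^esub> F) m = [n] \<cdot>\<^bsub>R\<^esub> F m"
  by (induction n) auto

lemma repeat_mset_inj: "q > 0 \<Longrightarrow> repeat_mset q a = repeat_mset q b \<longleftrightarrow> a = b"
  by (auto simp: multiset_eq_iff)

text \<open>Additivity of the q-th power applies to finite sums only. So F is split into its
  finitely many terms of size at most \<open>size m\<close> and a remainder of larger order. The
  q-th power of the remainder stays in the same \<open>tail\<close> ideal and does not reach the
  coefficient at m.\<close>

lemma (in full_series) frobenius_coeff:
  assumes p: "Factorial_Ring.prime p" "[p] \<cdot>\<^bsub>R\<^esub> \<one> = \<zero>" and F: "F \<in> carrier B"
  shows "(F [^]\<^bsub>B\<^esub> ((p::nat) ^ e)) (repeat_mset (p ^ e) m) = F m [^] (p ^ e)"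
    and "(\<And>m'. m \<noteq> repeat_mset (p ^ e) m') \<Longrightarrow> (F [^]\<^bsub>B\<^esub> (p ^ e)) m = \<zero>"
proof -
  define q where "q = p ^ e"
  have q: "q > 0" using p(1) by (simp add: q_def prime_gt_0_nat)
  have pB: "[p] \<cdot>\<^bsub>B\<^esub> \<one>\<^bsub>B\<^esub> = \<zero>\<^bsub>B\<^esub>"
    using p(2) by (auto simp: fun_eq_iff add_pow_apply one_apply)
  have main: "(F [^]\<^bsub>B\<^esub> q) m = (\<Oplus>a\<in>{a \<in> P. size a \<le> size m}. mono (repeat_mset q a) (F a [^] q) m)" for m
  proof -
    let ?A = "{a \<in> P. size a \<le> size m}"
    note fin = finite_P_size[of "size m"]
    define G where "G = (\<Oplus>\<^bsub>B\<^esub>a\<in>?A. mono a (F a))"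
    have mc: "mono a (F a) \<in> carrier B" if "a \<in> P" for a using that F by simp
    have G: "G \<in> carrier B" unfolding G_def using mc by (intro B.finsum_closed) auto
    have Gap: "G m' = F m'" if "size m' < Suc (size m)" for m'
    proof -
      have "G m' = (\<Oplus>a\<in>?A. mono a (F a) m')" unfolding G_def by (rule finsum_apply) (use fin mc in auto)
      also have "\<dots> = F m'"
      proof (cases "m' \<in> P")
        case True
        have "(\<Oplus>a\<in>?A. mono a (F a) m') = mono m' (F m') m'"
          by (rule finsum_single[OF fin]) (use True that F in \<open>auto simp: mono_def\<close>)
        then show ?thesis by simp
      next
        case False
        then show ?thesis using F by (auto simp: mono_def coeff_outside intro!: finsum_all_zero)
      qed
      finally show ?thesis .
    qed
    define H where "H = F \<ominus>\<^bsub>B\<^esub> G"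
    have HB: "H \<in> carrier B" using F G by (simp add: H_def)
    have Ht: "H \<in> tail (Suc (size m))"
      unfolding tail_def using Gap F G HB by (simp add: H_def a_minus_def r_neg)
    interpret T: ideal "tail (Suc (size m))" B by (rule tail_ideal)
    have Hq: "H [^]\<^bsub>B\<^esub> q \<in> tail (Suc (size m))" by (rule T.nat_pow_in[OF Ht q])
    have "F = H \<oplus>\<^bsub>B\<^esub> G" using F G by (simp add: H_def a_minus_def B.a_assoc B.l_neg)
    then have 0: "F [^]\<^bsub>B\<^esub> q = H [^]\<^bsub>B\<^esub> q \<oplus>\<^bsub>B\<^esub> G [^]\<^bsub>B\<^esub> q"
      unfolding q_def using B.frobenius_add_iter[OF p(1) pB HB G] by simp
    have "(F [^]\<^bsub>B\<^esub> q) m = (H [^]\<^bsub>B\<^esub> q) m \<oplus> (G [^]\<^bsub>B\<^esub> q) m" by (simp only: 0 add_apply)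
    also have "(H [^]\<^bsub>B\<^esub> q) m = \<zero>" using Hq unfolding tail_def by blast
    also have "\<zero> \<oplus> (G [^]\<^bsub>B\<^esub> q) m = (G [^]\<^bsub>B\<^esub> q) m"
      by (rule l_zero[OF coeff_closed[OF B.nat_pow_closed[OF G]]])
    finally have 1: "(F [^]\<^bsub>B\<^esub> q) m = (G [^]\<^bsub>B\<^esub> q) m" .
    have 2: "G [^]\<^bsub>B\<^esub> q = (\<Oplus>\<^bsub>B\<^esub>a\<in>?A. mono a (F a) [^]\<^bsub>B\<^esub> q)"
      unfolding G_def q_def by (rule B.frobenius_finsum[OF p(1) pB fin]) (use mc in auto)
    have 3: "(\<Oplus>\<^bsub>B\<^esub>a\<in>?A. mono a (F a) [^]\<^bsub>B\<^esub> q) m = (\<Oplus>a\<in>?A. (mono a (F a) [^]\<^bsub>B\<^esub> q) m)"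
      by (rule finsum_apply[OF fin]) (use mc in auto)
    have 4: "(\<Oplus>a\<in>?A. (mono a (F a) [^]\<^bsub>B\<^esub> q) m) = (\<Oplus>a\<in>?A. mono (repeat_mset q a) (F a [^] q) m)"
    proof (rule finsum_cong'[OF refl])
      fix a assume "a \<in> ?A"
      then show "(mono a (F a) [^]\<^bsub>B\<^esub> q) m = mono (repeat_mset q a) (F a [^] q) m"
        using F by (simp add: mono_pow)
    qed (use F in \<open>simp add: mono_def\<close>)
    show ?thesis using 1 2 3 4 by simp
  qed
  have "(F [^]\<^bsub>B\<^esub> q) (repeat_mset q m) = F m [^] q"
  proof (cases "m \<in> P")
    case True
    have "(F [^]\<^bsub>B\<^esub> q) (repeat_mset q m) = mono (repeat_mset q m) (F m [^] q) (repeat_mset q m)"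
      unfolding main
    proof (rule finsum_single[OF finite_P_size])
      have "size m \<le> size (repeat_mset q m)" using q by simp
      then show "m \<in> {a \<in> P. size a \<le> size (repeat_mset q m)}" using True by simp
      show "mono (repeat_mset q b) (F b [^] q) (repeat_mset q m) = \<zero>" if "b \<noteq> m" for b
        using that q by (auto simp: mono_def repeat_mset_inj)
    qed (use F in simp)
    then show ?thesis by simp
  next
    case False
    have "(F [^]\<^bsub>B\<^esub> q) (repeat_mset q m) = \<zero>"
      unfolding main
    proof (rule finsum_all_zero)
      fix b assume "b \<in> {a \<in> P. size a \<le> size (repeat_mset q m)}"
      then have "b \<noteq> m" using False by auto
      then show "mono (repeat_mset q b) (F b [^] q) (repeat_mset q m) = \<zero>"
        using q by (auto simp: mono_def repeat_mset_inj)
    qed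
    then show ?thesis using False F q by (simp add: coeff_outside nat_pow_zero)
  qed
  then show "(F [^]\<^bsub>B\<^esub> (p ^ e)) (repeat_mset (p ^ e) m) = F m [^] (p ^ e)" by (simp add: q_def)
  assume "\<And>m'. m \<noteq> repeat_mset (p ^ e) m'"
  then have "(F [^]\<^bsub>B\<^esub> q) m = \<zero>"
    unfolding main by (intro finsum_all_zero) (auto simp: mono_def q_def)
  then show "(F [^]\<^bsub>B\<^esub> (p ^ e)) m = \<zero>" by (simp add: q_def)
qed


section \<open>Bases over the subfield of \<open>q\<close>-th powers\<close>

text \<open>The coordinate functions \<open>c x\<close> already include the \<open>q\<close>-th root.\<close>

definition root_basis :: "('a, 'r) ring_scheme \<Rightarrow> nat \<Rightarrow> 'a set \<Rightarrow> ('a \<Rightarrow> 'a \<Rightarrow> 'a) \<Rightarrow> bool" where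
  "root_basis K q Y c \<longleftrightarrow> finite Y \<and> Y \<subseteq> carrier K \<and>
    (\<forall>x\<in>Y. \<forall>y\<in>carrier K. c x y \<in> carrier K) \<and>
    (\<forall>x\<in>Y. \<forall>y\<in>carrier K. \<forall>z\<in>carrier K. c x (y \<oplus>\<^bsub>K\<^esub> z) = c x y \<oplus>\<^bsub>K\<^esub> c x z) \<and>
    (\<forall>x\<in>Y. \<forall>y\<in>carrier K. \<forall>l\<in>carrier K. c x (l [^]\<^bsub>K\<^esub> q \<otimes>\<^bsub>K\<^esub> y) = l \<otimes>\<^bsub>K\<^esub> c x y) \<and>
    (\<forall>y\<in>carrier K. y = (\<Oplus>\<^bsub>K\<^esub>x\<in>Y. c x y [^]\<^bsub>K\<^esub> q \<otimes>\<^bsub>K\<^esub> x)) \<and>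
    (\<forall>x\<in>Y. \<forall>x'\<in>Y. c x x' = (if x = x' then \<one>\<^bsub>K\<^esub> else \<zero>\<^bsub>K\<^esub>))"

context field
begin

text \<open>Tower law. Expand y over \<open>K^q\<close> in \<open>Y\<close> with roots c x y, then
  expand each root over \<open>K^p\<close> in \<open>Z\<close>; raising the second expansion to the
  q-th power gives coordinates with respect to the products \<open>x z^q\<close>.\<close>

lemma root_basis_mult:
  assumes p: "Factorial_Ring.prime p" "[p] \<cdot>\<^bsub>R\<^esub> \<one> = \<zero>"
    and Y: "root_basis R (p ^ e) Y c" and Z: "root_basis R p Z d"
  shows "\<exists>W h. root_basis R (p ^ Suc e) W h \<and> card W = card Y * card Z"
proof -
  define q where "q = p ^ e"
  have q0: "q > 0" using p(1) by (simp add: q_def prime_gt_0_nat)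
  note YD = Y[unfolded root_basis_def, folded q_def] and ZD = Z[unfolded root_basis_def]
  define g where "g = (\<lambda>(x, z). x \<otimes> z [^] q)"
  define W where "W = g ` (Y \<times> Z)"
  have val: "d z (c x (g (x', z'))) = (if (x, z) = (x', z') then \<one> else \<zero>)"
    if "x \<in> Y" "z \<in> Z" "x' \<in> Y" "z' \<in> Z" for x z x' z'
  proof -
    have cl: "x' \<in> carrier R" "z' \<in> carrier R" using that YD ZD by auto
    have "c x (g (x', z')) = z' \<otimes> c x x'"
      using that YD cl m_comm[of x' "z' [^] q"] by (simp add: g_def)
    also have "\<dots> = (if x = x' then z' else \<zero>)" using that YD cl by auto
    moreover have "d z \<zero> = \<zero>"
    proof -
      have "d z (\<zero> [^] p \<otimes> \<zero>) = \<zero> \<otimes> d z \<zero>" using that ZD by blast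
      moreover have "d z \<zero> \<in> carrier R" using that ZD by blast
      ultimately show ?thesis by simp
    qed
    ultimately show ?thesis using that ZD by auto
  qed
  have inj: "inj_on g (Y \<times> Z)"
  proof (rule inj_onI)
    fix u v assume uv: "u \<in> Y \<times> Z" "v \<in> Y \<times> Z" "g u = g v"
    obtain x z x' z' where e: "u = (x, z)" "v = (x', z')" by (cases u, cases v) auto
    have "d z (c x (g u)) = \<one>" using val[of x z x z] uv e by simp
    moreover have "d z (c x (g v)) = (if (x, z) = (x', z') then \<one> else \<zero>)" using val[of x z x' z'] uv e by simp
    ultimately have "(if (x, z) = (x', z') then \<one> else \<zero>) = \<one>" using uv(3) by simp
    then show "u = v" using e one_not_zero by (metis (full_types))
  qed
  define iv where "iv = the_inv_into (Y \<times> Z) g"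
  have iv: "iv (g u) = u" if "u \<in> Y \<times> Z" for u using the_inv_into_f_f[OF inj that] by (simp add: iv_def)
  define h where "h w y = d (snd (iv w)) (c (fst (iv w)) y)" for w y
  have hg: "h (g (x, z)) y = d z (c x y)" if "x \<in> Y" "z \<in> Z" for x z y using iv[of "(x, z)"] that by (simp add: h_def)
  have pw: "l [^] (p ^ Suc e) = (l [^] p) [^] q" if "l \<in> carrier R" for l
    using that by (simp add: nat_pow_pow q_def)
  have "root_basis R (p ^ Suc e) W h"
    unfolding root_basis_def
  proof (intro conjI ballI)
    show "finite W" using YD ZD by (simp add: W_def)
    show "W \<subseteq> carrier R" using YD ZD by (auto simp: W_def g_def)
  next
    fix w y assume "w \<in> W" "y \<in> carrier R"
    then show "h w y \<in> carrier R" using YD ZD hg by (auto simp: W_def)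
  next
    fix w y y' assume *: "w \<in> W" "y \<in> carrier R" "y' \<in> carrier R"
    then obtain x z where w: "w = g (x, z)" "x \<in> Y" "z \<in> Z" by (auto simp: W_def)
    have "c x y \<in> carrier R" "c x y' \<in> carrier R" using YD w * by auto
    then show "h w (y \<oplus> y') = h w y \<oplus> h w y'" using YD ZD w * by (simp add: hg)
  next
    fix w y l assume *: "w \<in> W" "y \<in> carrier R" "l \<in> carrier R"
    then obtain x z where w: "w = g (x, z)" "x \<in> Y" "z \<in> Z" by (auto simp: W_def)
    have "c x y \<in> carrier R" "l [^] p \<in> carrier R" using YD w * by auto
    then show "h w (l [^] p ^ Suc e \<otimes> y) = l \<otimes> h w y"
      unfolding pw[OF *(3)] using YD ZD w * by (simp add: hg)
  next
    fix y assume y: "y \<in> carrier R"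
    have cl: "x \<in> carrier R" "z \<in> carrier R" "c x y \<in> carrier R" "d z (c x y) \<in> carrier R"
      if "x \<in> Y" "z \<in> Z" for x z using YD ZD y that by auto
    have "(\<Oplus>w\<in>W. h w y [^] p ^ Suc e \<otimes> w) = (\<Oplus>u\<in>Y \<times> Z. h (g u) y [^] p ^ Suc e \<otimes> g u)"
      unfolding W_def
    proof (rule finsum_reindex[OF _ inj], rule Pi_I)
      fix w assume "w \<in> g ` (Y \<times> Z)"
      then obtain x z where w: "w = g (x, z)" "x \<in> Y" "z \<in> Z" by auto
      then show "h w y [^] p ^ Suc e \<otimes> w \<in> carrier R"
        unfolding w(1) hg[OF w(2,3)] using cl by (simp add: g_def)
    qed
    also have "\<dots> = (\<Oplus>u\<in>Y \<times> Z. case u of (x, z) \<Rightarrow> (d z (c x y) [^] p \<otimes> z) [^] q \<otimes> x)"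
    proof (rule finsum_cong'[OF refl])
      fix u assume "u \<in> Y \<times> Z"
      then obtain x z where u: "u = (x, z)" "x \<in> Y" "z \<in> Z" by auto
      note c = cl[OF u(2,3)]
      show "h (g u) y [^] p ^ Suc e \<otimes> g u = (case u of (x, z) \<Rightarrow> (d z (c x y) [^] p \<otimes> z) [^] q \<otimes> x)"
        unfolding u(1) hg[OF u(2,3)] pw[OF c(4)] using c by (simp add: g_def nat_pow_distrib m_ac)
    qed (use cl in auto)
    also have "\<dots> = (\<Oplus>x\<in>Y. \<Oplus>z\<in>Z. (d z (c x y) [^] p \<otimes> z) [^] q \<otimes> x)"
      by (rule finsum_Sigma[symmetric]) (use cl YD ZD in auto)
    also have "\<dots> = (\<Oplus>x\<in>Y. c x y [^] q \<otimes> x)"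
    proof (rule finsum_cong'[OF refl])
      fix x assume x: "x \<in> Y"
      then have cx: "c x y \<in> carrier R" and xc: "x \<in> carrier R" using YD y by auto
      have "(\<Oplus>z\<in>Z. (d z (c x y) [^] p \<otimes> z) [^] q \<otimes> x) = (\<Oplus>z\<in>Z. (d z (c x y) [^] p \<otimes> z) [^] q) \<otimes> x"
        by (rule finsum_ldistr[symmetric]) (use ZD cl[OF x] xc in auto)
      also have "(\<Oplus>z\<in>Z. (d z (c x y) [^] p \<otimes> z) [^] q) = (\<Oplus>z\<in>Z. d z (c x y) [^] p \<otimes> z) [^] q"
        unfolding q_def by (rule frobenius_finsum[OF p, symmetric]) (use ZD cl[OF x] in auto)
      also have "(\<Oplus>z\<in>Z. d z (c x y) [^] p \<otimes> z) = c x y" using ZD cx by auto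
      finally show "(\<Oplus>z\<in>Z. (d z (c x y) [^] p \<otimes> z) [^] q \<otimes> x) = c x y [^] q \<otimes> x" .
    qed (use YD y in auto)
    also have "\<dots> = y" using YD y by auto
    finally show "y = (\<Oplus>w\<in>W. h w y [^] p ^ Suc e \<otimes> w)" by simp
  next
    fix w w' assume "w \<in> W" "w' \<in> W"
    then obtain u u' where u: "u \<in> Y \<times> Z" "u' \<in> Y \<times> Z" "w = g u" "w' = g u'" by (auto simp: W_def)
    obtain x z x' z' where e: "u = (x, z)" "u' = (x', z')" by (cases u, cases u') auto
    have "h w w' = (if u = u' then \<one> else \<zero>)" using val[of x z x' z'] u e by (simp add: hg)
    moreover have "w = w' \<longleftrightarrow> u = u'" using inj u by (auto dest: inj_onD)
    ultimately show "h w w' = (if w = w' then \<one> else \<zero>)" by simp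
  qed
  moreover have "card W = card Y * card Z"
    unfolding W_def by (simp add: card_image[OF inj] card_cartesian_product)
  ultimately show ?thesis by blast
qed

lemma root_basis_power:
  assumes p: "Factorial_Ring.prime p" "[p] \<cdot>\<^bsub>R\<^esub> \<one> = \<zero>" and Z: "root_basis R p Z d"
  shows "\<exists>W h. root_basis R (p ^ e) W h \<and> card W = card Z ^ e"
proof (induction e)
  case 0
  have "root_basis R (p ^ 0) {\<one>} (\<lambda>_ y. y)"
    unfolding root_basis_def by (simp add: finsum_insert nat_pow_eone)
  then show ?case by (intro exI[of _ "{\<one>}"] exI[of _ "\<lambda>_ y. y"] conjI) simp_all
next
  case (Suc e)
  then obtain W h where "root_basis R (p ^ e) W h" "card W = card Z ^ e" by blast
  then obtain W' h' where "root_basis R (p ^ Suc e) W' h'" "card W' = card W * card Z"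
    using root_basis_mult[OF p _ Z] by blast
  then show ?case using \<open>card W = card Z ^ e\<close> by (intro exI[of _ W'] exI[of _ h']) simp
qed

lemma combine_eq_finsum:
  assumes "length Ks = length Us" "set Ks \<subseteq> carrier R" "set Us \<subseteq> carrier R"
  shows "combine Ks Us = (\<Oplus>i\<in>{..<length Us}. Ks ! i \<otimes> Us ! i)"
  using assms
proof (induction Ks Us rule: list_induct2)
  case (Cons k Ks u Us)
  have cl: "Ks ! i \<otimes> Us ! i \<in> carrier R" if "i < length Us" for i
    using Cons that by (metis list.set_intros(2) m_closed nth_mem subsetD)
  have "(\<Oplus>i\<in>{..<Suc (length Us)}. (k # Ks) ! i \<otimes> (u # Us) ! i)
    = (\<Oplus>i\<in>insert 0 (Suc ` {..<length Us}). (k # Ks) ! i \<otimes> (u # Us) ! i)"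
    by (simp add: lessThan_Suc_eq_insert_0)
  also have "\<dots> = k \<otimes> u \<oplus> (\<Oplus>i\<in>Suc ` {..<length Us}. (k # Ks) ! i \<otimes> (u # Us) ! i)"
    using Cons cl by (subst finsum_insert) auto
  also have "(\<Oplus>i\<in>Suc ` {..<length Us}. (k # Ks) ! i \<otimes> (u # Us) ! i) = (\<Oplus>i\<in>{..<length Us}. Ks ! i \<otimes> Us ! i)"
    using cl by (subst finsum_reindex) auto
  finally show ?case using Cons by simp
qed simp

text \<open>The p-th power map is a ring endomorphism of a field, hence injective, and its image is
  a subfield.\<close>

lemma pth_powers_subfield:
  assumes p: "Factorial_Ring.prime p" "[p] \<cdot>\<^bsub>R\<^esub> \<one> = \<zero>"
  shows "subfield (pth_powers p R) R" "inj_on (\<lambda>x. x [^] p) (carrier R)"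
proof -
  have p0: "p > 0" using p(1) by (simp add: prime_gt_0_nat)
  interpret h: ring_hom_ring R R "\<lambda>x. x [^] p"
    by (rule ring_hom_ringI) (use ring_axioms frobenius_add[OF p] nat_pow_distrib in auto)
  show "subfield (pth_powers p R) R"
    using h.img_is_subfield(2)[OF carrier_is_subfield] one_not_zero by (simp add: pth_powers_def)
  show "inj_on (\<lambda>x. x [^] p) (carrier R)"
    using h.img_is_subfield(1)[OF carrier_is_subfield] one_not_zero by simp
qed

text \<open>Coordinates are chosen arbitrarily from the existence of expansions. Additivity and
  semilinearity then follow from uniqueness, which combines linear independence with injectivity of
  the p-th power map.\<close>

lemma root_basis_exists:
  assumes p: "Factorial_Ring.prime p" "[p] \<cdot>\<^bsub>R\<^esub> \<one> = \<zero>"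
    and fd: "finite_dimension (pth_powers p R) (carrier R)"
  shows "\<exists>Z d. root_basis R p Z d \<and> card Z = dim (pth_powers p R) (carrier R)"
proof -
  note sf = pth_powers_subfield[OF p]
  let ?K = "pth_powers p R"
  have dm: "dimension (dim ?K (carrier R)) ?K (carrier R)"
    using finite_dimensionE[OF sf(1) fd] by (simp add: over_def)
  obtain Us where Us: "set Us \<subseteq> carrier R" "independent ?K Us" "length Us = dim ?K (carrier R)" "Span ?K Us = carrier R"
    using exists_base[OF sf(1) dm] by blast
  have dist: "distinct Us" using independent_distinct[OF sf(1) Us(2)] .
  have Kc: "?K \<subseteq> carrier R" by (auto simp: pth_powers_def)
  define rt where "rt y = the_inv_into (carrier R) (\<lambda>x. x [^] p) y" for y
  have rt: "rt y \<in> carrier R" "rt y [^] p = y" if "y \<in> ?K" for y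
    using that the_inv_into_into[OF sf(2), of y "carrier R"] f_the_inv_into_f[OF sf(2), of y]
    by (auto simp: rt_def pth_powers_def)
  let ?n = "length Us"
  have Uc: "Us ! i \<in> carrier R" if "i < ?n" for i using Us(1) that nth_mem by blast
  have ex: "\<exists>f. (\<forall>i<?n. f i \<in> carrier R) \<and> y = (\<Oplus>i\<in>{..<?n}. f i [^] p \<otimes> Us ! i)" if y: "y \<in> carrier R" for y
  proof -
    obtain Ks where Ks: "set Ks \<subseteq> ?K" "length Ks = ?n" "y = combine Ks Us"
      using Span_mem_iff_length_version[OF sf(1) Us(1), of y] y Us(4) by auto
    have Ki: "Ks ! i \<in> ?K" if "i < ?n" for i using that Ks by (metis nth_mem subsetD)
    have Kss: "set Ks \<subseteq> carrier R" using Ks(1) Kc by blast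
    have Ki': "Ks ! i \<in> carrier R" if "i < ?n" for i using Ki[OF that] Kc by blast
    have "y = (\<Oplus>i\<in>{..<?n}. Ks ! i \<otimes> Us ! i)"
      using combine_eq_finsum[OF Ks(2) Kss Us(1)] Ks(3) by simp
    also have "\<dots> = (\<Oplus>i\<in>{..<?n}. rt (Ks ! i) [^] p \<otimes> Us ! i)"
      by (rule finsum_cong'[OF refl]) (use rt Ki Ki' Uc in auto)
    finally show ?thesis using rt Ki by (intro exI[of _ "\<lambda>i. rt (Ks ! i)"]) auto
  qed
  have p0: "p > 0" using p(1) by (simp add: prime_gt_0_nat)
  have zero: "f i = \<zero>" if f: "\<And>i. i < ?n \<Longrightarrow> f i \<in> carrier R" and s: "(\<Oplus>i\<in>{..<?n}. f i [^] p \<otimes> Us ! i) = \<zero>" and i: "i < ?n" for f i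
  proof -
    define Ks where "Ks = map (\<lambda>i. f i [^] p) [0..<?n]"
    have len: "length Ks = length Us" by (simp add: Ks_def)
    have sub: "set Ks \<subseteq> ?K" using f by (auto simp: Ks_def pth_powers_def)
    have Kss: "set Ks \<subseteq> carrier R" using sub Kc by blast
    have "combine Ks Us = (\<Oplus>i\<in>{..<?n}. Ks ! i \<otimes> Us ! i)"
      by (rule combine_eq_finsum[OF len Kss Us(1)])
    also have "\<dots> = (\<Oplus>i\<in>{..<?n}. f i [^] p \<otimes> Us ! i)"
      by (rule finsum_cong'[OF refl]) (use f Uc in \<open>auto simp: Ks_def\<close>)
    finally have "combine Ks Us = \<zero>" using s by simp
    then have "set (take ?n Ks) \<subseteq> {\<zero>}"
      by (rule independent_imp_trivial_combine[OF sf(1) Us(2) sub])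
    moreover have "Ks ! i \<in> set (take ?n Ks)" using len i by simp
    ultimately have "Ks ! i \<in> {\<zero>}" by blast
    then have "f i [^] p = \<zero>" using i by (simp add: Ks_def)
    then have "f i [^] p = \<zero> [^] p" using p0 by (simp add: nat_pow_zero)
    then show ?thesis using sf(2) f[OF i] by (auto dest: inj_onD)
  qed
  \<comment> \<open>As p-th powers are additive, subtracting two equal expansions gives an expansion
    of zero whose roots are the differences.\<close>
  have uniq: "f i = g i" if f: "\<And>i. i < ?n \<Longrightarrow> f i \<in> carrier R" and g: "\<And>i. i < ?n \<Longrightarrow> g i \<in> carrier R"
    and s: "(\<Oplus>i\<in>{..<?n}. f i [^] p \<otimes> Us ! i) = (\<Oplus>i\<in>{..<?n}. g i [^] p \<otimes> Us ! i)" and i: "i < ?n" for f g i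
  proof -
    let ?h = "\<lambda>i. f i \<ominus> g i"
    have "(\<Oplus>i\<in>{..<?n}. ?h i [^] p \<otimes> Us ! i) \<oplus> (\<Oplus>i\<in>{..<?n}. g i [^] p \<otimes> Us ! i) = (\<Oplus>i\<in>{..<?n}. ?h i [^] p \<otimes> Us ! i \<oplus> g i [^] p \<otimes> Us ! i)"
      by (rule finsum_addf[symmetric]) (use f g Uc in auto)
    also have "\<dots> = (\<Oplus>i\<in>{..<?n}. f i [^] p \<otimes> Us ! i)"
    proof (rule finsum_cong'[OF refl])
      fix i assume "i \<in> {..<?n}"
      then have c: "f i \<in> carrier R" "g i \<in> carrier R" "Us ! i \<in> carrier R" using f g Uc by auto
      have "f i = ?h i \<oplus> g i" using c by (simp add: a_minus_def a_assoc l_neg)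
      then have "f i [^] p = ?h i [^] p \<oplus> g i [^] p" using frobenius_add[OF p, of "?h i" "g i"] c by simp
      then show "?h i [^] p \<otimes> Us ! i \<oplus> g i [^] p \<otimes> Us ! i = f i [^] p \<otimes> Us ! i"
        using c by (simp add: l_distr)
    qed (use f Uc in auto)
    also have "\<dots> = (\<Oplus>i\<in>{..<?n}. g i [^] p \<otimes> Us ! i)" by (rule s)
    finally have "(\<Oplus>i\<in>{..<?n}. ?h i [^] p \<otimes> Us ! i) \<oplus> (\<Oplus>i\<in>{..<?n}. g i [^] p \<otimes> Us ! i) = (\<Oplus>i\<in>{..<?n}. g i [^] p \<otimes> Us ! i)" .
    moreover have c: "(\<Oplus>i\<in>{..<?n}. ?h i [^] p \<otimes> Us ! i) \<in> carrier R" "(\<Oplus>i\<in>{..<?n}. g i [^] p \<otimes> Us ! i) \<in> carrier R"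
      by (rule finsum_closed, use f g Uc in auto)+
    moreover have "x = \<zero>" if "x \<oplus> y = y" "x \<in> carrier R" "y \<in> carrier R" for x y
    proof -
      have "x = (x \<oplus> y) \<ominus> y" using that(2,3) by (simp add: a_minus_def a_assoc r_neg)
      then show ?thesis using that by (simp add: a_minus_def r_neg)
    qed
    ultimately have e: "(\<Oplus>i\<in>{..<?n}. ?h i [^] p \<otimes> Us ! i) = \<zero>" by blast
    have "?h i = \<zero>" by (rule zero[OF _ e i]) (use f g in auto)
    then show ?thesis using f[OF i] g[OF i] by simp
  qed
  obtain C where C: "\<And>y i. y \<in> carrier R \<Longrightarrow> i < ?n \<Longrightarrow> C y i \<in> carrier R"
    "\<And>y. y \<in> carrier R \<Longrightarrow> y = (\<Oplus>i\<in>{..<?n}. C y i [^] p \<otimes> Us ! i)"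
    using ex by metis
  define ix where "ix x = (THE i. i < ?n \<and> Us ! i = x)" for x
  have ix: "ix (Us ! i) = i" if "i < ?n" for i
    unfolding ix_def using that dist by (auto simp: nth_eq_iff_index_eq)
  define d where "d x y = C y (ix x)" for x y
  have dU: "d (Us ! i) y = C y i" if "i < ?n" for i y using ix that by (simp add: d_def)
  have bij: "bij_betw (\<lambda>i. Us ! i) {..<?n} (set Us)" by (rule bij_betw_nth[OF dist refl refl])
  have mem: "\<exists>i<?n. x = Us ! i" if "x \<in> set Us" for x using that by (metis in_set_conv_nth)
  have dC: "d x y \<in> carrier R" if *: "x \<in> set Us" "y \<in> carrier R" for x y
  proof -
    obtain i where i: "i < ?n" "x = Us ! i" using mem * by blast
    then show ?thesis using C(1)[OF *(2) i(1)] dU by simp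
  qed
  have "root_basis R p (set Us) d"
    unfolding root_basis_def
  proof (intro conjI ballI)
    fix x y assume "x \<in> set Us" "y \<in> carrier R"
    then show "d x y \<in> carrier R" by (rule dC)
  next
    fix x y z assume *: "x \<in> set Us" "y \<in> carrier R" "z \<in> carrier R"
    then obtain i where i: "i < ?n" "x = Us ! i" using mem by blast
    have "C (y \<oplus> z) i = C y i \<oplus> C z i"
    proof (rule uniq[OF _ _ _ i(1)])
      have "(\<Oplus>i\<in>{..<?n}. (C y i \<oplus> C z i) [^] p \<otimes> Us ! i) = (\<Oplus>i\<in>{..<?n}. C y i [^] p \<otimes> Us ! i \<oplus> C z i [^] p \<otimes> Us ! i)"
        by (rule finsum_cong'[OF refl]) (use C(1) * Uc frobenius_add[OF p] in \<open>auto simp: l_distr\<close>)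
      also have "\<dots> = (\<Oplus>i\<in>{..<?n}. C y i [^] p \<otimes> Us ! i) \<oplus> (\<Oplus>i\<in>{..<?n}. C z i [^] p \<otimes> Us ! i)"
        by (rule finsum_addf) (use C(1) * Uc in auto)
      also have "\<dots> = y \<oplus> z" by (simp only: C(2)[OF *(2), symmetric] C(2)[OF *(3), symmetric])
      also have "\<dots> = (\<Oplus>i\<in>{..<?n}. C (y \<oplus> z) i [^] p \<otimes> Us ! i)" by (rule C(2)) (use * in simp)
      finally show "(\<Oplus>i\<in>{..<?n}. C (y \<oplus> z) i [^] p \<otimes> Us ! i) = (\<Oplus>i\<in>{..<?n}. (C y i \<oplus> C z i) [^] p \<otimes> Us ! i)" by simp
    qed (use C(1) * in auto)
    then show "d x (y \<oplus> z) = d x y \<oplus> d x z" using i dU by simp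
  next
    fix x y l assume *: "x \<in> set Us" "y \<in> carrier R" "l \<in> carrier R"
    then obtain i where i: "i < ?n" "x = Us ! i" using mem by blast
    have "C (l [^] p \<otimes> y) i = l \<otimes> C y i"
    proof (rule uniq[OF _ _ _ i(1)])
      have "(\<Oplus>i\<in>{..<?n}. (l \<otimes> C y i) [^] p \<otimes> Us ! i) = (\<Oplus>i\<in>{..<?n}. l [^] p \<otimes> (C y i [^] p \<otimes> Us ! i))"
        by (rule finsum_cong'[OF refl]) (use C(1) * Uc in \<open>auto simp: nat_pow_distrib m_assoc\<close>)
      also have "\<dots> = l [^] p \<otimes> (\<Oplus>i\<in>{..<?n}. C y i [^] p \<otimes> Us ! i)"
        by (rule finsum_rdistr[symmetric]) (use C(1) * Uc in auto)
      also have "\<dots> = l [^] p \<otimes> y" by (simp only: C(2)[OF *(2), symmetric])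
      also have "\<dots> = (\<Oplus>i\<in>{..<?n}. C (l [^] p \<otimes> y) i [^] p \<otimes> Us ! i)" by (rule C(2)) (use * in simp)
      finally show "(\<Oplus>i\<in>{..<?n}. C (l [^] p \<otimes> y) i [^] p \<otimes> Us ! i) = (\<Oplus>i\<in>{..<?n}. (l \<otimes> C y i) [^] p \<otimes> Us ! i)" by simp
    qed (use C(1) * in auto)
    then show "d x (l [^] p \<otimes> y) = l \<otimes> d x y" using i dU by simp
  next
    fix y assume y: "y \<in> carrier R"
    have "(\<Oplus>i\<in>{..<?n}. C y i [^] p \<otimes> Us ! i) = (\<Oplus>x\<in>set Us. d x y [^] p \<otimes> x)"
      by (rule finsum_bij[OF bij]) (use dC Us(1) y dU in auto)
    with C(2)[OF y] show "y = (\<Oplus>x\<in>set Us. d x y [^] p \<otimes> x)" by (rule trans)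
  next
    fix x x' assume "x \<in> set Us" "x' \<in> set Us"
    then obtain i j where ij: "i < ?n" "x = Us ! i" "j < ?n" "x' = Us ! j" using mem by blast
    have "C (Us ! j) i = (if i = j then \<one> else \<zero>)"
    proof (rule uniq[OF _ _ _ ij(1)])
      have "(\<Oplus>i\<in>{..<?n}. (if i = j then \<one> else \<zero>) [^] p \<otimes> Us ! i) = (if j = j then \<one> else \<zero>) [^] p \<otimes> Us ! j"
        by (rule finsum_single) (use ij Uc p0 in \<open>auto simp: nat_pow_zero\<close>)
      also have "\<dots> = Us ! j" using Uc ij by simp
      also have "\<dots> = (\<Oplus>i\<in>{..<?n}. C (Us ! j) i [^] p \<otimes> Us ! i)" by (rule C(2)[OF Uc[OF ij(3)]])
      finally show "(\<Oplus>i\<in>{..<?n}. C (Us ! j) i [^] p \<otimes> Us ! i) = (\<Oplus>i\<in>{..<?n}. (if i = j then \<one> else \<zero>) [^] p \<otimes> Us ! i)" by simp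
    qed (use C(1) Uc ij in auto)
    moreover have "x = x' \<longleftrightarrow> i = j" using ij dist by (simp add: nth_eq_iff_index_eq)
    ultimately show "d x x' = (if x = x' then \<one> else \<zero>)" using ij dU by simp
  qed (use Us(1) in auto)
  moreover have "card (set Us) = dim ?K (carrier R)" using dist Us(3) by (simp add: distinct_card)
  ultimately show ?thesis by blast
qed

end

section \<open>Free summands of Frobenius modules\<close>

text \<open>A free summand described by a splitting: \<open>e\<close> is the image of the standard
  basis, and the \<open>\<phi>\<close> are coordinate forms, linear for the action of a as
  multiplication by \<open>a^q\<close>. Only ring elements occur and no complement module, so the
  notion passes easily along ring isomorphisms.\<close>

definition frob_dual :: "('a, 'r) ring_scheme \<Rightarrow> nat \<Rightarrow> nat \<Rightarrow> bool" where
  "frob_dual A q n \<longleftrightarrow> (\<exists>e \<phi>. (\<forall>i<n. e i \<in> carrier A) \<and> (\<forall>i<n. \<forall>x\<in>carrier A. \<phi> i x \<in> carrier A) \<and>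
    (\<forall>i<n. \<forall>x\<in>carrier A. \<forall>y\<in>carrier A. \<phi> i (x \<oplus>\<^bsub>A\<^esub> y) = \<phi> i x \<oplus>\<^bsub>A\<^esub> \<phi> i y) \<and>
    (\<forall>i<n. \<forall>a\<in>carrier A. \<forall>x\<in>carrier A. \<phi> i (a [^]\<^bsub>A\<^esub> q \<otimes>\<^bsub>A\<^esub> x) = a \<otimes>\<^bsub>A\<^esub> \<phi> i x) \<and>
    (\<forall>i<n. \<forall>j<n. \<phi> i (e j) = (if i = j then \<one>\<^bsub>A\<^esub> else \<zero>\<^bsub>A\<^esub>)))"

lemma frob_simps [simp]:
  "carrier (frobenius_module p k A) = carrier A" "zero (frobenius_module p k A) = \<zero>\<^bsub>A\<^esub>"
  "add (frobenius_module p k A) = add A"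
  "smult (frobenius_module p k A) a x = a [^]\<^bsub>A\<^esub> (p ^ k) \<otimes>\<^bsub>A\<^esub> x"
  by (simp_all add: frobenius_module_def)

lemma finsum_frobenius_module: "finsum (frobenius_module p k A) = finsum A"
  by (intro ext) (simp add: finsum_def finprod_def)

lemma free_simps [simp]:
  "carrier (free_module A n) = {..<n} \<rightarrow>\<^sub>E carrier A" "zero (free_module A n) = (\<lambda>i\<in>{..<n}. \<zero>\<^bsub>A\<^esub>)"
  "add (free_module A n) x y = (\<lambda>i\<in>{..<n}. x i \<oplus>\<^bsub>A\<^esub> y i)"
  "smult (free_module A n) a x = (\<lambda>i\<in>{..<n}. a \<otimes>\<^bsub>A\<^esub> x i)"
  by (simp_all add: free_module_def)

lemma sum_simps [simp]:
  "carrier (module_sum M N) = carrier M \<times> carrier N" "zero (module_sum M N) = (\<zero>\<^bsub>M\<^esub>, \<zero>\<^bsub>N\<^esub>)"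
  "add (module_sum M N) x y = (fst x \<oplus>\<^bsub>M\<^esub> fst y, snd x \<oplus>\<^bsub>N\<^esub> snd y)"
  "smult (module_sum M N) a x = (a \<odot>\<^bsub>M\<^esub> fst x, a \<odot>\<^bsub>N\<^esub> snd x)"
  by (simp_all add: module_sum_def)

context cring
begin

lemma free_summand_imp_dual:
  assumes "has_free_summand R (frobenius_module p k R) n"
  shows "frob_dual R (p ^ k) n"
proof -
  let ?q = "p ^ k"
  obtain N :: "('a, 'a) module" where N: "module R N"
    and iso: "module_isomorphic R (frobenius_module p k R) (module_sum (free_module R n) N)"
    using assms unfolding has_free_summand_def by blast
  interpret N: module R N by fact
  obtain h where h: "bij_betw h (carrier R) (({..<n} \<rightarrow>\<^sub>E carrier R) \<times> carrier N)"
    and add: "\<And>x y. x \<in> carrier R \<Longrightarrow> y \<in> carrier R \<Longrightarrow>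
      h (x \<oplus> y) = ((\<lambda>i\<in>{..<n}. fst (h x) i \<oplus> fst (h y) i), snd (h x) \<oplus>\<^bsub>N\<^esub> snd (h y))"
    and smult: "\<And>a x. a \<in> carrier R \<Longrightarrow> x \<in> carrier R \<Longrightarrow>
      h (a [^] ?q \<otimes> x) = ((\<lambda>i\<in>{..<n}. a \<otimes> fst (h x) i), a \<odot>\<^bsub>N\<^esub> snd (h x))"
  proof -
    obtain h where "bij_betw h (carrier R) (({..<n} \<rightarrow>\<^sub>E carrier R) \<times> carrier N)"
      "\<forall>x\<in>carrier R. \<forall>y\<in>carrier R. h (x \<oplus> y) = h x \<oplus>\<^bsub>module_sum (free_module R n) N\<^esub> h y"
      "\<forall>a\<in>carrier R. \<forall>x\<in>carrier R. h (a [^] ?q \<otimes> x) = a \<odot>\<^bsub>module_sum (free_module R n) N\<^esub> h x"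
      using iso unfolding module_isomorphic_def frob_simps sum_simps(1) free_simps(1) by blast
    then show thesis by (intro that[of h]) simp_all
  qed
  define u where "u j = ((\<lambda>i\<in>{..<n}. if i = j then \<one> else \<zero>), \<zero>\<^bsub>N\<^esub>)" for j
  have u: "u j \<in> ({..<n} \<rightarrow>\<^sub>E carrier R) \<times> carrier N" for j by (auto simp: u_def)
  define e where "e j = inv_into (carrier R) h (u j)" for j
  have e: "e j \<in> carrier R" "h (e j) = u j" for j
  proof -
    have "u j \<in> h ` carrier R" unfolding bij_betw_imp_surj_on[OF h] by (rule u)
    then show "e j \<in> carrier R" "h (e j) = u j"
      unfolding e_def by (rule inv_into_into, rule f_inv_into_f)
  qed
  have hc: "fst (h x) i \<in> carrier R" if "x \<in> carrier R" "i < n" for x i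
  proof -
    have "h x \<in> ({..<n} \<rightarrow>\<^sub>E carrier R) \<times> carrier N" by (rule bij_betw_apply[OF h that(1)])
    then have f: "fst (h x) \<in> {..<n} \<rightarrow>\<^sub>E carrier R" by (simp only: mem_Times_iff)
    show ?thesis by (rule PiE_mem[OF f]) (use that in simp)
  qed
  show ?thesis
    unfolding frob_dual_def
  proof (rule exI[of _ e], rule exI[of _ "\<lambda>i x. fst (h x) i"], intro conjI allI impI ballI)
    fix i j assume "i < n"
    then show "fst (h (e j)) i = (if i = j then \<one> else \<zero>)" by (simp only: e(2) u_def fst_conv restrict_apply' lessThan_iff)
  next
    fix i x y assume *: "i < n" "x \<in> carrier R" "y \<in> carrier R"
    show "fst (h (x \<oplus> y)) i = fst (h x) i \<oplus> fst (h y) i" unfolding add[OF *(2,3)] using *(1) by simp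
  next
    fix i a x assume *: "i < n" "a \<in> carrier R" "x \<in> carrier R"
    show "fst (h (a [^] ?q \<otimes> x)) i = a \<otimes> fst (h x) i" unfolding smult[OF *(2,3)] using *(1) by simp
  qed (rule e(1), rule hc)
qed

text \<open>The complement is the common kernel of the forms, and x splits as s (\<Phi> x) plus an
  element of this kernel. Additivity of q-th powers is what makes the kernel a module and s
  additive.\<close>

lemma dual_imp_free_summand:
  assumes p: "Factorial_Ring.prime p" "[p] \<cdot>\<^bsub>R\<^esub> \<one> = \<zero>" and dual: "frob_dual R (p ^ k) n"
  shows "has_free_summand R (frobenius_module p k R) n"
proof -
  define q where "q = p ^ k"
  obtain e \<phi> where D: "\<forall>i<n. e i \<in> carrier R" "\<forall>i<n. \<forall>x\<in>carrier R. \<phi> i x \<in> carrier R"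
    "\<forall>i<n. \<forall>x\<in>carrier R. \<forall>y\<in>carrier R. \<phi> i (x \<oplus> y) = \<phi> i x \<oplus> \<phi> i y"
    "\<forall>i<n. \<forall>a\<in>carrier R. \<forall>x\<in>carrier R. \<phi> i (a [^] q \<otimes> x) = a \<otimes> \<phi> i x"
    "\<forall>i<n. \<forall>j<n. \<phi> i (e j) = (if i = j then \<one> else \<zero>)"
    using dual unfolding frob_dual_def q_def[symmetric] by (elim exE conjE) (rule that; assumption)
  have e: "\<And>i. i < n \<Longrightarrow> e i \<in> carrier R"
    and \<phi>: "\<And>i x. i < n \<Longrightarrow> x \<in> carrier R \<Longrightarrow> \<phi> i x \<in> carrier R"
    and add: "\<And>i x y. i < n \<Longrightarrow> x \<in> carrier R \<Longrightarrow> y \<in> carrier R \<Longrightarrow> \<phi> i (x \<oplus> y) = \<phi> i x \<oplus> \<phi> i y"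
    and sm: "\<And>i a x. i < n \<Longrightarrow> a \<in> carrier R \<Longrightarrow> x \<in> carrier R \<Longrightarrow> \<phi> i (a [^] q \<otimes> x) = a \<otimes> \<phi> i x"
    and dl: "\<And>i j. i < n \<Longrightarrow> j < n \<Longrightarrow> \<phi> i (e j) = (if i = j then \<one> else \<zero>)"
    using D by blast+
  have qadd: "(a \<oplus> b) [^] q = a [^] q \<oplus> b [^] q" if "a \<in> carrier R" "b \<in> carrier R" for a b
    using frobenius_add_iter[OF p that] by (simp add: q_def)
  have q0: "\<zero> [^] q = \<zero>" using p(1) by (simp add: q_def nat_pow_zero prime_gt_0_nat)
  have \<phi>0: "\<phi> i \<zero> = \<zero>" if "i < n" for i
  proof -
    have "\<phi> i (\<zero> [^] q \<otimes> \<zero>) = \<zero> \<otimes> \<phi> i \<zero>" by (rule sm[OF that]) auto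
    then show ?thesis using \<phi>[OF that, of \<zero>] by simp
  qed
  have \<phi>neg: "\<phi> i (\<ominus> x) = \<ominus> \<phi> i x" if "i < n" "x \<in> carrier R" for i x
  proof -
    have "\<phi> i (\<ominus> x) \<oplus> \<phi> i x = \<zero>" using add[OF that(1), of "\<ominus> x" x] that \<phi>0 by (simp add: l_neg)
    then show ?thesis using minus_equality[of "\<phi> i (\<ominus> x)" "\<phi> i x"] \<phi> that by simp
  qed
  define C where "C = {x \<in> carrier R. \<forall>i<n. \<phi> i x = \<zero>}"
  define N where "N = (frobenius_module p k R)\<lparr>carrier := C\<rparr>"
  have Ns: "carrier N = C" "\<And>x y. x \<oplus>\<^bsub>N\<^esub> y = x \<oplus> y" "\<zero>\<^bsub>N\<^esub> = \<zero>" "\<And>a x. a \<odot>\<^bsub>N\<^esub> x = a [^] q \<otimes> x"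
    by (simp_all add: N_def q_def frobenius_module_def)
  have C: "x \<in> C \<Longrightarrow> x \<in> carrier R" for x by (simp add: C_def)
  have Cadd: "x \<oplus> y \<in> C" if "x \<in> C" "y \<in> C" for x y using that by (simp add: C_def add)
  have Csm: "a [^] q \<otimes> x \<in> C" if "a \<in> carrier R" "x \<in> C" for a x using that by (simp add: C_def sm)
  have Cneg: "\<ominus> x \<in> C" if "x \<in> C" for x using that by (simp add: C_def \<phi>neg)
  have C0: "\<zero> \<in> C" by (simp add: C_def \<phi>0)
  have modN: "module R N"
  proof (rule moduleI)
    show "abelian_group N"
    proof (rule abelian_groupI, unfold Ns)
      fix x assume x: "x \<in> C"
      show "\<exists>y\<in>C. y \<oplus> x = \<zero>" using l_neg[OF C[OF x]] Cneg[OF x] by blast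
      show "\<zero> \<oplus> x = x" by (rule l_zero[OF C[OF x]])
      fix y assume y: "y \<in> C"
      show "x \<oplus> y = y \<oplus> x" by (rule a_comm[OF C[OF x] C[OF y]])
      fix z assume z: "z \<in> C"
      show "x \<oplus> y \<oplus> z = x \<oplus> (y \<oplus> z)" by (rule a_assoc[OF C[OF x] C[OF y] C[OF z]])
    qed (rule Cadd C0; assumption)+
  next
    fix a b x assume "a \<in> carrier R" "b \<in> carrier R" "x \<in> carrier N"
    then have *: "a \<in> carrier R" "b \<in> carrier R" "x \<in> C" "x \<in> carrier R" by (simp_all only: Ns C)
    show "(a \<oplus> b) \<odot>\<^bsub>N\<^esub> x = a \<odot>\<^bsub>N\<^esub> x \<oplus>\<^bsub>N\<^esub> b \<odot>\<^bsub>N\<^esub> x"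
      unfolding Ns using * by (simp add: qadd l_distr)
    show "(a \<otimes> b) \<odot>\<^bsub>N\<^esub> x = a \<odot>\<^bsub>N\<^esub> (b \<odot>\<^bsub>N\<^esub> x)"
      unfolding Ns using * by (simp add: nat_pow_distrib m_assoc)
  next
    fix a x assume "a \<in> carrier R" "x \<in> carrier N"
    then show "a \<odot>\<^bsub>N\<^esub> x \<in> carrier N" unfolding Ns by (rule Csm)
  next
    fix x assume "x \<in> carrier N"
    then show "\<one> \<odot>\<^bsub>N\<^esub> x = x" unfolding Ns using C[of x] by simp
  next
    fix a x y assume "a \<in> carrier R" "x \<in> carrier N" "y \<in> carrier N"
    then have *: "a \<in> carrier R" "x \<in> carrier R" "y \<in> carrier R" by (simp_all only: Ns C)
    show "a \<odot>\<^bsub>N\<^esub> (x \<oplus>\<^bsub>N\<^esub> y) = a \<odot>\<^bsub>N\<^esub> x \<oplus>\<^bsub>N\<^esub> a \<odot>\<^bsub>N\<^esub> y"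
      unfolding Ns using * by (simp add: r_distr)
  qed (rule is_cring)
  define s where "s c = (\<Oplus>i\<in>{..<n}. c i [^] q \<otimes> e i)" for c
  have sc: "s c \<in> carrier R" if "\<And>i. i < n \<Longrightarrow> c i \<in> carrier R" for c
    unfolding s_def using that e by (intro finsum_closed) auto
  have fsum: "\<phi> i (\<Oplus>j\<in>A. f j) = (\<Oplus>j\<in>A. \<phi> i (f j))" if "i < n" "finite A" "\<And>j. j \<in> A \<Longrightarrow> f j \<in> carrier R" for i A and f :: "nat \<Rightarrow> 'a"
    using that(2,3)
  proof (induction A)
    case (insert x A)
    then have "f x \<in> carrier R" "f \<in> A \<rightarrow> carrier R" "(\<lambda>j. \<phi> i (f j)) \<in> A \<rightarrow> carrier R" "(\<Oplus>j\<in>A. f j) \<in> carrier R"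
      using \<phi>[OF that(1)] by (auto intro!: finsum_closed)
    then show ?case using insert add[OF that(1)] \<phi>[OF that(1)] by simp
  qed (use \<phi>0 that in auto)
  have \<phi>s: "\<phi> i (s c) = c i" if i: "i < n" and c: "\<And>i. i < n \<Longrightarrow> c i \<in> carrier R" for i c
  proof -
    have "\<phi> i (s c) = (\<Oplus>j\<in>{..<n}. \<phi> i (c j [^] q \<otimes> e j))"
      unfolding s_def using c e i by (intro fsum) auto
    also have "\<dots> = (\<Oplus>j\<in>{..<n}. if j = i then c i else \<zero>)"
      by (rule finsum_cong'[OF refl]) (use c e i in \<open>auto simp: sm dl\<close>)
    also have "\<dots> = (if i = i then c i else \<zero>)"
      by (rule finsum_single) (use i c in auto)
    finally show ?thesis by simp
  qed
  define \<Phi> where "\<Phi> x = (\<lambda>i\<in>{..<n}. \<phi> i x)" for x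
  have \<Phi>c: "\<Phi> x \<in> {..<n} \<rightarrow>\<^sub>E carrier R" if "x \<in> carrier R" for x using \<phi> that by (auto simp: \<Phi>_def)
  have s\<Phi>: "s (\<Phi> x) \<in> carrier R" if "x \<in> carrier R" for x by (rule sc) (use \<phi> that in \<open>simp add: \<Phi>_def\<close>)
  have s_add: "s (\<Phi> (x \<oplus> y)) = s (\<Phi> x) \<oplus> s (\<Phi> y)" if "x \<in> carrier R" "y \<in> carrier R" for x y
  proof -
    have "s (\<Phi> (x \<oplus> y)) = (\<Oplus>i\<in>{..<n}. \<Phi> x i [^] q \<otimes> e i \<oplus> \<Phi> y i [^] q \<otimes> e i)"
      unfolding s_def by (rule finsum_cong'[OF refl]) (use that \<phi> e in \<open>auto simp: \<Phi>_def add qadd l_distr\<close>)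
    also have "\<dots> = s (\<Phi> x) \<oplus> s (\<Phi> y)"
      unfolding s_def by (rule finsum_addf) (use that \<phi> e in \<open>auto simp: \<Phi>_def\<close>)
    finally show ?thesis .
  qed
  have s_sm: "s (\<Phi> (a [^] q \<otimes> x)) = a [^] q \<otimes> s (\<Phi> x)" if "a \<in> carrier R" "x \<in> carrier R" for a x
  proof -
    have "s (\<Phi> (a [^] q \<otimes> x)) = (\<Oplus>i\<in>{..<n}. a [^] q \<otimes> (\<Phi> x i [^] q \<otimes> e i))"
      unfolding s_def by (rule finsum_cong'[OF refl]) (use that \<phi> e in \<open>auto simp: \<Phi>_def sm nat_pow_distrib m_assoc\<close>)
    also have "\<dots> = a [^] q \<otimes> s (\<Phi> x)"
      unfolding s_def by (rule finsum_rdistr[symmetric]) (use that \<phi> e in \<open>auto simp: \<Phi>_def\<close>)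
    finally show ?thesis .
  qed
  define h where "h x = (\<Phi> x, x \<ominus> s (\<Phi> x))" for x
  have pr: "x \<ominus> s (\<Phi> x) \<in> C" if x: "x \<in> carrier R" for x
  proof -
    have "\<phi> i (x \<ominus> s (\<Phi> x)) = \<zero>" if i: "i < n" for i
    proof -
      have "\<phi> i (s (\<Phi> x)) = \<Phi> x i" by (rule \<phi>s[OF i]) (use \<phi> x in \<open>simp add: \<Phi>_def\<close>)
      then show ?thesis using add[OF i x, of "\<ominus> s (\<Phi> x)"] \<phi>neg[OF i s\<Phi>[OF x]] s\<Phi>[OF x] \<phi>[OF i x] i
        by (simp add: a_minus_def \<Phi>_def r_neg)
    qed
    then show ?thesis using x s\<Phi> by (simp add: C_def)
  qed
  have bij: "bij_betw h (carrier R) (({..<n} \<rightarrow>\<^sub>E carrier R) \<times> C)"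
  proof (rule bij_betwI[where g = "\<lambda>(c, y). s c \<oplus> y"])
    show "h \<in> carrier R \<rightarrow> ({..<n} \<rightarrow>\<^sub>E carrier R) \<times> C" using \<Phi>c pr by (simp add: h_def)
    show "(\<lambda>(c, y). s c \<oplus> y) \<in> ({..<n} \<rightarrow>\<^sub>E carrier R) \<times> C \<rightarrow> carrier R"
      using sc by (auto simp: C_def PiE_def Pi_def)
    fix x assume x: "x \<in> carrier R"
    have "s (\<Phi> x) \<oplus> (x \<ominus> s (\<Phi> x)) = x"
      using x s\<Phi>[OF x] by (simp add: a_minus_def a_lcomm r_neg)
    then show "(case h x of (c, y) \<Rightarrow> s c \<oplus> y) = x" by (simp add: h_def)
  next
    fix z assume z: "z \<in> ({..<n} \<rightarrow>\<^sub>E carrier R) \<times> C"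
    then obtain c y where cy: "z = (c, y)" "c \<in> {..<n} \<rightarrow>\<^sub>E carrier R" "y \<in> carrier R" "\<forall>i<n. \<phi> i y = \<zero>"
      by (auto simp: C_def)
    have cc: "c i \<in> carrier R" if "i < n" for i using cy(2) that by auto
    have scc: "s c \<in> carrier R" by (rule sc[OF cc])
    have "\<Phi> (s c \<oplus> y) = c"
    proof
      fix i
      show "\<Phi> (s c \<oplus> y) i = c i"
      proof (cases "i < n")
        case True
        then show ?thesis using add[OF True scc cy(3)] \<phi>s[OF True cc] cy(4) cc[OF True] by (simp add: \<Phi>_def)
      next
        case False
        then show ?thesis using cy(2) by (auto simp: \<Phi>_def PiE_def extensional_def)
      qed
    qed
    moreover have "s c \<oplus> y \<ominus> s c = y" using scc cy(3) by (simp add: a_minus_def a_ac r_neg r_neg2 r_neg1)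
    ultimately show "h (case z of (c, y) \<Rightarrow> s c \<oplus> y) = z" by (simp add: h_def cy(1))
  qed
  have "module_isomorphic R (frobenius_module p k R) (module_sum (free_module R n) N)"
    unfolding module_isomorphic_def
  proof (intro exI[of _ h] conjI ballI)
    show "bij_betw h (carrier (frobenius_module p k R)) (carrier (module_sum (free_module R n) N))"
      using bij by (simp add: Ns)
  next
    fix x y assume "x \<in> carrier (frobenius_module p k R)" "y \<in> carrier (frobenius_module p k R)"
    then have xy: "x \<in> carrier R" "y \<in> carrier R" by simp_all
    have 1: "\<Phi> (x \<oplus> y) = (\<lambda>i\<in>{..<n}. \<Phi> x i \<oplus> \<Phi> y i)" using xy by (auto simp: \<Phi>_def add)
    have 2: "(x \<oplus> y) \<ominus> s (\<Phi> (x \<oplus> y)) = (x \<ominus> s (\<Phi> x)) \<oplus> (y \<ominus> s (\<Phi> y))"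
      unfolding s_add[OF xy] using xy s\<Phi> by (simp add: a_minus_def minus_add a_ac)
    show "h (x \<oplus>\<^bsub>frobenius_module p k R\<^esub> y) = h x \<oplus>\<^bsub>module_sum (free_module R n) N\<^esub> h y"
      using 1 2 by (simp add: h_def Ns)
  next
    fix a x assume "a \<in> carrier R" "x \<in> carrier (frobenius_module p k R)"
    then have ax: "a \<in> carrier R" "x \<in> carrier R" by simp_all
    have 1: "\<Phi> (a [^] q \<otimes> x) = (\<lambda>i\<in>{..<n}. a \<otimes> \<Phi> x i)" using ax by (auto simp: \<Phi>_def sm)
    have 2: "a [^] q \<otimes> x \<ominus> s (\<Phi> (a [^] q \<otimes> x)) = a [^] q \<otimes> (x \<ominus> s (\<Phi> x))"
      unfolding s_sm[OF ax] using ax s\<Phi> by (simp add: a_minus_def r_distr r_minus)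
    show "h (a \<odot>\<^bsub>frobenius_module p k R\<^esub> x) = a \<odot>\<^bsub>module_sum (free_module R n) N\<^esub> h x"
      using 1 2 by (simp add: h_def Ns q_def[symmetric])
  qed
  then show ?thesis unfolding has_free_summand_def using modN by blast
qed

end

lemma root_basisD:
  assumes "root_basis K q Y c"
  shows "finite Y" "Y \<subseteq> carrier K" "\<And>x y. x \<in> Y \<Longrightarrow> y \<in> carrier K \<Longrightarrow> c x y \<in> carrier K"
    "\<And>x y z. x \<in> Y \<Longrightarrow> y \<in> carrier K \<Longrightarrow> z \<in> carrier K \<Longrightarrow> c x (y \<oplus>\<^bsub>K\<^esub> z) = c x y \<oplus>\<^bsub>K\<^esub> c x z"
    "\<And>x y l. x \<in> Y \<Longrightarrow> y \<in> carrier K \<Longrightarrow> l \<in> carrier K \<Longrightarrow> c x (l [^]\<^bsub>K\<^esub> q \<otimes>\<^bsub>K\<^esub> y) = l \<otimes>\<^bsub>K\<^esub> c x y"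
    "\<And>y. y \<in> carrier K \<Longrightarrow> y = (\<Oplus>\<^bsub>K\<^esub>x\<in>Y. c x y [^]\<^bsub>K\<^esub> q \<otimes>\<^bsub>K\<^esub> x)"
    "\<And>x x'. x \<in> Y \<Longrightarrow> x' \<in> Y \<Longrightarrow> c x x' = (if x = x' then \<one>\<^bsub>K\<^esub> else \<zero>\<^bsub>K\<^esub>)"
proof -
  note D = assms[unfolded root_basis_def]
  note D1 = conjunct2[OF D] note D2 = conjunct2[OF D1] note D3 = conjunct2[OF D2]
  note D4 = conjunct2[OF D3] note D5 = conjunct2[OF D4] note D6 = conjunct2[OF D5]
  show "finite Y" by (rule conjunct1[OF D])
  show "Y \<subseteq> carrier K" by (rule conjunct1[OF D1])
  show "c x y \<in> carrier K" if "x \<in> Y" "y \<in> carrier K" for x y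
    by (rule conjunct1[OF D2, rule_format, OF that])
  show "c x (y \<oplus>\<^bsub>K\<^esub> z) = c x y \<oplus>\<^bsub>K\<^esub> c x z" if "x \<in> Y" "y \<in> carrier K" "z \<in> carrier K" for x y z
    by (rule conjunct1[OF D3, rule_format, OF that])
  show "c x (l [^]\<^bsub>K\<^esub> q \<otimes>\<^bsub>K\<^esub> y) = l \<otimes>\<^bsub>K\<^esub> c x y" if "x \<in> Y" "y \<in> carrier K" "l \<in> carrier K" for x y l
    by (rule conjunct1[OF D4, rule_format, OF that])
  show "y = (\<Oplus>\<^bsub>K\<^esub>x\<in>Y. c x y [^]\<^bsub>K\<^esub> q \<otimes>\<^bsub>K\<^esub> x)" if "y \<in> carrier K" for y
    by (rule conjunct1[OF D5, rule_format, OF that])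
  show "c x x' = (if x = x' then \<one>\<^bsub>K\<^esub> else \<zero>\<^bsub>K\<^esub>)" if "x \<in> Y" "x' \<in> Y" for x x'
    by (rule D6[rule_format, OF that])
qed

section \<open>Coefficient extraction as dual forms\<close>

locale frob_series = full_series R P J for R (structure) and P :: "'i::linorder multiset set" and J +
  fixes p :: nat and e :: nat and Y :: "'a set" and c :: "'a \<Rightarrow> 'a \<Rightarrow> 'a"
  assumes p: "Factorial_Ring.prime p" and char_p: "[p] \<cdot>\<^bsub>R\<^esub> \<one> = \<zero>"
    and Y: "root_basis R (p ^ e) Y c"
begin

definition q :: nat where "q = p ^ e"

lemma q_pos: "q > 0" using p by (simp add: q_def prime_gt_0_nat)

lemmas Yr = root_basisD[OF Y, folded q_def]

lemma frob_at: "F \<in> carrier B \<Longrightarrow> (F [^]\<^bsub>B\<^esub> q) (repeat_mset q m) = F m [^] q"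
  unfolding q_def by (rule frobenius_coeff(1)[OF p char_p])

lemma frob_off: "F \<in> carrier B \<Longrightarrow> (\<And>m'. m \<noteq> repeat_mset q m') \<Longrightarrow> (F [^]\<^bsub>B\<^esub> q) m = \<zero>"
  unfolding q_def by (rule frobenius_coeff(2)[OF p char_p])

lemma zero_pow_q: "\<zero> [^] q = \<zero>"
  using q_pos by (simp add: nat_pow_zero)

lemma c_zero: "b \<in> Y \<Longrightarrow> c b \<zero> = \<zero>"
proof -
  assume b: "b \<in> Y"
  have "c b (\<zero> [^] q \<otimes> \<zero>) = \<zero> \<otimes> c b \<zero>" by (rule Yr(5)[OF b]) auto
  then show ?thesis using Yr(3)[OF b, of \<zero>] by simp
qed

lemma c_finsum:
  assumes b: "b \<in> Y" and A: "finite A" and f: "\<And>i. i \<in> A \<Longrightarrow> f i \<in> carrier R"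
  shows "c b (\<Oplus>i\<in>A. f i) = (\<Oplus>i\<in>A. c b (f i))"
  using A f
proof (induction A)
  case (insert x A)
  then have *: "f x \<in> carrier R" "f \<in> A \<rightarrow> carrier R" "(\<lambda>j. c b (f j)) \<in> A \<rightarrow> carrier R"
    using Yr(3)[OF b] by auto
  have s: "(\<Oplus>j\<in>A. f j) \<in> carrier R" by (rule finsum_closed[OF *(2)])
  show ?case
    using finsum_insert[OF insert(1,2) *(2,1)] finsum_insert[OF insert(1,2) *(3) Yr(3)[OF b *(1)]]
      Yr(4)[OF b *(1) s] insert by simp
qed (simp add: c_zero[OF b])

text \<open>Not divisible by the q-th power of a variable of the ambient power series ring. This is
  stronger than not being divisible by the q-th power of a nontrivial monomial of
  \<open>B\<close>.\<close>

definition good :: "'i multiset set" where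
  "good = {m \<in> P. \<forall>k. count m k < q}"

lemma good_unique:
  assumes "m \<in> good" "m' \<in> good" "m' = m + repeat_mset q h"
  shows "h = {#}"
proof (rule multiset_eqI)
  fix k
  have "count m' k < q" using assms(2) by (simp add: good_def)
  moreover have "q * count h k \<le> count m' k" using assms(3) by simp
  ultimately have "q * count h k < q * 1" by linarith
  then show "count h k = count {#} k" by (simp only: mult_less_cancel1) simp
qed

text \<open>Compare multiplicities after division by q: those of m are remainders and do not affect
  the quotient.\<close>

lemma good_sub: "m \<in> good \<Longrightarrow> repeat_mset q s \<subseteq># m + repeat_mset q h \<longleftrightarrow> s \<subseteq># h"
proof
  assume m: "m \<in> good" and s: "repeat_mset q s \<subseteq># m + repeat_mset q h"
  show "s \<subseteq># h"
    unfolding subseteq_mset_def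
  proof
    fix k
    have "q * count s k \<le> count m k + q * count h k"
      using s unfolding subseteq_mset_def by (metis count_repeat_mset count_union)
    also have "\<dots> < q * Suc (count h k)" using m by (simp add: good_def)
    finally show "count s k \<le> count h k" by (simp only: mult_less_cancel1 less_Suc_eq_le)
  qed
next
  assume "s \<subseteq># h"
  then show "repeat_mset q s \<subseteq># m + repeat_mset q h"
    unfolding subseteq_mset_def by (auto intro: trans_le_add2 mult_le_mono2)
qed

text \<open>The form dual to \<open>b y^m\<close>: from the coefficients at the exponents m + q h it
  takes the q-th root of the component along b.\<close>

definition proj :: "'i multiset \<Rightarrow> 'a \<Rightarrow> ('i multiset \<Rightarrow> 'a) \<Rightarrow> 'i multiset \<Rightarrow> 'a" where
  "proj m b F = (\<lambda>h. if h \<in> P then c b (F (m + repeat_mset q h)) else \<zero>)"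

lemma proj_closed: "b \<in> Y \<Longrightarrow> F \<in> carrier B \<Longrightarrow> proj m b F \<in> carrier B"
  unfolding carrier_B proj_def using Yr(3) by auto

lemma proj_add: "b \<in> Y \<Longrightarrow> F \<in> carrier B \<Longrightarrow> G \<in> carrier B \<Longrightarrow> proj m b (F \<oplus>\<^bsub>B\<^esub> G) = proj m b F \<oplus>\<^bsub>B\<^esub> proj m b G"
  by (rule ext) (simp add: proj_def Yr(4))

text \<open>The coefficients of \<open>a^q\<close> are q-th powers located at exponents q s. For
  good m the convolution at m + q h therefore runs over s contained in h, which is the convolution
  of a with the projection at h.\<close>

lemma proj_linear:
  assumes b: "b \<in> Y" and m: "m \<in> good" and a: "a \<in> carrier B" and F: "F \<in> carrier B"
  shows "proj m b (a [^]\<^bsub>B\<^esub> q \<otimes>\<^bsub>B\<^esub> F) = a \<otimes>\<^bsub>B\<^esub> proj m b F"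
proof
  fix h
  have aq: "a [^]\<^bsub>B\<^esub> q \<in> carrier B" by (rule B.nat_pow_closed[OF a])
  show "proj m b (a [^]\<^bsub>B\<^esub> q \<otimes>\<^bsub>B\<^esub> F) h = (a \<otimes>\<^bsub>B\<^esub> proj m b F) h"
  proof (cases "h \<in> P")
    case False
    have "a \<otimes>\<^bsub>B\<^esub> proj m b F \<in> carrier B" by (rule mult_closed_B[OF a proj_closed[OF b F]])
    from coeff_outside[OF this False] show ?thesis using False by (simp add: proj_def)
  next
    case True
    let ?M = "m + repeat_mset q h"
    have "(a [^]\<^bsub>B\<^esub> q \<otimes>\<^bsub>B\<^esub> F) ?M = (\<Oplus>s\<in>{s. s \<subseteq># ?M}. (a [^]\<^bsub>B\<^esub> q) s \<otimes> F (?M - s))"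
      by (rule mult_apply')
    also have "\<dots> = (\<Oplus>s\<in>repeat_mset q ` {s. s \<subseteq># h}. (a [^]\<^bsub>B\<^esub> q) s \<otimes> F (?M - s))"
    proof (rule finsum_neutral_left[symmetric])
      show "repeat_mset q ` {s. s \<subseteq># h} \<subseteq> {s. s \<subseteq># ?M}" using good_sub[OF m] by auto
      fix s assume s: "s \<in> {s. s \<subseteq># ?M} - repeat_mset q ` {s. s \<subseteq># h}"
      have "s \<noteq> repeat_mset q s'" for s' using s good_sub[OF m, of s' h] by auto
      then have "(a [^]\<^bsub>B\<^esub> q) s = \<zero>" by (rule frob_off[OF a])
      then show "(a [^]\<^bsub>B\<^esub> q) s \<otimes> F (?M - s) = \<zero>" using coeff_closed[OF F] by simp
    qed (simp_all add: coeff_closed[OF F] coeff_closed[OF aq])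
    also have "\<dots> = (\<Oplus>s\<in>{s. s \<subseteq># h}. (a [^]\<^bsub>B\<^esub> q) (repeat_mset q s) \<otimes> F (?M - repeat_mset q s))"
      by (rule finsum_reindex) (auto simp: coeff_closed[OF F] coeff_closed[OF aq] inj_on_def repeat_mset_inj[OF q_pos])
    also have "\<dots> = (\<Oplus>s\<in>{s. s \<subseteq># h}. a s [^] q \<otimes> F (m + repeat_mset q (h - s)))"
    proof (rule finsum_cong'[OF refl])
      fix s assume "s \<in> {s. s \<subseteq># h}"
      then have "?M - repeat_mset q s = m + repeat_mset q (h - s)"
        by (auto simp: multiset_eq_iff subseteq_mset_def diff_mult_distrib2)
      then show "(a [^]\<^bsub>B\<^esub> q) (repeat_mset q s) \<otimes> F (?M - repeat_mset q s) = a s [^] q \<otimes> F (m + repeat_mset q (h - s))"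
        by (simp add: frob_at[OF a])
    qed (simp add: coeff_closed[OF F] coeff_closed[OF a])
    finally have 1: "(a [^]\<^bsub>B\<^esub> q \<otimes>\<^bsub>B\<^esub> F) ?M = (\<Oplus>s\<in>{s. s \<subseteq># h}. a s [^] q \<otimes> F (m + repeat_mset q (h - s)))" .
    have "proj m b (a [^]\<^bsub>B\<^esub> q \<otimes>\<^bsub>B\<^esub> F) h = c b (\<Oplus>s\<in>{s. s \<subseteq># h}. a s [^] q \<otimes> F (m + repeat_mset q (h - s)))"
      using True by (simp only: proj_def 1 if_True)
    also have "\<dots> = (\<Oplus>s\<in>{s. s \<subseteq># h}. c b (a s [^] q \<otimes> F (m + repeat_mset q (h - s))))"
      by (rule c_finsum[OF b]) (simp_all add: coeff_closed[OF F] coeff_closed[OF a])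
    also have "\<dots> = (\<Oplus>s\<in>{s. s \<subseteq># h}. a s \<otimes> proj m b F (h - s))"
    proof (rule finsum_cong'[OF refl])
      fix s assume s: "s \<in> {s. s \<subseteq># h}"
      have 2: "c b (a s [^] q \<otimes> F (m + repeat_mset q (h - s))) = a s \<otimes> c b (F (m + repeat_mset q (h - s)))"
        by (rule Yr(5)[OF b]) (simp_all add: coeff_closed[OF F] coeff_closed[OF a])
      show "c b (a s [^] q \<otimes> F (m + repeat_mset q (h - s))) = a s \<otimes> proj m b F (h - s)"
      proof (cases "s \<in> P")
        case True
        \<comment> \<open>Here \<open>full\<close> is essential: a factor s of h in \<open>P\<close>
          has its cofactor in \<open>P\<close>, so the cutoff in \<open>proj\<close> loses
          nothing.\<close>
        then have "h - s \<in> P" using full[OF True \<open>h \<in> P\<close>] s by simp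
        then show ?thesis using 2 by (simp add: proj_def)
      next
        case False
        then have "a s = \<zero>" by (rule coeff_outside[OF a])
        then show ?thesis using 2 Yr(3)[OF b coeff_closed[OF F]] coeff_closed[OF proj_closed[OF b F]] by simp
      qed
    qed (simp add: coeff_closed[OF a] coeff_closed[OF proj_closed[OF b F]])
    also have "\<dots> = (a \<otimes>\<^bsub>B\<^esub> proj m b F) h" by (rule mult_apply'[symmetric])
    finally show ?thesis .
  qed
qed

lemma proj_mono:
  assumes b: "b \<in> Y" "b' \<in> Y" and m: "m \<in> good" "m' \<in> good"
  shows "proj m b (mono m' b') = (if m = m' \<and> b = b' then \<one>\<^bsub>B\<^esub> else \<zero>\<^bsub>B\<^esub>)"
proof
  fix h
  have *: "m + repeat_mset q h = m' \<longleftrightarrow> h = {#} \<and> m = m'"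
    using good_unique[OF m, of h] by auto
  have e: "repeat_mset q h = {#} \<longleftrightarrow> h = {#}" using repeat_mset_inj[OF q_pos, of h "{#}"] by simp
  show "proj m b (mono m' b') h = (if m = m' \<and> b = b' then \<one>\<^bsub>B\<^esub> else \<zero>\<^bsub>B\<^esub>) h"
    using empty_in Yr(7)[OF b] c_zero[OF b(1)] by (auto simp: proj_def mono_def * one_apply e)
qed

lemma finite_good: "finite good"
proof (rule finite_subset[OF _ finite_sub_multisets])
  show "good \<subseteq> {a. a \<subseteq># repeat_mset q (mset_set J)}"
  proof safe
    fix m assume m: "m \<in> good"
    then have "set_mset m \<subseteq> J" using P_sub by (simp add: good_def)
    then show "m \<subseteq># repeat_mset q (mset_set J)"
      using m finite_J unfolding subseteq_mset_def good_def
      by (auto simp: count_mset_set' not_in_iff intro: less_imp_le)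
  qed
qed

lemma frob_dual_good: "frob_dual B q (card good * card Y)"
proof -
  have fin: "finite (good \<times> Y)" using finite_good Yr(1) by simp
  obtain en where en: "bij_betw en {..<card good * card Y} (good \<times> Y)"
    using ex_bij_betw_nat_finite[OF fin] by (auto simp: card_cartesian_product atLeast0LessThan)
  have mem: "fst (en i) \<in> good" "snd (en i) \<in> Y" if "i < card good * card Y" for i
  proof -
    have "en i \<in> good \<times> Y" by (rule bij_betw_apply[OF en]) (use that in simp)
    then show "fst (en i) \<in> good" "snd (en i) \<in> Y" by (simp_all only: mem_Times_iff)
  qed
  show ?thesis
    unfolding frob_dual_def
  proof (rule exI[of _ "\<lambda>i. mono (fst (en i)) (snd (en i))"], rule exI[of _ "\<lambda>i. proj (fst (en i)) (snd (en i))"], intro conjI allI impI ballI)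
    fix i assume i: "i < card good * card Y"
    have "fst (en i) \<in> P" "snd (en i) \<in> carrier R" using mem[OF i] Yr(2) by (auto simp: good_def)
    then show "mono (fst (en i)) (snd (en i)) \<in> carrier B" by (rule mono_closed)
    fix x assume x: "x \<in> carrier B"
    show "proj (fst (en i)) (snd (en i)) x \<in> carrier B" by (rule proj_closed[OF mem(2)[OF i] x])
    fix y assume y: "y \<in> carrier B"
    show "proj (fst (en i)) (snd (en i)) (x \<oplus>\<^bsub>B\<^esub> y) = proj (fst (en i)) (snd (en i)) x \<oplus>\<^bsub>B\<^esub> proj (fst (en i)) (snd (en i)) y"
      by (rule proj_add[OF mem(2)[OF i] x y])
  next
    fix i a x assume i: "i < card good * card Y" and ax: "a \<in> carrier B" "x \<in> carrier B"
    show "proj (fst (en i)) (snd (en i)) (a [^]\<^bsub>B\<^esub> q \<otimes>\<^bsub>B\<^esub> x) = a \<otimes>\<^bsub>B\<^esub> proj (fst (en i)) (snd (en i)) x"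
      by (rule proj_linear[OF mem(2)[OF i] mem(1)[OF i] ax])
  next
    fix i j assume ij: "i < card good * card Y" "j < card good * card Y"
    have "fst (en i) = fst (en j) \<and> snd (en i) = snd (en j) \<longleftrightarrow> i = j"
      using ij en by (auto simp: prod_eq_iff[symmetric] bij_betw_def inj_on_def)
    then show "proj (fst (en i)) (snd (en i)) (mono (fst (en j)) (snd (en j))) = (if i = j then \<one>\<^bsub>B\<^esub> else \<zero>\<^bsub>B\<^esub>)"
      using proj_mono[OF mem(2)[OF ij(1)] mem(2)[OF ij(2)] mem(1)[OF ij(1)] mem(1)[OF ij(2)]] by simp
  qed
qed

end

text \<open>\<open>G\<close> generates \<open>P\<close> over its q-multiples, so the elements
  \<open>b y^r\<close> with r in \<open>G\<close> generate the Frobenius module.\<close>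

locale frob_series_gen = frob_series R P J p e Y c
  for R (structure) and P :: "'i::linorder multiset set" and J and p e Y c +
  fixes G
  assumes G: "finite G" "G \<subseteq> P" "m \<in> P \<Longrightarrow> \<exists>r\<in>G. \<exists>s\<in>P. m = r + repeat_mset q s"
begin

text \<open>An exponent may be of the form r + q s for several r in \<open>G\<close>; fixing one
  assigns each coefficient to a single generator.\<close>

definition rep where "rep m = (SOME r. r \<in> G \<and> (\<exists>s\<in>P. m = r + repeat_mset q s))"

lemma rep:
  assumes "m \<in> P" shows "rep m \<in> G" "\<exists>s\<in>P. m = rep m + repeat_mset q s"
proof -
  have "rep m \<in> G \<and> (\<exists>s\<in>P. m = rep m + repeat_mset q s)"
    unfolding rep_def by (rule someI_ex) (use G(3)[OF assms] in blast)
  then show "rep m \<in> G" "\<exists>s\<in>P. m = rep m + repeat_mset q s" by blast+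
qed

definition coord where
  "coord F r b s = (if s \<in> P \<and> rep (r + repeat_mset q s) = r then c b (F (r + repeat_mset q s)) else \<zero>)"

lemma coord_closed: "b \<in> Y \<Longrightarrow> F \<in> carrier B \<Longrightarrow> coord F r b \<in> carrier B"
  unfolding carrier_B coord_def using Yr(3) by auto

lemma gen_closed: "r \<in> G \<Longrightarrow> b \<in> Y \<Longrightarrow> mono r b \<in> carrier B"
  using G(2) Yr(2) by (intro mono_closed) auto

text \<open>At the exponent m only the generators with r = \<open>rep m\<close> contribute. For any
  other r either m - r is not a q-multiple, or \<open>coord\<close> vanishes there by the choice of
  \<open>rep\<close>.\<close>

lemma frob_generate:
  assumes F: "F \<in> carrier B"
  shows "F = (\<Oplus>\<^bsub>B\<^esub>x\<in>G \<times> Y. coord F (fst x) (snd x) [^]\<^bsub>B\<^esub> q \<otimes>\<^bsub>B\<^esub> mono (fst x) (snd x))"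
proof
  fix m
  let ?T = "\<lambda>r b. coord F r b [^]\<^bsub>B\<^esub> q \<otimes>\<^bsub>B\<^esub> mono r b"
  have Tc: "?T r b \<in> carrier B" if "r \<in> G" "b \<in> Y" for r b
    by (rule mult_closed_B[OF B.nat_pow_closed[OF coord_closed[OF that(2) F]] gen_closed[OF that]])
  have fin: "finite (G \<times> Y)" using G(1) Yr(1) by simp
  have T: "?T r b m = (if r \<subseteq># m then b \<otimes> (coord F r b [^]\<^bsub>B\<^esub> q) (m - r) else \<zero>)" if "r \<in> G" "b \<in> Y" for r b
  proof -
    have "?T r b = mono r b \<otimes>\<^bsub>B\<^esub> coord F r b [^]\<^bsub>B\<^esub> q"
      by (rule mult_comm_B[OF B.nat_pow_closed[OF coord_closed[OF that(2) F]] gen_closed[OF that]])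
    moreover have "b \<in> carrier R" "r \<in> P" using that G(2) Yr(2) by blast+
    ultimately show ?thesis
      using mono_mult_apply[OF _ B.nat_pow_closed[OF coord_closed[OF that(2) F]]] by (simp only:)
  qed
  have "(\<Oplus>\<^bsub>B\<^esub>x\<in>G \<times> Y. ?T (fst x) (snd x)) m = (\<Oplus>x\<in>G \<times> Y. ?T (fst x) (snd x) m)"
    by (rule finsum_apply[OF fin]) (use Tc in auto)
  also have "\<dots> = F m"
  proof (cases "m \<in> P")
    case False
    have "(\<Oplus>x\<in>G \<times> Y. ?T (fst x) (snd x) m) = \<zero>"
    proof (rule finsum_all_zero)
      fix x assume "x \<in> G \<times> Y"
      then have "?T (fst x) (snd x) \<in> carrier B" using Tc by (simp add: mem_Times_iff)
      from coeff_outside[OF this False] show "?T (fst x) (snd x) m = \<zero>" .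
    qed
    then show ?thesis using coeff_outside[OF F False] by simp
  next
    case True
    define r0 where "r0 = rep m"
    obtain s0 where s0: "s0 \<in> P" "m = r0 + repeat_mset q s0" using rep(2)[OF True] unfolding r0_def by blast
    have r0: "r0 \<in> G" unfolding r0_def by (rule rep(1)[OF True])
    have zero: "?T r b m = \<zero>" if "r \<in> G" "b \<in> Y" "r \<noteq> r0" for r b
    proof (cases "r \<subseteq># m")
      case True
      have "(coord F r b [^]\<^bsub>B\<^esub> q) (m - r) = \<zero>"
      proof (cases "\<exists>s. m - r = repeat_mset q s")
        case True2: True
        then obtain s where s: "m - r = repeat_mset q s" by blast
        then have "m = r + repeat_mset q s" using True by (metis subset_mset.add_diff_inverse)
        then have "rep (r + repeat_mset q s) \<noteq> r" using that(3) unfolding r0_def by simp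
        then have "coord F r b s = \<zero>" by (simp add: coord_def)
        then show ?thesis unfolding s frob_at[OF coord_closed[OF that(2) F]] by (simp add: zero_pow_q)
      next
        case False
        then show ?thesis by (intro frob_off[OF coord_closed[OF that(2) F]]) auto
      qed
      moreover have "b \<in> carrier R" using that Yr(2) by blast
      ultimately show ?thesis using T[OF that(1,2)] by simp
    next
      case False
      then show ?thesis using T[OF that(1,2)] by simp
    qed
    have val: "?T r0 b m = c b (F m) [^] q \<otimes> b" if "b \<in> Y" for b
    proof -
      have "m - r0 = repeat_mset q s0" using s0 by simp
      moreover have "coord F r0 b s0 = c b (F m)" unfolding coord_def s0(2)[symmetric] r0_def[symmetric] using s0(1) by simp
      moreover have "r0 \<subseteq># m" using s0 by simp
      ultimately have "?T r0 b m = b \<otimes> c b (F m) [^] q"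
        using T[OF r0 that] frob_at[OF coord_closed[OF that F], of r0 s0] by simp
      moreover have "b \<in> carrier R" using that Yr(2) by blast
      ultimately show ?thesis using m_comm[OF _ nat_pow_closed[OF Yr(3)[OF that coeff_closed[OF F]]]] by simp
    qed
    have "(\<Oplus>x\<in>G \<times> Y. ?T (fst x) (snd x) m) = (\<Oplus>x\<in>Pair r0 ` Y. ?T (fst x) (snd x) m)"
    proof (rule finsum_neutral_left[symmetric, OF fin])
      show "Pair r0 ` Y \<subseteq> G \<times> Y" using r0 by auto
    next
      fix x assume x: "x \<in> G \<times> Y - Pair r0 ` Y"
      then have xc: "fst x \<in> G" "snd x \<in> Y" by (simp_all only: Diff_iff mem_Times_iff)
      have "fst x \<noteq> r0"
      proof
        assume "fst x = r0"
        then have "x = Pair r0 (snd x)" by (simp add: prod_eq_iff)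
        then have "x \<in> Pair r0 ` Y" using xc(2) by (rule image_eqI)
        then show False using x by simp
      qed
      then show "?T (fst x) (snd x) m = \<zero>" by (rule zero[OF xc])
    next
      fix x assume "x \<in> Pair r0 ` Y"
      then have c: "fst x \<in> G" "snd x \<in> Y" using r0 by auto
      show "?T (fst x) (snd x) m \<in> carrier R" by (rule coeff_closed[OF Tc[OF c]])
    qed
    also have "\<dots> = (\<Oplus>b\<in>Y. ?T r0 b m)"
    proof (subst finsum_reindex)
      show "(\<lambda>x. ?T (fst x) (snd x) m) \<in> Pair r0 ` Y \<rightarrow> carrier R"
      proof
        fix x assume "x \<in> Pair r0 ` Y"
        then have c: "fst x \<in> G" "snd x \<in> Y" using r0 by auto
        show "?T (fst x) (snd x) m \<in> carrier R" by (rule coeff_closed[OF Tc[OF c]])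
      qed
    qed (simp_all add: inj_on_def)
    also have "\<dots> = (\<Oplus>b\<in>Y. c b (F m) [^] q \<otimes> b)"
    proof (rule finsum_cong'[OF refl])
      show "(\<lambda>b. c b (F m) [^] q \<otimes> b) \<in> Y \<rightarrow> carrier R"
        using Yr(2) Yr(3)[OF _ coeff_closed[OF F]] by auto
    qed (rule val)
    also have "\<dots> = F m" by (rule Yr(6)[OF coeff_closed[OF F], symmetric])
    finally show ?thesis .
  qed
  finally show "F m = (\<Oplus>\<^bsub>B\<^esub>x\<in>G \<times> Y. ?T (fst x) (snd x)) m" by simp
qed

text \<open>In \<open>finitely_generated_module\<close> the scalars are indexed by the generators
  themselves, so the pair (r, b) must be recoverable from \<open>b y^r\<close>.\<close>

lemma gen_inj: "inj_on (\<lambda>x. mono (fst x) (snd x)) (G \<times> Y)"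
proof (rule inj_onI)
  fix x y assume xy: "x \<in> G \<times> Y" "y \<in> G \<times> Y" "mono (fst x) (snd x) = mono (fst y) (snd y)"
  have nz: "b \<noteq> \<zero>" if "b \<in> Y" for b using Yr(7)[OF that that] c_zero[OF that] one_not_zero by auto
  have "mono (fst x) (snd x) (fst x) = mono (fst y) (snd y) (fst x)" using xy by simp
  then have "snd x = (if fst x = fst y then snd y else \<zero>)" by (simp add: mono_def)
  then show "x = y" using nz[of "snd x"] xy by (auto simp: prod_eq_iff split: if_splits)
qed

lemma frob_finitely_generated: "finitely_generated_module B (frobenius_module p e B)"
proof -
  let ?g = "\<lambda>x. mono (fst x) (snd x)"
  have gc: "?g x \<in> carrier B" if "x \<in> G \<times> Y" for x using gen_closed that by (simp add: mem_Times_iff)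
  show ?thesis
    unfolding finitely_generated_module_def
  proof (intro exI[of _ "?g ` (G \<times> Y)"] conjI ballI)
    show "?g ` (G \<times> Y) \<subseteq> carrier (frobenius_module p e B)" using gc by auto
    show "finite (?g ` (G \<times> Y))" using G(1) Yr(1) by simp
    fix F assume "F \<in> carrier (frobenius_module p e B)"
    then have F: "F \<in> carrier B" by simp
    define iv where "iv = the_inv_into (G \<times> Y) ?g"
    have iv: "iv (?g x) = x" if "x \<in> G \<times> Y" for x
      unfolding iv_def by (rule the_inv_into_f_f[OF gen_inj that])
    define d where "d y = coord F (fst (iv y)) (snd (iv y))" for y
    have dc: "d (?g x) \<in> carrier B" if "x \<in> G \<times> Y" for x
      unfolding d_def iv[OF that] by (rule coord_closed[OF _ F]) (use that in auto)
    have "(\<Oplus>\<^bsub>B\<^esub>y\<in>?g ` (G \<times> Y). d y [^]\<^bsub>B\<^esub> q \<otimes>\<^bsub>B\<^esub> y) = (\<Oplus>\<^bsub>B\<^esub>x\<in>G \<times> Y. d (?g x) [^]\<^bsub>B\<^esub> q \<otimes>\<^bsub>B\<^esub> ?g x)"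
      by (rule B.finsum_reindex[OF _ gen_inj]) (use dc gc in auto)
    also have "\<dots> = (\<Oplus>\<^bsub>B\<^esub>x\<in>G \<times> Y. coord F (fst x) (snd x) [^]\<^bsub>B\<^esub> q \<otimes>\<^bsub>B\<^esub> ?g x)"
    proof (rule B.finsum_cong'[OF refl])
      fix x assume x: "x \<in> G \<times> Y"
      show "d (?g x) [^]\<^bsub>B\<^esub> q \<otimes>\<^bsub>B\<^esub> ?g x = coord F (fst x) (snd x) [^]\<^bsub>B\<^esub> q \<otimes>\<^bsub>B\<^esub> ?g x"
        by (simp only: d_def iv[OF x])
    next
      show "(\<lambda>x. coord F (fst x) (snd x) [^]\<^bsub>B\<^esub> q \<otimes>\<^bsub>B\<^esub> ?g x) \<in> G \<times> Y \<rightarrow> carrier B"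
        using coord_closed[OF _ F] gc by auto
    qed
    also have "\<dots> = F" by (rule frob_generate[OF F, symmetric])
    finally have "F = (\<Oplus>\<^bsub>B\<^esub>y\<in>?g ` (G \<times> Y). d y [^]\<^bsub>B\<^esub> q \<otimes>\<^bsub>B\<^esub> y)" by (rule sym)
    then show "\<exists>d\<in>?g ` (G \<times> Y) \<rightarrow> carrier B. F = (\<Oplus>\<^bsub>frobenius_module p e B\<^esub>y\<in>?g ` (G \<times> Y). d y \<odot>\<^bsub>frobenius_module p e B\<^esub> y)"
      unfolding finsum_frobenius_module frob_simps q_def[symmetric] by (intro bexI[of _ d]) (use dc in auto)
  qed
qed

text \<open>
  If \<open>m' + q w = m + q v\<close>, then a form \<open>\<phi>\<close> satisfies \<open>y^w \<phi>(b y^m') = y^v \<phi>(b y^m)\<close>; as \<open>w\<close> does not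
  divide \<open>v\<close>, the constant coefficient of \<open>\<phi>(b y^m)\<close> vanishes.
\<close>

lemma frob_dual_bound:
  assumes bad: "\<And>m. m \<in> P \<Longrightarrow> m \<notin> good \<Longrightarrow>
      \<exists>v\<in>P. \<exists>w\<in>P. \<exists>m'\<in>P. m' + repeat_mset q w = m + repeat_mset q v \<and> \<not> w \<subseteq># v"
    and dual: "frob_dual B q n"
  shows "n \<le> card good * card Y"
proof (rule ccontr)
  assume less: "\<not> n \<le> card good * card Y"
  obtain ev \<phi> where D: "\<forall>i<n. ev i \<in> carrier B" "\<forall>i<n. \<forall>x\<in>carrier B. \<phi> i x \<in> carrier B"
    "\<forall>i<n. \<forall>x\<in>carrier B. \<forall>y\<in>carrier B. \<phi> i (x \<oplus>\<^bsub>B\<^esub> y) = \<phi> i x \<oplus>\<^bsub>B\<^esub> \<phi> i y"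
    "\<forall>i<n. \<forall>a\<in>carrier B. \<forall>x\<in>carrier B. \<phi> i (a [^]\<^bsub>B\<^esub> q \<otimes>\<^bsub>B\<^esub> x) = a \<otimes>\<^bsub>B\<^esub> \<phi> i x"
    "\<forall>i<n. \<forall>j<n. \<phi> i (ev j) = (if i = j then \<one>\<^bsub>B\<^esub> else \<zero>\<^bsub>B\<^esub>)"
    using dual unfolding frob_dual_def by (elim exE conjE) (rule that; assumption)
  have lin: "\<phi> i (a [^]\<^bsub>B\<^esub> q \<otimes>\<^bsub>B\<^esub> x) = a \<otimes>\<^bsub>B\<^esub> \<phi> i x" if "i < n" "a \<in> carrier B" "x \<in> carrier B" for i a x
    using D(4) that by simp
  have \<phi>c: "\<phi> i x \<in> carrier B" if "i < n" "x \<in> carrier B" for i x using D(2) that by simp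
  have \<phi>0: "\<phi> i \<zero>\<^bsub>B\<^esub> = \<zero>\<^bsub>B\<^esub>" if i: "i < n" for i
  proof -
    have 0: "\<zero>\<^bsub>B\<^esub> \<in> carrier B" by (rule B.zero_closed)
    have "\<phi> i (\<zero>\<^bsub>B\<^esub> [^]\<^bsub>B\<^esub> q \<otimes>\<^bsub>B\<^esub> \<zero>\<^bsub>B\<^esub>) = \<zero>\<^bsub>B\<^esub> \<otimes>\<^bsub>B\<^esub> \<phi> i \<zero>\<^bsub>B\<^esub>" by (rule lin[OF i 0 0])
    then show ?thesis unfolding B.l_null[OF \<phi>c[OF i 0]] B.r_null[OF B.nat_pow_closed[OF 0]] .
  qed
  have \<phi>sum: "\<phi> i (\<Oplus>\<^bsub>B\<^esub>x\<in>A. f x) = (\<Oplus>\<^bsub>B\<^esub>x\<in>A. \<phi> i (f x))"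
    if i: "i < n" and A: "finite A" and f: "\<And>x. x \<in> A \<Longrightarrow> f x \<in> carrier B" for i A and f :: "'i multiset \<times> 'a \<Rightarrow> _"
    using A f
  proof (induction A)
    case (insert x A)
    then have *: "f x \<in> carrier B" "f \<in> A \<rightarrow> carrier B" "(\<lambda>j. \<phi> i (f j)) \<in> A \<rightarrow> carrier B"
      using \<phi>c[OF i] by auto
    have s: "(\<Oplus>\<^bsub>B\<^esub>j\<in>A. f j) \<in> carrier B" by (rule B.finsum_closed[OF *(2)])
    have "\<phi> i (\<Oplus>\<^bsub>B\<^esub>j\<in>insert x A. f j) = \<phi> i (f x \<oplus>\<^bsub>B\<^esub> (\<Oplus>\<^bsub>B\<^esub>j\<in>A. f j))"
      by (rule arg_cong[OF B.finsum_insert[OF insert(1,2) *(2,1)]])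
    also have "\<dots> = \<phi> i (f x) \<oplus>\<^bsub>B\<^esub> \<phi> i (\<Oplus>\<^bsub>B\<^esub>j\<in>A. f j)"
      by (rule D(3)[rule_format, OF i *(1) s])
    also have "\<phi> i (\<Oplus>\<^bsub>B\<^esub>j\<in>A. f j) = (\<Oplus>\<^bsub>B\<^esub>j\<in>A. \<phi> i (f j))"
      by (rule insert.IH) (use insert.prems in simp)
    also have "\<phi> i (f x) \<oplus>\<^bsub>B\<^esub> (\<Oplus>\<^bsub>B\<^esub>j\<in>A. \<phi> i (f j)) = (\<Oplus>\<^bsub>B\<^esub>j\<in>insert x A. \<phi> i (f j))"
      by (rule B.finsum_insert[OF insert(1,2) *(3) \<phi>c[OF i *(1)], symmetric])
    finally show ?case .
  next
    case empty
    show ?case unfolding B.finsum_empty by (rule \<phi>0[OF i])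
  qed
  have fin: "finite (G \<times> Y)" using G(1) Yr(1) by simp
  \<comment> \<open>Forms are evaluated modulo the maximal ideal, which turns the question into
    linear algebra over the coefficient field.\<close>
  define \<psi> where "\<psi> i x = \<phi> i (mono (fst x) (snd x)) {#}" for i x
  have gc: "mono (fst x) (snd x) \<in> carrier B" if "x \<in> G \<times> Y" for x using gen_closed that by (simp add: mem_Times_iff)
  have bz: "\<psi> i x = \<zero>" if i: "i < n" and x: "x \<in> G \<times> Y" "fst x \<notin> good" for i x
  proof -
    obtain m b where mb: "x = (m, b)" "m \<in> P" "b \<in> Y" "b \<in> carrier R" "m \<notin> good"
      using x G(2) Yr(2) by (cases x) auto
    obtain v w m' where w: "v \<in> P" "w \<in> P" "m' \<in> P" "m' + repeat_mset q w = m + repeat_mset q v" "\<not> w \<subseteq># v"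
      using bad[OF mb(2,5)] by blast
    have c: "mono w \<one> \<in> carrier B" "mono v \<one> \<in> carrier B" "mono m b \<in> carrier B" "mono m' b \<in> carrier B"
      using w mb by simp_all
    have pw: "mono u \<one> [^]\<^bsub>B\<^esub> q \<otimes>\<^bsub>B\<^esub> mono m'' b = mono (m'' + repeat_mset q u) b" if "u \<in> P" "m'' \<in> P" for u m''
      using that mb repeat_in[OF that(1)] by (simp add: mono_pow mono_mult_mono add.commute)
    have "mono w \<one> \<otimes>\<^bsub>B\<^esub> \<phi> i (mono m' b) = \<phi> i (mono w \<one> [^]\<^bsub>B\<^esub> q \<otimes>\<^bsub>B\<^esub> mono m' b)"
      by (rule lin[OF i c(1,4), symmetric])
    also have "\<dots> = \<phi> i (mono v \<one> [^]\<^bsub>B\<^esub> q \<otimes>\<^bsub>B\<^esub> mono m b)"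
      unfolding pw[OF w(2,3)] pw[OF w(1) mb(2)] w(4) ..
    also have "\<dots> = mono v \<one> \<otimes>\<^bsub>B\<^esub> \<phi> i (mono m b)"
      by (rule lin[OF i c(2,3)])
    finally have "(mono w \<one> \<otimes>\<^bsub>B\<^esub> \<phi> i (mono m' b)) v = (mono v \<one> \<otimes>\<^bsub>B\<^esub> \<phi> i (mono m b)) v" by simp
    then have "\<zero> = \<phi> i (mono m b) {#}"
      using mono_mult_apply[OF one_closed \<phi>c[OF i c(4)] w(2), of v] mono_mult_apply[OF one_closed \<phi>c[OF i c(3)] w(1), of v] w(5)
        coeff_closed[OF \<phi>c[OF i c(3)], of "{#}"] by simp
    then show ?thesis by (simp add: \<psi>_def mb)
  qed
  define H where "H = (G \<inter> good) \<times> Y"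
  have H: "finite H" "H \<subseteq> G \<times> Y" "card H \<le> card good * card Y"
    using G(1) Yr(1) finite_good by (auto simp: H_def card_cartesian_product card_mono)
  define \<nu> where "\<nu> j x = coord (ev j) (fst x) (snd x) {#}" for j x
  have cc: "coord (ev j) (fst x) (snd x) \<in> carrier B" if "j < n" "x \<in> G \<times> Y" for j x
    using that D(1) by (intro coord_closed) auto
  have \<nu>c: "\<nu> j x \<in> carrier R" if "j < n" "x \<in> G \<times> Y" for j x
    unfolding \<nu>_def by (rule coeff_closed[OF cc[OF that]])
  have \<psi>c: "\<psi> i x \<in> carrier R" if "i < n" "x \<in> G \<times> Y" for i x
    unfolding \<psi>_def by (rule coeff_closed[OF \<phi>c[OF that(1) gc[OF that(2)]]])
  \<comment> \<open>The identity matrix of size n is a product through the index set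
    \<open>H\<close>: generators with exponents that are not good contribute zero. If n exceeded
    \<open>card H\<close>, the vectors \<open>\<nu> j\<close> would be linearly dependent, and
    pairing the relation with \<open>\<psi> i\<close> would kill each of its coefficients.\<close>
  have delta: "(\<Oplus>x\<in>H. \<nu> j x \<otimes> \<psi> i x) = (if i = j then \<one> else \<zero>)" if ij: "i < n" "j < n" for i j
  proof -
    have ej: "ev j \<in> carrier B" using D(1) ij by simp
    let ?T = "\<lambda>x. coord (ev j) (fst x) (snd x) [^]\<^bsub>B\<^esub> q \<otimes>\<^bsub>B\<^esub> mono (fst x) (snd x)"
    have Tc: "?T x \<in> carrier B" if "x \<in> G \<times> Y" for x
      by (rule mult_closed_B[OF B.nat_pow_closed[OF cc[OF ij(2) that]] gc[OF that]])
    have T: "\<phi> i (?T x) = coord (ev j) (fst x) (snd x) \<otimes>\<^bsub>B\<^esub> \<phi> i (mono (fst x) (snd x))" if "x \<in> G \<times> Y" for x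
      by (rule lin[OF ij(1) cc[OF ij(2) that] gc[OF that]])
    have "\<phi> i (ev j) = \<phi> i (\<Oplus>\<^bsub>B\<^esub>x\<in>G \<times> Y. ?T x)" by (rule arg_cong[OF frob_generate[OF ej]])
    also have "\<dots> = (\<Oplus>\<^bsub>B\<^esub>x\<in>G \<times> Y. \<phi> i (?T x))" by (rule \<phi>sum[OF ij(1) fin Tc])
    finally have "\<phi> i (ev j) = (\<Oplus>\<^bsub>B\<^esub>x\<in>G \<times> Y. \<phi> i (?T x))" .
    then have "\<phi> i (ev j) {#} = (\<Oplus>\<^bsub>B\<^esub>x\<in>G \<times> Y. \<phi> i (?T x)) {#}" by (rule fun_cong)
    also have "\<dots> = (\<Oplus>x\<in>G \<times> Y. \<phi> i (?T x) {#})"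
      by (rule finsum_apply[OF fin]) (rule \<phi>c[OF ij(1) Tc])
    also have "\<dots> = (\<Oplus>x\<in>G \<times> Y. \<nu> j x \<otimes> \<psi> i x)"
    proof (rule finsum_cong'[OF refl])
      fix x assume x: "x \<in> G \<times> Y"
      show "\<phi> i (?T x) {#} = \<nu> j x \<otimes> \<psi> i x"
        unfolding T[OF x] mult_const[OF cc[OF ij(2) x] \<phi>c[OF ij(1) gc[OF x]]] \<nu>_def \<psi>_def ..
    qed (use \<nu>c \<psi>c ij in auto)
    also have "\<dots> = (\<Oplus>x\<in>H. \<nu> j x \<otimes> \<psi> i x)"
    proof (rule finsum_neutral_left[symmetric, OF fin H(2)])
      fix x assume "x \<in> G \<times> Y - H"
      then have x: "x \<in> G \<times> Y" "fst x \<notin> good" by (auto simp: H_def)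
      show "\<nu> j x \<otimes> \<psi> i x = \<zero>" unfolding bz[OF ij(1) x] using \<nu>c[OF ij(2) x(1)] by simp
    qed (use \<nu>c \<psi>c ij H(2) in auto)
    finally have 1: "\<phi> i (ev j) {#} = (\<Oplus>x\<in>H. \<nu> j x \<otimes> \<psi> i x)" .
    have "\<phi> i (ev j) {#} = (if i = j then \<one>\<^bsub>B\<^esub> else \<zero>\<^bsub>B\<^esub>) {#}"
      by (rule fun_cong[OF D(5)[rule_format, OF ij]])
    also have "\<dots> = (if i = j then \<one> else \<zero>)" by (simp add: one_apply)
    finally show ?thesis unfolding 1 .
  qed
  have cardn: "card H < card {..<n}" using H(3) less by simp
  obtain \<kappa> where k: "\<forall>s\<in>{..<n}. \<kappa> s \<in> carrier R" "\<exists>s\<in>{..<n}. \<kappa> s \<noteq> \<zero>" "\<forall>m\<in>H. (\<Oplus>s\<in>{..<n}. \<kappa> s \<otimes> \<nu> s m) = \<zero>"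
  proof -
    have "\<exists>\<kappa>. (\<forall>s\<in>{..<n}. \<kappa> s \<in> carrier R) \<and> (\<exists>s\<in>{..<n}. \<kappa> s \<noteq> \<zero>) \<and>
        (\<forall>m\<in>H. (\<Oplus>s\<in>{..<n}. \<kappa> s \<otimes> \<nu> s m) = \<zero>)"
    proof (rule nontrivial_solution[OF finite_lessThan H(1) cardn])
      fix s m assume s: "s \<in> {..<n}" and m: "m \<in> H"
      have "m \<in> G \<times> Y" by (rule subsetD[OF H(2) m])
      with s show "\<nu> s m \<in> carrier R" by (intro \<nu>c) simp_all
    qed
    then show thesis by (elim exE conjE) (rule that; assumption)
  qed
  have "\<kappa> i = \<zero>" if i: "i < n" for i
  proof -
    have kc: "\<kappa> j \<in> carrier R" if "j < n" for j using k(1) that by simp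
    have Hc: "\<nu> j x \<in> carrier R" "\<psi> i x \<in> carrier R" if "j < n" "x \<in> H" for j x using \<nu>c \<psi>c i H(2) that by auto
    have "\<kappa> i = (\<Oplus>j\<in>{..<n}. \<kappa> j \<otimes> (if i = j then \<one> else \<zero>))"
    proof -
      have "(\<Oplus>j\<in>{..<n}. \<kappa> j \<otimes> (if i = j then \<one> else \<zero>)) = \<kappa> i \<otimes> (if i = i then \<one> else \<zero>)"
        by (rule finsum_single) (use i kc in auto)
      then show ?thesis using kc[OF i] by simp
    qed
    also have "\<dots> = (\<Oplus>j\<in>{..<n}. \<kappa> j \<otimes> (\<Oplus>x\<in>H. \<nu> j x \<otimes> \<psi> i x))"
    proof (rule finsum_cong'[OF refl])
      fix j assume "j \<in> {..<n}"
      then have j: "j < n" by simp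
      show "\<kappa> j \<otimes> (if i = j then \<one> else \<zero>) = \<kappa> j \<otimes> (\<Oplus>x\<in>H. \<nu> j x \<otimes> \<psi> i x)"
        by (simp only: delta[OF i j])
    next
      show "(\<lambda>j. \<kappa> j \<otimes> (\<Oplus>x\<in>H. \<nu> j x \<otimes> \<psi> i x)) \<in> {..<n} \<rightarrow> carrier R"
      proof
        fix j assume "j \<in> {..<n}"
        then have j: "j < n" by simp
        show "\<kappa> j \<otimes> (\<Oplus>x\<in>H. \<nu> j x \<otimes> \<psi> i x) \<in> carrier R"
          unfolding delta[OF i j] using kc[OF j] by simp
      qed
    qed
    also have "\<dots> = (\<Oplus>j\<in>{..<n}. (\<Oplus>x\<in>H. (\<kappa> j \<otimes> \<nu> j x) \<otimes> \<psi> i x))"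
    proof (rule finsum_cong'[OF refl])
      fix j assume "j \<in> {..<n}"
      then have j: "j < n" by simp
      have "\<kappa> j \<otimes> (\<Oplus>x\<in>H. \<nu> j x \<otimes> \<psi> i x) = (\<Oplus>x\<in>H. \<kappa> j \<otimes> (\<nu> j x \<otimes> \<psi> i x))"
        by (rule finsum_rdistr) (use H(1) kc[OF j] Hc[OF j] in auto)
      also have "\<dots> = (\<Oplus>x\<in>H. (\<kappa> j \<otimes> \<nu> j x) \<otimes> \<psi> i x)"
        by (rule finsum_cong'[OF refl]) (use kc[OF j] Hc[OF j] in \<open>auto simp: m_assoc\<close>)
      finally show "\<kappa> j \<otimes> (\<Oplus>x\<in>H. \<nu> j x \<otimes> \<psi> i x) = (\<Oplus>x\<in>H. (\<kappa> j \<otimes> \<nu> j x) \<otimes> \<psi> i x)" .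
    qed (use kc Hc in \<open>auto intro!: finsum_closed\<close>)
    also have "\<dots> = (\<Oplus>x\<in>H. \<Oplus>j\<in>{..<n}. (\<kappa> j \<otimes> \<nu> j x) \<otimes> \<psi> i x)"
      by (rule finsum_swap) (use H(1) kc Hc in auto)
    also have "\<dots> = \<zero>"
    proof (rule finsum_all_zero)
      fix x assume x: "x \<in> H"
      have "(\<Oplus>j\<in>{..<n}. (\<kappa> j \<otimes> \<nu> j x) \<otimes> \<psi> i x) = (\<Oplus>j\<in>{..<n}. \<kappa> j \<otimes> \<nu> j x) \<otimes> \<psi> i x"
        by (rule finsum_ldistr[symmetric]) (use kc Hc x i in auto)
      then show "(\<Oplus>j\<in>{..<n}. (\<kappa> j \<otimes> \<nu> j x) \<otimes> \<psi> i x) = \<zero>" using k(3) x Hc(2)[OF i x] by simp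
    qed
    finally show ?thesis .
  qed
  then show False using k(2) by auto
qed

end

section \<open>Invariance under ring isomorphisms\<close>

text \<open>Serves to compute each ingredient of the F-signature in the ring of monoid series; by
  \<open>sym\<close> every transported fact is available in both directions.\<close>

locale ring_isom = A: cring A + B: cring B for A :: "('a, 'r) ring_scheme" and B :: "('b, 's) ring_scheme" +
  fixes h assumes iso: "h \<in> ring_iso A B"
begin

lemma bij: "bij_betw h (carrier A) (carrier B)"
  by (rule ring_iso_memE(5)[OF iso])

lemma closed: "x \<in> carrier A \<Longrightarrow> h x \<in> carrier B"
  by (rule ring_iso_memE(1)[OF iso])

lemma h_add: "x \<in> carrier A \<Longrightarrow> y \<in> carrier A \<Longrightarrow> h (x \<oplus>\<^bsub>A\<^esub> y) = h x \<oplus>\<^bsub>B\<^esub> h y"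
  by (rule ring_iso_memE(3)[OF iso])

lemma h_mult: "x \<in> carrier A \<Longrightarrow> y \<in> carrier A \<Longrightarrow> h (x \<otimes>\<^bsub>A\<^esub> y) = h x \<otimes>\<^bsub>B\<^esub> h y"
  by (rule ring_iso_memE(2)[OF iso])

lemma h_one: "h \<one>\<^bsub>A\<^esub> = \<one>\<^bsub>B\<^esub>"
  by (rule ring_iso_memE(4)[OF iso])

lemma hom: "ring_hom_ring A B h"
  by (rule ring_hom_ringI[OF A.ring_axioms B.ring_axioms closed h_mult h_add h_one])

lemma h_zero: "h \<zero>\<^bsub>A\<^esub> = \<zero>\<^bsub>B\<^esub>"
proof -
  interpret ring_hom_ring A B h by (rule hom)
  show ?thesis by (rule hom_zero)
qed

lemma h_pow: "x \<in> carrier A \<Longrightarrow> h (x [^]\<^bsub>A\<^esub> (n::nat)) = h x [^]\<^bsub>B\<^esub> n"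
  by (rule ring_hom_ring.hom_nat_pow[OF hom])

lemma h_inj: "x \<in> carrier A \<Longrightarrow> y \<in> carrier A \<Longrightarrow> h x = h y \<longleftrightarrow> x = y"
  using bij by (meson bij_betw_imp_inj_on inj_on_eq_iff)

lemma h_finsum:
  assumes "finite S" "\<And>x. x \<in> S \<Longrightarrow> f x \<in> carrier A"
  shows "h (\<Oplus>\<^bsub>A\<^esub>x\<in>S. f x) = (\<Oplus>\<^bsub>B\<^esub>x\<in>S. h (f x))"
  using assms
proof (induction S)
  case empty
  show ?case unfolding A.finsum_empty B.finsum_empty by (rule h_zero)
next
  case (insert x S)
  have c: "f \<in> S \<rightarrow> carrier A" "f x \<in> carrier A" using insert.prems by simp_all
  have d: "(\<lambda>x. h (f x)) \<in> S \<rightarrow> carrier B" "h (f x) \<in> carrier B" using insert.prems closed by simp_all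
  have "h (\<Oplus>\<^bsub>A\<^esub>x\<in>S. f x) = (\<Oplus>\<^bsub>B\<^esub>x\<in>S. h (f x))" using insert by simp
  then show ?case
    unfolding A.finsum_insert[OF insert.hyps c] B.finsum_insert[OF insert.hyps d] h_add[OF c(2) A.finsum_closed[OF c(1)]] by simp
qed

definition g where "g = inv_into (carrier A) h"

lemma g: "y \<in> carrier B \<Longrightarrow> g y \<in> carrier A" "y \<in> carrier B \<Longrightarrow> h (g y) = y" "x \<in> carrier A \<Longrightarrow> g (h x) = x"
  unfolding g_def using bij_betw_imp_surj_on[OF bij] bij_betw_imp_inj_on[OF bij]
  by (simp_all add: inv_into_into f_inv_into_f)

lemma g_iso: "g \<in> ring_iso B A"
  unfolding g_def by (rule ring_iso_set_sym[OF A.ring_axioms iso])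

lemma sym: "ring_isom B A g"
  by (intro ring_isom.intro ring_isom_axioms.intro A.is_cring B.is_cring g_iso)

lemma image_g: "J \<subseteq> carrier B \<Longrightarrow> h ` (g ` J) = J"
proof -
  assume J: "J \<subseteq> carrier B"
  have "h (g y) = y" if "y \<in> J" for y by (rule g(2)[OF subsetD[OF J that]])
  then show ?thesis by (simp add: image_image)
qed

lemma image_h: "I \<subseteq> carrier A \<Longrightarrow> g ` (h ` I) = I"
proof -
  assume I: "I \<subseteq> carrier A"
  have "g (h y) = y" if "y \<in> I" for y by (rule g(3)[OF subsetD[OF I that]])
  then show ?thesis by (simp add: image_image)
qed

lemma image_carrier: "h ` carrier A = carrier B"
  by (rule bij_betw_imp_surj_on[OF bij])

lemma h_image_mem: "I \<subseteq> carrier A \<Longrightarrow> x \<in> carrier A \<Longrightarrow> h x \<in> h ` I \<longleftrightarrow> x \<in> I"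
  using h_inj by (meson bij bij_betw_imp_inj_on inj_on_image_mem_iff)

lemma image_ideal:
  assumes I: "ideal I A" shows "ideal (h ` I) B"
proof (rule B.idealI_cring)
  have IA: "I \<subseteq> carrier A" using ideal.Icarr[OF I] by (rule subsetI)
  note sg = ideal.axioms(1)[OF I]
  show "h ` I \<subseteq> carrier B" using IA closed by (rule_tac image_subsetI) (rule closed, erule subsetD)
  show "\<zero>\<^bsub>B\<^esub> \<in> h ` I" unfolding h_zero[symmetric] by (rule imageI[OF additive_subgroup.zero_closed[OF sg]])
  fix a b assume "a \<in> h ` I"
  then obtain x where x: "x \<in> I" "a = h x" by (rule imageE) 
  note xA = subsetD[OF IA x(1)]
  show "a \<oplus>\<^bsub>B\<^esub> b \<in> h ` I" if "b \<in> h ` I"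
  proof -
    obtain y where y: "y \<in> I" "b = h y" using \<open>b \<in> h ` I\<close> by (rule imageE)
    show ?thesis unfolding x(2) y(2) h_add[OF xA subsetD[OF IA y(1)], symmetric]
      by (rule imageI[OF additive_subgroup.a_closed[OF sg x(1) y(1)]])
  qed
  show "b \<otimes>\<^bsub>B\<^esub> a \<in> h ` I" if b: "b \<in> carrier B"
  proof -
    have "h (g b \<otimes>\<^bsub>A\<^esub> x) = b \<otimes>\<^bsub>B\<^esub> a" unfolding h_mult[OF g(1)[OF b] xA] g(2)[OF b] x(2) ..
    moreover have "h (g b \<otimes>\<^bsub>A\<^esub> x) \<in> h ` I" by (rule imageI[OF ideal.I_l_closed[OF I x(1) g(1)[OF b]]])
    ultimately show ?thesis by simp
  qed
qed

lemma image_proper: "I \<subseteq> carrier A \<Longrightarrow> carrier A \<noteq> I \<Longrightarrow> carrier B \<noteq> h ` I"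
  using image_h image_carrier by (metis subset_refl)

lemma image_prime:
  assumes I: "primeideal I A" shows "primeideal (h ` I) B"
proof (rule primeidealI)
  have ii: "ideal I A" by (rule primeideal.axioms(1)[OF I])
  have IA: "I \<subseteq> carrier A" using ideal.Icarr[OF ii] by (rule subsetI)
  show "ideal (h ` I) B" by (rule image_ideal[OF ii])
  show "carrier B \<noteq> h ` I" by (rule image_proper[OF IA primeideal.I_notcarr[OF I]])
  fix a b assume ab: "a \<in> carrier B" "b \<in> carrier B" "a \<otimes>\<^bsub>B\<^esub> b \<in> h ` I"
  have "h (g a \<otimes>\<^bsub>A\<^esub> g b) = a \<otimes>\<^bsub>B\<^esub> b" unfolding h_mult[OF g(1)[OF ab(1)] g(1)[OF ab(2)]] g(2)[OF ab(1)] g(2)[OF ab(2)] ..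
  then have "h (g a \<otimes>\<^bsub>A\<^esub> g b) \<in> h ` I" using ab(3) by simp
  then have "g a \<otimes>\<^bsub>A\<^esub> g b \<in> I" using h_image_mem[OF IA A.m_closed[OF g(1)[OF ab(1)] g(1)[OF ab(2)]]] by simp
  then have "g a \<in> I \<or> g b \<in> I" by (rule primeideal.I_prime[OF I g(1)[OF ab(1)] g(1)[OF ab(2)]])
  then have "h (g a) \<in> h ` I \<or> h (g b) \<in> h ` I" by (elim disjE) (simp_all only: imageI simp_thms)
  then show "a \<in> h ` I \<or> b \<in> h ` I" unfolding g(2)[OF ab(1)] g(2)[OF ab(2)] .
qed (rule B.is_cring)

lemma image_maximal:
  assumes I: "maximalideal I A" shows "maximalideal (h ` I) B"
proof (rule maximalidealI)
  have ii: "ideal I A" by (rule maximalideal.axioms(1)[OF I])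
  have IA: "I \<subseteq> carrier A" using ideal.Icarr[OF ii] by (rule subsetI)
  show "ideal (h ` I) B" by (rule image_ideal[OF ii])
  show "carrier B \<noteq> h ` I" by (rule image_proper[OF IA maximalideal.I_notcarr[OF I]])
  fix J assume J: "ideal J B" "h ` I \<subseteq> J" "J \<subseteq> carrier B"
  have "ideal (g ` J) A" by (rule ring_isom.image_ideal[OF sym J(1)])
  moreover have "I \<subseteq> g ` J" using image_mono[OF J(2), of g] unfolding image_h[OF IA] .
  moreover have "g ` J \<subseteq> carrier A"
    by (rule image_subsetI) (rule g(1)[OF subsetD[OF J(3)]])
  ultimately have "g ` J = I \<or> g ` J = carrier A" by (rule maximalideal.I_maximal[OF I])
  then show "J = h ` I \<or> J = carrier B"
    using image_g[OF J(3)] image_carrier by metis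
qed

lemma krull_chain_sub:
  "{enat l | l. \<exists>P. (\<forall>i\<le>l. primeideal (P i) A) \<and> (\<forall>i<l. P i \<subset> P (Suc i))}
    \<subseteq> {enat l | l. \<exists>P. (\<forall>i\<le>l. primeideal (P i) B) \<and> (\<forall>i<l. P i \<subset> P (Suc i))}"
proof safe
  fix l and P :: "nat \<Rightarrow> 'a set"
  assume P: "\<forall>i\<le>l. primeideal (P i) A" "\<forall>i<l. P i \<subset> P (Suc i)"
  have sub: "P i \<subseteq> carrier A" if "i \<le> l" for i
    using ideal.Icarr[OF primeideal.axioms(1)[OF P(1)[rule_format, OF that]]] by (rule subsetI)
  have "h ` P i \<subset> h ` P (Suc i)" if i: "i < l" for i
  proof -
    have s: "P i \<subseteq> P (Suc i)" "P i \<noteq> P (Suc i)" using P(2) i by auto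
    have "h ` P i \<noteq> h ` P (Suc i)"
    proof
      assume e: "h ` P i = h ` P (Suc i)"
      have "P i = g ` (h ` P i)" by (rule image_h[OF sub, symmetric]) (use i in simp)
      also have "\<dots> = P (Suc i)" unfolding e by (rule image_h[OF sub]) (use i in simp)
      finally show False using s(2) by contradiction
    qed
    then show ?thesis using image_mono[OF s(1), of h] by (rule_tac psubsetI)
  qed
  moreover have "primeideal (h ` P i) B" if "i \<le> l" for i by (rule image_prime[OF P(1)[rule_format, OF that]])
  ultimately show "\<exists>l'. enat l = enat l' \<and> (\<exists>P. (\<forall>i\<le>l'. primeideal (P i) B) \<and> (\<forall>i<l'. P i \<subset> P (Suc i)))"
    by (intro exI[of _ l] conjI refl exI[of _ "\<lambda>i. h ` P i"]) simp_all
qed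

lemma krull_dim_eq: "krull_dim A = krull_dim B"
  unfolding krull_dim_def
  by (rule arg_cong[where f = Sup], rule equalityI, rule krull_chain_sub, rule ring_isom.krull_chain_sub[OF sym])

lemma noetherian_image:
  assumes "noetherian_ring A" shows "noetherian_ring B"
proof (rule B.noetherian_ringI)
  fix J assume J: "ideal J B"
  have JB: "J \<subseteq> carrier B" using ideal.Icarr[OF J] by (rule subsetI)
  have "ideal (g ` J) A" by (rule ring_isom.image_ideal[OF sym J])
  then obtain S where S: "S \<subseteq> carrier A" "finite S" "g ` J = Idl\<^bsub>A\<^esub> S"
    using noetherian_ring.finetely_gen[OF assms] by blast
  have sS: "h ` S \<subseteq> carrier B" using image_mono[OF S(1), of h] unfolding image_carrier .
  have "S \<subseteq> g ` J" unfolding S(3) by (rule A.genideal_self[OF S(1)])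
  then have "h ` S \<subseteq> J" using image_mono[of S "g ` J" h] unfolding image_g[OF JB] by simp
  then have 1: "Idl\<^bsub>B\<^esub> (h ` S) \<subseteq> J" by (rule B.genideal_minimal[OF J])
  note iK = B.genideal_ideal[OF sS]
  have KB: "Idl\<^bsub>B\<^esub> (h ` S) \<subseteq> carrier B" using ideal.Icarr[OF iK] by (rule subsetI)
  have "S = g ` h ` S" by (rule image_h[OF S(1), symmetric])
  also have "\<dots> \<subseteq> g ` (Idl\<^bsub>B\<^esub> (h ` S))" by (rule image_mono[OF B.genideal_self[OF sS]])
  finally have "Idl\<^bsub>A\<^esub> S \<subseteq> g ` (Idl\<^bsub>B\<^esub> (h ` S))" by (rule A.genideal_minimal[OF ring_isom.image_ideal[OF sym iK]])
  then have "h ` (g ` J) \<subseteq> h ` (g ` (Idl\<^bsub>B\<^esub> (h ` S)))" unfolding S(3)[symmetric] by (rule image_mono)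
  then have 2: "J \<subseteq> Idl\<^bsub>B\<^esub> (h ` S)" unfolding image_g[OF JB] image_g[OF KB] .
  show "\<exists>A\<subseteq>carrier B. finite A \<and> J = Idl\<^bsub>B\<^esub> A"
    using 1 2 sS finite_imageI[OF S(2), of h] by (intro exI[of _ "h ` S"] conjI equalityI)
qed

lemma noetherian_local_image:
  assumes "noetherian_local_ring A" shows "noetherian_local_ring B"
proof -
  have nl: "noetherian_ring A" "\<exists>!m. maximalideal m A"
    using assms unfolding noetherian_local_ring_def by simp_all
  obtain m where m: "maximalideal m A" "\<forall>I. maximalideal I A \<longrightarrow> I = m"
    using nl(2) by (elim ex1E) (rule that; assumption)
  have u: "I = h ` m" if I: "maximalideal I B" for I
  proof -
    have "g ` I = m" by (rule m(2)[rule_format, OF ring_isom.image_maximal[OF sym I]])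
    moreover have "I \<subseteq> carrier B" using ideal.Icarr[OF maximalideal.axioms(1)[OF I]] by (rule subsetI)
    ultimately show ?thesis using image_g[of I] by simp
  qed
  have "\<exists>!m. maximalideal m B"
  proof (rule ex1I)
    show "maximalideal (h ` m) B" by (rule image_maximal[OF m(1)])
  qed (rule u)
  then show ?thesis
    unfolding noetherian_local_ring_def by (intro conjI B.is_cring noetherian_image[OF nl(1)])
qed

lemma has_char_image:
  assumes "has_char A p" shows "has_char B p"
  unfolding has_char_def
proof
  fix n :: nat
  have "h ([n] \<cdot>\<^bsub>A\<^esub> \<one>\<^bsub>A\<^esub>) = [n] \<cdot>\<^bsub>B\<^esub> \<one>\<^bsub>B\<^esub>"
    by (induction n) (simp_all add: h_zero h_add h_one)
  then have "[n] \<cdot>\<^bsub>B\<^esub> \<one>\<^bsub>B\<^esub> = \<zero>\<^bsub>B\<^esub> \<longleftrightarrow> h ([n] \<cdot>\<^bsub>A\<^esub> \<one>\<^bsub>A\<^esub>) = h \<zero>\<^bsub>A\<^esub>" by (simp add: h_zero)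
  also have "\<dots> \<longleftrightarrow> [n] \<cdot>\<^bsub>A\<^esub> \<one>\<^bsub>A\<^esub> = \<zero>\<^bsub>A\<^esub>" by (rule h_inj) simp_all
  also have "\<dots> \<longleftrightarrow> p dvd n" using assms by (simp add: has_char_def)
  finally show "[n] \<cdot>\<^bsub>B\<^esub> \<one>\<^bsub>B\<^esub> = \<zero>\<^bsub>B\<^esub> \<longleftrightarrow> p dvd n" .
qed

text \<open>Forms are conjugated by the isomorphism; they stay linear because it commutes with q-th
  powers.\<close>

lemma frob_dual_image:
  assumes "frob_dual A q n" shows "frob_dual B q n"
proof -
  obtain e \<phi> where D: "\<forall>i<n. e i \<in> carrier A" "\<forall>i<n. \<forall>x\<in>carrier A. \<phi> i x \<in> carrier A"
    "\<forall>i<n. \<forall>x\<in>carrier A. \<forall>y\<in>carrier A. \<phi> i (x \<oplus>\<^bsub>A\<^esub> y) = \<phi> i x \<oplus>\<^bsub>A\<^esub> \<phi> i y"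
    "\<forall>i<n. \<forall>a\<in>carrier A. \<forall>x\<in>carrier A. \<phi> i (a [^]\<^bsub>A\<^esub> q \<otimes>\<^bsub>A\<^esub> x) = a \<otimes>\<^bsub>A\<^esub> \<phi> i x"
    "\<forall>i<n. \<forall>j<n. \<phi> i (e j) = (if i = j then \<one>\<^bsub>A\<^esub> else \<zero>\<^bsub>A\<^esub>)"
    using assms unfolding frob_dual_def by (elim exE conjE) (rule that; assumption)
  interpret g: ring_isom B A g by (rule sym)
  show ?thesis
    unfolding frob_dual_def
  proof (rule exI[of _ "\<lambda>i. h (e i)"], rule exI[of _ "\<lambda>i x. h (\<phi> i (g x))"], intro conjI allI impI ballI)
    fix i assume i: "i < n"
    show "h (e i) \<in> carrier B" by (rule closed[OF D(1)[rule_format, OF i]])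
    fix x assume x: "x \<in> carrier B"
    note px = D(2)[rule_format, OF i g(1)[OF x]]
    show "h (\<phi> i (g x)) \<in> carrier B" by (rule closed[OF px])
    fix y assume y: "y \<in> carrier B"
    show "h (\<phi> i (g (x \<oplus>\<^bsub>B\<^esub> y))) = h (\<phi> i (g x)) \<oplus>\<^bsub>B\<^esub> h (\<phi> i (g y))"
      unfolding g.h_add[OF x y] D(3)[rule_format, OF i g(1)[OF x] g(1)[OF y]]
      by (rule h_add[OF px D(2)[rule_format, OF i g(1)[OF y]]])
  next
    fix i a x assume i: "i < n" and a: "a \<in> carrier B" and x: "x \<in> carrier B"
    show "h (\<phi> i (g (a [^]\<^bsub>B\<^esub> q \<otimes>\<^bsub>B\<^esub> x))) = a \<otimes>\<^bsub>B\<^esub> h (\<phi> i (g x))"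
      unfolding g.h_mult[OF B.nat_pow_closed[OF a] x] g.h_pow[OF a] D(4)[rule_format, OF i g(1)[OF a] g(1)[OF x]]
        h_mult[OF g(1)[OF a] D(2)[rule_format, OF i g(1)[OF x]]] g(2)[OF a] ..
  next
    fix i j assume ij: "i < n" "j < n"
    show "h (\<phi> i (g (h (e j)))) = (if i = j then \<one>\<^bsub>B\<^esub> else \<zero>\<^bsub>B\<^esub>)"
      unfolding g(3)[OF D(1)[rule_format, OF ij(2)]] D(5)[rule_format, OF ij] by (simp add: h_one h_zero)
  qed
qed

lemma frob_dual_eq: "frob_dual A q n \<longleftrightarrow> frob_dual B q n"
  using frob_dual_image ring_isom.frob_dual_image[OF sym] by blast

lemma F_finite_image:
  assumes "F_finite p A" shows "F_finite p B"
proof -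
  obtain S where S: "S \<subseteq> carrier A" "finite S"
    and gen: "\<And>x. x \<in> carrier A \<Longrightarrow> \<exists>c\<in>S \<rightarrow> carrier A. x = (\<Oplus>\<^bsub>A\<^esub>b\<in>S. c b [^]\<^bsub>A\<^esub> (p ^ 1) \<otimes>\<^bsub>A\<^esub> b)"
    using assms unfolding F_finite_def finitely_generated_module_def finsum_frobenius_module frob_simps by (elim exE conjE) simp
  have inj: "inj_on h S" using bij_betw_imp_inj_on[OF bij] S(1) by (rule inj_on_subset)
  show ?thesis
    unfolding F_finite_def finitely_generated_module_def finsum_frobenius_module frob_simps
  proof (intro exI[of _ "h ` S"] conjI ballI)
    show "h ` S \<subseteq> carrier B" using image_mono[OF S(1), of h] unfolding image_carrier .
    show "finite (h ` S)" by (rule finite_imageI[OF S(2)])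
    fix y assume y: "y \<in> carrier B"
    obtain c where c: "c \<in> S \<rightarrow> carrier A" "g y = (\<Oplus>\<^bsub>A\<^esub>b\<in>S. c b [^]\<^bsub>A\<^esub> (p ^ 1) \<otimes>\<^bsub>A\<^esub> b)"
      using gen[OF g(1)[OF y]] by (elim bexE)
    have cc: "c b \<in> carrier A" "b \<in> carrier A" if "b \<in> S" for b
      using c(1) S(1) that by auto
    let ?d = "\<lambda>z. h (c (g z))"
    have gh: "g (h b) = b" if "b \<in> S" for b by (rule g(3)[OF cc(2)[OF that]])
    have "y = h (g y)" by (rule g(2)[OF y, symmetric])
    also have "\<dots> = (\<Oplus>\<^bsub>B\<^esub>b\<in>S. h (c b [^]\<^bsub>A\<^esub> (p ^ 1) \<otimes>\<^bsub>A\<^esub> b))"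
      unfolding c(2) by (rule h_finsum[OF S(2)]) (use cc in simp)
    also have "\<dots> = (\<Oplus>\<^bsub>B\<^esub>b\<in>S. ?d (h b) [^]\<^bsub>B\<^esub> (p ^ 1) \<otimes>\<^bsub>B\<^esub> h b)"
    proof (rule B.finsum_cong'[OF refl])
      fix b assume b: "b \<in> S"
      show "h (c b [^]\<^bsub>A\<^esub> (p ^ 1) \<otimes>\<^bsub>A\<^esub> b) = ?d (h b) [^]\<^bsub>B\<^esub> (p ^ 1) \<otimes>\<^bsub>B\<^esub> h b"
        unfolding gh[OF b] h_mult[OF A.nat_pow_closed[OF cc(1)[OF b]] cc(2)[OF b]] h_pow[OF cc(1)[OF b]] ..
    next
      show "(\<lambda>b. ?d (h b) [^]\<^bsub>B\<^esub> (p ^ 1) \<otimes>\<^bsub>B\<^esub> h b) \<in> S \<rightarrow> carrier B"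
        using cc gh closed by simp
    qed
    also have "\<dots> = (\<Oplus>\<^bsub>B\<^esub>z\<in>h ` S. ?d z [^]\<^bsub>B\<^esub> (p ^ 1) \<otimes>\<^bsub>B\<^esub> z)"
    proof (rule B.finsum_reindex[OF _ inj, symmetric], rule Pi_I)
      fix z assume "z \<in> h ` S"
      then obtain b where b: "b \<in> S" "z = h b" by (rule imageE)
      show "?d z [^]\<^bsub>B\<^esub> (p ^ 1) \<otimes>\<^bsub>B\<^esub> z \<in> carrier B"
        unfolding b(2) gh[OF b(1)] using closed[OF cc(1)[OF b(1)]] closed[OF cc(2)[OF b(1)]] by simp
    qed
    finally have e: "y = (\<Oplus>\<^bsub>B\<^esub>z\<in>h ` S. ?d z [^]\<^bsub>B\<^esub> (p ^ 1) \<otimes>\<^bsub>B\<^esub> z)" .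
    have "?d \<in> h ` S \<rightarrow> carrier B"
    proof (rule Pi_I)
      fix z assume "z \<in> h ` S"
      then obtain b where b: "b \<in> S" "z = h b" by (rule imageE)
      show "?d z \<in> carrier B" unfolding b(2) gh[OF b(1)] by (rule closed[OF cc(1)[OF b(1)]])
    qed
    with e show "\<exists>c\<in>h ` S \<rightarrow> carrier B. y = (\<Oplus>\<^bsub>B\<^esub>z\<in>h ` S. c z [^]\<^bsub>B\<^esub> (p ^ 1) \<otimes>\<^bsub>B\<^esub> z)"
      by (rule bexI)
  qed
qed

end

lemma max_free_rank_eqI:
  assumes "cring A" "Factorial_Ring.prime p" "[p] \<cdot>\<^bsub>A\<^esub> \<one>\<^bsub>A\<^esub> = \<zero>\<^bsub>A\<^esub>"
    and "frob_dual A (p ^ e) N" "\<And>n. frob_dual A (p ^ e) n \<Longrightarrow> n \<le> N"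
  shows "max_free_rank A (frobenius_module p e A) = N"
proof -
  interpret cring A by fact
  show ?thesis
    unfolding max_free_rank_def
  proof (rule Greatest_equality)
    show "has_free_summand A (frobenius_module p e A) N"
      by (rule dual_imp_free_summand[OF assms(2,3,4)])
    fix n assume "has_free_summand A (frobenius_module p e A) n"
    then show "n \<le> N" by (rule assms(5)[OF free_summand_imp_dual])
  qed
qed

text \<open>A surjection onto a field has a maximal kernel, and in a local ring this is the ideal
  selected by \<open>residue_field\<close>. So the residue field is K up to isomorphism, and the
  degree over p-th powers is carried along.\<close>

lemma frobenius_alpha_eqI:
  assumes A: "noetherian_local_ring A" and K: "field K" and hom: "ring_hom_ring A K \<theta>"
    and surj: "\<theta> ` carrier A = carrier K" and p: "Factorial_Ring.prime p" "[p] \<cdot>\<^bsub>K\<^esub> \<one>\<^bsub>K\<^esub> = \<zero>\<^bsub>K\<^esub>"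
    and fd: "ring.finite_dimension K (pth_powers p K) (carrier K)"
  shows "frobenius_alpha p A = log (real p) (real (ring.dim K (pth_powers p K) (carrier K)))"
proof -
  interpret A: cring A using A by (simp add: noetherian_local_ring_def)
  interpret K: field K by fact
  interpret \<theta>: ring_hom_ring A K \<theta> by fact
  let ?m = "a_kernel A K \<theta>"
  interpret m: ideal ?m A by (rule \<theta>.kernel_is_ideal)
  have mem: "x \<in> ?m \<longleftrightarrow> x \<in> carrier A \<and> \<theta> x = \<zero>\<^bsub>K\<^esub>" for x
    unfolding a_kernel_def' by (rule mem_Collect_eq)
  have max: "maximalideal ?m A"
  proof (rule maximalidealI[OF m.is_ideal])
    show "carrier A \<noteq> ?m"
    proof
      assume e: "carrier A = ?m"
      have "\<one>\<^bsub>A\<^esub> \<in> ?m" unfolding e[symmetric] by (rule A.one_closed)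
      then have "\<theta> \<one>\<^bsub>A\<^esub> = \<zero>\<^bsub>K\<^esub>" unfolding mem by (rule conjunct2)
      then show False unfolding \<theta>.hom_one using K.one_not_zero by contradiction
    qed
    fix I assume I: "ideal I A" "?m \<subseteq> I" "I \<subseteq> carrier A"
    show "I = ?m \<or> I = carrier A"
    proof (cases "I = ?m")
      case False
      then obtain x where x: "x \<in> I" "x \<notin> ?m" using I(2) by blast
      have xA: "x \<in> carrier A" by (rule subsetD[OF I(3) x(1)])
      have tx: "\<theta> x \<in> carrier K" "\<theta> x \<noteq> \<zero>\<^bsub>K\<^esub>" using x(2) xA by (simp_all add: mem)
      then have u: "\<theta> x \<in> Units K" by (simp add: K.field_Units)
      have "inv\<^bsub>K\<^esub> (\<theta> x) \<in> \<theta> ` carrier A" unfolding surj by (rule K.Units_inv_closed[OF u])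
      then obtain y where y: "inv\<^bsub>K\<^esub> (\<theta> x) = \<theta> y" "y \<in> carrier A" by (rule imageE)
      have inv: "\<theta> y \<otimes>\<^bsub>K\<^esub> \<theta> x = \<one>\<^bsub>K\<^esub>" unfolding y(1)[symmetric] by (rule K.Units_l_inv[OF u])
      have yx: "y \<otimes>\<^bsub>A\<^esub> x \<in> I" by (rule ideal.I_l_closed[OF I(1) x(1) y(2)])
      have "\<theta> (\<one>\<^bsub>A\<^esub> \<ominus>\<^bsub>A\<^esub> y \<otimes>\<^bsub>A\<^esub> x) = \<zero>\<^bsub>K\<^esub>"
        using xA y(2) by (simp add: a_minus_def inv K.r_neg)
      then have "\<one>\<^bsub>A\<^esub> \<ominus>\<^bsub>A\<^esub> y \<otimes>\<^bsub>A\<^esub> x \<in> ?m" using xA y(2) by (simp add: mem)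
      then have "\<one>\<^bsub>A\<^esub> \<ominus>\<^bsub>A\<^esub> y \<otimes>\<^bsub>A\<^esub> x \<in> I" by (rule subsetD[OF I(2)])
      then have "(\<one>\<^bsub>A\<^esub> \<ominus>\<^bsub>A\<^esub> y \<otimes>\<^bsub>A\<^esub> x) \<oplus>\<^bsub>A\<^esub> y \<otimes>\<^bsub>A\<^esub> x \<in> I"
        by (rule additive_subgroup.a_closed[OF ideal.axioms(1)[OF I(1)] _ yx])
      moreover have "(\<one>\<^bsub>A\<^esub> \<ominus>\<^bsub>A\<^esub> y \<otimes>\<^bsub>A\<^esub> x) \<oplus>\<^bsub>A\<^esub> y \<otimes>\<^bsub>A\<^esub> x = \<one>\<^bsub>A\<^esub>"
        using xA y(2) by (simp add: a_minus_def A.a_assoc A.l_neg)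
      ultimately have "\<one>\<^bsub>A\<^esub> \<in> I" by simp
      then show ?thesis by (rule disjI2[OF ideal.one_imp_carrier[OF I(1)]])
    qed simp
  qed
  have hiso: "(\<lambda>Z. the_elem (\<theta> ` Z)) \<in> ring_iso (A Quot ?m) K"
    by (rule \<theta>.FactRing_iso_set[OF surj])
  have Qc: "cring (A Quot ?m)" by (rule m.quotient_is_cring[OF A.is_cring])
  interpret I: ring_isom "A Quot ?m" K "\<lambda>Z. the_elem (\<theta> ` Z)"
    by (intro ring_isom.intro ring_isom_axioms.intro Qc K.is_cring hiso)
  interpret J: ring_isom K "A Quot ?m" I.g by (rule I.sym)
  have ex: "\<exists>!m. maximalideal m A" using A by (simp add: noetherian_local_ring_def)
  have "(THE m. maximalideal m A) = ?m" by (rule the1_equality[OF ex max])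
  then have rf: "residue_field A = A Quot ?m" by (simp add: residue_field_def)
  \<comment> \<open>Dimensions are pushed forward along an injective homomorphism, so the inverse
    isomorphism, starting from K, is the one to use.\<close>
  interpret Jh: ring_hom_ring K "A Quot ?m" I.g by (rule J.hom)
  have sf: "subfield (pth_powers p K) K" by (rule K.pth_powers_subfield(1)[OF p])
  have dm: "K.dimension (K.dim (pth_powers p K) (carrier K)) (pth_powers p K) (carrier K)"
    using K.finite_dimensionE[OF sf fd] by (simp add: over_def)
  have nz: "\<one>\<^bsub>A Quot ?m\<^esub> \<noteq> \<zero>\<^bsub>A Quot ?m\<^esub>"
  proof
    assume "\<one>\<^bsub>A Quot ?m\<^esub> = \<zero>\<^bsub>A Quot ?m\<^esub>"
    then have "I.g \<one>\<^bsub>K\<^esub> = I.g \<zero>\<^bsub>K\<^esub>" by (simp only: J.h_one J.h_zero)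
    then have "\<one>\<^bsub>K\<^esub> = \<zero>\<^bsub>K\<^esub>" using J.h_inj[OF K.one_closed K.zero_closed] by simp
    then show False using K.one_not_zero by contradiction
  qed
  have dim2: "ring.dimension (A Quot ?m) (K.dim (pth_powers p K) (carrier K)) (I.g ` pth_powers p K) (I.g ` carrier K)"
    by (rule Jh.inj_hom_dimension[OF sf nz bij_betw_imp_inj_on[OF J.bij] dm])
  have pw: "I.g ` pth_powers p K = pth_powers p (A Quot ?m)"
  proof -
    have "I.g ` pth_powers p K = (\<lambda>x. I.g x [^]\<^bsub>A Quot ?m\<^esub> p) ` carrier K"
      unfolding pth_powers_def image_image by (rule image_cong[OF refl J.h_pow])
    also have "\<dots> = (\<lambda>x. x [^]\<^bsub>A Quot ?m\<^esub> p) ` (I.g ` carrier K)" by (simp only: image_image)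
    finally show ?thesis unfolding J.image_carrier pth_powers_def .
  qed
  have sf2: "subfield (pth_powers p (A Quot ?m)) (A Quot ?m)"
    unfolding pw[symmetric] by (rule Jh.img_is_subfield(2)[OF sf nz])
  have dim3: "ring.dimension (A Quot ?m) (K.dim (pth_powers p K) (carrier K)) (pth_powers p (A Quot ?m)) (carrier (A Quot ?m))"
    using dim2 unfolding pw J.image_carrier .
  have "ring.dim (A Quot ?m) (pth_powers p (A Quot ?m)) (carrier (A Quot ?m)) = K.dim (pth_powers p K) (carrier K)"
    using I.A.dimI[OF sf2 dim3] by (simp add: over_def)
  then show ?thesis by (simp add: frobenius_alpha_def Let_def rf)
qed

section \<open>Prime ideals of faces\<close>

text \<open>For a face, cutting a series down to exponents in the face is compatible with products,
  because a sum lies in the face only if both summands do. The ideal is the kernel of this map, and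
  its target, the series ring of the face, is a domain.\<close>

lemma (in field_series) face_prime:
  assumes Fc: "Fc \<subseteq> P" "{#} \<in> Fc" "\<And>a b. a \<in> P \<Longrightarrow> b \<in> P \<Longrightarrow> a + b \<in> Fc \<longleftrightarrow> a \<in> Fc \<and> b \<in> Fc"
  shows "primeideal {F \<in> carrier B. \<forall>m\<in>Fc. F m = \<zero>} B"
proof -
  let ?I = "{F \<in> carrier B. \<forall>m\<in>Fc. F m = \<zero>}"
  have PF: "a \<in> P" if "a \<in> Fc" for a using Fc(1) that by blast
  interpret Q: field_series R Fc J
  proof unfold_locales
    show "{#} \<in> Fc" by (rule Fc(2))
    show "a + b \<in> Fc" if "a \<in> Fc" "b \<in> Fc" for a b using Fc(3)[OF PF[OF that(1)] PF[OF that(2)]] that by simp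
    show "finite J" by (rule finite_J)
    show "set_mset m \<subseteq> J" if "m \<in> Fc" for m by (rule P_sub[OF PF[OF that]])
  qed
  define \<rho> where "\<rho> F = (\<lambda>m. if m \<in> Fc then F m else \<zero>)" for F :: "'i multiset \<Rightarrow> 'a"
  have \<rho>c: "\<rho> F \<in> carrier Q.B" if "F \<in> carrier B" for F
    unfolding Q.carrier_B using coeff_closed[OF that] by (simp add: \<rho>_def)
  have mul: "(\<rho> F \<otimes>\<^bsub>Q.B\<^esub> \<rho> G) m = (F \<otimes>\<^bsub>B\<^esub> G) m" if F: "F \<in> carrier B" and G: "G \<in> carrier B" and m: "m \<in> Fc" for F G m
    unfolding Q.mult_apply' mult_apply'
  proof (rule finsum_cong'[OF refl])
    fix a assume a: "a \<in> {a. a \<subseteq># m}"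
    show "\<rho> F a \<otimes> \<rho> G (m - a) = F a \<otimes> G (m - a)"
    proof (cases "a \<in> P \<and> m - a \<in> P")
      case True
      then have "a \<in> Fc" "m - a \<in> Fc" using Fc(3)[of a "m - a"] a m by simp_all
      then show ?thesis by (simp add: \<rho>_def)
    next
      case False
      then have "F a = \<zero> \<or> G (m - a) = \<zero>" using coeff_outside[OF F] coeff_outside[OF G] by blast
      then show ?thesis using coeff_closed[OF F] coeff_closed[OF G] by (auto simp: \<rho>_def)
    qed
  qed (simp add: coeff_closed[OF F] coeff_closed[OF G])
  have idl: "ideal ?I B"
  proof (rule B.idealI_cring)
    show "\<zero>\<^bsub>B\<^esub> \<in> ?I" by simp
    fix F assume F: "F \<in> ?I"
    then have FB: "F \<in> carrier B" by simp
    show "F \<oplus>\<^bsub>B\<^esub> G \<in> ?I" if "G \<in> ?I" for G using F that by simp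
    show "G \<otimes>\<^bsub>B\<^esub> F \<in> ?I" if G: "G \<in> carrier B" for G
    proof -
      have "(G \<otimes>\<^bsub>B\<^esub> F) m = \<zero>" if m: "m \<in> Fc" for m
        unfolding mult_apply'
      proof (rule finsum_all_zero)
        fix a assume a: "a \<in> {a. a \<subseteq># m}"
        show "G a \<otimes> F (m - a) = \<zero>"
        proof (cases "a \<in> P \<and> m - a \<in> P")
          case True
          then have "m - a \<in> Fc" using Fc(3)[of a "m - a"] a m by simp
          then show ?thesis using F coeff_closed[OF G] by simp
        next
          case False
          then have "G a = \<zero> \<or> F (m - a) = \<zero>" using coeff_outside[OF FB] coeff_outside[OF G] by blast
          then show ?thesis using coeff_closed[OF FB] coeff_closed[OF G] by auto
        qed
      qed
      then show ?thesis using mult_closed_B[OF G FB] by simp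
    qed
  qed simp
  show ?thesis
  proof (rule primeidealI[OF idl B.is_cring])
    show "carrier B \<noteq> ?I"
    proof
      assume e: "carrier B = ?I"
      have "\<one>\<^bsub>B\<^esub> \<in> ?I" unfolding e[symmetric] by (rule one_in_B)
      then have "\<one>\<^bsub>B\<^esub> {#} = \<zero>" using Fc(2) by simp
      then show False by (simp add: one_apply)
    qed
    fix F G assume F: "F \<in> carrier B" and G: "G \<in> carrier B" and FG: "F \<otimes>\<^bsub>B\<^esub> G \<in> ?I"
    have "\<rho> F \<otimes>\<^bsub>Q.B\<^esub> \<rho> G = \<zero>\<^bsub>Q.B\<^esub>"
    proof
      fix m
      show "(\<rho> F \<otimes>\<^bsub>Q.B\<^esub> \<rho> G) m = \<zero>\<^bsub>Q.B\<^esub> m"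
      proof (cases "m \<in> Fc")
        case True
        then show ?thesis using mul[OF F G True] FG by simp
      next
        case False
        then show ?thesis using Q.coeff_outside[OF Q.mult_closed_B[OF \<rho>c[OF F] \<rho>c[OF G]]] by simp
      qed
    qed
    then have "\<rho> F = \<zero>\<^bsub>Q.B\<^esub> \<or> \<rho> G = \<zero>\<^bsub>Q.B\<^esub>"
      by (rule domain.integral[OF Q.B_domain _ \<rho>c[OF F] \<rho>c[OF G]])
    moreover have "H \<in> ?I" if "H \<in> carrier B" "\<rho> H = \<zero>\<^bsub>Q.B\<^esub>" for H
    proof -
      have "H m = \<zero>" if "m \<in> Fc" for m
        using fun_cong[OF \<open>\<rho> H = \<zero>\<^bsub>Q.B\<^esub>\<close>, of m] that by (simp add: \<rho>_def)
      then show ?thesis using that(1) by simp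
    qed
    ultimately show "F \<in> ?I \<or> G \<in> ?I" using F G by blast
  qed
qed


section \<open>The exponent monoid of the hypersurface\<close>

definition mk :: "'i set \<Rightarrow> ('i \<Rightarrow> nat) \<Rightarrow> 'i multiset" where
  "mk A f = (\<Sum>x\<in>A. replicate_mset (f x) x)"

lemma count_mk: "finite A \<Longrightarrow> count (mk A f) x = (if x \<in> A then f x else 0)"
  by (simp add: mk_def count_sum sum.delta')

lemma set_mk: "finite A \<Longrightarrow> set_mset (mk A f) \<subseteq> A"
proof
  fix x assume A: "finite A" and "x \<in># mk A f"
  then have "count (mk A f) x \<noteq> 0" by simp
  then show "x \<in> A" unfolding count_mk[OF A] by (rule contrapos_np) simp
qed

text \<open>
  The variables \<open>x\<^sub>j\<close>, \<open>u\<close>, \<open>v\<close> are realised in the power series ring in \<open>y\<^sub>k\<close>, \<open>0 < \<bar>k\<bar> \<le> n\<close>, as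
  \<open>y\<^sub>jy\<^sub>-\<^sub>j\<close>, \<open>\<Prod>y\<^sub>j^d\<^sub>j\<close> and \<open>\<Prod>y\<^sub>-\<^sub>j^d\<^sub>j\<close>, so that \<open>uv = \<Prod>x\<^sub>j^d\<^sub>j\<close>. The exponent \<open>expo i \<alpha>\<close> is that of \<open>x^\<alpha> u^i\<close> for
  \<open>i \<ge> 0\<close> and of \<open>x^\<alpha> v^(-i)\<close> for \<open>i \<le> 0\<close>. The monoid is cut out by divisibility-closed conditions, which is
  what the division algorithm needs.
\<close>

locale star_exponents =
  fixes n :: nat and d :: "nat \<Rightarrow> nat"
  assumes n: "n \<ge> 1" and d: "\<And>j. j \<in> {1..n} \<Longrightarrow> d j > 0"
begin

definition vars :: "int set" where
  "vars = {k. k \<noteq> 0 \<and> nat \<bar>k\<bar> \<le> n}"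

text \<open>The exponent of \<open>y_k\<close> minus that of \<open>y_-k\<close> in the monomial
  realising u.\<close>

definition dl :: "int \<Rightarrow> int" where
  "dl k = sgn k * int (d (nat \<bar>k\<bar>))"

definition PP :: "int multiset set" where
  "PP = {m. set_mset m \<subseteq> vars \<and> (\<exists>i. \<forall>k\<in>vars. int (count m k) - int (count m (-k)) = i * dl k)}"

definition expo :: "int \<Rightarrow> (nat \<Rightarrow> nat) \<Rightarrow> int multiset" where
  "expo i \<alpha> = mk vars (\<lambda>k. nat (i * dl k) + \<alpha> (nat \<bar>k\<bar>))"

lemma finite_vars: "finite vars"
  by (rule finite_subset[of _ "{- int n..int n}"]) (auto simp: vars_def)

lemma vars: "k \<in> vars \<Longrightarrow> nat \<bar>k\<bar> \<in> {1..n}" "k \<in> vars \<Longrightarrow> - k \<in> vars"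
  by (auto simp: vars_def)

lemma int_vars: "j \<in> {1..n} \<Longrightarrow> int j \<in> vars" "j \<in> {1..n} \<Longrightarrow> - int j \<in> vars"
  by (auto simp: vars_def)

lemma dl_minus: "dl (- k) = - dl k"
  by (simp add: dl_def sgn_minus)

lemma dl_int: "j \<in> {1..n} \<Longrightarrow> dl (int j) = int (d j)" "j \<in> {1..n} \<Longrightarrow> dl (- int j) = - int (d j)"
  by (auto simp: dl_def)

lemma dl_abs: "k \<in> vars \<Longrightarrow> \<bar>dl k\<bar> = int (d (nat \<bar>k\<bar>))"
  by (simp add: dl_def abs_mult vars_def abs_sgn_eq)

lemma count_expo: "k \<in> vars \<Longrightarrow> count (expo i \<alpha>) k = nat (i * dl k) + \<alpha> (nat \<bar>k\<bar>)"
  by (simp add: expo_def count_mk finite_vars)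

lemma count_expo_out: "k \<notin> vars \<Longrightarrow> count (expo i \<alpha>) k = 0"
  by (simp add: expo_def count_mk finite_vars)

lemma expo_in: "expo i \<alpha> \<in> PP"
proof -
  have "int (count (expo i \<alpha>) k) - int (count (expo i \<alpha>) (- k)) = i * dl k" if "k \<in> vars" for k
    using that vars(2)[OF that] by (simp add: count_expo dl_minus)
  moreover have "set_mset (expo i \<alpha>) \<subseteq> vars" unfolding expo_def by (rule set_mk[OF finite_vars])
  ultimately show ?thesis unfolding PP_def mem_Collect_eq by (intro conjI exI[of _ i] ballI)
qed

lemma PP_expo:
  assumes "m \<in> PP" obtains i \<alpha> where "m = expo i \<alpha>"
proof -
  obtain i where i: "\<And>k. k \<in> vars \<Longrightarrow> int (count m k) - int (count m (-k)) = i * dl k" "set_mset m \<subseteq> vars"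
    using assms unfolding PP_def mem_Collect_eq by (elim conjE exE) (rule that, erule (1) bspec)
  have aux: "a = nat x + min a b" if "int a - int b = x" for a b x using that by auto
  \<comment> \<open>The largest power of \<open>x_j = y_j y_-j\<close> dividing the monomial; after
    removing these, a pure power of u or of v remains.\<close>
  define \<alpha> where "\<alpha> j = min (count m (int j)) (count m (- int j))" for j
  have "m = expo i \<alpha>"
  proof (rule multiset_eqI)
    fix k
    show "count m k = count (expo i \<alpha>) k"
    proof (cases "k \<in> vars")
      case True
      have "\<alpha> (nat \<bar>k\<bar>) = min (count m k) (count m (- k))"
        by (cases "k \<ge> 0") (auto simp: \<alpha>_def min.commute)
      then show ?thesis unfolding count_expo[OF True] using aux[OF i(1)[OF True]] by simp
    next
      case False
      then have "k \<notin># m" using i(2) by blast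
      then show ?thesis by (simp add: count_expo_out[OF False] not_in_iff)
    qed
  qed
  then show thesis by (rule that)
qed

lemma expo_eq_iff: "expo i \<alpha> = expo i' \<beta> \<longleftrightarrow> i = i' \<and> (\<forall>j\<in>{1..n}. \<alpha> j = \<beta> j)"
proof
  assume e: "expo i \<alpha> = expo i' \<beta>"
  have c: "nat (i * dl k) + \<alpha> (nat \<bar>k\<bar>) = nat (i' * dl k) + \<beta> (nat \<bar>k\<bar>)" if "k \<in> vars" for k
    using arg_cong[OF e, of "\<lambda>m. count m k"] that by (simp add: count_expo)
  have ii: "i = i'"
  proof -
    have 1: "1 \<in> {1..n}" using n by simp
    have aux: "x = y" if "nat x + a = nat y + b" "nat (- x) + a = nat (- y) + b" for x y :: int and a b using that by linarith
    have "i * dl (int 1) = i' * dl (int 1)"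
      by (rule aux[OF c[OF int_vars(1)[OF 1]]]) (use c[OF int_vars(2)[OF 1]] in \<open>simp add: dl_minus\<close>)
    then have "i * int (d 1) = i' * int (d 1)" unfolding dl_int(1)[OF 1] .
    then show ?thesis using d[OF 1] by simp
  qed
  moreover have "\<alpha> j = \<beta> j" if "j \<in> {1..n}" for j
    using c[OF int_vars(1)[OF that]] ii by simp
  ultimately show "i = i' \<and> (\<forall>j\<in>{1..n}. \<alpha> j = \<beta> j)" by blast
next
  assume e: "i = i' \<and> (\<forall>j\<in>{1..n}. \<alpha> j = \<beta> j)"
  show "expo i \<alpha> = expo i' \<beta>"
  proof (rule multiset_eqI)
    fix k show "count (expo i \<alpha>) k = count (expo i' \<beta>) k"
      by (cases "k \<in> vars") (use e vars(1) in \<open>auto simp: count_expo count_expo_out\<close>)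
  qed
qed

text \<open>The indices must not have opposite signs: otherwise u meets v, and the product uv turns
  into powers of the x_j.\<close>

lemma expo_add:
  assumes "i * i' \<ge> 0"
  shows "expo i \<alpha> + expo i' \<beta> = expo (i + i') (\<lambda>j. \<alpha> j + \<beta> j)"
proof (rule multiset_eqI)
  fix k
  have "nat (i * x) + nat (i' * x) = nat ((i + i') * x)" for x
  proof -
    have "i \<ge> 0 \<and> i' \<ge> 0 \<or> i \<le> 0 \<and> i' \<le> 0" using assms by (auto simp: zero_le_mult_iff)
    then have "(i * x \<ge> 0 \<and> i' * x \<ge> 0) \<or> (i * x \<le> 0 \<and> i' * x \<le> 0)"
      by (cases "x \<ge> 0") (auto simp: mult_nonneg_nonneg mult_nonpos_nonneg mult_nonneg_nonpos mult_nonpos_nonpos)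
    then show ?thesis by (auto simp: distrib_right nat_add_distrib)
  qed
  then show "count (expo i \<alpha> + expo i' \<beta>) k = count (expo (i + i') (\<lambda>j. \<alpha> j + \<beta> j)) k"
    by (cases "k \<in> vars") (simp_all add: count_expo count_expo_out)
qed

lemma expo_repeat: "repeat_mset q (expo i \<alpha>) = expo (int q * i) (\<lambda>j. q * \<alpha> j)"
proof (rule multiset_eqI)
  fix k
  have "q * nat x = nat (int q * x)" for x by (simp add: nat_mult_distrib)
  then show "count (repeat_mset q (expo i \<alpha>)) k = count (expo (int q * i) (\<lambda>j. q * \<alpha> j)) k"
    by (cases "k \<in> vars") (simp_all add: count_expo count_expo_out distrib_left mult.assoc)
qed

lemma PP_add: assumes "a \<in> PP" "b \<in> PP" shows "a + b \<in> PP"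
proof -
  obtain i i' where i: "\<forall>k\<in>vars. int (count a k) - int (count a (-k)) = i * dl k"
    "\<forall>k\<in>vars. int (count b k) - int (count b (-k)) = i' * dl k" using assms by (auto simp: PP_def)
  have "\<forall>k\<in>vars. int (count (a + b) k) - int (count (a + b) (-k)) = (i + i') * dl k"
  proof
    fix k assume "k \<in> vars"
    with i[rule_format, of k] show "int (count (a + b) k) - int (count (a + b) (-k)) = (i + i') * dl k"
      by (simp add: distrib_right)
  qed
  then show ?thesis using assms by (auto simp: PP_def)
qed

lemma PP_diff: assumes "a \<in> PP" "b \<in> PP" "a \<subseteq># b" shows "b - a \<in> PP"
proof -
  obtain i i' where i: "\<forall>k\<in>vars. int (count a k) - int (count a (-k)) = i * dl k"
    "\<forall>k\<in>vars. int (count b k) - int (count b (-k)) = i' * dl k" using assms by (auto simp: PP_def)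
  have c: "int (count (b - a) k) = int (count b k) - int (count a k)" for k
    using assms(3) by (simp add: subseteq_mset_def of_nat_diff)
  have "\<forall>k\<in>vars. int (count (b - a) k) - int (count (b - a) (-k)) = (i' - i) * dl k"
  proof
    fix k assume "k \<in> vars"
    with i[rule_format, of k] show "int (count (b - a) k) - int (count (b - a) (-k)) = (i' - i) * dl k"
      unfolding c by (simp add: left_diff_distrib)
  qed
  moreover have "set_mset (b - a) \<subseteq> vars" using assms(2) set_mset_mono[OF diff_subset_eq_self, of b a] by (auto simp: PP_def)
  ultimately show ?thesis by (auto simp: PP_def)
qed

lemma PP_empty: "{#} \<in> PP"
  by (auto simp: PP_def intro: exI[of _ 0])

lemma full_series_PP: "field K \<Longrightarrow> full_series K PP vars"
proof -
  assume K: "field K"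
  interpret field K by fact
  show ?thesis
    by unfold_locales (auto simp: PP_empty PP_add PP_diff finite_vars, auto simp: PP_def)
qed

text \<open>Parameters (i, \<alpha>) for counting exponents. \<open>expo\<close> sees \<alpha> only
  on \<open>{1..n}\<close>, so extensional functions are taken to make the parametrisation
  injective.\<close>

definition box :: "(int \<Rightarrow> nat \<Rightarrow> nat) \<Rightarrow> nat \<Rightarrow> (int \<times> (nat \<Rightarrow> nat)) set" where
  "box b k = (SIGMA i:{- int k<..<int k}. PiE {1..n} (\<lambda>j. {..<b i j}))"

lemma finite_box: "finite (box b k)"
  unfolding box_def by (intro finite_SigmaI finite_PiE) auto

lemma card_box: "card (box b k) = (\<Sum>i\<in>{- int k<..<int k}. \<Prod>j=1..n. b i j)"
  unfolding box_def by (subst card_SigmaI) (auto simp: card_PiE intro!: finite_PiE)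

lemma expo_restrict: "expo i \<alpha> = expo i (restrict \<alpha> {1..n})"
  by (simp add: expo_eq_iff)

lemma box_inj: "inj_on (\<lambda>(i, \<alpha>). expo i \<alpha>) (box b k)"
proof (rule inj_onI, clarify)
  fix i \<alpha> i' \<beta> assume *: "(i, \<alpha>) \<in> box b k" "(i', \<beta>) \<in> box b k" "expo i \<alpha> = expo i' \<beta>"
  then have "i = i'" "\<forall>j\<in>{1..n}. \<alpha> j = \<beta> j" by (auto simp: expo_eq_iff)
  moreover have "\<alpha> = \<beta>"
    by (rule PiE_ext[of \<alpha> "{1..n}" "\<lambda>j. {..<b i j}" \<beta>]) (use * calculation in \<open>auto simp: box_def\<close>)
  ultimately show "i = i' \<and> \<alpha> = \<beta>" by blast
qed

text \<open>The larger of the multiplicities of \<open>y_j\<close> and \<open>y_-j\<close> is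
  \<bar>i\<bar> d_j + \<alpha>_j; with d_1 at least 1 this also bounds \<bar>i\<bar>.\<close>

lemma count_bound:
  assumes "m = expo i \<alpha>" "\<And>k. k \<in> vars \<Longrightarrow> count m k < q"
  shows "i \<in> {- int q<..<int q}" "\<And>j. j \<in> {1..n} \<Longrightarrow> nat \<bar>i\<bar> * d j + \<alpha> j < q"
proof -
  show *: "nat \<bar>i\<bar> * d j + \<alpha> j < q" if j: "j \<in> {1..n}" for j
  proof (cases "i \<ge> 0")
    case True
    have "nat (i * int (d j)) + \<alpha> j < q"
      using assms(2)[OF int_vars(1)[OF j]] dl_int(1)[OF j] by (simp add: assms(1) count_expo[OF int_vars(1)[OF j]])
    then show ?thesis using True by (simp add: nat_mult_distrib)
  next
    case False
    have "nat (i * - int (d j)) + \<alpha> j < q"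
      using assms(2)[OF int_vars(2)[OF j]] dl_int(2)[OF j] by (simp add: assms(1) count_expo[OF int_vars(2)[OF j]])
    moreover have "i * - int (d j) = \<bar>i\<bar> * int (d j)" using False by simp
    ultimately show ?thesis by (simp add: nat_mult_distrib)
  qed
  have "1 \<le> d 1" using d[of 1] n by simp
  then have "nat \<bar>i\<bar> * 1 \<le> nat \<bar>i\<bar> * d 1" by (rule mult_le_mono2)
  moreover have "nat \<bar>i\<bar> * d 1 + \<alpha> 1 < q" by (rule *) (use n in simp)
  ultimately have "nat \<bar>i\<bar> < q" by linarith
  then show "i \<in> {- int q<..<int q}" by auto
qed

text \<open>The truncated subtraction supplies the maximum with 0: if \<bar>i\<bar> d_j reaches q
  for some j, the degree i admits no good exponent.\<close>

lemma good_box: "{m \<in> PP. \<forall>k. count m k < q} = (\<lambda>(i, \<alpha>). expo i \<alpha>) ` box (\<lambda>i j. q - nat \<bar>i\<bar> * d j) q"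
proof (intro equalityI subsetI)
  fix m assume m: "m \<in> {m \<in> PP. \<forall>k. count m k < q}"
  then obtain i \<alpha> where ia: "m = expo i \<alpha>" using PP_expo by blast
  have lt: "\<And>k. k \<in> vars \<Longrightarrow> count m k < q" using m by blast
  have "(i, restrict \<alpha> {1..n}) \<in> box (\<lambda>i j. q - nat \<bar>i\<bar> * d j) q"
    unfolding box_def using count_bound[OF ia lt] by (auto simp: less_diff_conv add.commute)
  then show "m \<in> (\<lambda>(i, \<alpha>). expo i \<alpha>) ` box (\<lambda>i j. q - nat \<bar>i\<bar> * d j) q"
    using ia expo_restrict[of i \<alpha>] by (intro image_eqI[of _ _ "(i, restrict \<alpha> {1..n})"]) auto
next
  fix m assume "m \<in> (\<lambda>(i, \<alpha>). expo i \<alpha>) ` box (\<lambda>i j. q - nat \<bar>i\<bar> * d j) q"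
  then obtain i \<alpha> where ia: "m = expo i \<alpha>" "(i, \<alpha>) \<in> box (\<lambda>i j. q - nat \<bar>i\<bar> * d j) q" by auto
  have q: "q > 0" using ia(2) by (auto simp: box_def)
  have "count m k < q" for k
  proof (cases "k \<in> vars")
    case True
    have "\<alpha> (nat \<bar>k\<bar>) < q - nat \<bar>i\<bar> * d (nat \<bar>k\<bar>)" using ia(2) vars(1)[OF True] by (auto simp: box_def)
    moreover have "nat (i * dl k) \<le> nat \<bar>i\<bar> * d (nat \<bar>k\<bar>)"
    proof -
      have "i * dl k \<le> \<bar>i * dl k\<bar>" by simp
      also have "\<dots> = \<bar>i\<bar> * int (d (nat \<bar>k\<bar>))" by (simp add: abs_mult dl_abs[OF True])
      finally have "nat (i * dl k) \<le> nat (\<bar>i\<bar> * int (d (nat \<bar>k\<bar>)))" by (rule nat_mono)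
      then show ?thesis by (simp add: nat_mult_distrib)
    qed
    ultimately show ?thesis unfolding ia(1) count_expo[OF True] by linarith
  next
    case False
    then show ?thesis using q by (simp add: ia(1) count_expo_out)
  qed
  then show "m \<in> {m \<in> PP. \<forall>k. count m k < q}" using ia expo_in by simp
qed

lemma card_good: "card {m \<in> PP. \<forall>k. count m k < q} = (\<Sum>i\<in>{- int q<..<int q}. \<Prod>j=1..n. (q - nat \<bar>i\<bar> * d j))"
  unfolding good_box by (simp add: card_image[OF box_inj] card_box)

text \<open>A crude count, fewer than 2k values of i and at most k for each \<alpha>_j; only the
  degree n + 1 matters for the dimension.\<close>

lemma growth: "card {m \<in> PP. size m < k} \<le> 2 * k ^ (n + 1)"
proof -
  have "{m \<in> PP. size m < k} \<subseteq> (\<lambda>(i, \<alpha>). expo i \<alpha>) ` box (\<lambda>i j. k) k"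
  proof
    fix m assume m: "m \<in> {m \<in> PP. size m < k}"
    then obtain i \<alpha> where ia: "m = expo i \<alpha>" using PP_expo by blast
    have lt: "count m x < k" for x using m count_le_size[of m x] by simp
    have b: "i \<in> {- int k<..<int k}" "\<And>j. j \<in> {1..n} \<Longrightarrow> \<alpha> j < k"
      using count_bound[OF ia lt] by fastforce+
    then have "(i, restrict \<alpha> {1..n}) \<in> box (\<lambda>i j. k) k" unfolding box_def by auto
    then show "m \<in> (\<lambda>(i, \<alpha>). expo i \<alpha>) ` box (\<lambda>i j. k) k"
      using ia expo_restrict[of i \<alpha>] by (intro image_eqI[of _ _ "(i, restrict \<alpha> {1..n})"]) auto
  qed
  then have "card {m \<in> PP. size m < k} \<le> card (box (\<lambda>i j. k) k)"
    using card_mono[OF finite_imageI[OF finite_box]] card_image_le[OF finite_box] by (meson le_trans)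
  also have "\<dots> = nat (2 * int k - 1) * k ^ n" by (simp add: card_box)
  also have "\<dots> \<le> (2 * k) * k ^ n" by (rule mult_le_mono1) simp
  also have "\<dots> = 2 * k ^ (n + 1)" by simp
  finally show ?thesis .
qed

lemma expo_gen:
  assumes q: "q > 0" and m: "m \<in> PP"
  shows "\<exists>r\<in>(\<lambda>(i, \<alpha>). expo i \<alpha>) ` box (\<lambda>i j. q) q. \<exists>s\<in>PP. m = r + repeat_mset q s"
proof -
  obtain i \<alpha> where ia: "m = expo i \<alpha>" using PP_expo m by blast
  \<comment> \<open>The absolute value of i is divided by q and its sign is given to quotient and
    remainder alike, since \<open>expo_add\<close> requires indices without opposite signs.\<close>
  define i1 where "i1 = sgn i * (\<bar>i\<bar> div int q)"
  define i2 where "i2 = sgn i * (\<bar>i\<bar> mod int q)"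
  have i: "i = i2 + int q * i1"
  proof -
    have "i2 + int q * i1 = sgn i * (\<bar>i\<bar> mod int q + int q * (\<bar>i\<bar> div int q))"
      by (simp only: i1_def i2_def distrib_left mult.left_commute[of "int q" "sgn i"])
    also have "\<bar>i\<bar> mod int q + int q * (\<bar>i\<bar> div int q) = \<bar>i\<bar>" by simp
    finally show ?thesis by (simp add: sgn_mult_abs)
  qed
  have nn: "\<bar>i\<bar> mod int q \<ge> 0" "\<bar>i\<bar> mod int q < int q" "\<bar>i\<bar> div int q \<ge> 0" using q by (simp_all add: pos_imp_zdiv_nonneg_iff)
  have ss: "i2 * (int q * i1) \<ge> 0"
  proof -
    have "i2 * (int q * i1) = (sgn i * sgn i) * ((\<bar>i\<bar> mod int q) * (int q * (\<bar>i\<bar> div int q)))"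
      by (simp add: i1_def i2_def algebra_simps)
    also have "\<dots> \<ge> 0"
      by (rule mult_nonneg_nonneg[OF zero_le_square mult_nonneg_nonneg[OF nn(1) mult_nonneg_nonneg[OF of_nat_0_le_iff nn(3)]]])
    finally show ?thesis .
  qed
  have i2: "i2 \<in> {- int q<..<int q}"
    using nn by (cases "i = 0"; cases "i > 0") (auto simp: i2_def)
  let ?r = "expo i2 (restrict (\<lambda>j. \<alpha> j mod q) {1..n})" and ?s = "expo i1 (\<lambda>j. \<alpha> j div q)"
  have "?r + repeat_mset q ?s = m"
    unfolding expo_repeat expo_add[OF ss] ia by (auto simp: expo_eq_iff i[symmetric])
  moreover have "?r \<in> (\<lambda>(i, \<alpha>). expo i \<alpha>) ` box (\<lambda>i j. q) q"
    using i2 q by (intro image_eqI[of _ _ "(i2, restrict (\<lambda>j. \<alpha> j mod q) {1..n})"]) (auto simp: box_def)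
  ultimately show ?thesis using expo_in by metis
qed

text \<open>Suppose \<open>y_k^q\<close> divides the monomial. Take for w the exponent of
  \<open>x_\<bar>k\<bar> = y_k y_-k\<close>, and for v that of the product of all
  \<open>y_j^d_\<bar>j\<bar>\<close> with j of sign opposite to k. In m + q v the factor
  \<open>y_k^q\<close> comes from m and \<open>y_-k^q\<close> from q v, so q w can be subtracted,
  while v does not involve \<open>y_k\<close> and so is not a multiple of w.\<close>

lemma expo_bad:
  assumes m: "m \<in> PP" and k: "count m k \<ge> q" "q > 0"
  shows "\<exists>v\<in>PP. \<exists>w\<in>PP. \<exists>m'\<in>PP. m' + repeat_mset q w = m + repeat_mset q v \<and> \<not> w \<subseteq># v"
proof -
  have kv: "k \<in> vars"
  proof -
    have "k \<in># m" using k by (simp flip: count_greater_zero_iff)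
    then show ?thesis using m by (auto simp: PP_def)
  qed
  define v where "v = expo (- sgn k) (\<lambda>_. 0)"
  define w where "w = expo 0 (\<lambda>j. if j = nat \<bar>k\<bar> then 1 else 0)"
  have k0: "k \<noteq> 0" using kv by (simp add: vars_def)
  have dk: "d (nat \<bar>k\<bar>) > 0" using d vars(1)[OF kv] by blast
  have vk: "count v k = 0" "count v (- k) = d (nat \<bar>k\<bar>)"
  proof -
    have "sgn k * sgn k = 1" using k0 by (simp add: sgn_if)
    then have "- sgn k * dl k = - int (d (nat \<bar>k\<bar>))" by (simp add: dl_def mult.assoc[symmetric])
    then show "count v k = 0" "count v (- k) = d (nat \<bar>k\<bar>)"
      using count_expo[OF kv] count_expo[OF vars(2)[OF kv]] by (simp_all add: v_def dl_minus)
  qed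
  have wx: "count w x = (if x = k \<or> x = - k then 1 else 0)" for x
  proof (cases "x \<in> vars")
    case True
    have "nat \<bar>x\<bar> = nat \<bar>k\<bar> \<longleftrightarrow> x = k \<or> x = - k" by auto
    then show ?thesis by (simp add: w_def count_expo[OF True])
  next
    case False
    then show ?thesis using kv vars(2)[OF kv] by (auto simp: w_def count_expo_out)
  qed
  have sub: "repeat_mset q w \<subseteq># m + repeat_mset q v"
    unfolding subseteq_mset_def
  proof
    fix x
    have "q \<le> q * d (nat \<bar>k\<bar>)" using dk by simp
    then show "count (repeat_mset q w) x \<le> count (m + repeat_mset q v) x"
      using k(1) vk by (auto simp: wx intro: trans_le_add2)
  qed
  have rep: "repeat_mset q a \<in> PP" if "a \<in> PP" for a
    using that by (induction q) (auto simp: PP_empty PP_add)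
  define m' where "m' = m + repeat_mset q v - repeat_mset q w"
  have "v \<in> PP" "w \<in> PP" by (simp_all add: v_def w_def expo_in)
  moreover from this have "m' \<in> PP" unfolding m'_def using m rep sub by (intro PP_diff PP_add) auto
  moreover have "m' + repeat_mset q w = m + repeat_mset q v" unfolding m'_def using sub by simp
  moreover have "\<not> w \<subseteq># v"
  proof
    assume "w \<subseteq># v"
    then have "count w k \<le> count v k" by (simp add: subseteq_mset_def)
    then show False using vk(1) wx[of k] by simp
  qed
  ultimately show ?thesis by blast
qed

text \<open>For t at most n: the monomials free of \<open>y_1, ..., y_t\<close>. In particular face
  0 is all of \<open>PP\<close> and face n consists of the powers of v; the second alternative makes
  face n + 1 trivial. The n + 2 faces t = 0, ..., n + 1 give the chain of primes.\<close>

definition face :: "nat \<Rightarrow> int multiset set" where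
  "face t = {m \<in> PP. \<forall>k\<in>vars. 0 < k \<and> k \<le> int t \<or> t = n + 1 \<longrightarrow> count m k = 0}"

lemma faceD: "m \<in> face t \<Longrightarrow> k \<in> vars \<Longrightarrow> 0 < k \<Longrightarrow> k \<le> int t \<Longrightarrow> count m k = 0"
  by (simp add: face_def)

lemma krull_dim_PP:
  assumes K: "field K"
  shows "krull_dim (mseries K PP) = enat (n + 1)"
proof -
  interpret full_series K PP vars by (rule full_series_PP[OF K])
  define Q where "Q t = {F \<in> carrier B. \<forall>m\<in>face t. F m = \<zero>\<^bsub>K\<^esub>}" for t
  have "primeideal (Q t) B" for t
    unfolding Q_def by (rule face_prime) (auto simp: face_def PP_empty PP_add)
  moreover have "Q t \<subset> Q (Suc t)" if t: "t < n + 1" for t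
  proof
    show "Q t \<subseteq> Q (Suc t)" using t by (auto simp: Q_def face_def)
    \<comment> \<open>The monomial v separates the last two faces, and \<open>x_(t+1)\<close> the
      earlier ones.\<close>
    obtain e where e: "e \<in> face t" "e \<notin> face (Suc t)"
    proof (cases "t = n")
      case True
      have 1: "1 \<in> {1..n}" using n by simp
      have "count (expo (-1) (\<lambda>_. 0)) (- 1) > 0"
        using count_expo[OF int_vars(2)[OF 1], of "-1" "\<lambda>_. 0"] dl_int(2)[OF 1] d[OF 1] by simp
      then have "expo (-1) (\<lambda>_. 0) \<notin> face (Suc t)"
        using int_vars(2)[OF 1] True by (auto simp: face_def)
      moreover have "expo (-1) (\<lambda>_. 0) \<in> face t"
        using True expo_in by (auto simp: face_def count_expo dl_def)
      ultimately show thesis using that by blast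
    next
      case False
      then have st: "Suc t \<in> {1..n}" using t by simp
      let ?e = "expo 0 (\<lambda>j. if j = Suc t then 1 else 0)"
      have "count ?e (int (Suc t)) = 1" using count_expo[OF int_vars(1)[OF st], of 0] by simp
      then have "?e \<notin> face (Suc t)" using faceD[of ?e "Suc t", OF _ int_vars(1)[OF st]] by auto
      moreover have "?e \<in> face t" using False t expo_in by (auto simp: face_def count_expo)
      ultimately show thesis using that by blast
    qed
    have eP: "e \<in> PP" using e(1) by (simp add: face_def)
    have "mono e \<one>\<^bsub>K\<^esub> \<in> Q (Suc t)" using e(2) eP by (auto simp: Q_def mono_def[of e])
    moreover have "mono e \<one>\<^bsub>K\<^esub> \<notin> Q t"
    proof
      assume "mono e \<one>\<^bsub>K\<^esub> \<in> Q t"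
      then have "\<forall>m\<in>face t. mono e \<one>\<^bsub>K\<^esub> m = \<zero>\<^bsub>K\<^esub>" unfolding Q_def by blast
      then have "mono e \<one>\<^bsub>K\<^esub> e = \<zero>\<^bsub>K\<^esub>" using e(1) by (rule bspec)
      then show False unfolding mono_apply_same using one_not_zero by contradiction
    qed
    ultimately show "Q t \<noteq> Q (Suc t)" by blast
  qed
  ultimately have chain: "\<exists>Q. (\<forall>i\<le>n + 1. primeideal (Q i) B) \<and> (\<forall>i<n + 1. Q i \<subset> Q (Suc i))"
    by (intro exI[of _ Q]) simp
  show ?thesis
    unfolding krull_dim_def
  proof (rule cSup_eq_maximum)
    show "enat (n + 1) \<in> {enat l |l. \<exists>P. (\<forall>i\<le>l. primeideal (P i) B) \<and> (\<forall>i<l. P i \<subset> P (Suc i))}"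
      using chain by blast
    fix x assume "x \<in> {enat l |l. \<exists>P. (\<forall>i\<le>l. primeideal (P i) B) \<and> (\<forall>i<l. P i \<subset> P (Suc i))}"
    then obtain l Q' where l: "x = enat l" "\<forall>i\<le>l. primeideal (Q' i) B" "\<forall>i<l. Q' i \<subset> Q' (Suc i)" by blast
    have "l \<le> n + 1" by (rule prime_chain_bound[of 2 "n + 1" l Q', OF growth]) (use l in auto)
    then show "x \<le> enat (n + 1)" using l(1) by simp
  qed
qed

end

section \<open>The hypersurface as a ring of monoid series\<close>

lemma (in monoid_series) indexed_const_mono: "indexed_const k = mono {#} k"
  by (auto simp: indexed_const_def mono_def)

lemma (in monoid_series) indexed_var_mono: "indexed_var i = mono {#i#} \<one>"
proof
  fix m
  show "indexed_var i m = mono {#i#} \<one> m"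
  proof (cases "i \<in># m")
    case True
    then have "m - {#i#} = {#} \<longleftrightarrow> m = {#i#}"
      by (metis diff_single_trivial insert_DiffM multi_self_add_other_not_self add_mset_add_single add_0 diff_empty cancel_comm_monoid_add_class.diff_cancel)
    then show ?thesis using True by (simp add: indexed_var_def indexed_pmult_def indexed_const_def mono_def)
  next
    case False
    then show ?thesis by (auto simp: indexed_var_def indexed_pmult_def mono_def)
  qed
qed

lemma (in monoid_series) finprod_mono:
  assumes "finite A" "\<And>i. i \<in> A \<Longrightarrow> f i \<in> P"
  shows "(\<Otimes>\<^bsub>B\<^esub>i\<in>A. mono (f i) \<one>) = mono (\<Sum>i\<in>A. f i) \<one>" and "(\<Sum>i\<in>A. f i) \<in> P"
proof -
  have "(\<Otimes>\<^bsub>B\<^esub>i\<in>A. mono (f i) \<one>) = mono (\<Sum>i\<in>A. f i) \<one> \<and> (\<Sum>i\<in>A. f i) \<in> P"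
    using assms
  proof (induction A)
    case empty
    show ?case by (simp add: one_mono empty_in)
  next
    case (insert x A)
    then have IH: "(\<Otimes>\<^bsub>B\<^esub>i\<in>A. mono (f i) \<one>) = mono (\<Sum>i\<in>A. f i) \<one>" "(\<Sum>i\<in>A. f i) \<in> P" by simp_all
    have c: "(\<lambda>i. mono (f i) \<one>) \<in> A \<rightarrow> carrier B" "mono (f x) \<one> \<in> carrier B" using insert.prems by simp_all
    have fx: "f x \<in> P" using insert.prems by simp
    have "(\<Otimes>\<^bsub>B\<^esub>i\<in>insert x A. mono (f i) \<one>) = mono (f x) \<one> \<otimes>\<^bsub>B\<^esub> mono (\<Sum>i\<in>A. f i) \<one>"
      unfolding B.finprod_insert[OF insert.hyps c] IH(1) ..
    also have "\<dots> = mono (f x + (\<Sum>i\<in>A. f i)) \<one>" using mono_mult_mono[OF one_closed one_closed fx IH(2)] by simp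
    finally show ?case using insert.hyps add_in[OF fx IH(2)] by simp
  qed
  then show "(\<Otimes>\<^bsub>B\<^esub>i\<in>A. mono (f i) \<one>) = mono (\<Sum>i\<in>A. f i) \<one>" "(\<Sum>i\<in>A. f i) \<in> P" by blast+
qed

text \<open>Below, \<open>S\<close> is \<open>K[[x]]\<close>, \<open>T\<close> is
  \<open>S[[u,v]]\<close>, and \<open>Q\<close> is the ring of monoid series to be identified with
  the quotient of \<open>T\<close>.\<close>

locale star_iso = star_exponents n d + field K for n d and K :: "('a, 'r) ring_scheme" (structure)
begin

definition PS :: "nat multiset set" where "PS = {m. set_mset m \<subseteq> {1..n}}"

abbreviation "PT \<equiv> {m :: uv multiset. set_mset m \<subseteq> {U, V}}"

lemma PT: "(\<mu> :: uv multiset) \<in> PT"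
proof -
  have "x \<in> {U, V}" for x by (cases x) simp_all
  then show ?thesis by blast
qed

sublocale S: monoid_series K PS
  by unfold_locales (auto simp: PS_def)

sublocale T: monoid_series S.B PT
  by (intro monoid_series.intro monoid_series_axioms.intro S.B_cring) auto

sublocale Q: full_series K PP vars
  by (rule full_series_PP[OF field_axioms])

lemma T_coeff: "F \<in> carrier T.B \<Longrightarrow> F \<mu> \<in> carrier S.B" by (rule T.coeff_closed)

lemma T_coeff2: "F \<in> carrier T.B \<Longrightarrow> F \<mu> \<nu> \<in> carrier K"
  by (rule S.coeff_closed[OF T.coeff_closed])

lemma T_out: "F \<in> carrier T.B \<Longrightarrow> \<nu> \<notin> PS \<Longrightarrow> F \<mu> \<nu> = \<zero>"
  by (rule S.coeff_outside[OF T.coeff_closed])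

lemma T_carrierI:
  assumes "\<And>\<mu> \<nu>. F \<mu> \<nu> \<in> carrier K" "\<And>\<mu> \<nu>. \<nu> \<notin> PS \<Longrightarrow> F \<mu> \<nu> = \<zero>"
  shows "F \<in> carrier T.B"
  unfolding T.carrier_B S.carrier_B using assms PT by blast

lemma PS_addD: "\<nu> + \<nu>' \<in> PS \<Longrightarrow> \<nu> \<in> PS \<and> \<nu>' \<in> PS"
  by (auto simp: PS_def)

text \<open>Exponent of the image of the monomial with uv-part \<mu> and x-part \<nu>, the sign
  being kept apart in \<open>sg\<close>.\<close>

definition eps :: "uv multiset \<Rightarrow> nat multiset \<Rightarrow> int multiset" where
  "eps \<mu> \<nu> = mk vars (\<lambda>k. (if k > 0 then count \<mu> U else count \<mu> V) * d (nat \<bar>k\<bar>) + count \<nu> (nat \<bar>k\<bar>))"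

lemma eps_add: "eps (\<mu> + \<mu>') (\<nu> + \<nu>') = eps \<mu> \<nu> + eps \<mu>' \<nu>'"
  by (rule multiset_eqI) (simp add: eps_def count_mk[OF finite_vars] distrib_right)

text \<open>The common part of the powers of u and v is a power of uv, whose exponent equals that of
  the same power of f.\<close>

lemma eps_expo:
  "eps \<mu> \<nu> = expo (int (count \<mu> U) - int (count \<mu> V)) (\<lambda>j. min (count \<mu> U) (count \<mu> V) * d j + count \<nu> j)"
proof (rule multiset_eqI)
  fix k
  show "count (eps \<mu> \<nu>) k = count (expo (int (count \<mu> U) - int (count \<mu> V)) (\<lambda>j. min (count \<mu> U) (count \<mu> V) * d j + count \<nu> j)) k"
  proof (cases "k \<in> vars")
    case True
    let ?u = "count \<mu> U" and ?v = "count \<mu> V" and ?d = "d (nat \<bar>k\<bar>)"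
    have k0: "k \<noteq> 0" using True by (simp add: vars_def)
    have "(if k > 0 then ?u else ?v) * ?d = nat ((int ?u - int ?v) * dl k) + min ?u ?v * ?d"
    proof (cases "k > 0")
      case p: True
      then have dk: "dl k = int ?d" by (simp add: dl_def)
      show ?thesis
      proof (cases "?v \<le> ?u")
        case True
        then have "(int ?u - int ?v) * dl k = int ((?u - ?v) * ?d)" by (simp add: dk of_nat_diff)
        then have "nat ((int ?u - int ?v) * dl k) = (?u - ?v) * ?d" by (simp only: nat_int)
        moreover have "(?u - ?v) * ?d + ?v * ?d = ?u * ?d" using True by (simp add: distrib_right[symmetric])
        ultimately show ?thesis using p True by (simp add: min_def)
      next
        case False
        then have "(int ?u - int ?v) * dl k \<le> 0" by (simp add: dk mult_nonpos_nonneg)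
        then show ?thesis using p False by (simp add: min_def)
      qed
    next
      case p: False
      then have dk: "dl k = - int ?d" using k0 by (simp add: dl_def)
      show ?thesis
      proof (cases "?u \<le> ?v")
        case True
        then have "(int ?u - int ?v) * dl k = int ((?v - ?u) * ?d)" by (simp add: dk of_nat_diff left_diff_distrib)
        then have "nat ((int ?u - int ?v) * dl k) = (?v - ?u) * ?d" by (simp only: nat_int)
        moreover have "(?v - ?u) * ?d + ?u * ?d = ?v * ?d" using True by (simp add: distrib_right[symmetric])
        ultimately show ?thesis using p True by (simp add: min_def)
      next
        case False
        then have "(int ?u - int ?v) * dl k \<le> 0" by (simp add: dk mult_nonneg_nonpos)
        then show ?thesis using p False by (simp add: min_def)
      qed
    qed
    then show ?thesis using True by (simp add: eps_def count_mk[OF finite_vars] count_expo)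
  next
    case False
    then show ?thesis by (simp add: eps_def count_mk[OF finite_vars] count_expo_out)
  qed
qed

lemma eps_in: "eps \<mu> \<nu> \<in> PP"
  unfolding eps_expo by (rule expo_in)

definition uv :: "uv multiset" where "uv = {#U, V#}"

definition dd :: "nat multiset" where "dd = mk {1..n} d"

lemma count_uv [simp]: "count uv x = 1"
  by (cases x) (simp_all add: uv_def)

lemma count_dd: "count dd j = (if j \<in> {1..n} then d j else 0)"
  by (simp add: dd_def count_mk)

lemma dd_in: "dd \<in> PS"
  unfolding PS_def dd_def by (rule CollectI, rule set_mk) simp

lemma uv_multiset_eqI: "count \<mu> U = count \<mu>' U \<Longrightarrow> count \<mu> V = count \<mu>' V \<Longrightarrow> \<mu> = \<mu>'"
  by (rule multiset_eqI) (metis uv.exhaust)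

lemma eps_uv: "eps (\<mu> + uv) \<nu> = eps \<mu> (\<nu> + dd)"
  by (rule multiset_eqI) (use vars(1) in \<open>auto simp: eps_def count_mk[OF finite_vars] count_dd\<close>)

lemma eps_uv_repeat: "eps (\<mu> + repeat_mset k uv) \<nu> = eps \<mu> (\<nu> + repeat_mset k dd)"
  by (rule multiset_eqI) (use vars(1) in \<open>auto simp: eps_def count_mk[OF finite_vars] count_dd distrib_right\<close>)

text \<open>The monomials of \<open>T\<close> lying over \<open>y^m\<close>. These sets are finite,
  so the substitution is defined coefficientwise by finite sums, with no convergence
  involved.\<close>

definition fib :: "int multiset \<Rightarrow> (uv multiset \<times> nat multiset) set" where
  "fib m = {x. snd x \<in> PS \<and> eps (fst x) (snd x) = m}"

definition mults :: "nat multiset \<Rightarrow> nat set" where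
  "mults \<nu> = {k. repeat_mset k dd \<subseteq># \<nu>}"

lemma mults_finite: "finite (mults \<nu>)"
proof (rule finite_subset)
  show "mults \<nu> \<subseteq> {..count \<nu> 1}"
  proof
    fix k assume "k \<in> mults \<nu>"
    then have "count (repeat_mset k dd) 1 \<le> count \<nu> 1" unfolding mults_def subseteq_mset_def by blast
    then have "k * d 1 \<le> count \<nu> 1" using n by (simp add: count_dd)
    moreover have "k \<le> k * d 1" using n d[of 1] by simp
    ultimately have "k \<le> count \<nu> 1" by (rule order_trans[rotated])
    then show "k \<in> {..count \<nu> 1}" by simp
  qed
qed simp

lemma PS_diff: "\<nu> \<in> PS \<Longrightarrow> \<nu> - \<nu>' \<in> PS"
  using set_mset_mono[OF diff_subset_eq_self, of \<nu> \<nu>'] by (auto simp: PS_def)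

text \<open>Each fibre over \<open>PP\<close> has one member without a factor uv. The others arise
  by trading f for uv, k times, as long as f divides the x-part.\<close>

lemma fib_pure:
  assumes pure: "\<not> uv \<subseteq># \<mu>" and nu: "\<nu> \<in> PS"
  shows "fib (eps \<mu> \<nu>) = (\<lambda>k. (\<mu> + repeat_mset k uv, \<nu> - repeat_mset k dd)) ` mults \<nu>"
proof (intro equalityI subsetI)
  fix x assume "x \<in> fib (eps \<mu> \<nu>)"
  then obtain \<mu>' \<nu>' where x: "x = (\<mu>', \<nu>')" "\<nu>' \<in> PS" "eps \<mu>' \<nu>' = eps \<mu> \<nu>" by (cases x) (auto simp: fib_def)
  define k where "k = min (count \<mu>' U) (count \<mu>' V)"
  have "count \<mu> U = 0 \<or> count \<mu> V = 0"
  proof (rule ccontr)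
    assume a: "\<not> ?thesis"
    have "uv \<subseteq># \<mu>"
      unfolding subseteq_mset_def
    proof
      fix z show "count uv z \<le> count \<mu> z" using a by (cases z) (auto simp: Suc_le_eq)
    qed
    then show False using pure by contradiction
  qed
  then have m0: "min (count \<mu> U) (count \<mu> V) = 0" by auto
  have e: "int (count \<mu>' U) - int (count \<mu>' V) = int (count \<mu> U) - int (count \<mu> V)"
    "\<And>j. j \<in> {1..n} \<Longrightarrow> k * d j + count \<nu>' j = count \<nu> j"
    using x(3) unfolding eps_expo expo_eq_iff k_def m0 by auto
  have mu: "\<mu>' = \<mu> + repeat_mset k uv"
    by (rule uv_multiset_eqI) (use e(1) m0 in \<open>auto simp: k_def\<close>)
  have nu': "\<nu> = \<nu>' + repeat_mset k dd"
  proof (rule multiset_eqI)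
    fix j
    show "count \<nu> j = count (\<nu>' + repeat_mset k dd) j"
    proof (cases "j \<in> {1..n}")
      case True
      then show ?thesis using e(2)[OF True] by (simp add: count_dd)
    next
      case False
      then have "j \<notin># \<nu>" "j \<notin># \<nu>'" using nu x(2) by (auto simp: PS_def)
      then show ?thesis using False by (auto simp: count_dd not_in_iff)
    qed
  qed
  then have "k \<in> mults \<nu>" by (simp add: mults_def)
  moreover have "x = (\<mu> + repeat_mset k uv, \<nu> - repeat_mset k dd)" using x(1) mu nu' by simp
  ultimately show "x \<in> (\<lambda>k. (\<mu> + repeat_mset k uv, \<nu> - repeat_mset k dd)) ` mults \<nu>" by blast
next
  fix x assume "x \<in> (\<lambda>k. (\<mu> + repeat_mset k uv, \<nu> - repeat_mset k dd)) ` mults \<nu>"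
  then obtain k where k: "k \<in> mults \<nu>" "x = (\<mu> + repeat_mset k uv, \<nu> - repeat_mset k dd)" by blast
  have "eps (\<mu> + repeat_mset k uv) (\<nu> - repeat_mset k dd) = eps \<mu> \<nu>"
    unfolding eps_uv_repeat using k(1) by (simp add: mults_def)
  then show "x \<in> fib (eps \<mu> \<nu>)" using PS_diff[OF nu] by (simp add: fib_def k(2))
qed

lemma pure_exists:
  assumes "m \<in> PP"
  obtains \<mu> \<nu> where "\<not> uv \<subseteq># \<mu>" "\<nu> \<in> PS" "m = eps \<mu> \<nu>"
proof -
  obtain i \<alpha> where ia: "m = expo i \<alpha>" using PP_expo assms by blast
  define \<mu> where "\<mu> = replicate_mset (nat i) U + replicate_mset (nat (- i)) V"
  define \<nu> where "\<nu> = mk {1..n} \<alpha>"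
  have c: "count \<mu> U = nat i" "count \<mu> V = nat (- i)" by (simp_all add: \<mu>_def)
  have "\<not> uv \<subseteq># \<mu>"
  proof
    assume "uv \<subseteq># \<mu>"
    then have "count uv U \<le> count \<mu> U" "count uv V \<le> count \<mu> V" by (simp_all only: subseteq_mset_def)
    then show False unfolding c by simp
  qed
  moreover have "\<nu> \<in> PS" unfolding PS_def \<nu>_def by (rule CollectI, rule set_mk) simp
  moreover have "m = eps \<mu> \<nu>" unfolding eps_expo c ia expo_eq_iff by (auto simp: \<nu>_def count_mk)
  ultimately show thesis by (rule that)
qed

lemma fib_finite: "finite (fib m)"
proof (cases "m \<in> PP")
  case True
  then obtain \<mu> \<nu> where "\<not> uv \<subseteq># \<mu>" "\<nu> \<in> PS" "m = eps \<mu> \<nu>" by (rule pure_exists)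
  then show ?thesis using fib_pure mults_finite by simp
next
  case False
  then have "fib m = {}" using eps_in by (auto simp: fib_def)
  then show ?thesis by simp
qed

definition sg :: "uv multiset \<Rightarrow> 'a" where "sg \<mu> = (\<ominus> \<one>) [^] count \<mu> U"

lemma sg_closed: "sg \<mu> \<in> carrier K" by (simp add: sg_def)

lemma sg_add: "sg (\<mu> + \<mu>') = sg \<mu> \<otimes> sg \<mu>'" by (simp add: sg_def nat_pow_mult)

lemma sg_square: "sg \<mu> \<otimes> sg \<mu> = \<one>"
proof -
  have "\<ominus> \<one> \<otimes> \<ominus> \<one> = \<one>" by (simp add: l_minus)
  then have "(\<ominus> \<one> \<otimes> \<ominus> \<one>) [^] count \<mu> U = \<one>" by simp
  then show ?thesis by (simp add: sg_def nat_pow_distrib)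
qed

lemma sg_cancel: "x \<in> carrier K \<Longrightarrow> sg \<mu> \<otimes> (sg \<mu> \<otimes> x) = x"
  using m_assoc[OF sg_closed sg_closed, of x \<mu> \<mu>] by (simp add: sg_square)

definition \<Phi> :: "(uv multiset \<Rightarrow> nat multiset \<Rightarrow> 'a) \<Rightarrow> int multiset \<Rightarrow> 'a" where
  "\<Phi> F m = (\<Oplus>x\<in>fib m. sg (fst x) \<otimes> F (fst x) (snd x))"

lemma Phi_closed: "F \<in> carrier T.B \<Longrightarrow> \<Phi> F \<in> carrier Q.B"
  unfolding Q.carrier_B
proof (intro conjI allI impI)
  fix m assume F: "F \<in> carrier T.B"
  show "\<Phi> F m \<in> carrier K" unfolding \<Phi>_def by (rule finsum_closed) (simp add: T_coeff2[OF F] sg_closed)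
  assume "m \<notin> PP"
  then have "fib m = {}" using eps_in by (auto simp: fib_def)
  then show "\<Phi> F m = \<zero>" by (simp add: \<Phi>_def)
qed

lemma Phi_add: "F \<in> carrier T.B \<Longrightarrow> G \<in> carrier T.B \<Longrightarrow> \<Phi> (F \<oplus>\<^bsub>T.B\<^esub> G) = \<Phi> F \<oplus>\<^bsub>Q.B\<^esub> \<Phi> G"
proof
  fix m assume F: "F \<in> carrier T.B" and G: "G \<in> carrier T.B"
  have "\<Phi> (F \<oplus>\<^bsub>T.B\<^esub> G) m = (\<Oplus>x\<in>fib m. sg (fst x) \<otimes> F (fst x) (snd x) \<oplus> sg (fst x) \<otimes> G (fst x) (snd x))"
    unfolding \<Phi>_def T.add_apply S.add_apply
    by (rule finsum_cong'[OF refl]) (simp_all add: T_coeff2[OF F] T_coeff2[OF G] sg_closed r_distr)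
  also have "\<dots> = \<Phi> F m \<oplus> \<Phi> G m"
    unfolding \<Phi>_def by (rule finsum_addf) (simp_all add: T_coeff2[OF F] T_coeff2[OF G] sg_closed)
  finally show "\<Phi> (F \<oplus>\<^bsub>T.B\<^esub> G) m = (\<Phi> F \<oplus>\<^bsub>Q.B\<^esub> \<Phi> G) m" unfolding Q.add_apply .
qed

lemma Phi_mono:
  assumes "\<nu> \<in> PS" "k \<in> carrier K"
  shows "\<Phi> (T.mono \<mu> (S.mono \<nu> k)) = Q.mono (eps \<mu> \<nu>) (sg \<mu> \<otimes> k)"
proof
  fix m
  have z: "T.mono \<mu> (S.mono \<nu> k) \<mu>' \<nu>' = (if \<mu>' = \<mu> \<and> \<nu>' = \<nu> then k else \<zero>)" for \<mu>' \<nu>'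
    unfolding T.mono_def S.mono_def by simp
  show "\<Phi> (T.mono \<mu> (S.mono \<nu> k)) m = Q.mono (eps \<mu> \<nu>) (sg \<mu> \<otimes> k) m"
  proof (cases "m = eps \<mu> \<nu>")
    case True
    have "\<Phi> (T.mono \<mu> (S.mono \<nu> k)) m = sg (fst (\<mu>, \<nu>)) \<otimes> T.mono \<mu> (S.mono \<nu> k) (fst (\<mu>, \<nu>)) (snd (\<mu>, \<nu>))"
      unfolding \<Phi>_def
    proof (rule finsum_single[OF fib_finite])
      show "(\<mu>, \<nu>) \<in> fib m" using True assms by (simp add: fib_def)
      fix x assume "x \<noteq> (\<mu>, \<nu>)"
      then have "\<not> (fst x = \<mu> \<and> snd x = \<nu>)" by (auto simp: prod_eq_iff)
      then show "sg (fst x) \<otimes> T.mono \<mu> (S.mono \<nu> k) (fst x) (snd x) = \<zero>"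
        unfolding z by (simp only: if_not_P if_False r_null[OF sg_closed])
    qed (simp add: z assms sg_closed)
    then show ?thesis using True by (simp add: z Q.mono_def)
  next
    case False
    have "\<Phi> (T.mono \<mu> (S.mono \<nu> k)) m = \<zero>"
      unfolding \<Phi>_def
    proof (rule finsum_all_zero)
      fix x assume "x \<in> fib m"
      then have "\<not> (fst x = \<mu> \<and> snd x = \<nu>)" using False by (auto simp: fib_def)
      then show "sg (fst x) \<otimes> T.mono \<mu> (S.mono \<nu> k) (fst x) (snd x) = \<zero>"
        unfolding z by (simp only: if_not_P if_False r_null[OF sg_closed])
    qed
    then show ?thesis using False by (simp add: Q.mono_def)
  qed
qed

lemma Phi_one: "\<Phi> \<one>\<^bsub>T.B\<^esub> = \<one>\<^bsub>Q.B\<^esub>"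
proof -
  have "eps {#} {#} = {#}" by (rule multiset_eqI) (simp add: eps_def count_mk[OF finite_vars])
  then show ?thesis
    unfolding T.one_mono S.one_mono Q.one_mono using Phi_mono[OF S.empty_in one_closed, of "{#}"] by (simp add: sg_def)
qed

lemma T_mult_apply:
  assumes F: "F \<in> carrier T.B" and G: "G \<in> carrier T.B"
  shows "(F \<otimes>\<^bsub>T.B\<^esub> G) \<mu> \<nu> = (\<Oplus>y\<in>splits \<mu> \<times> splits \<nu>. F (fst (fst y)) (fst (snd y)) \<otimes> G (snd (fst y)) (snd (snd y)))"
proof -
  have "(F \<otimes>\<^bsub>T.B\<^esub> G) \<mu> = (\<Oplus>\<^bsub>S.B\<^esub>y\<in>splits \<mu>. F (fst y) \<otimes>\<^bsub>S.B\<^esub> G (snd y))"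
    unfolding T.mult_apply[OF F G] by (simp only: case_prod_unfold)
  then have "(F \<otimes>\<^bsub>T.B\<^esub> G) \<mu> \<nu> = (\<Oplus>\<^bsub>S.B\<^esub>y\<in>splits \<mu>. F (fst y) \<otimes>\<^bsub>S.B\<^esub> G (snd y)) \<nu>" by (rule fun_cong)
  also have "\<dots> = (\<Oplus>y\<in>splits \<mu>. (F (fst y) \<otimes>\<^bsub>S.B\<^esub> G (snd y)) \<nu>)"
    by (rule S.finsum_apply[OF finite_splits S.mult_closed_B[OF T_coeff[OF F] T_coeff[OF G]]])
  also have "\<dots> = (\<Oplus>y\<in>splits \<mu>. \<Oplus>z\<in>splits \<nu>. F (fst y) (fst z) \<otimes> G (snd y) (snd z))"
    unfolding S.mult_apply[OF T_coeff[OF F] T_coeff[OF G]] by (simp only: case_prod_unfold)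
  also have "\<dots> = (\<Oplus>x\<in>splits \<mu> \<times> splits \<nu>. case x of (y, z) \<Rightarrow> F (fst y) (fst z) \<otimes> G (snd y) (snd z))"
    by (rule finsum_Sigma) (simp_all add: T_coeff2[OF F] T_coeff2[OF G])
  finally show ?thesis by (simp only: case_prod_beta)
qed

text \<open>Both coefficients at m are rearranged into one sum over \<open>Q4\<close>, the pairs of
  monomials of \<open>T\<close> whose exponents map to a pair with sum m.\<close>

lemma Phi_mult:
  assumes F: "F \<in> carrier T.B" and G: "G \<in> carrier T.B"
  shows "\<Phi> (F \<otimes>\<^bsub>T.B\<^esub> G) = \<Phi> F \<otimes>\<^bsub>Q.B\<^esub> \<Phi> G"
proof
  fix m
  define tm where "tm = (\<lambda>(F :: uv multiset \<Rightarrow> nat multiset \<Rightarrow> 'a) x. sg (fst x) \<otimes> F (fst x) (snd x))"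
  have tc: "tm F x \<in> carrier K" "tm G x \<in> carrier K" for x
    by (simp_all add: tm_def sg_closed T_coeff2[OF F] T_coeff2[OF G])
  define Q4 where "Q4 = {(a, b). snd a \<in> PS \<and> snd b \<in> PS \<and> eps (fst a) (snd a) + eps (fst b) (snd b) = m}"
  let ?L = "SIGMA x:fib m. splits (fst x) \<times> splits (snd x)"
  let ?R = "SIGMA s:splits m. fib (fst s) \<times> fib (snd s)"
  have "\<Phi> (F \<otimes>\<^bsub>T.B\<^esub> G) m = (\<Oplus>x\<in>fib m. \<Oplus>y\<in>splits (fst x) \<times> splits (snd x).
      sg (fst x) \<otimes> (F (fst (fst y)) (fst (snd y)) \<otimes> G (snd (fst y)) (snd (snd y))))"
    unfolding \<Phi>_def
  proof (rule finsum_cong'[OF refl])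
    fix x assume "x \<in> fib m"
    show "sg (fst x) \<otimes> (F \<otimes>\<^bsub>T.B\<^esub> G) (fst x) (snd x) = (\<Oplus>y\<in>splits (fst x) \<times> splits (snd x).
      sg (fst x) \<otimes> (F (fst (fst y)) (fst (snd y)) \<otimes> G (snd (fst y)) (snd (snd y))))"
      unfolding T_mult_apply[OF F G]
      by (rule finsum_rdistr) (simp_all add: sg_closed T_coeff2[OF F] T_coeff2[OF G])
  qed (auto intro!: finsum_closed simp: sg_closed T_coeff2[OF F] T_coeff2[OF G])
  also have "\<dots> = (\<Oplus>z\<in>?L. case z of (x, y) \<Rightarrow>
      sg (fst x) \<otimes> (F (fst (fst y)) (fst (snd y)) \<otimes> G (snd (fst y)) (snd (snd y))))"
    by (rule finsum_Sigma) (simp_all add: fib_finite sg_closed T_coeff2[OF F] T_coeff2[OF G])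
  also have "\<dots> = (\<Oplus>w\<in>Q4. tm F (fst w) \<otimes> tm G (snd w))"
  proof (rule finsum_bij[where h = "\<lambda>(x, (y, z)). ((fst y, fst z), (snd y, snd z))"])
    show "bij_betw (\<lambda>(x, (y, z)). ((fst y, fst z), (snd y, snd z))) ?L Q4"
      by (rule bij_betwI[where g = "\<lambda>(a, b). ((fst a + fst b, snd a + snd b), ((fst a, fst b), (snd a, snd b)))"])
        (auto simp: Q4_def fib_def eps_add[symmetric] intro: S.add_in dest: PS_addD)
    fix z assume "z \<in> ?L"
    then obtain \<mu> \<nu> \<mu>1 \<mu>2 \<nu>1 \<nu>2 where z: "z = ((\<mu>, \<nu>), ((\<mu>1, \<mu>2), (\<nu>1, \<nu>2)))" "\<mu> = \<mu>1 + \<mu>2" by (cases z) auto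
    have c: "sg \<mu>1 \<in> carrier K" "sg \<mu>2 \<in> carrier K" "F \<mu>1 \<nu>1 \<in> carrier K" "G \<mu>2 \<nu>2 \<in> carrier K"
      by (simp_all add: sg_closed T_coeff2[OF F] T_coeff2[OF G])
    then have "sg \<mu> \<otimes> (F \<mu>1 \<nu>1 \<otimes> G \<mu>2 \<nu>2) = (sg \<mu>1 \<otimes> F \<mu>1 \<nu>1) \<otimes> (sg \<mu>2 \<otimes> G \<mu>2 \<nu>2)"
      unfolding z(2) sg_add by (simp add: m_ac)
    then show "(case z of (x, y) \<Rightarrow> sg (fst x) \<otimes> (F (fst (fst y)) (fst (snd y)) \<otimes> G (snd (fst y)) (snd (snd y))))
      = tm F (fst ((\<lambda>(x, (y, z)). ((fst y, fst z), (snd y, snd z))) z)) \<otimes> tm G (snd ((\<lambda>(x, (y, z)). ((fst y, fst z), (snd y, snd z))) z))"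
      by (simp add: z(1) tm_def)
  qed (simp add: tc)
  finally have L: "\<Phi> (F \<otimes>\<^bsub>T.B\<^esub> G) m = (\<Oplus>w\<in>Q4. tm F (fst w) \<otimes> tm G (snd w))" .
  have "(\<Phi> F \<otimes>\<^bsub>Q.B\<^esub> \<Phi> G) m = (\<Oplus>s\<in>splits m. \<Phi> F (fst s) \<otimes> \<Phi> G (snd s))"
    unfolding Q.mult_apply[OF Phi_closed[OF F] Phi_closed[OF G]] by (simp only: case_prod_unfold)
  also have "\<dots> = (\<Oplus>s\<in>splits m. \<Oplus>w\<in>fib (fst s) \<times> fib (snd s). tm F (fst w) \<otimes> tm G (snd w))"
  proof (rule finsum_cong'[OF refl])
    fix s assume "s \<in> splits m"
    have sF: "(\<Oplus>a\<in>fib (fst s). tm F a) \<in> carrier K" by (rule finsum_closed) (simp add: tc)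
    have "\<Phi> F (fst s) \<otimes> \<Phi> G (snd s) = (\<Oplus>a\<in>fib (fst s). tm F a) \<otimes> (\<Oplus>b\<in>fib (snd s). tm G b)"
      by (simp only: \<Phi>_def tm_def)
    also have "\<dots> = (\<Oplus>a\<in>fib (fst s). tm F a \<otimes> (\<Oplus>b\<in>fib (snd s). tm G b))"
      by (rule finsum_ldistr[OF fib_finite finsum_closed]) (simp_all add: tc)
    also have "\<dots> = (\<Oplus>a\<in>fib (fst s). \<Oplus>b\<in>fib (snd s). tm F a \<otimes> tm G b)"
      by (rule finsum_cong'[OF refl]) (auto intro!: finsum_closed finsum_rdistr[OF fib_finite] simp: tc)
    also have "\<dots> = (\<Oplus>w\<in>fib (fst s) \<times> fib (snd s). case w of (a, b) \<Rightarrow> tm F a \<otimes> tm G b)"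
      by (rule finsum_Sigma) (simp_all add: fib_finite tc)
    finally show "\<Phi> F (fst s) \<otimes> \<Phi> G (snd s) = (\<Oplus>w\<in>fib (fst s) \<times> fib (snd s). tm F (fst w) \<otimes> tm G (snd w))"
      by (simp only: case_prod_beta)
  qed (auto intro!: finsum_closed simp: tc)
  also have "\<dots> = (\<Oplus>z\<in>?R. case z of (s, w) \<Rightarrow> tm F (fst w) \<otimes> tm G (snd w))"
    by (rule finsum_Sigma) (simp_all add: fib_finite tc)
  also have "\<dots> = (\<Oplus>w\<in>Q4. tm F (fst w) \<otimes> tm G (snd w))"
  proof (rule finsum_bij[where h = snd])
    show "bij_betw snd ?R Q4"
      by (rule bij_betwI[where g = "\<lambda>(a, b). ((eps (fst a) (snd a), eps (fst b) (snd b)), (a, b))"])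
        (auto simp: Q4_def fib_def)
  qed (auto simp: tc)
  finally show "\<Phi> (F \<otimes>\<^bsub>T.B\<^esub> G) m = (\<Phi> F \<otimes>\<^bsub>Q.B\<^esub> \<Phi> G) m" using L by simp
qed

lemma Phi_hom: "ring_hom_ring T.B Q.B \<Phi>"
  by (rule ring_hom_ringI[OF T.B.ring_axioms Q.B.ring_axioms])
    (rule Phi_closed Phi_mult Phi_add Phi_one; assumption)+

text \<open>A preimage is supported on the monomials without a factor uv, of which each fibre over
  \<open>PP\<close> contains exactly one.\<close>

lemma Phi_surj: "\<Phi> ` carrier T.B = carrier Q.B"
proof (intro equalityI subsetI)
  fix H assume "H \<in> \<Phi> ` carrier T.B"
  then show "H \<in> carrier Q.B" using Phi_closed by blast
next
  fix H assume H: "H \<in> carrier Q.B"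
  define F where "F \<mu> \<nu> = (if \<nu> \<in> PS \<and> \<not> uv \<subseteq># \<mu> then sg \<mu> \<otimes> H (eps \<mu> \<nu>) else \<zero>)" for \<mu> \<nu>
  have FT: "F \<in> carrier T.B"
    by (rule T_carrierI) (simp_all add: F_def sg_closed Q.coeff_closed[OF H])
  have "\<Phi> F = H"
  proof
    fix m
    show "\<Phi> F m = H m"
    proof (cases "m \<in> PP")
      case False
      then show ?thesis using Q.coeff_outside[OF H False] Q.coeff_outside[OF Phi_closed[OF FT] False] by simp
    next
      case True
      then obtain \<mu> \<nu> where pure: "\<not> uv \<subseteq># \<mu>" "\<nu> \<in> PS" "m = eps \<mu> \<nu>" by (rule pure_exists)
      have "\<Phi> F m = sg (fst (\<mu>, \<nu>)) \<otimes> F (fst (\<mu>, \<nu>)) (snd (\<mu>, \<nu>))"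
        unfolding \<Phi>_def
      proof (rule finsum_single[OF fib_finite])
        show "(\<mu>, \<nu>) \<in> fib m" using pure by (simp add: fib_def)
        fix x assume x: "x \<in> fib m" "x \<noteq> (\<mu>, \<nu>)"
        then obtain k where k: "x = (\<mu> + repeat_mset k uv, \<nu> - repeat_mset k dd)"
          using fib_pure[OF pure(1,2)] pure(3) by auto
        then obtain k' where "k = Suc k'" using x(2) by (cases k) auto
        then have "uv \<subseteq># fst x" using k by simp
        then show "sg (fst x) \<otimes> F (fst x) (snd x) = \<zero>" using sg_closed by (simp add: F_def)
      qed (simp add: sg_closed T_coeff2[OF FT])
      also have "\<dots> = H m" using pure sg_cancel[OF Q.coeff_closed[OF H]] by (simp add: F_def)
      finally show ?thesis .
    qed
  qed
  then show "H \<in> \<Phi> ` carrier T.B" using FT by blast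
qed

section \<open>The kernel of the substitution\<close>

definition fuv where "fuv = T.mono {#} (S.mono dd \<one>) \<oplus>\<^bsub>T.B\<^esub> T.mono uv \<one>\<^bsub>S.B\<^esub>"

lemma fuv_in: "fuv \<in> carrier T.B"
proof -
  have "S.mono dd \<one> \<in> carrier S.B" by (rule S.mono_closed[OF dd_in one_closed])
  then show ?thesis unfolding fuv_def
    by (intro T.B.add.m_closed T.mono_closed PT S.B.one_closed)
qed

lemma Phi_fuv: "\<Phi> fuv = \<zero>\<^bsub>Q.B\<^esub>"
proof -
  have c: "T.mono {#} (S.mono dd \<one>) \<in> carrier T.B" "T.mono uv (S.mono {#} \<one>) \<in> carrier T.B"
    by (intro T.mono_closed PT S.mono_closed dd_in S.empty_in one_closed)+
  have e: "eps uv {#} = eps {#} dd" using eps_uv[of "{#}" "{#}"] by simp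
  have "\<Phi> fuv = Q.mono (eps {#} dd) (sg {#} \<otimes> \<one>) \<oplus>\<^bsub>Q.B\<^esub> Q.mono (eps {#} dd) (sg uv \<otimes> \<one>)"
    unfolding fuv_def S.one_mono Phi_add[OF c] Phi_mono[OF dd_in one_closed] Phi_mono[OF S.empty_in one_closed] e ..
  also have "\<dots> = \<zero>\<^bsub>Q.B\<^esub>"
  proof
    fix m
    show "(Q.mono (eps {#} dd) (sg {#} \<otimes> \<one>) \<oplus>\<^bsub>Q.B\<^esub> Q.mono (eps {#} dd) (sg uv \<otimes> \<one>)) m = \<zero>\<^bsub>Q.B\<^esub> m"
      unfolding Q.add_apply by (simp add: Q.mono_def sg_def r_neg)
  qed
  finally show ?thesis .
qed

text \<open>
  The quotient of \<open>F\<close> by \<open>f + uv\<close> has the coefficients \<open>ptail F (\<mu> + uv) \<nu>\<close>, the division being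
  carried out in powers of \<open>uv\<close>.
\<close>

definition ptail :: "(uv multiset \<Rightarrow> nat multiset \<Rightarrow> 'a) \<Rightarrow> uv multiset \<Rightarrow> nat multiset \<Rightarrow> 'a" where
  "ptail F \<mu> \<nu> = (\<Oplus>k\<in>mults \<nu>. (\<ominus> \<one>) [^] k \<otimes> F (\<mu> + repeat_mset k uv) (\<nu> - repeat_mset k dd))"

lemma ptail_closed: "F \<in> carrier T.B \<Longrightarrow> ptail F \<mu> \<nu> \<in> carrier K"
  unfolding ptail_def by (intro finsum_closed) (simp add: T_coeff2)

lemma mults_step: "mults \<nu> = insert 0 (if dd \<subseteq># \<nu> then Suc ` mults (\<nu> - dd) else {})"
proof -
  have "Suc k \<in> mults \<nu> \<longleftrightarrow> dd \<subseteq># \<nu> \<and> k \<in> mults (\<nu> - dd)" for k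
  proof -
    have "dd + repeat_mset k dd \<subseteq># \<nu> \<longleftrightarrow> dd \<subseteq># \<nu> \<and> repeat_mset k dd \<subseteq># \<nu> - dd"
      by (metis mset_subset_eq_add_left subset_mset.le_diff_conv2 subset_mset.order_trans add.commute)
    then show ?thesis by (simp add: mults_def)
  qed
  moreover have "0 \<in> mults \<nu>" by (simp add: mults_def)
  ultimately show ?thesis by (auto simp: image_iff) (metis not0_implies_Suc)+
qed

text \<open>Separating the term k = 0 of the alternating sum leaves minus the sum at (\<mu> + uv,
  \<nu> - dd). For the candidate quotient G the two summands are the coefficients of f G and, where
  uv divides \<mu>, of uv G.\<close>

lemma ptail_step:
  assumes F: "F \<in> carrier T.B"
  shows "F \<mu> \<nu> = (if dd \<subseteq># \<nu> then ptail F (\<mu> + uv) (\<nu> - dd) else \<zero>) \<oplus> ptail F \<mu> \<nu>"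
proof -
  let ?t = "\<lambda>k. (\<ominus> \<one>) [^] k \<otimes> F (\<mu> + repeat_mset k uv) (\<nu> - repeat_mset k dd)"
  have tc: "?t k \<in> carrier K" for k by (simp add: T_coeff2[OF F])
  have Fc: "F \<mu> \<nu> \<in> carrier K" by (rule T_coeff2[OF F])
  have t0: "?t 0 = F \<mu> \<nu>" using Fc by simp
  show ?thesis
  proof (cases "dd \<subseteq># \<nu>")
    case False
    then have "mults \<nu> = {0}" using mults_step[of \<nu>] by simp
    then have "ptail F \<mu> \<nu> = finsum K ?t {0}" by (simp only: ptail_def)
    also have "\<dots> = ?t 0 \<oplus> finsum K ?t {}"
      by (rule finsum_insert) (simp, simp, rule Pi_I, rule tc, rule tc)
    finally have "ptail F \<mu> \<nu> = ?t 0" using r_zero[OF tc[of 0]] by (simp only: finsum_empty)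
    then show ?thesis using False t0 Fc by simp
  next
    case True
    have "ptail F \<mu> \<nu> = ?t 0 \<oplus> (\<Oplus>k\<in>Suc ` mults (\<nu> - dd). ?t k)"
      unfolding ptail_def mults_step[of \<nu>] if_P[OF True]
      by (rule finsum_insert) (simp add: mults_finite, simp, rule Pi_I, rule tc, rule tc)
    also have "(\<Oplus>k\<in>Suc ` mults (\<nu> - dd). ?t k) = (\<Oplus>k\<in>mults (\<nu> - dd). ?t (Suc k))"
      by (rule finsum_reindex) (use tc in auto)
    also have "\<dots> = (\<Oplus>k\<in>mults (\<nu> - dd). \<ominus> \<one> \<otimes> ((\<ominus> \<one>) [^] k \<otimes> F (\<mu> + uv + repeat_mset k uv) (\<nu> - dd - repeat_mset k dd)))"
    proof (rule finsum_cong'[OF refl])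
      fix k
      have "(\<ominus> \<one>) [^] Suc k = \<ominus> \<one> \<otimes> (\<ominus> \<one>) [^] k" by (simp add: m_comm)
      moreover have "\<mu> + repeat_mset (Suc k) uv = \<mu> + uv + repeat_mset k uv" by (simp add: add.assoc)
      moreover have "\<nu> - repeat_mset (Suc k) dd = \<nu> - dd - repeat_mset k dd" by (simp add: diff_diff_eq)
      ultimately show "?t (Suc k) = \<ominus> \<one> \<otimes> ((\<ominus> \<one>) [^] k \<otimes> F (\<mu> + uv + repeat_mset k uv) (\<nu> - dd - repeat_mset k dd))"
        using m_assoc[of "\<ominus> \<one>" "(\<ominus> \<one>) [^] k" "F (\<mu> + uv + repeat_mset k uv) (\<nu> - dd - repeat_mset k dd)"] T_coeff2[OF F]
        by (simp add: add.assoc)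
    qed (simp add: T_coeff2[OF F])
    also have "\<dots> = \<ominus> \<one> \<otimes> ptail F (\<mu> + uv) (\<nu> - dd)"
      unfolding ptail_def by (rule finsum_rdistr[symmetric]) (simp_all add: mults_finite T_coeff2[OF F])
    finally have "ptail F \<mu> \<nu> = F \<mu> \<nu> \<oplus> (\<ominus> \<one> \<otimes> ptail F (\<mu> + uv) (\<nu> - dd))" unfolding t0 .
    then show ?thesis
      using True Fc ptail_closed[OF F, of "\<mu> + uv" "\<nu> - dd"] by (simp add: l_minus a_lcomm r_neg)
  qed
qed

text \<open>Where uv does not divide \<mu>, \<open>ptail\<close> sums over a whole fibre, so up to
  sign it is a coefficient of \<Phi> F. This is the remainder of the division by f + uv.\<close>

lemma ptail_pure:
  assumes F: "F \<in> carrier T.B" and pure: "\<not> uv \<subseteq># \<mu>" "\<nu> \<in> PS"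
  shows "ptail F \<mu> \<nu> = sg \<mu> \<otimes> \<Phi> F (eps \<mu> \<nu>)"
proof -
  let ?h = "\<lambda>k. (\<mu> + repeat_mset k uv, \<nu> - repeat_mset k dd)"
  have inj: "inj_on ?h (mults \<nu>)"
  proof (rule inj_onI)
    fix k l assume "?h k = ?h l"
    then have "count (\<mu> + repeat_mset k uv) U = count (\<mu> + repeat_mset l uv) U" by simp
    then show "k = l" by simp
  qed
  have "\<Phi> F (eps \<mu> \<nu>) = (\<Oplus>k\<in>mults \<nu>. sg (fst (?h k)) \<otimes> F (fst (?h k)) (snd (?h k)))"
    unfolding \<Phi>_def fib_pure[OF pure] by (rule finsum_reindex[OF _ inj]) (simp add: sg_closed T_coeff2[OF F])
  also have "\<dots> = (\<Oplus>k\<in>mults \<nu>. sg \<mu> \<otimes> ((\<ominus> \<one>) [^] k \<otimes> F (\<mu> + repeat_mset k uv) (\<nu> - repeat_mset k dd)))"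
  proof (rule finsum_cong'[OF refl])
    fix k
    have "sg (\<mu> + repeat_mset k uv) = sg \<mu> \<otimes> (\<ominus> \<one>) [^] k" unfolding sg_add by (simp add: sg_def)
    then show "sg (fst (?h k)) \<otimes> F (fst (?h k)) (snd (?h k)) = sg \<mu> \<otimes> ((\<ominus> \<one>) [^] k \<otimes> F (\<mu> + repeat_mset k uv) (\<nu> - repeat_mset k dd))"
      using m_assoc[OF sg_closed, of "(\<ominus> \<one>) [^] k" "F (\<mu> + repeat_mset k uv) (\<nu> - repeat_mset k dd)" \<mu>] T_coeff2[OF F] by simp
  qed (simp add: sg_closed T_coeff2[OF F])
  also have "\<dots> = sg \<mu> \<otimes> ptail F \<mu> \<nu>"
    unfolding ptail_def by (rule finsum_rdistr[symmetric]) (simp_all add: mults_finite sg_closed T_coeff2[OF F])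
  finally show ?thesis using sg_cancel[OF ptail_closed[OF F]] by simp
qed

lemma kernel_sub:
  assumes F: "F \<in> carrier T.B" and zero: "\<Phi> F = \<zero>\<^bsub>Q.B\<^esub>"
  shows "F \<in> PIdl\<^bsub>T.B\<^esub> fuv"
proof -
  define G where "G \<mu> \<nu> = ptail F (\<mu> + uv) \<nu>" for \<mu> \<nu>
  have GT: "G \<in> carrier T.B"
  proof (rule T_carrierI)
    show "G \<mu> \<nu> \<in> carrier K" for \<mu> \<nu> unfolding G_def by (rule ptail_closed[OF F])
    fix \<mu> and \<nu> :: "nat multiset" assume nu: "\<nu> \<notin> PS"
    show "G \<mu> \<nu> = \<zero>"
      unfolding G_def ptail_def
    proof (rule finsum_all_zero)
      fix k assume k: "k \<in> mults \<nu>"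
      have "\<nu> - repeat_mset k dd \<notin> PS"
      proof
        assume "\<nu> - repeat_mset k dd \<in> PS"
        then have "(\<nu> - repeat_mset k dd) + repeat_mset k dd \<in> PS"
          by (rule S.add_in[OF _ S.repeat_in[OF dd_in]])
        then show False using nu k by (simp add: mults_def)
      qed
      then show "(\<ominus> \<one>) [^] k \<otimes> F (\<mu> + uv + repeat_mset k uv) (\<nu> - repeat_mset k dd) = \<zero>"
        using T_out[OF F] by simp
    qed
  qed
  have fc: "S.mono dd \<one> \<in> carrier S.B" by (rule S.mono_closed[OF dd_in one_closed])
  have c: "T.mono {#} (S.mono dd \<one>) \<in> carrier T.B" "T.mono uv \<one>\<^bsub>S.B\<^esub> \<in> carrier T.B"
    by (intro T.mono_closed PT fc S.B.one_closed)+
  have "F = fuv \<otimes>\<^bsub>T.B\<^esub> G"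
  proof (rule ext, rule ext)
    fix \<mu> \<nu>
    have 1: "(T.mono {#} (S.mono dd \<one>) \<otimes>\<^bsub>T.B\<^esub> G) \<mu> \<nu> = (if dd \<subseteq># \<nu> then G \<mu> (\<nu> - dd) else \<zero>)"
    proof -
      have "(T.mono {#} (S.mono dd \<one>) \<otimes>\<^bsub>T.B\<^esub> G) \<mu> = S.mono dd \<one> \<otimes>\<^bsub>S.B\<^esub> G \<mu>"
        using T.mono_mult_apply[OF fc GT PT, of "{#}" \<mu>] by simp
      then have "(T.mono {#} (S.mono dd \<one>) \<otimes>\<^bsub>T.B\<^esub> G) \<mu> \<nu> = (S.mono dd \<one> \<otimes>\<^bsub>S.B\<^esub> G \<mu>) \<nu>" by (rule fun_cong)
      also have "\<dots> = (if dd \<subseteq># \<nu> then \<one> \<otimes> G \<mu> (\<nu> - dd) else \<zero>)"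
        by (rule S.mono_mult_apply[OF one_closed T_coeff[OF GT] dd_in])
      finally show ?thesis using T_coeff2[OF GT] by simp
    qed
    have 2: "(T.mono uv \<one>\<^bsub>S.B\<^esub> \<otimes>\<^bsub>T.B\<^esub> G) \<mu> \<nu> = (if uv \<subseteq># \<mu> then G (\<mu> - uv) \<nu> else \<zero>)"
    proof -
      have "(T.mono uv \<one>\<^bsub>S.B\<^esub> \<otimes>\<^bsub>T.B\<^esub> G) \<mu> = (if uv \<subseteq># \<mu> then \<one>\<^bsub>S.B\<^esub> \<otimes>\<^bsub>S.B\<^esub> G (\<mu> - uv) else \<zero>\<^bsub>S.B\<^esub>)"
        by (rule T.mono_mult_apply[OF S.B.one_closed GT PT])
      then have "(T.mono uv \<one>\<^bsub>S.B\<^esub> \<otimes>\<^bsub>T.B\<^esub> G) \<mu> \<nu> = (if uv \<subseteq># \<mu> then \<one>\<^bsub>S.B\<^esub> \<otimes>\<^bsub>S.B\<^esub> G (\<mu> - uv) else \<zero>\<^bsub>S.B\<^esub>) \<nu>" by (rule fun_cong)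
      then show ?thesis using S.B.l_one[OF T_coeff[OF GT]] by simp
    qed
    have "(fuv \<otimes>\<^bsub>T.B\<^esub> G) \<mu> \<nu> = (if dd \<subseteq># \<nu> then G \<mu> (\<nu> - dd) else \<zero>) \<oplus> (if uv \<subseteq># \<mu> then G (\<mu> - uv) \<nu> else \<zero>)"
      unfolding fuv_def T.B.l_distr[OF c GT] T.add_apply S.add_apply 1 2 ..
    also have "(if uv \<subseteq># \<mu> then G (\<mu> - uv) \<nu> else \<zero>) = ptail F \<mu> \<nu>"
    proof (cases "uv \<subseteq># \<mu>")
      case True
      then show ?thesis by (simp add: G_def)
    next
      case False
      \<comment> \<open>Here uv G has no term, so exactness of the division means that the remainder
        vanishes. This is where \<Phi> F = 0 enters.\<close>
      have "ptail F \<mu> \<nu> = \<zero>"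
      proof (cases "\<nu> \<in> PS")
        case True
        show ?thesis unfolding ptail_pure[OF F False True] zero Q.zero_apply using sg_closed by simp
      next
        case nu: False
        have "F \<mu> \<nu> = \<zero>" by (rule T_out[OF F nu])
        moreover have "(if dd \<subseteq># \<nu> then ptail F (\<mu> + uv) (\<nu> - dd) else \<zero>) = \<zero>"
        proof (cases "dd \<subseteq># \<nu>")
          case True
          have "\<nu> - dd \<notin> PS"
          proof
            assume "\<nu> - dd \<in> PS"
            then have "\<nu> - dd + dd \<in> PS" by (rule S.add_in[OF _ dd_in])
            then show False using nu True by simp
          qed
          then have "G \<mu> (\<nu> - dd) = \<zero>" by (rule T_out[OF GT])
          then show ?thesis by (simp add: G_def)
        qed simp
        ultimately show ?thesis using ptail_step[OF F, of \<mu> \<nu>] ptail_closed[OF F, of \<mu> \<nu>] by simp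
      qed
      then show ?thesis using False by simp
    qed
    also have "(if dd \<subseteq># \<nu> then G \<mu> (\<nu> - dd) else \<zero>) \<oplus> ptail F \<mu> \<nu> = F \<mu> \<nu>"
      unfolding G_def by (rule ptail_step[OF F, symmetric])
    finally show "F \<mu> \<nu> = (fuv \<otimes>\<^bsub>T.B\<^esub> G) \<mu> \<nu>" by (rule sym)
  qed
  also have "fuv \<otimes>\<^bsub>T.B\<^esub> G = G \<otimes>\<^bsub>T.B\<^esub> fuv" by (rule T.B.m_comm[OF fuv_in GT])
  finally show ?thesis unfolding cgenideal_def using GT by blast
qed

lemma kernel_eq: "a_kernel T.B Q.B \<Phi> = PIdl\<^bsub>T.B\<^esub> fuv"
proof (intro equalityI subsetI)
  fix F assume "F \<in> a_kernel T.B Q.B \<Phi>"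
  then have "F \<in> carrier T.B" "\<Phi> F = \<zero>\<^bsub>Q.B\<^esub>" unfolding a_kernel_def' by blast+
  then show "F \<in> PIdl\<^bsub>T.B\<^esub> fuv" by (rule kernel_sub)
next
  fix F assume "F \<in> PIdl\<^bsub>T.B\<^esub> fuv"
  then obtain G where G: "G \<in> carrier T.B" "F = G \<otimes>\<^bsub>T.B\<^esub> fuv" unfolding cgenideal_def by blast
  have "\<Phi> F = \<zero>\<^bsub>Q.B\<^esub>" unfolding G(2) Phi_mult[OF G(1) fuv_in] Phi_fuv by (rule Q.B.r_null[OF Phi_closed[OF G(1)]])
  moreover have "F \<in> carrier T.B" unfolding G(2) by (rule T.mult_closed_B[OF G(1) fuv_in])
  ultimately show "F \<in> a_kernel T.B Q.B \<Phi>" unfolding a_kernel_def' by (intro CollectI conjI)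
qed

lemma PS_single: "j \<in> {1..n} \<Longrightarrow> {#j#} \<in> PS"
  by (simp add: PS_def)

lemma monomial_series_eq: "monomial_series K n d = S.mono dd \<one>"
proof -
  have S: "power_series K {1..n} = S.B" unfolding power_series_eq PS_def ..
  have "monomial_series K n d = (\<Otimes>\<^bsub>S.B\<^esub>j\<in>{1..n}. S.mono {#j#} \<one> [^]\<^bsub>S.B\<^esub> d j)"
    unfolding monomial_series_def Let_def S S.indexed_var_mono ..
  also have "\<dots> = (\<Otimes>\<^bsub>S.B\<^esub>j\<in>{1..n}. S.mono (replicate_mset (d j) j) \<one>)"
  proof (rule S.B.finprod_cong'[OF refl])
    fix j assume j: "j \<in> {1..n}"
    have "repeat_mset (d j) {#j#} = replicate_mset (d j) j" by (rule multiset_eqI) simp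
    then show "S.mono {#j#} \<one> [^]\<^bsub>S.B\<^esub> d j = S.mono (replicate_mset (d j) j) \<one>"
      unfolding S.mono_pow[OF one_closed PS_single[OF j]] by simp
  next
    show "(\<lambda>j. S.mono (replicate_mset (d j) j) \<one>) \<in> {1..n} \<rightarrow> carrier S.B"
    proof
      fix j assume "j \<in> {1..n}"
      then have "replicate_mset (d j) j \<in> PS" by (auto simp: PS_def)
      then show "S.mono (replicate_mset (d j) j) \<one> \<in> carrier S.B" by (rule S.mono_closed[OF _ one_closed])
    qed
  qed
  also have "\<dots> = S.mono (\<Sum>j\<in>{1..n}. replicate_mset (d j) j) \<one>"
    by (rule S.finprod_mono(1)) (auto simp: PS_def)
  finally show ?thesis by (simp only: dd_def mk_def)
qed

lemma star_ring_eq: "star_ring (power_series K {1..n}) (monomial_series K n d) = T.B Quot (a_kernel T.B Q.B \<Phi>)"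
proof -
  have S: "power_series K {1..n} = S.B" unfolding power_series_eq PS_def ..
  have T: "power_series S.B {U, V} = T.B" unfolding power_series_eq ..
  have "T.mono {#U#} \<one>\<^bsub>S.B\<^esub> \<otimes>\<^bsub>T.B\<^esub> T.mono {#V#} \<one>\<^bsub>S.B\<^esub> = T.mono uv \<one>\<^bsub>S.B\<^esub>"
    using T.mono_mult_mono[OF S.B.one_closed S.B.one_closed PT PT, of "{#U#}" "{#V#}"] S.B.l_one[OF S.B.one_closed]
    by (simp add: uv_def add_mset_commute)
  then show ?thesis
    unfolding star_ring_def Let_def S T kernel_eq fuv_def monomial_series_eq T.indexed_const_mono T.indexed_var_mono by simp
qed

lemma star_ring_iso: "\<exists>h. ring_isom (star_ring (power_series K {1..n}) (monomial_series K n d)) Q.B h"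
proof -
  interpret \<Phi>: ring_hom_ring T.B Q.B \<Phi> by (rule Phi_hom)
  interpret k: ideal "a_kernel T.B Q.B \<Phi>" T.B by (rule \<Phi>.kernel_is_ideal)
  have "ring_isom (T.B Quot (a_kernel T.B Q.B \<Phi>)) Q.B (\<lambda>Z. the_elem (\<Phi> ` Z))"
    by (intro ring_isom.intro ring_isom_axioms.intro k.quotient_is_cring T.B_cring Q.B_cring \<Phi>.FactRing_iso_set Phi_surj)
  then show ?thesis unfolding star_ring_eq by blast
qed

end

section \<open>The limit\<close>

text \<open>The hypotheses say that H is a primitive of a decreasing g, in a form free of integrals.
  Left sums overestimate and right sums underestimate the increment of H, and the two differ by the
  telescoped (g 0 - g 1) / q.\<close>

lemma riemann_limit:
  fixes g H :: "real \<Rightarrow> real"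
  assumes lower: "\<And>s t. 0 \<le> s \<Longrightarrow> s \<le> t \<Longrightarrow> g t * (t - s) \<le> H t - H s"
    and upper: "\<And>s t. 0 \<le> s \<Longrightarrow> s \<le> t \<Longrightarrow> H t - H s \<le> g s * (t - s)"
  shows "(\<lambda>q. (\<Sum>i<q. g (real i / real q)) / real q) \<longlonglongrightarrow> H 1 - H 0"
proof (rule tendsto_sandwich[where f = "\<lambda>_. H 1 - H 0" and h = "\<lambda>q. H 1 - H 0 + (g 0 - g 1) / real q"])
  have *: "H 1 - H 0 \<le> (\<Sum>i<q. g (real i / real q)) / real q \<and>
      (\<Sum>i<q. g (real i / real q)) / real q \<le> H 1 - H 0 + (g 0 - g 1) / real q" if q: "q > 0" for q
  proof -
    define x where "x i = real i / real q" for i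
    have x: "0 \<le> x i" "x i \<le> x (Suc i)" "x (Suc i) - x i = 1 / real q" for i
      using q by (simp_all add: x_def divide_simps)
    have tel: "(\<Sum>i<q. H (x (Suc i)) - H (x i)) = H 1 - H 0"
      using sum_lessThan_telescope[of "\<lambda>i. H (x i)" q] q by (simp add: x_def)
    have "(\<Sum>i<q. H (x (Suc i)) - H (x i)) \<le> (\<Sum>i<q. g (x i) / real q)"
      by (rule sum_mono) (use upper[OF x(1,2)] x(3) in simp)
    moreover have "(\<Sum>i<q. g (x (Suc i)) / real q) \<le> (\<Sum>i<q. H (x (Suc i)) - H (x i))"
      by (rule sum_mono) (use lower[OF x(1,2)] x(3) in simp)
    moreover have "(\<Sum>i<q. g (x (Suc i)) / real q) = (\<Sum>i<q. g (x i) / real q) - (g 0 - g 1) / real q"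
      using sum_lessThan_telescope[of "\<lambda>i. g (x i) / real q" q] q
      by (simp add: x_def sum_subtractf diff_divide_distrib)
    ultimately show ?thesis unfolding tel by (simp add: x_def sum_divide_distrib)
  qed
  show "eventually (\<lambda>q. H 1 - H 0 \<le> (\<Sum>i<q. g (real i / real q)) / real q) sequentially"
    using eventually_gt_at_top[of 0] by eventually_elim (use * in blast)
  show "eventually (\<lambda>q. (\<Sum>i<q. g (real i / real q)) / real q \<le> H 1 - H 0 + (g 0 - g 1) / real q) sequentially"
    using eventually_gt_at_top[of 0] by eventually_elim (use * in blast)
  have "(\<lambda>q. H 1 - H 0 + (g 0 - g 1) / real q) \<longlonglongrightarrow> H 1 - H 0 + 0"
    by (intro tendsto_add tendsto_const lim_const_over_n)
  then show "(\<lambda>q. H 1 - H 0 + (g 0 - g 1) / real q) \<longlonglongrightarrow> H 1 - H 0" by simp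
qed simp

context star_exponents
begin

definition dmax :: nat where "dmax = Max (d ` {1..n})"

lemma dmax: "j \<in> {1..n} \<Longrightarrow> d j \<le> dmax" "\<exists>j\<in>{1..n}. d j = dmax" "dmax > 0"
proof -
  have ne: "d ` {1..n} \<noteq> {}" using n by simp
  show "j \<in> {1..n} \<Longrightarrow> d j \<le> dmax" by (simp add: dmax_def)
  show "\<exists>j\<in>{1..n}. d j = dmax" using Max_in[OF _ ne] by (auto simp: dmax_def)
  then show "dmax > 0" using d by force
qed

definition wt :: "nat set \<Rightarrow> real" where
  "wt J = (\<Prod>j\<in>J. real dmax - real (d j)) * (\<Prod>j\<in>{1..n} - J. real (d j))"

text \<open>
  The integral of \<open>\<Prod>(1 - t d\<^sub>j)\<close> is expanded in powers of \<open>1 - t d\<close>, using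
  \<open>1 - t d\<^sub>j = (d - d\<^sub>j)/d + (d\<^sub>j/d)(1 - t d)\<close>; this is where the sums \<open>W\<^sub>s\<close> come from.
\<close>

definition prim :: "real \<Rightarrow> real" where
  "prim t = - (\<Sum>J\<in>Pow {1..n}. wt J / real dmax ^ (n + 1) * ((1 - t * real dmax) ^ (n - card J + 1) / real (n - card J + 1)))"

lemma prod_expand:
  "(\<Prod>j=1..n. 1 - t * real (d j)) = (\<Sum>J\<in>Pow {1..n}. wt J / real dmax ^ n * (1 - t * real dmax) ^ (n - card J))"
proof -
  let ?D = "real dmax"
  have D: "?D > 0" using dmax(3) by simp
  have "(\<Prod>j=1..n. 1 - t * real (d j)) = (\<Prod>j=1..n. (?D - real (d j)) / ?D + real (d j) / ?D * (1 - t * ?D))"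
    by (rule prod.cong) (use D in \<open>auto simp: field_simps\<close>)
  also have "\<dots> = (\<Sum>J\<in>Pow {1..n}. (\<Prod>j\<in>J. (?D - real (d j)) / ?D) * (\<Prod>j\<in>{1..n} - J. real (d j) / ?D * (1 - t * ?D)))"
    by (rule prod_add) simp
  also have "\<dots> = (\<Sum>J\<in>Pow {1..n}. wt J / ?D ^ n * (1 - t * ?D) ^ (n - card J))"
  proof (rule sum.cong[OF refl])
    fix J assume "J \<in> Pow {1..n}"
    then have J: "J \<subseteq> {1..n}" "finite J" by (auto intro: finite_subset)
    have c: "card J \<le> n" using card_mono[OF _ J(1)] by simp
    have c': "card ({1..n} - J) = n - card J" using card_Diff_subset[OF J(2,1)] by simp
    have "?D ^ card J * ?D ^ (n - card J) = ?D ^ n" using c by (simp flip: power_add)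
    then show "(\<Prod>j\<in>J. (?D - real (d j)) / ?D) * (\<Prod>j\<in>{1..n} - J. real (d j) / ?D * (1 - t * ?D))
      = wt J / ?D ^ n * (1 - t * ?D) ^ (n - card J)"
      by (simp add: wt_def prod_dividef prod.distrib c'[unfolded One_nat_def])
  qed
  finally show ?thesis .
qed

lemma prim_deriv: "(prim has_real_derivative (\<Prod>j=1..n. 1 - t * real (d j))) (at t)"
proof -
  let ?D = "real dmax"
  have D: "?D > 0" using dmax(3) by simp
  \<comment> \<open>Differentiating the power of 1 - t d brings down a factor -d, which cancels one
    of the n + 1 powers in the denominator.\<close>
  have 1: "((\<lambda>t. wt J / ?D ^ (n + 1) * ((1 - t * ?D) ^ (k + 1) / real (k + 1)))
      has_real_derivative - (wt J / ?D ^ n * (1 - t * ?D) ^ k)) (at t)" for J k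
    by (rule derivative_eq_intros refl | simp)+ (use D in \<open>simp add: field_simps\<close>)
  have "((\<lambda>t. - (\<Sum>J\<in>Pow {1..n}. wt J / ?D ^ (n + 1) * ((1 - t * ?D) ^ (n - card J + 1) / real (n - card J + 1))))
      has_real_derivative - (\<Sum>J\<in>Pow {1..n}. - (wt J / ?D ^ n * (1 - t * ?D) ^ (n - card J)))) (at t)"
    by (intro DERIV_minus DERIV_sum 1)
  then show ?thesis unfolding prod_expand by (simp add: prim_def[abs_def] sum_negf)
qed

text \<open>Density of the good exponents: for i = t q with t at least 0, their number is
  \<open>q^n * cut t\<close>.\<close>

definition cut :: "real \<Rightarrow> real" where
  "cut t = (\<Prod>j=1..n. max 0 (1 - t * real (d j)))"

lemma cut_nonneg: "cut t \<ge> 0"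
  unfolding cut_def by (rule prod_nonneg) simp

lemma cut_antimono: "s \<le> t \<Longrightarrow> cut t \<le> cut s"
  unfolding cut_def by (rule prod_mono, intro conjI max.mono diff_mono mult_right_mono order_refl) simp_all

lemma cut_zero: "1 / real dmax \<le> t \<Longrightarrow> cut t = 0"
proof -
  assume t: "1 / real dmax \<le> t"
  obtain j where j: "j \<in> {1..n}" "d j = dmax" using dmax(2) by blast
  have "1 - t * real (d j) \<le> 0" using t dmax(3) j(2) by (simp add: field_simps)
  then have "max 0 (1 - t * real (d j)) = 0" by simp
  then show ?thesis unfolding cut_def using j(1) by (intro prod_zero) auto
qed

lemma cut_eq: "0 \<le> t \<Longrightarrow> t \<le> 1 / real dmax \<Longrightarrow> cut t = (\<Prod>j=1..n. 1 - t * real (d j))"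
  unfolding cut_def
proof (rule prod.cong[OF refl])
  fix j assume t: "0 \<le> t" "t \<le> 1 / real dmax" and j: "j \<in> {1..n}"
  have "t * real (d j) \<le> t * real dmax" using t dmax(1)[OF j] by (intro mult_left_mono) simp_all
  also have "\<dots> \<le> 1" using t(2) dmax(3) by (simp add: field_simps)
  finally show "max 0 (1 - t * real (d j)) = 1 - t * real (d j)" by simp
qed

text \<open>\<open>prim\<close>, stopped at the zero 1/d of \<open>cut\<close>, is a primitive of
  \<open>cut\<close>. The mean value theorem gives an intermediate value of \<open>cut\<close>, and
  monotonicity compares it with the values at the endpoints.\<close>

lemma cut_prim:
  assumes "0 \<le> s" "s \<le> t"
  shows "cut t * (t - s) \<le> prim (min t (1 / real dmax)) - prim (min s (1 / real dmax))"
    and "prim (min t (1 / real dmax)) - prim (min s (1 / real dmax)) \<le> cut s * (t - s)"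
proof -
  let ?E = "1 / real dmax" let ?t = "min t ?E"
  have "cut t * (t - s) \<le> prim ?t - prim (min s ?E) \<and> prim ?t - prim (min s ?E) \<le> cut s * (t - s)"
  proof (cases "s < ?E \<and> s < t")
    case True
    then have st: "s < ?t" by simp
    obtain z where z: "s < z" "z < ?t" "prim ?t - prim s = (?t - s) * (\<Prod>j=1..n. 1 - z * real (d j))"
      using MVT2[OF st, of prim "\<lambda>z. \<Prod>j=1..n. 1 - z * real (d j)"] prim_deriv by blast
    have e: "prim ?t - prim s = cut z * (?t - s)" using z assms by (simp add: cut_eq mult.commute)
    have "cut z * (?t - s) \<le> cut s * (t - s)"
      by (rule mult_mono) (use z cut_antimono[of s z] cut_nonneg assms in auto)
    moreover have "cut t * (t - s) \<le> cut z * (?t - s)"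
    proof (cases "t \<le> ?E")
      case True
      then show ?thesis using z cut_antimono[of z t] assms by (simp add: mult_right_mono)
    next
      case False
      then have "cut t = 0" by (intro cut_zero) simp
      then show ?thesis using cut_nonneg[of z] st by simp
    qed
    ultimately show ?thesis using e True by simp
  next
    case False
    then show ?thesis
    proof (cases "s = t")
      case ne: False
      then have s: "?E \<le> s" "?E \<le> t" using False assms by auto
      then show ?thesis using cut_zero[OF s(2)] cut_nonneg[of s] assms by simp
    qed simp
  qed
  then show "cut t * (t - s) \<le> prim ?t - prim (min s ?E)" "prim ?t - prim (min s ?E) \<le> cut s * (t - s)" by blast+
qed

text \<open>At t = 0 all powers of 1 - t d are 1; grouping the subsets by cardinality produces the
  sums W_s with denominators n - s + 1.\<close>

lemma prim_zero: "- prim 0 = 1 / real dmax ^ (n + 1) *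
      ((\<Prod>j=1..n. real (d j)) / (real n + 1)
        + (\<Sum>s=1..n - 1. W_sum n d dmax s / (real n - real s + 1)))"
proof -
  have "- prim 0 = 1 / real dmax ^ (n + 1) * (\<Sum>J\<in>Pow {1..n}. wt J / real (n - card J + 1))"
    by (simp add: prim_def sum_distrib_left)
  also have "(\<Sum>J\<in>Pow {1..n}. wt J / real (n - card J + 1))
      = (\<Sum>s\<in>{0..n}. \<Sum>J\<in>{J\<in>Pow {1..n}. card J = s}. wt J / real (n - card J + 1))"
  proof (rule sum.group[symmetric])
    show "card ` Pow {1..n} \<subseteq> {0..n}"
    proof
      fix k assume "k \<in> card ` Pow {1..n}"
      then obtain J where "k = card J" "J \<subseteq> {1..n}" by blast
      then show "k \<in> {0..n}" using card_mono[of "{1..n}" J] by simp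
    qed
  qed simp_all
  also have "\<dots> = (\<Sum>s\<in>{0..n}. W_sum n d dmax s / (real n - real s + 1))"
  proof (rule sum.cong[OF refl])
    fix s assume s: "s \<in> {0..n}"
    have "(\<Sum>J\<in>{J\<in>Pow {1..n}. card J = s}. wt J / real (n - card J + 1))
        = (\<Sum>J\<in>{J\<in>Pow {1..n}. card J = s}. wt J / (real n - real s + 1))"
      by (rule sum.cong[OF refl]) (use s in \<open>auto simp: of_nat_diff\<close>)
    then show "(\<Sum>J\<in>{J\<in>Pow {1..n}. card J = s}. wt J / real (n - card J + 1)) = W_sum n d dmax s / (real n - real s + 1)"
      by (simp add: W_sum_def wt_def sum_divide_distrib)
  qed
  also have "{0..n} = insert 0 (insert n {1..n - 1})" using n by auto
  also have "(\<Sum>s\<in>insert 0 (insert n {1..n - 1}). W_sum n d dmax s / (real n - real s + 1))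
      = W_sum n d dmax 0 / (real n + 1) + (W_sum n d dmax n + (\<Sum>s=1..n - 1. W_sum n d dmax s / (real n - real s + 1)))"
    using n by (subst sum.insert) auto
  also have "W_sum n d dmax 0 = (\<Prod>j=1..n. real (d j))"
  proof -
    have "{J. J \<subseteq> {1..n} \<and> card J = 0} = {{}}" using finite_subset[of _ "{1..n}"] by auto
    then show ?thesis by (simp add: W_sum_def)
  qed
  \<comment> \<open>The maximum is attained, so the only subset of size n contributes a product with
    a zero factor. This is why the formula ends at n - 1.\<close>
  also have "W_sum n d dmax n = 0"
  proof -
    have "{J. J \<subseteq> {1..n} \<and> card J = n} = {{1..n}}" using card_subset_eq[of "{1..n}"] by auto
    moreover have "(\<Prod>j=1..n. real dmax - real (d j)) = 0" using dmax(2) by (intro prod_zero) force+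
    ultimately show ?thesis by (simp add: W_sum_def)
  qed
  finally show ?thesis by simp
qed

text \<open>The degrees i and -i contribute equally, which gives the factor 2; the degree 0 is
  counted once, and correcting for it costs 1/q, which tends to 0.\<close>

lemma count_limit:
  "(\<lambda>q. real (card {m \<in> PP. \<forall>k. count m k < q}) / real q ^ (n + 1)) \<longlonglongrightarrow>
    2 / real dmax ^ (n + 1) * ((\<Prod>j=1..n. real (d j)) / (real n + 1)
        + (\<Sum>s=1..n - 1. W_sum n d dmax s / (real n - real s + 1)))"
proof -
  let ?H = "\<lambda>t. prim (min t (1 / real dmax))"
  have E: "1 / real dmax \<le> 1" "0 \<le> 1 / real dmax" "real dmax \<noteq> 0" using dmax(3) by simp_all
  have "prim (1 / real dmax) = 0" unfolding prim_def using E(3) by simp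
  then have H: "?H 1 - ?H 0 = - prim 0" unfolding min.absorb2[OF E(1)] min.absorb1[OF E(2)] by simp
  have "(\<lambda>q. (\<Sum>i<q. cut (real i / real q)) / real q) \<longlonglongrightarrow> - prim 0"
    using riemann_limit[of cut ?H] cut_prim unfolding H by blast
  then have "(\<lambda>q. 2 * ((\<Sum>i<q. cut (real i / real q)) / real q) - 1 / real q) \<longlonglongrightarrow> 2 * - prim 0 - 0"
    by (intro tendsto_diff tendsto_mult tendsto_const lim_const_over_n)
  moreover have "\<forall>\<^sub>F q in sequentially. 2 * ((\<Sum>i<q. cut (real i / real q)) / real q) - 1 / real q
      = real (card {m \<in> PP. \<forall>k. count m k < q}) / real q ^ (n + 1)"
    using eventually_gt_at_top[of 0]
  proof eventually_elim
    fix q :: nat assume q: "q > 0"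
    define N where "N i = (\<Prod>j=1..n. (q - i * d j))" for i
    have N: "real (N i) = real q ^ n * cut (real i / real q)" for i
    proof -
      have "real (q - i * d j) = real q * max 0 (1 - real i / real q * real (d j))" for j
      proof (cases "i * d j \<le> q")
        case True
        then have "real i * real (d j) \<le> real q" unfolding of_nat_mult[symmetric] of_nat_le_iff .
        then have "0 \<le> 1 - real i / real q * real (d j)" using q by (simp add: field_simps)
        then show ?thesis using True q by (simp add: of_nat_diff max_def field_simps)
      next
        case False
        then have "real q \<le> real i * real (d j)" unfolding of_nat_mult[symmetric] of_nat_le_iff by simp
        then have "1 - real i / real q * real (d j) \<le> 0" using q by (simp add: field_simps)
        then show ?thesis using False by simp
      qed
      then show ?thesis by (simp add: N_def cut_def prod.distrib)
    qed
    have split: "{- int q<..<int q} = (\<lambda>i. - int i) ` {1..<q} \<union> int ` {0..<q}"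
    proof (intro equalityI subsetI)
      fix x assume x: "x \<in> {- int q<..<int q}"
      show "x \<in> (\<lambda>i. - int i) ` {1..<q} \<union> int ` {0..<q}"
        by (cases "x < 0") (use x in \<open>auto intro!: image_eqI[of x _ "nat \<bar>x\<bar>"]\<close>)
    qed auto
    have "card {m \<in> PP. \<forall>k. count m k < q} = (\<Sum>i\<in>{- int q<..<int q}. N (nat \<bar>i\<bar>))"
      unfolding card_good N_def ..
    also have "\<dots> = (\<Sum>i\<in>(\<lambda>i. - int i) ` {1..<q}. N (nat \<bar>i\<bar>)) + (\<Sum>i\<in>int ` {0..<q}. N (nat \<bar>i\<bar>))"
      unfolding split by (rule sum.union_disjoint) auto
    also have "\<dots> = (\<Sum>i\<in>{1..<q}. N i) + (\<Sum>i<q. N i)"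
      by (simp add: sum.reindex inj_on_def atLeast0LessThan)
    finally have "real (card {m \<in> PP. \<forall>k. count m k < q}) = (\<Sum>i\<in>{1..<q}. real (N i)) + (\<Sum>i<q. real (N i))" by simp
    also have "{..<q} = insert 0 {1..<q}" using q by auto
    also have "(\<Sum>i\<in>insert 0 {1..<q}. real (N i)) = real (N 0) + (\<Sum>i\<in>{1..<q}. real (N i))" by simp
    finally have c: "real (card {m \<in> PP. \<forall>k. count m k < q}) = 2 * (\<Sum>i\<in>{1..<q}. real (N i)) + real q ^ n"
      by (simp add: N cut_def)
    have "(\<Sum>i<q. cut (real i / real q)) = 1 + (\<Sum>i\<in>{1..<q}. cut (real i / real q))"
    proof -
      have "{..<q} = insert 0 {1..<q}" using q by auto
      then show ?thesis by (simp add: cut_def)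
    qed
    moreover have "(\<Sum>i\<in>{1..<q}. real (N i)) = real q ^ n * (\<Sum>i\<in>{1..<q}. cut (real i / real q))"
      by (simp add: N sum_distrib_left)
    ultimately show "2 * ((\<Sum>i<q. cut (real i / real q)) / real q) - 1 / real q
        = real (card {m \<in> PP. \<forall>k. count m k < q}) / real q ^ (n + 1)"
      unfolding c using q by (simp add: field_simps)
  qed
  ultimately have "(\<lambda>q. real (card {m \<in> PP. \<forall>k. count m k < q}) / real q ^ (n + 1)) \<longlonglongrightarrow> 2 * - prim 0 - 0"
    by (rule Lim_transform_eventually)
  then show ?thesis unfolding prim_zero by simp
qed

section \<open>Rank, residue field and the resulting signature\<close>

lemma frobenius_facts:
  assumes K: "field K" and p: "Factorial_Ring.prime p" "[p] \<cdot>\<^bsub>K\<^esub> \<one>\<^bsub>K\<^esub> = \<zero>\<^bsub>K\<^esub>" and W: "root_basis K (p ^ e) W c"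
  shows "finitely_generated_module (mseries K PP) (frobenius_module p e (mseries K PP))"
    and "frob_dual (mseries K PP) (p ^ e) (card {m \<in> PP. \<forall>k. count m k < p ^ e} * card W)"
    and "frob_dual (mseries K PP) (p ^ e) N \<Longrightarrow> N \<le> card {m \<in> PP. \<forall>k. count m k < p ^ e} * card W"
proof -
  interpret full_series K PP vars by (rule full_series_PP[OF K])
  interpret f: frob_series K PP vars p e W c
    by (intro frob_series.intro frob_series_axioms.intro full_series_axioms p W)
  interpret f: frob_series_gen K PP vars p e W c "(\<lambda>(i, \<alpha>). expo i \<alpha>) ` box (\<lambda>i j. p ^ e) (p ^ e)"
  proof (intro frob_series_gen.intro frob_series_gen_axioms.intro f.frob_series_axioms)
    show "finite ((\<lambda>(i, \<alpha>). expo i \<alpha>) ` box (\<lambda>i j. p ^ e) (p ^ e))" using finite_box by (rule finite_imageI)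
    show "(\<lambda>(i, \<alpha>). expo i \<alpha>) ` box (\<lambda>i j. p ^ e) (p ^ e) \<subseteq> PP" using expo_in by auto
    fix m assume "m \<in> PP"
    then show "\<exists>r\<in>(\<lambda>(i, \<alpha>). expo i \<alpha>) ` box (\<lambda>i j. p ^ e) (p ^ e). \<exists>s\<in>PP. m = r + repeat_mset f.q s"
      using expo_gen f.q_pos unfolding f.q_def by blast
  qed
  have good: "f.good = {m \<in> PP. \<forall>k. count m k < p ^ e}" unfolding f.good_def f.q_def ..
  show "finitely_generated_module (mseries K PP) (frobenius_module p e (mseries K PP))"
    by (rule f.frob_finitely_generated)
  show "frob_dual (mseries K PP) (p ^ e) (card {m \<in> PP. \<forall>k. count m k < p ^ e} * card W)"
    using f.frob_dual_good unfolding good f.q_def .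
  have bad: "\<exists>v\<in>PP. \<exists>w\<in>PP. \<exists>m'\<in>PP. m' + repeat_mset f.q w = m + repeat_mset f.q v \<and> \<not> w \<subseteq># v"
    if m: "m \<in> PP" "m \<notin> f.good" for m
  proof -
    obtain k where "count m k \<ge> f.q" using m by (auto simp: f.good_def not_less)
    then show ?thesis by (rule expo_bad[OF m(1) _ f.q_pos])
  qed
  assume "frob_dual (mseries K PP) (p ^ e) N"
  then show "N \<le> card {m \<in> PP. \<forall>k. count m k < p ^ e} * card W"
    using f.frob_dual_bound[OF bad] unfolding good f.q_def by blast
qed

end

text \<open>With r = \<open>[K : K^p]\<close> the factor \<open>r^e\<close> is
  \<open>[K : K^q]\<close>, exactly the one that occurs in the rank; the quotient then depends on q
  alone.\<close>

lemma powr_frobenius: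
  assumes "real p > 1" "r > 0"
  shows "real p powr (real e * (real D + log (real p) (real r))) = real (p ^ e) ^ D * real r ^ e"
proof -
  have "real p powr (real e * (real D + log (real p) (real r)))
      = real p powr real (e * D) * (real p powr log (real p) (real r)) powr real e"
    by (simp add: powr_add powr_powr distrib_left mult.commute)
  also have "\<dots> = real p ^ (e * D) * real r ^ e"
    using assms by (simp add: powr_realpow del: of_nat_mult)
  finally show ?thesis by (simp add: power_mult)
qed

context star_iso
begin

lemma signature:
  assumes p: "Factorial_Ring.prime p" "has_char K p"
    and fd: "finite_dimension (pth_powers p K) (carrier K)"
  shows "has_F_signature p (star_ring (power_series K {1..n}) (monomial_series K n d))
    (2 / real dmax ^ (n + 1) *
      ((\<Prod>j=1..n. real (d j)) / (real n + 1)
        + (\<Sum>s=1..n - 1. W_sum n d dmax s / (real n - real s + 1))))"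
proof -
  let ?A = "star_ring (power_series K {1..n}) (monomial_series K n d)"
  let ?r = "dim (pth_powers p K) (carrier K)"
  have char: "[p] \<cdot> \<one> = \<zero>" using p(2) unfolding has_char_def by simp
  obtain h where h: "ring_isom ?A Q.B h" using star_ring_iso by blast
  interpret h: ring_isom ?A Q.B h by (rule h)
  obtain Z c where Z: "root_basis K p Z c" "card Z = ?r" using root_basis_exists[OF p(1) char fd] by blast
  have r0: "?r > 0"
  proof -
    \<comment> \<open>Positivity of the degree, needed for the logarithm: over an empty basis the
      expansion of 1 would be 0.\<close>
    have "Z \<noteq> {}"
    proof
      assume "Z = {}"
      then have "\<one> = \<zero>" using Z(1) one_closed unfolding root_basis_def by (metis finsum_empty)
      then show False using one_not_zero by contradiction
    qed
    then show ?thesis using Z by (auto simp: root_basis_def card_gt_0_iff)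
  qed
  have noeth: "noetherian_local_ring ?A"
    by (rule ring_isom.noetherian_local_image[OF h.sym Q.B_noetherian_local])
  have "has_char Q.B p"
    unfolding has_char_def
  proof
    fix m :: nat
    have 1: "([m] \<cdot>\<^bsub>Q.B\<^esub> \<one>\<^bsub>Q.B\<^esub>) \<mu> = [m] \<cdot> (if \<mu> = {#} then \<one> else \<zero>)" for \<mu>
      unfolding Q.add_pow_apply[OF Q.B.one_closed] Q.one_apply ..
    have "[m] \<cdot>\<^bsub>Q.B\<^esub> \<one>\<^bsub>Q.B\<^esub> = \<zero>\<^bsub>Q.B\<^esub> \<longleftrightarrow> [m] \<cdot> \<one> = \<zero>"
      unfolding fun_eq_iff 1 Q.zero_apply by (auto simp: add.nat_pow_one)
    then show "[m] \<cdot>\<^bsub>Q.B\<^esub> \<one>\<^bsub>Q.B\<^esub> = \<zero>\<^bsub>Q.B\<^esub> \<longleftrightarrow> p dvd m" using p(2) by (simp add: has_char_def)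
  qed
  then have charA: "has_char ?A p" by (rule ring_isom.has_char_image[OF h.sym])
  then have charA0: "[p] \<cdot>\<^bsub>?A\<^esub> \<one>\<^bsub>?A\<^esub> = \<zero>\<^bsub>?A\<^esub>" unfolding has_char_def by simp
  have "F_finite p Q.B"
    unfolding F_finite_def by (rule frobenius_facts(1)[OF field_axioms p(1) char]) (use Z(1) in simp)
  then have ffin: "F_finite p ?A" by (rule ring_isom.F_finite_image[OF h.sym])
  have dimA: "krull_dim ?A = enat (n + 1)" unfolding h.krull_dim_eq by (rule krull_dim_PP[OF field_axioms])
  have rank: "max_free_rank ?A (frobenius_module p e ?A) = card {m \<in> PP. \<forall>k. count m k < p ^ e} * ?r ^ e" for e
  proof -
    obtain W c' where W: "root_basis K (p ^ e) W c'" "card W = card Z ^ e"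
      using root_basis_power[OF p(1) char Z(1)] by blast
    note facts = frobenius_facts[OF field_axioms p(1) char W(1), unfolded W(2) Z(2)]
    show ?thesis
      by (rule max_free_rank_eqI[OF h.A.cring_axioms p(1) charA0]) (unfold h.frob_dual_eq, fact facts(2), fact facts(3))
  qed
  have alpha: "frobenius_alpha p ?A = log (real p) (real ?r)"
  proof (rule frobenius_alpha_eqI[OF noeth field_axioms _ _ p(1) char fd])
    \<comment> \<open>The constant coefficient after the isomorphism is the residue map.\<close>
    show "ring_hom_ring ?A K (\<lambda>x. h x {#})"
    proof (rule ring_hom_ringI[OF h.A.ring_axioms ring_axioms])
      show "h x {#} \<in> carrier K" if "x \<in> carrier ?A" for x by (rule Q.coeff_closed[OF h.closed[OF that]])
      show "h (x \<otimes>\<^bsub>?A\<^esub> y) {#} = h x {#} \<otimes> h y {#}" if "x \<in> carrier ?A" "y \<in> carrier ?A" for x y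
        unfolding h.h_mult[OF that] by (rule Q.mult_const[OF h.closed[OF that(1)] h.closed[OF that(2)]])
      show "h (x \<oplus>\<^bsub>?A\<^esub> y) {#} = h x {#} \<oplus> h y {#}" if "x \<in> carrier ?A" "y \<in> carrier ?A" for x y
        unfolding h.h_add[OF that] by (rule Q.add_apply)
      show "h \<one>\<^bsub>?A\<^esub> {#} = \<one>" unfolding h.h_one Q.one_apply by simp
    qed
    show "(\<lambda>x. h x {#}) ` carrier ?A = carrier K"
    proof (intro equalityI subsetI)
      fix y assume "y \<in> (\<lambda>x. h x {#}) ` carrier ?A"
      then show "y \<in> carrier K" using Q.coeff_closed[OF h.closed] by blast
    next
      fix k assume k: "k \<in> carrier K"
      have "Q.mono {#} k \<in> h ` carrier ?A" unfolding h.image_carrier by (rule Q.mono_closed[OF Q.empty_in k])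
      then obtain x where x: "x \<in> carrier ?A" "Q.mono {#} k = h x" by blast
      have "h x {#} = k" unfolding x(2)[symmetric] by (rule Q.mono_apply_same)
      then show "k \<in> (\<lambda>x. h x {#}) ` carrier ?A" using x(1) by blast
    qed
  qed
  have p1: "real p > 1" using prime_gt_1_nat[OF p(1)] by simp
  \<comment> \<open>After cancellation of \<open>[K : K^q]\<close> the sequence is the count
    sequence along the subsequence of q = \<open>p^e\<close>.\<close>
  have "(\<lambda>e. real (max_free_rank ?A (frobenius_module p e ?A)) / real p powr (real e * (real (n + 1) + frobenius_alpha p ?A)))
      = (\<lambda>q. real (card {m \<in> PP. \<forall>k. count m k < q}) / real q ^ (n + 1)) \<circ> (\<lambda>e. p ^ e)"
    unfolding rank alpha powr_frobenius[OF p1 r0] using r0 by (simp add: fun_eq_iff)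
  moreover have "strict_mono (\<lambda>e. p ^ e)" using prime_gt_1_nat[OF p(1)] by (simp add: strict_mono_def)
  ultimately show ?thesis
    unfolding has_F_signature_def
    using p(1) charA noeth ffin dimA LIMSEQ_subseq_LIMSEQ[OF count_limit, of "\<lambda>e. p ^ e"]
    by (intro conjI exI[of _ "n + 1"]) simp_all
qed

end

theorem theorem6p7:
  fixes K :: "('a, 'r) ring_scheme" and p n dmax :: nat and d :: "nat \<Rightarrow> nat"
  assumes "field K"
    and "Factorial_Ring.prime p" and "has_char K p"
    and "ring.finite_dimension K (pth_powers p K) (carrier K)"
    and "n \<ge> 1"
    and "\<And>j. j \<in> {1..n} \<Longrightarrow> d j > 0"
    and "dmax = Max (d ` {1..n})"
  shows "has_F_signature p (star_ring (power_series K {1..n}) (monomial_series K n d))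
    (2 / real dmax ^ (n + 1) *
      ((\<Prod>j=1..n. real (d j)) / (real n + 1)
        + (\<Sum>s=1..n - 1. W_sum n d dmax s / (real n - real s + 1))))"
proof -
  interpret star_iso n d K
    by (intro star_iso.intro star_exponents.intro assms)
  show ?thesis using signature[OF assms(2,3,4)] unfolding dmax_def assms(7) .
qed

end
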